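(* Let $d=1$, $D=(a,b)$ a bounded interval, and assume that the Green's function $G(x,y)$ is Lipschitz continuous. Assume [H2] and [H3] (see context), let $f\in L^2(D)$, let $u_0=\mathcal G f$, assumed continuous on $D$, and let $u_\varepsilon$ be the solution of the perturbed problem with the modified potential $q_\varepsilon$. Set $$u_{1\varepsilon}(x,\omega)=-\int_D G(x,y)\,\frac{1}{\sqrt\varepsilon}\,q\Big(\frac y\varepsilon,\omega\Big)u_0(y)\,dy,\qquad u_1(x,\omega)=-\sigma\int_D G(x,y)u_0(y)\,dW_y(\omega),$$ where $W$ is a standard Wiener process ($dW_y$ is standard white noise on $D$) and $\sigma\ge 0$, $\sigma^2=\int_{-\infty}^{\infty}R(r)\,dr$. Then, as $\varepsilon\to0$, the process $u_{1\varepsilon}$ converges weakly and in distribution in the space of continuous paths $\mathcal C(D)$ to $u_1$. As a consequence, $$\frac{u_\varepsilon-u_0}{\sqrt\varepsilon}(x)\ \longrightarrow\ -\sigma\int_D G(x,y)u_0(y)\,dW_y\qquad\text{in distribution as }\varepsilon\to0,$$ in the space of integrable paths $L^1(D)$.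
   Context: Here $d=1$. $D\subset\mathbb R^d$ is a bounded open set; $\|\cdot\|$ denotes the $L^2(D)$ norm or the operator norm on $\mathcal L(L^2(D))$. $P(\mathbf x,\mathbf D)$ is a deterministic self-adjoint elliptic pseudo-differential operator such that $Pu=f$ in $D$, $u=0$ on $\partial D$, has a unique solution $u(\mathbf x)=\mathcal G f(\mathbf x)=\int_D G(\mathbf x,\mathbf y)f(\mathbf y)\,d\mathbf y$, where $G$ is real-valued, non-negative, symmetric, and $\sup_{\mathbf x\in D}\int_D |G|^{2+\eta}(\mathbf x,\mathbf y)\,d\mathbf y<\infty$ for some $\eta>0$. Random field: $q(\mathbf x,\omega)$, $\mathbf x\in\mathbb R^d$, is a real, mean-zero, strictly stationary process on a probability space $(\Omega,\mathcal F,\mathbb P)$, with integrable correlation function $R(\mathbf x)=\mathbb E\{q(\mathbf y)q(\mathbf y+\mathbf x)\}$. [H2]: $\mathbb E\{q^6\}<\infty$ and $q$ is strongly mixing: there is a bounded decreasing function $\varphi:[0,\infty)\to[0,\infty)$ with $r^{d-1}\varphi^{1/2}(r)$ integrable on $\mathbb R^+$ such that for all Borel sets $A,B\subset\mathbb R^d$ at Euclidean distance $d(A,B)$ and all real square-integrable random variables $\zeta,\xi$ measurable with respect to the $\sigma$-algebras generated by $q$ restricted to $A$ and $B$ respectively, $$\big|\mathbb E\{(\zeta-\mathbb E\zeta)(\xi-\mathbb E\xi)\}\big|\le \varphi(2\,d(A,B))\,(\mathbb E\{\zeta^2\}\mathbb E\{\xi^2\})^{1/2}.$$ Modified potential: $\tilde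 q_\varepsilon(\mathbf x,\omega)=q(\mathbf x/\varepsilon,\omega)$; fix $0<\rho<1$, let $\Omega_\varepsilon=\{\omega:\|\mathcal G\tilde q_\varepsilon\mathcal G\tilde q_\varepsilon\|>\rho\}$, and set $q_\varepsilon=\tilde q_\varepsilon$ on $\Omega\setminus\Omega_\varepsilon$, $q_\varepsilon=0$ on $\Omega_\varepsilon$ (potentials act as multiplication operators). [H3]: $\lim_{\varepsilon\to0}\mathbb E\big\{\chi_{\Omega_\varepsilon}(\omega)\,\|\varepsilon^{-d/2}q(\cdot/\varepsilon,\omega)\|\big\}=0$. The perturbed problem is $Pu_\varepsilon+q_\varepsilon u_\varepsilon=f$ in $D$, $u_\varepsilon=0$ on $\partial D$, understood through the equation $u_\varepsilon=\mathcal G f-\mathcal Gq_\varepsilon\mathcal Gf+\mathcal Gq_\varepsilon\mathcal Gq_\varepsilon u_\varepsilon$, which is uniquely solvable $\mathbb P$-a.s. *)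

theory Defs
  imports "HOL-Probability.Probability"
begin

section \<open>Function spaces on a subset of the real line\<close>

definition L2 :: "real set \<Rightarrow> (real \<Rightarrow> real) set" where
  "L2 D = {u. set_borel_measurable lborel D u \<and> set_integrable lborel D (\<lambda>x. (u x)\<^sup>2)}"

definition L2_norm :: "real set \<Rightarrow> (real \<Rightarrow> real) \<Rightarrow> real" where
  "L2_norm D u = sqrt (LINT x:D|lborel. (u x)\<^sup>2)"

text \<open>
  The norm of \<open>\<L>(L\<^sup>2(D))\<close>, extended by \<open>\<infinity>\<close> to maps that are unbounded or leave \<open>L\<^sup>2(D)\<close>.
\<close>

definition L2_operator_norm :: "real set \<Rightarrow> ((real \<Rightarrow> real) \<Rightarrow> real \<Rightarrow> real) \<Rightarrow> ennreal" where
  "L2_operator_norm D T =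
    (SUP u \<in> {u \<in> L2 D. L2_norm D u \<le> 1}.
      if T u \<in> L2 D then ennreal (L2_norm D (T u)) else \<infinity>)"

definition C_metric :: "real set \<Rightarrow> (real \<Rightarrow> real) metric" where
  "C_metric D = cfunspace (top_of_set D) euclidean_metric"

definition L1_rel :: "real set \<Rightarrow> ((real \<Rightarrow> real) \<times> (real \<Rightarrow> real)) set" where
  "L1_rel D = {(u, v). set_integrable lborel D u \<and> set_integrable lborel D v \<and>
     (AE x in lborel. x \<in> D \<longrightarrow> u x = v x)}"

definition L1_class :: "real set \<Rightarrow> (real \<Rightarrow> real) \<Rightarrow> (real \<Rightarrow> real) set" where
  "L1_class D u = L1_rel D `` {u}"

definition L1_space :: "real set \<Rightarrow> (real \<Rightarrow> real) set set" where
  "L1_space D = {u. set_integrable lborel D u} // L1_rel D"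

definition L1_dist :: "real set \<Rightarrow> (real \<Rightarrow> real) set \<Rightarrow> (real \<Rightarrow> real) set \<Rightarrow> real" where
  "L1_dist D U V = (LINT x:D|lborel. \<bar>(SOME u. u \<in> U) x - (SOME v. v \<in> V) x\<bar>)"

definition L1_metric :: "real set \<Rightarrow> (real \<Rightarrow> real) set metric" where
  "L1_metric D = metric (L1_space D, L1_dist D)"

lemma equiv_L1_rel: "equiv {u. set_integrable lborel D u} (L1_rel D)"
proof (rule equivI)
  show "L1_rel D \<subseteq> {u. set_integrable lborel D u} \<times> {u. set_integrable lborel D u}"
    by (auto simp: L1_rel_def)
  show "refl_on {u. set_integrable lborel D u} (L1_rel D)"
    by (auto simp: refl_on_def L1_rel_def)
  show "sym (L1_rel D)"
    by (auto simp: sym_def L1_rel_def elim: eventually_mono)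
  show "trans (L1_rel D)"
  proof (rule transI)
    fix u v w
    assume uv: "(u, v) \<in> L1_rel D" and vw: "(v, w) \<in> L1_rel D"
    have "AE x in lborel. x \<in> D \<longrightarrow> u x = v x" "AE x in lborel. x \<in> D \<longrightarrow> v x = w x"
      using uv vw by (auto simp: L1_rel_def)
    then have "AE x in lborel. x \<in> D \<longrightarrow> u x = w x"
      by eventually_elim simp
    then show "(u, w) \<in> L1_rel D"
      using uv vw by (auto simp: L1_rel_def)
  qed
qed

lemma L1_representative:
  assumes "U \<in> L1_space D"
  shows "set_integrable lborel D (SOME u. u \<in> U)" "U = L1_class D (SOME u. u \<in> U)"
proof -
  have "(SOME u. u \<in> U) \<in> U"
    using in_quotient_imp_non_empty[OF equiv_L1_rel] assms
    unfolding L1_space_def by (metis some_in_eq)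
  then show "set_integrable lborel D (SOME u. u \<in> U)" "U = L1_class D (SOME u. u \<in> U)"
    using in_quotient_imp_subset[OF equiv_L1_rel] Image_singleton_iff
      equiv_class_eq[OF equiv_L1_rel] assms
    unfolding L1_space_def L1_class_def by (blast, metis quotientE)
qed

lemma L1_class_eq_iff:
  assumes "set_integrable lborel D u" "set_integrable lborel D v"
  shows "L1_class D u = L1_class D v \<longleftrightarrow> (AE x in lborel. x \<in> D \<longrightarrow> u x = v x)"
  using eq_equiv_class_iff[OF equiv_L1_rel] assms
  by (auto simp: L1_class_def L1_rel_def)

lemma set_integrable_abs_diff:
  fixes u v :: "real \<Rightarrow> real"
  assumes "set_integrable lborel D u" "set_integrable lborel D v"
  shows "set_integrable lborel D (\<lambda>x. \<bar>u x - v x\<bar>)"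
  using assms by (intro set_integrable_abs set_integral_diff)

lemma Metric_space_L1: "Metric_space (L1_space D) (L1_dist D)"
proof
  fix U V :: "(real \<Rightarrow> real) set"
  show "0 \<le> L1_dist D U V"
    by (auto simp: L1_dist_def set_lebesgue_integral_def intro!: integral_nonneg_AE)
  show "L1_dist D U V = L1_dist D V U"
    by (simp add: L1_dist_def abs_minus_commute)
next
  fix U V :: "(real \<Rightarrow> real) set"
  assume "U \<in> L1_space D" "V \<in> L1_space D"
  define u where "u = (SOME u. u \<in> U)"
  define v where "v = (SOME v. v \<in> V)"
  have u: "set_integrable lborel D u" "U = L1_class D u"
    using L1_representative[OF \<open>U \<in> L1_space D\<close>] by (simp_all add: u_def)
  have v: "set_integrable lborel D v" "V = L1_class D v"
    using L1_representative[OF \<open>V \<in> L1_space D\<close>] by (simp_all add: v_def)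
  have "L1_dist D U V = (LINT x|lborel. indicator D x * \<bar>u x - v x\<bar>)"
    by (simp add: L1_dist_def set_lebesgue_integral_def u_def v_def)
  also have "\<dots> = 0 \<longleftrightarrow> (AE x in lborel. indicator D x * \<bar>u x - v x\<bar> = 0)"
    using set_integrable_abs_diff[OF u(1) v(1)]
    by (intro integral_nonneg_eq_0_iff_AE) (auto simp: set_integrable_def)
  also have "\<dots> \<longleftrightarrow> (AE x in lborel. x \<in> D \<longrightarrow> u x = v x)"
    by (intro AE_cong) (auto simp: indicator_def)
  also have "\<dots> \<longleftrightarrow> U = V"
    using L1_class_eq_iff[OF u(1) v(1)] u(2) v(2) by simp
  finally show "L1_dist D U V = 0 \<longleftrightarrow> U = V" .
next
  fix U V W :: "(real \<Rightarrow> real) set"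
  assume "U \<in> L1_space D" "V \<in> L1_space D" "W \<in> L1_space D"
  define u where "u = (SOME u. u \<in> U)"
  define v where "v = (SOME v. v \<in> V)"
  define w where "w = (SOME w. w \<in> W)"
  have u: "set_integrable lborel D u" and v: "set_integrable lborel D v"
    and w: "set_integrable lborel D w"
    using L1_representative \<open>U \<in> L1_space D\<close> \<open>V \<in> L1_space D\<close> \<open>W \<in> L1_space D\<close>
    by (simp_all add: u_def v_def w_def)
  have "(LINT x:D|lborel. \<bar>u x - w x\<bar>) \<le> (LINT x:D|lborel. \<bar>u x - v x\<bar> + \<bar>v x - w x\<bar>)"
    by (rule set_integral_mono)
      (auto intro!: set_integrable_abs_diff set_integral_add u v w)
  also have "\<dots> = (LINT x:D|lborel. \<bar>u x - v x\<bar>) + (LINT x:D|lborel. \<bar>v x - w x\<bar>)"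
    by (intro set_integral_add set_integrable_abs_diff u v w)
  finally show "L1_dist D U W \<le> L1_dist D U V + L1_dist D V W"
    by (simp add: L1_dist_def u_def v_def w_def)
qed

lemma mspace_L1_metric [simp]: "mspace (L1_metric D) = L1_space D"
  and mdist_L1_metric [simp]: "mdist (L1_metric D) = L1_dist D"
  by (simp_all add: L1_metric_def Metric_space.mspace_metric Metric_space.mdist_metric
      Metric_space_L1)


section \<open>Convergence in distribution\<close>

definition borel_sigma :: "'s topology \<Rightarrow> 's measure" where
  "borel_sigma T = sigma (topspace T) {U. openin T U}"

text \<open>
  The random elements \<open>X \<epsilon>\<close> and \<open>Y\<close> need only be defined almost surely: \<open>X'\<close> and \<open>Y'\<close> are
  Borel measurable modifications with values in the space everywhere.  The choice of the
  modifications does not affect the expectations.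
\<close>

definition converges_in_distribution ::
  "'s topology \<Rightarrow> 'i filter \<Rightarrow> 'w measure \<Rightarrow> ('i \<Rightarrow> 'w \<Rightarrow> 's) \<Rightarrow> 'v measure \<Rightarrow> ('v \<Rightarrow> 's) \<Rightarrow> bool"
where
  "converges_in_distribution T \<F> M X N Y \<longleftrightarrow>
    (\<exists>X' Y'.
      (\<forall>\<^sub>F \<epsilon> in \<F>. X' \<epsilon> \<in> measurable M (borel_sigma T) \<and> (AE \<omega> in M. X \<epsilon> \<omega> = X' \<epsilon> \<omega>)) \<and>
      Y' \<in> measurable N (borel_sigma T) \<and> (AE \<omega> in N. Y \<omega> = Y' \<omega>) \<and>
      (\<forall>F :: 's \<Rightarrow> real. continuous_map T euclideanreal F \<longrightarrow> bounded (F ` topspace T) \<longrightarrow>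
        ((\<lambda>\<epsilon>. LINT \<omega>|M. F (X' \<epsilon> \<omega>)) \<longlongrightarrow> (LINT \<omega>|N. F (Y' \<omega>))) \<F>))"


section \<open>The Dirichlet problem and its Green's function\<close>

definition green_op :: "real set \<Rightarrow> (real \<Rightarrow> real \<Rightarrow> real) \<Rightarrow> (real \<Rightarrow> real) \<Rightarrow> real \<Rightarrow> real" where
  "green_op D G f x = (LINT y:D|lborel. G x y * f y)"

definition zero_on_boundary :: "real set \<Rightarrow> (real \<Rightarrow> real) \<Rightarrow> bool" where
  "zero_on_boundary D u \<longleftrightarrow> (\<forall>z \<in> frontier D. (u \<longlongrightarrow> 0) (at z within D))"

text \<open>
  \<open>P\<close> is an operator with domain \<open>\<D>\<close> in \<open>L\<^sup>2(D)\<close>.  Only symmetry under the boundary condition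
  is asked for; an operator that is also onto \<open>L\<^sup>2(D)\<close>, as required in \<open>green_function\<close> below,
  is then self-adjoint.
\<close>

definition symmetric_operator ::
  "real set \<Rightarrow> (real \<Rightarrow> real) set \<Rightarrow> ((real \<Rightarrow> real) \<Rightarrow> real \<Rightarrow> real) \<Rightarrow> bool"
where
  "symmetric_operator D \<D> P \<longleftrightarrow>
    (\<forall>u \<in> \<D>. u \<in> L2 D \<and> P u \<in> L2 D) \<and>
    (\<forall>u \<in> \<D>. \<forall>v \<in> \<D>. \<forall>\<alpha> \<beta>. (\<lambda>x. \<alpha> * u x + \<beta> * v x) \<in> \<D> \<and>
      (AE x in lborel. x \<in> D \<longrightarrow> P (\<lambda>x. \<alpha> * u x + \<beta> * v x) x = \<alpha> * P u x + \<beta> * P v x)) \<and>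
    (\<forall>u \<in> \<D>. \<forall>v \<in> \<D>. zero_on_boundary D u \<longrightarrow> zero_on_boundary D v \<longrightarrow>
      (LINT x:D|lborel. P u x * v x) = (LINT x:D|lborel. u x * P v x))"

definition dirichlet_solution ::
  "real set \<Rightarrow> (real \<Rightarrow> real) set \<Rightarrow> ((real \<Rightarrow> real) \<Rightarrow> real \<Rightarrow> real) \<Rightarrow> (real \<Rightarrow> real) \<Rightarrow> (real \<Rightarrow> real) \<Rightarrow> bool"
where
  "dirichlet_solution D \<D> P f u \<longleftrightarrow>
    u \<in> \<D> \<and> (AE x in lborel. x \<in> D \<longrightarrow> P u x = f x) \<and> zero_on_boundary D u"

definition green_function ::
  "real set \<Rightarrow> (real \<Rightarrow> real) set \<Rightarrow> ((real \<Rightarrow> real) \<Rightarrow> real \<Rightarrow> real) \<Rightarrow> (real \<Rightarrow> real \<Rightarrow> real) \<Rightarrow> bool"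
where
  "green_function D \<D> P G \<longleftrightarrow>
    (\<forall>f \<in> L2 D. dirichlet_solution D \<D> P f (green_op D G f) \<and>
      (\<forall>u. dirichlet_solution D \<D> P f u \<longrightarrow>
        (AE x in lborel. x \<in> D \<longrightarrow> u x = green_op D G f x)))"


section \<open>The random potential\<close>

definition strictly_stationary :: "'w measure \<Rightarrow> (real \<Rightarrow> 'w \<Rightarrow> real) \<Rightarrow> bool" where
  "strictly_stationary M q \<longleftrightarrow>
    (\<forall>J h. finite J \<longrightarrow>
      distr M (PiM J (\<lambda>_. borel)) (\<lambda>\<omega>. \<lambda>x\<in>J. q (x + h) \<omega>) =
      distr M (PiM J (\<lambda>_. borel)) (\<lambda>\<omega>. \<lambda>x\<in>J. q x \<omega>))"

text \<open>For a stationary field the base point is immaterial; we take \<open>y = 0\<close>.\<close>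

definition correlation :: "'w measure \<Rightarrow> (real \<Rightarrow> 'w \<Rightarrow> real) \<Rightarrow> real \<Rightarrow> real" where
  "correlation M q x = (LINT \<omega>|M. q 0 \<omega> * q (0 + x) \<omega>)"

definition field_sigma :: "'w measure \<Rightarrow> (real \<Rightarrow> 'w \<Rightarrow> real) \<Rightarrow> real set \<Rightarrow> 'w measure" where
  "field_sigma M q A = sigma (space M) {q x -` S \<inter> space M | x S. x \<in> A \<and> S \<in> sets borel}"

text \<open>Strong mixing in dimension \<open>d = 1\<close>, where \<open>r\<^bsup>d-1\<^esup> \<phi>\<^bsup>1/2\<^esup>(r) = \<phi>\<^bsup>1/2\<^esup>(r)\<close>.\<close>

definition strongly_mixing :: "'w measure \<Rightarrow> (real \<Rightarrow> 'w \<Rightarrow> real) \<Rightarrow> bool" where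
  "strongly_mixing M q \<longleftrightarrow>
    (\<exists>\<phi> :: real \<Rightarrow> real.
      (\<forall>r \<ge> 0. 0 \<le> \<phi> r) \<and> bounded (\<phi> ` {0..}) \<and> antimono_on {0..} \<phi> \<and>
      set_integrable lborel {0..} (\<lambda>r. sqrt (\<phi> r)) \<and>
      (\<forall>A \<in> sets borel. \<forall>B \<in> sets borel. A \<noteq> {} \<longrightarrow> B \<noteq> {} \<longrightarrow>
        (\<forall>\<zeta> \<in> borel_measurable (field_sigma M q A). \<forall>\<xi> \<in> borel_measurable (field_sigma M q B).
          integrable M (\<lambda>\<omega>. (\<zeta> \<omega>)\<^sup>2) \<longrightarrow> integrable M (\<lambda>\<omega>. (\<xi> \<omega>)\<^sup>2) \<longrightarrow>
          \<bar>LINT \<omega>|M. (\<zeta> \<omega> - (LINT \<omega>'|M. \<zeta> \<omega>')) * (\<xi> \<omega> - (LINT \<omega>'|M. \<xi> \<omega>'))\<bar>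
            \<le> \<phi> (2 * setdist A B) *
              sqrt ((LINT \<omega>|M. (\<zeta> \<omega>)\<^sup>2) * (LINT \<omega>|M. (\<xi> \<omega>)\<^sup>2)))))"

text \<open>The event \<open>\<parallel>\<G> q(\<cdot>/\<epsilon>) \<G> q(\<cdot>/\<epsilon>)\<parallel> > \<rho>\<close>.\<close>

definition exceptional_set ::
  "'w measure \<Rightarrow> real set \<Rightarrow> (real \<Rightarrow> real \<Rightarrow> real) \<Rightarrow> (real \<Rightarrow> 'w \<Rightarrow> real) \<Rightarrow> real \<Rightarrow> real \<Rightarrow> 'w set"
where
  "exceptional_set M D G q \<rho> \<epsilon> =
    {\<omega> \<in> space M. ennreal \<rho> < L2_operator_norm D
      (\<lambda>u. green_op D G (\<lambda>x. q (x / \<epsilon>) \<omega> * green_op D G (\<lambda>y. q (y / \<epsilon>) \<omega> * u y) x))}"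

definition modified_potential ::
  "'w measure \<Rightarrow> real set \<Rightarrow> (real \<Rightarrow> real \<Rightarrow> real) \<Rightarrow> (real \<Rightarrow> 'w \<Rightarrow> real) \<Rightarrow> real
    \<Rightarrow> real \<Rightarrow> real \<Rightarrow> 'w \<Rightarrow> real"
where
  "modified_potential M D G q \<rho> \<epsilon> x \<omega> =
    (if \<omega> \<in> exceptional_set M D G q \<rho> \<epsilon> then 0 else q (x / \<epsilon>) \<omega>)"

text \<open>
  The solution of \<open>P u + q\<^sub>\<epsilon> u = f\<close> in \<open>D\<close>, \<open>u = 0\<close> on the boundary, in the form
  \<open>u = \<G> f - \<G> q\<^sub>\<epsilon> \<G> f + \<G> q\<^sub>\<epsilon> \<G> q\<^sub>\<epsilon> u\<close> in \<open>L\<^sup>2(D)\<close>, for a realization \<open>V\<close> of \<open>q\<^sub>\<epsilon>\<close>.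
\<close>

definition perturbed_solution ::
  "real set \<Rightarrow> (real \<Rightarrow> real \<Rightarrow> real) \<Rightarrow> (real \<Rightarrow> real) \<Rightarrow> (real \<Rightarrow> real) \<Rightarrow> (real \<Rightarrow> real) \<Rightarrow> bool"
where
  "perturbed_solution D G V f u \<longleftrightarrow>
    u \<in> L2 D \<and>
    (AE x in lborel. x \<in> D \<longrightarrow>
      u x = green_op D G f x - green_op D G (\<lambda>y. V y * green_op D G f y) x
        + green_op D G (\<lambda>y. V y * green_op D G (\<lambda>z. V z * u z) y) x)"


section \<open>Wiener process and Wiener integral\<close>

text \<open>The process is two-sided, since the interval \<open>D\<close> need not lie in the half line.\<close>

definition standard_wiener_process :: "'v measure \<Rightarrow> (real \<Rightarrow> 'v \<Rightarrow> real) \<Rightarrow> bool" where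
  "standard_wiener_process N W \<longleftrightarrow>
    (\<forall>t. W t \<in> borel_measurable N) \<and>
    (AE \<omega> in N. W 0 \<omega> = 0) \<and>
    (\<forall>s t. s < t \<longrightarrow>
      distributed N lborel (\<lambda>\<omega>. W t \<omega> - W s \<omega>) (normal_density 0 (sqrt (t - s)))) \<and>
    (\<forall>n (t :: nat \<Rightarrow> real). strict_mono_on {..n} t \<longrightarrow>
      prob_space.indep_vars N (\<lambda>_. borel) (\<lambda>i \<omega>. W (t (Suc i)) \<omega> - W (t i) \<omega>) {..<n}) \<and>
    (AE \<omega> in N. continuous_on UNIV (\<lambda>t. W t \<omega>))"

text \<open>
  A list of triples \<open>(c, s, t)\<close> stands for the step function summing the functions equal to \<open>c\<close>
  on \<open>{s<..t}\<close>.  The Wiener integral on \<open>(a, b)\<close> is the extension of the integral of step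
  functions by \<open>L\<^sup>2\<close>-isometry; it is determined almost surely.
\<close>

definition step_function :: "(real \<times> real \<times> real) list \<Rightarrow> real \<Rightarrow> real" where
  "step_function S x = (\<Sum>(c, s, t) \<leftarrow> S. c * indicator {s<..t} x)"

definition step_integral ::
  "(real \<Rightarrow> 'v \<Rightarrow> real) \<Rightarrow> (real \<times> real \<times> real) list \<Rightarrow> 'v \<Rightarrow> real" where
  "step_integral W S \<omega> = (\<Sum>(c, s, t) \<leftarrow> S. c * (W t \<omega> - W s \<omega>))"

definition has_wiener_integral ::
  "'v measure \<Rightarrow> (real \<Rightarrow> 'v \<Rightarrow> real) \<Rightarrow> real \<Rightarrow> real \<Rightarrow> (real \<Rightarrow> real) \<Rightarrow> ('v \<Rightarrow> real) \<Rightarrow> bool"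
where
  "has_wiener_integral N W a b h Z \<longleftrightarrow>
    h \<in> L2 {a<..<b} \<and> Z \<in> borel_measurable N \<and>
    (\<exists>S :: nat \<Rightarrow> (real \<times> real \<times> real) list.
      (\<forall>k. \<forall>(c, s, t) \<in> set (S k). a \<le> s \<and> s \<le> t \<and> t \<le> b) \<and>
      (\<lambda>k. \<integral>\<^sup>+x\<in>{a<..<b}. ennreal ((step_function (S k) x - h x)\<^sup>2) \<partial>lborel) \<longlonglongrightarrow> 0 \<and>
      (\<lambda>k. \<integral>\<^sup>+\<omega>. ennreal ((step_integral W (S k) \<omega> - Z \<omega>)\<^sup>2) \<partial>N) \<longlonglongrightarrow> 0)"

text \<open>
  \<open>u\<^sub>1\<close> is a version with continuous paths of \<open>u\<^sub>1(x) = -\<sigma> \<integral> K(x, y) dW\<^sub>y\<close>, \<open>x \<in> (a, b)\<close>.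
  Such a version is unique up to indistinguishability.
\<close>

definition continuous_wiener_field ::
  "'v measure \<Rightarrow> (real \<Rightarrow> 'v \<Rightarrow> real) \<Rightarrow> real \<Rightarrow> real \<Rightarrow> real \<Rightarrow> (real \<Rightarrow> real \<Rightarrow> real)
    \<Rightarrow> (real \<Rightarrow> 'v \<Rightarrow> real) \<Rightarrow> bool"
where
  "continuous_wiener_field N W a b \<sigma> K u\<^sub>1 \<longleftrightarrow>
    (\<forall>x \<in> {a<..<b}. \<exists>Z. has_wiener_integral N W a b (K x) Z \<and>
      (AE \<omega> in N. u\<^sub>1 x \<omega> = - \<sigma> * Z \<omega>)) \<and>
    (AE \<omega> in N. continuous_on {a<..<b} (\<lambda>x. u\<^sub>1 x \<omega>))"

end

theory Submission
  imports Defs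
begin

text \<open>
  Let \<open>B\<close> be the increments of \<open>-\<epsilon>\<^bsup>-1/2\<^esup> \<integral> q(y/\<epsilon>) dy\<close>.  Passing from dyadic level \<open>k\<close> to \<open>k + 1\<close> changes
  a Riemann sum of a Lipschitz function against \<open>B\<close> by at most a multiple of
  \<open>2\<^bsup>-k\<^esup> \<Sum>\<^sub>j \<bar>B(I\<^bsub>k+1,j\<^esub>)\<bar>\<close>, and \<open>E \<bar>B(s, t)\<bar> \<le> c (t - s)\<^bsup>1/2\<^esup>\<close> because \<open>R\<close> is
  integrable.  Hence \<open>u\<^bsub>1\<epsilon>\<^esub>\<close> is, uniformly in \<open>\<epsilon>\<close> and up to a small error in \<open>C(D)\<close>, a Lipschitz
  function of finitely many increments, and the Wiener integral is treated in the same way.  The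
  increments over adjacent intervals become independent by mixing.  Each is asymptotically Gaussian:
  cut it into \<open>n\<close> asymptotically independent blocks, expand the characteristic function of a block to
  second order with a remainder controlled by the fourth moment (bounded through mixing and the sixth
  moment of \<open>q\<close>), and let \<open>n\<close> tend to infinity after \<open>\<epsilon> \<rightarrow> 0\<close>.

  The same variation bound shows that \<open>\<G> q \<G> q\<close> is \<open>O(\<epsilon>\<^bsup>1/2\<^esup>)\<close> in probability, so the exceptional
  set is negligible in the limit.  It also shows that \<open>\<G> q \<G> q u\<^sub>0\<close> is \<open>o(\<epsilon>\<^bsup>1/2\<^esup>)\<close>, since the function
  \<open>\<G> q u\<^sub>0\<close> is of size \<open>\<epsilon>\<^bsup>1/2\<^esup>\<close> with Lipschitz constants bounded in probability.  Hence
  \<open>\<epsilon>\<^bsup>-1/2\<^esup>(u\<^sub>\<epsilon> - u\<^sub>0)\<close> and \<open>u\<^bsub>1\<epsilon>\<^esub>\<close> differ by a quantity that tends to \<open>0\<close> in probability.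
\<close>

section \<open>Borel measurability and weak convergence in metric spaces\<close>

text \<open>The mean of \<open>|B(s, t)|\<close> is only of order \<open>(t - s)^(1/2)\<close>, and
  the total variation of \<open>B\<close> may grow like \<epsilon>^(-1/2), so no bound through the
  variation of the paths is uniform in \<epsilon>. The Lipschitz integrand compensates: level
  \<open>k + 1\<close> has \<open>2^(k+1)\<close> increments of mean size about
  \<open>2^(-k/2)\<close>, weighted by \<open>2^(-k)\<close>, and the refinement errors form a
  geometric series of ratio \<open>2^(-1/2)\<close>. The bound is uniform in \<open>x\<close>.
  Bounded continuous functions on an open interval form a nonseparable space, so measurability
  cannot be read off from point evaluations. Random elements are built as pathwise limits of
  finite-dimensional ones, and the solution, of which no measurability is assumed, as a limit of
  Neumann iterates. The function \<open>w = \<G> q u0\<close> is small in the sup norm but not in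
  its Lipschitz constant. Cutting the dyadic series at a level \<open>m\<close> bounds an integral
  against \<open>q\<close> by \<epsilon>^(1/2) times \<open>2^m\<close> times the sup norm plus a
  small multiple of the Lipschitz constant. For \<open>\<G> q w\<close> one therefore fixes
  \<open>m\<close> first and lets \<epsilon> tend to 0 afterwards.\<close>

lemma space_borel_sigma [simp]: "space (borel_sigma T) = topspace T"
  unfolding borel_sigma_def by (rule space_measure_of) (auto dest: openin_subset)

lemma openin_in_sets_borel_sigma: "openin T U \<Longrightarrow> U \<in> sets (borel_sigma T)"
  unfolding borel_sigma_def by (subst sets_measure_of) (auto dest: openin_subset)

lemma measurable_borel_sigmaI:
  assumes "\<And>\<omega>. \<omega> \<in> space M \<Longrightarrow> X \<omega> \<in> topspace T"
    and "\<And>U. openin T U \<Longrightarrow> X -` U \<inter> space M \<in> sets M"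
  shows "X \<in> measurable M (borel_sigma T)"
  unfolding borel_sigma_def using assms
  by (intro measurable_measure_of) (auto dest: openin_subset)

lemma measurable_borel_sigma_continuous_map:
  assumes "continuous_map T T' f"
  shows "f \<in> measurable (borel_sigma T) (borel_sigma T')"
proof (rule measurable_borel_sigmaI)
  show "f x \<in> topspace T'" if "x \<in> space (borel_sigma T)" for x
    using assms that by (auto simp: continuous_map_def)
next
  fix U assume "openin T' U"
  then have "openin T {x \<in> topspace T. f x \<in> U}"
    using assms by (auto simp: continuous_map_def)
  moreover have "{x \<in> topspace T. f x \<in> U} = f -` U \<inter> space (borel_sigma T)"
    by auto
  ultimately show "f -` U \<inter> space (borel_sigma T) \<in> sets (borel_sigma T)"
    by (metis openin_in_sets_borel_sigma)
qed

lemma borel_sigma_euclidean: "measurable M (borel_sigma euclidean) = borel_measurable M"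
  unfolding borel_sigma_def borel_def Collect_cong[OF open_openin[symmetric]] topspace_euclidean ..

lemma borel_measurable_continuous_map:
  assumes "continuous_map T euclideanreal f"
  shows "f \<in> borel_measurable (borel_sigma T)"
  using measurable_borel_sigma_continuous_map[OF assms] by (simp add: borel_sigma_euclidean)

lemma continuous_map_Lipschitz_real:
  assumes "\<And>x y. x \<in> mspace m \<Longrightarrow> y \<in> mspace m \<Longrightarrow> \<bar>f x - f y\<bar> \<le> L * mdist m x y"
  shows "continuous_map (mtopology_of m) euclideanreal f"
  using Lipschitz_continuous_imp_continuous_map[of m euclidean_metric f] assms
  by (auto simp: Lipschitz_continuous_map_def dist_real_def)

text \<open>The distance \<open>g\<close> to the complement \<open>C\<close> of an open set is
  1-Lipschitz and positive exactly on the open set, so the claim reduces to a pointwise limit of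
  real random variables. The argument is valid in nonseparable spaces, such as the bounded
  continuous functions on an open interval.\<close>

lemma measurable_borel_sigma_limit:
  assumes X: "\<And>n::nat. X n \<in> measurable M (borel_sigma (mtopology_of m))"
    and Y: "\<And>\<omega>. \<omega> \<in> space M \<Longrightarrow> Y \<omega> \<in> mspace m"
    and lim: "\<And>\<omega>. \<omega> \<in> space M \<Longrightarrow> (\<lambda>n. mdist m (X n \<omega>) (Y \<omega>)) \<longlonglongrightarrow> 0"
  shows "Y \<in> measurable M (borel_sigma (mtopology_of m))"
proof (rule measurable_borel_sigmaI)
  interpret m: Metric_space "mspace m" "mdist m" by simp
  show "Y \<omega> \<in> topspace (mtopology_of m)" if "\<omega> \<in> space M" for \<omega>
    using Y that by simp
  fix U assume U: "openin (mtopology_of m) U"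
  define C where "C = mspace m - U"
  show "Y -` U \<inter> space M \<in> sets M"
  \<comment> \<open>The infimum that defines the distance is meaningful only for a nonempty
    complement.\<close>
  proof (cases "C = {}")
    case True
    then have "Y -` U \<inter> space M = space M" using Y by (auto simp: C_def)
    then show ?thesis by simp
  next
    case False
    define g where "g x = (INF c\<in>C. mdist m x c)" for x
    have bdd: "bdd_below (mdist m x ` C)" for x
      by (rule bdd_belowI[of _ 0]) auto
    have g_le: "g x \<le> g y + mdist m x y" if "x \<in> mspace m" "y \<in> mspace m" for x y
    proof -
      have "g x - mdist m x y \<le> g y" unfolding g_def
      proof (rule cINF_greatest[OF False])
        fix c assume c: "c \<in> C"
        have "(INF c\<in>C. mdist m x c) \<le> mdist m x c" by (rule cINF_lower[OF bdd c])
        also have "\<dots> \<le> mdist m x y + mdist m y c"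
          using c that by (intro m.triangle) (auto simp: C_def)
        finally show "(INF c\<in>C. mdist m x c) - mdist m x y \<le> mdist m y c" by simp
      qed
      then show ?thesis by simp
    qed
    have lip: "\<bar>g x - g y\<bar> \<le> 1 * mdist m x y" if "x \<in> mspace m" "y \<in> mspace m" for x y
      using g_le[OF that] g_le[OF that(2,1)] m.commute[of x y] by simp
    have g_pos: "0 < g x \<longleftrightarrow> x \<in> U" if x: "x \<in> mspace m" for x
    proof
      assume "0 < g x"
      show "x \<in> U"
      proof (rule ccontr)
        assume "x \<notin> U"
        then have "x \<in> C" using x by (simp add: C_def)
        then have "g x \<le> mdist m x x" unfolding g_def by (rule cINF_lower[OF bdd])
        with \<open>0 < g x\<close> x show False by simp
      qed
    next
      assume "x \<in> U"
      then obtain r where r: "0 < r" "m.mball x r \<subseteq> U"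
        using U by (auto simp: mtopology_of_def m.openin_mtopology)
      have "r \<le> g x" unfolding g_def
        using r x by (intro cINF_greatest[OF False]) (force simp: C_def m.in_mball not_less[symmetric])
      with r show "0 < g x" by simp
    qed
    have gm: "g \<in> borel_measurable (borel_sigma (mtopology_of m))"
      by (rule borel_measurable_continuous_map[OF continuous_map_Lipschitz_real[OF lip]])
    have "(\<lambda>\<omega>. g (Y \<omega>)) \<in> borel_measurable M"
    proof (rule borel_measurable_LIMSEQ_real)
      show "(\<lambda>\<omega>. g (X n \<omega>)) \<in> borel_measurable M" for n
        by (rule measurable_compose[OF X gm])
      fix \<omega> assume \<omega>: "\<omega> \<in> space M"
      have "X n \<omega> \<in> mspace m" for n
        using measurable_space[OF X \<omega>] by simp
      then have "\<bar>g (X n \<omega>) - g (Y \<omega>)\<bar> \<le> mdist m (X n \<omega>) (Y \<omega>)" for n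
        using lip[of "X n \<omega>" "Y \<omega>"] Y[OF \<omega>] by simp
      then have "(\<lambda>n. g (X n \<omega>) - g (Y \<omega>)) \<longlonglongrightarrow> 0"
        by (intro Lim_null_comparison[OF _ lim[OF \<omega>]]) auto
      then show "(\<lambda>n. g (X n \<omega>)) \<longlonglongrightarrow> g (Y \<omega>)" by (simp add: LIM_zero_iff)
    qed
    then have "{\<omega> \<in> space M. 0 < g (Y \<omega>)} \<in> sets M" by measurable
    moreover have "{\<omega> \<in> space M. 0 < g (Y \<omega>)} = Y -` U \<inter> space M"
      using Y g_pos by auto
    ultimately show ?thesis by simp
  qed
qed

section \<open>Convergence in distribution tested on bounded Lipschitz functions\<close>

definition bounded_Lipschitz :: "'s metric \<Rightarrow> real \<Rightarrow> real \<Rightarrow> ('s \<Rightarrow> real) \<Rightarrow> bool" where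
  "bounded_Lipschitz m B L f \<longleftrightarrow> 0 \<le> B \<and> 0 \<le> L \<and> (\<forall>x\<in>mspace m. \<bar>f x\<bar> \<le> B) \<and>
     (\<forall>x\<in>mspace m. \<forall>y\<in>mspace m. \<bar>f x - f y\<bar> \<le> L * mdist m x y)"

lemma bounded_Lipschitz_measurable:
  assumes "bounded_Lipschitz m B L f"
  shows "f \<in> borel_measurable (borel_sigma (mtopology_of m))"
  using assms
  by (intro borel_measurable_continuous_map continuous_map_Lipschitz_real[of m f L])
    (auto simp: bounded_Lipschitz_def)

lemma (in prob_space) integrable_bounded_compose:
  fixes f :: "'s \<Rightarrow> real"
  assumes "X \<in> measurable M (borel_sigma T)" "f \<in> borel_measurable (borel_sigma T)"
    and "\<And>x. x \<in> topspace T \<Longrightarrow> \<bar>f x\<bar> \<le> B"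
  shows "integrable M (\<lambda>\<omega>. f (X \<omega>))"
  using measurable_space[OF assms(1)] assms
  by (intro integrable_const_bound[of _ B] measurable_compose[OF assms(1)]) auto

text \<open>The approximants are the inf-convolutions of \<open>F\<close> with multiples of the distance.\<close>

lemma Lipschitz_approximation_from_below:
  fixes F :: "'s \<Rightarrow> real"
  assumes F: "continuous_map (mtopology_of m) euclideanreal F"
    and B: "\<And>x. x \<in> mspace m \<Longrightarrow> \<bar>F x\<bar> \<le> B" and "0 \<le> B"
  obtains f :: "nat \<Rightarrow> 's \<Rightarrow> real" where "\<And>j. bounded_Lipschitz m B (real j) (f j)"
    and "\<And>j x. x \<in> mspace m \<Longrightarrow> f j x \<le> F x"
    and "\<And>x. x \<in> mspace m \<Longrightarrow> (\<lambda>j. f j x) \<longlonglongrightarrow> F x"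
proof
  interpret m: Metric_space "mspace m" "mdist m" by simp
  define f where "f j x = (INF y\<in>mspace m. F y + real j * mdist m x y)" for j :: nat and x
  have low: "- B \<le> F y + real j * mdist m x y" if "y \<in> mspace m" for j x y
    using B[OF that] mult_nonneg_nonneg[OF of_nat_0_le_iff[of j] m.nonneg[of x y]] by linarith
  have bdd: "bdd_below ((\<lambda>y. F y + real j * mdist m x y) ` mspace m)" for j x
    by (rule bdd_belowI[of _ "- B"]) (use low in auto)
  show le: "f j x \<le> F x" if "x \<in> mspace m" for j x
    using cINF_lower[OF bdd[of j x] that] that by (simp add: f_def)
  have ge: "- B \<le> f j x" if "x \<in> mspace m" for j x
    unfolding f_def using that low by (intro cINF_greatest) auto
  have lip: "f j x \<le> f j y + real j * mdist m x y" if "x \<in> mspace m" "y \<in> mspace m" for j x y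
  proof -
    have "f j x - real j * mdist m x y \<le> f j y" unfolding f_def[of j y]
    proof (rule cINF_greatest)
      fix z assume z: "z \<in> mspace m"
      have "f j x \<le> F z + real j * mdist m x z" unfolding f_def by (rule cINF_lower[OF bdd z])
      also have "\<dots> \<le> F z + real j * (mdist m x y + mdist m y z)"
        using z that by (intro add_left_mono mult_left_mono m.triangle) auto
      finally show "f j x - real j * mdist m x y \<le> F z + real j * mdist m y z"
        by (simp add: algebra_simps)
    qed (use that in auto)
    then show ?thesis by simp
  qed
  show "bounded_Lipschitz m B (real j) (f j)" for j
    unfolding bounded_Lipschitz_def
  proof (intro conjI ballI \<open>0 \<le> B\<close> of_nat_0_le_iff)
    fix x assume x: "x \<in> mspace m"
    show "\<bar>f j x\<bar> \<le> B" using le[OF x, of j] ge[OF x, of j] B[OF x] by linarith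
    fix y assume y: "y \<in> mspace m"
    show "\<bar>f j x - f j y\<bar> \<le> real j * mdist m x y"
      using lip[OF x y, of j] lip[OF y x, of j] m.commute[of x y] by simp
  qed
  show "(\<lambda>j. f j x) \<longlonglongrightarrow> F x" if x: "x \<in> mspace m" for x
  proof (rule LIMSEQ_I)
    fix e :: real assume e: "0 < e"
    have "openin (mtopology_of m) {y \<in> mspace m. F y \<in> {F x - e / 2<..}}"
      using openin_continuous_map_preimage[OF F, of "{F x - e / 2<..}"] by simp
    then obtain r where r: "0 < r" "m.mball x r \<subseteq> {y \<in> mspace m. F x - e / 2 < F y}"
      using x e by (auto simp: mtopology_of_def m.openin_mtopology)
    \<comment> \<open>Beyond distance \<open>r\<close> the penalty exceeds \<open>2 * B\<close>, the
      largest possible oscillation of \<open>F\<close>, so the infimum is decided inside the ball,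
      where \<open>F\<close> is almost \<open>F x\<close>.\<close>
    obtain n :: nat where n: "2 * B / r < real n" using reals_Archimedean2 by blast
    have "norm (f j x - F x) < e" if "n \<le> j" for j
    proof -
      have "F x - e / 2 \<le> f j x" unfolding f_def
      proof (rule cINF_greatest)
        fix y assume y: "y \<in> mspace m"
        show "F x - e / 2 \<le> F y + real j * mdist m x y"
        proof (cases "mdist m x y < r")
          case True
          then have "y \<in> m.mball x r" using x y by simp
          then have "F x - e / 2 < F y" using r by auto
          then show ?thesis using mult_nonneg_nonneg[OF of_nat_0_le_iff[of j] m.nonneg[of x y]] by linarith
        next
          case False
          have "2 * B \<le> real n * r" using n r by (simp add: field_simps)
          also have "\<dots> \<le> real j * mdist m x y" using False that r by (intro mult_mono) auto
          finally show ?thesis using B[OF x] B[OF y] e by simp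
        qed
      qed (use x in auto)
      then show ?thesis using le[OF x, of j] e by simp
    qed
    then show "\<exists>no. \<forall>j\<ge>no. norm (f j x - F x) < e" by blast
  qed
qed

text \<open>Lipschitz approximants from below turn the hypothesis into an asymptotic lower bound for
  the expectations of \<open>F\<close>; the same bound for \<open>- F\<close> is the upper one. This
  is the portmanteau argument, carried out without compactness.\<close>

lemma bounded_Lipschitz_imp_continuous_convergence:
  fixes m :: "'s metric" and F :: "'s \<Rightarrow> real"
  assumes M: "prob_space M" and N: "prob_space N"
    and X: "\<forall>\<^sub>F \<epsilon> in \<F>. X \<epsilon> \<in> measurable M (borel_sigma (mtopology_of m))"
    and Y: "Y \<in> measurable N (borel_sigma (mtopology_of m))"
    and conv: "\<And>f B L. bounded_Lipschitz m B L f \<Longrightarrow>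
      ((\<lambda>\<epsilon>. LINT \<omega>|M. f (X \<epsilon> \<omega>)) \<longlongrightarrow> (LINT \<omega>|N. f (Y \<omega>))) \<F>"
    and F: "continuous_map (mtopology_of m) euclideanreal F" "bounded (F ` mspace m)"
  shows "((\<lambda>\<epsilon>. LINT \<omega>|M. F (X \<epsilon> \<omega>)) \<longlongrightarrow> (LINT \<omega>|N. F (Y \<omega>))) \<F>"
proof -
  interpret M: prob_space M by fact
  interpret N: prob_space N by fact
  have lower: "\<forall>\<^sub>F \<epsilon> in \<F>. (LINT \<omega>|N. F (Y \<omega>)) - e < (LINT \<omega>|M. F (X \<epsilon> \<omega>))"
    if F: "continuous_map (mtopology_of m) euclideanreal F"
      and B: "\<And>x. x \<in> mspace m \<Longrightarrow> \<bar>F x\<bar> \<le> B" and B0: "0 \<le> B" and e: "0 < e" for F :: "'s \<Rightarrow> real" and B e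
  proof -
    obtain f :: "nat \<Rightarrow> 's \<Rightarrow> real" where f: "\<And>j. bounded_Lipschitz m B (real j) (f j)"
        "\<And>j x. x \<in> mspace m \<Longrightarrow> f j x \<le> F x"
        "\<And>x. x \<in> mspace m \<Longrightarrow> (\<lambda>j. f j x) \<longlonglongrightarrow> F x"
      using Lipschitz_approximation_from_below[OF F B B0] by blast
    have Ys: "Y \<omega> \<in> mspace m" if "\<omega> \<in> space N" for \<omega>
      using measurable_space[OF Y that] by simp
    note fm = bounded_Lipschitz_measurable[OF f(1)]
    have fB: "\<bar>f j x\<bar> \<le> B" if "x \<in> mspace m" for j x
      using f(1)[of j] that by (auto simp: bounded_Lipschitz_def)
    have "(\<lambda>j. LINT \<omega>|N. f j (Y \<omega>)) \<longlonglongrightarrow> (LINT \<omega>|N. F (Y \<omega>))"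
      by (rule integral_dominated_convergence[where w = "\<lambda>_. B"])
        (use Ys f(3) fB in \<open>auto intro!: measurable_compose[OF Y] borel_measurable_continuous_map F fm\<close>)
    then have "\<forall>\<^sub>F j in sequentially. (LINT \<omega>|N. F (Y \<omega>)) - e / 2 < (LINT \<omega>|N. f j (Y \<omega>))"
      by (rule order_tendstoD) (use e in simp)
    then obtain j where j: "(LINT \<omega>|N. F (Y \<omega>)) - e / 2 < (LINT \<omega>|N. f j (Y \<omega>))"
      by (auto simp: eventually_sequentially)
    have "\<forall>\<^sub>F \<epsilon> in \<F>. (LINT \<omega>|N. f j (Y \<omega>)) - e / 2 < (LINT \<omega>|M. f j (X \<epsilon> \<omega>))"
      by (rule order_tendstoD[OF conv[OF f(1)]]) (use e in simp)
    with X show ?thesis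
    proof eventually_elim
      case (elim \<epsilon>)
      have Xs: "X \<epsilon> \<omega> \<in> mspace m" if "\<omega> \<in> space M" for \<omega>
        using measurable_space[OF elim(1) that] by simp
      have "(LINT \<omega>|M. f j (X \<epsilon> \<omega>)) \<le> (LINT \<omega>|M. F (X \<epsilon> \<omega>))"
        using Xs f(2) fB B
        by (intro integral_mono M.integrable_bounded_compose[OF elim(1), where B = B]
            borel_measurable_continuous_map F fm) auto
      with elim j show ?case by simp
    qed
  qed
  obtain B where B: "\<And>x. x \<in> mspace m \<Longrightarrow> \<bar>F x\<bar> \<le> B" "0 \<le> B"
    using F(2) unfolding bounded_pos by (metis imageI less_imp_le real_norm_def)
  show ?thesis
  proof (rule order_tendstoI)
    fix c assume "c < (LINT \<omega>|N. F (Y \<omega>))"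
    then show "\<forall>\<^sub>F \<epsilon> in \<F>. c < (LINT \<omega>|M. F (X \<epsilon> \<omega>))"
      using lower[OF F(1) B, of "(LINT \<omega>|N. F (Y \<omega>)) - c"] by simp
  next
    fix c assume c: "(LINT \<omega>|N. F (Y \<omega>)) < c"
    have "continuous_map (mtopology_of m) euclideanreal (\<lambda>x. - F x)"
      using F(1) by (rule continuous_map_minus)
    from lower[OF this, of B "c - (LINT \<omega>|N. F (Y \<omega>))"] B c
    show "\<forall>\<^sub>F \<epsilon> in \<F>. (LINT \<omega>|M. F (X \<epsilon> \<omega>)) < c" by simp
  qed
qed

text \<open>The distance of two random elements of a nonseparable space may fail to be measurable,
  hence the measurable majorant \<open>g\<close>. It takes values in \<open>ennreal\<close>, so that
  the random series \<open>TV\<close> can be inserted directly.\<close>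

lemma (in prob_space) bounded_Lipschitz_expectation_diff:
  assumes X: "X \<in> measurable M (borel_sigma (mtopology_of m))"
    and Z: "Z \<in> measurable M (borel_sigma (mtopology_of m))"
    and f: "bounded_Lipschitz m B L f"
    and g: "g \<in> borel_measurable M" "AE \<omega> in M. ennreal (mdist m (X \<omega>) (Z \<omega>)) \<le> g \<omega>"
    and e: "(\<integral>\<^sup>+\<omega>. g \<omega> \<partial>M) \<le> ennreal e" "0 \<le> e"
  shows "\<bar>(LINT \<omega>|M. f (X \<omega>)) - (LINT \<omega>|M. f (Z \<omega>))\<bar> \<le> L * e"
proof -
  have L: "0 \<le> L" and fB: "\<And>x. x \<in> mspace m \<Longrightarrow> \<bar>f x\<bar> \<le> B"
    using f by (auto simp: bounded_Lipschitz_def)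
  have int: "integrable M (\<lambda>\<omega>. f (X \<omega>))" "integrable M (\<lambda>\<omega>. f (Z \<omega>))"
    using fB by (auto intro!: integrable_bounded_compose[OF X] integrable_bounded_compose[OF Z]
        bounded_Lipschitz_measurable[OF f])
  have "ennreal \<bar>(LINT \<omega>|M. f (X \<omega>)) - (LINT \<omega>|M. f (Z \<omega>))\<bar>
      = ennreal (norm (LINT \<omega>|M. f (X \<omega>) - f (Z \<omega>)))"
    using int by simp
  also have "\<dots> \<le> (\<integral>\<^sup>+\<omega>. norm (f (X \<omega>) - f (Z \<omega>)) \<partial>M)"
    by (rule integral_norm_bound_ennreal) (use int in simp)
  also have "\<dots> \<le> (\<integral>\<^sup>+\<omega>. ennreal L * g \<omega> \<partial>M)"
  proof (rule nn_integral_mono_AE)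
    show "AE \<omega> in M. ennreal (norm (f (X \<omega>) - f (Z \<omega>))) \<le> ennreal L * g \<omega>"
      using g(2) AE_space
    proof eventually_elim
      case (elim \<omega>)
      have "X \<omega> \<in> mspace m" "Z \<omega> \<in> mspace m"
        using measurable_space[OF X elim(2)] measurable_space[OF Z elim(2)] by simp_all
      then have "\<bar>f (X \<omega>) - f (Z \<omega>)\<bar> \<le> L * mdist m (X \<omega>) (Z \<omega>)"
        using f by (auto simp: bounded_Lipschitz_def)
      then have "ennreal (norm (f (X \<omega>) - f (Z \<omega>))) \<le> ennreal L * ennreal (mdist m (X \<omega>) (Z \<omega>))"
        using L by (simp add: ennreal_mult'[symmetric] ennreal_leI)
      also have "\<dots> \<le> ennreal L * g \<omega>" using elim(1) by (rule mult_left_mono) simp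
      finally show ?case .
    qed
  qed
  also have "\<dots> = ennreal L * (\<integral>\<^sup>+\<omega>. g \<omega> \<partial>M)" by (rule nn_integral_cmult[OF g(1)])
  also have "\<dots> \<le> ennreal L * ennreal e" using e by (intro mult_left_mono) auto
  also have "\<dots> = ennreal (L * e)" using L by (simp add: ennreal_mult')
  finally show ?thesis using L e by (simp add: ennreal_le_iff)
qed

text \<open>Outside \<open>E\<close> only the bound \<open>B\<close> is used, which costs
  \<open>2 * B * \<eta>\<close>. Closeness in probability enters the proof through this
  estimate.\<close>

lemma (in prob_space) bounded_Lipschitz_expectation_diff_event:
  assumes X: "X \<in> measurable M (borel_sigma (mtopology_of m))"
    and Z: "Z \<in> measurable M (borel_sigma (mtopology_of m))"
    and f: "bounded_Lipschitz m B L f"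
    and E: "E \<in> sets M" "prob (space M - E) \<le> \<eta>"
    and \<delta>: "AE \<omega> in M. \<omega> \<in> E \<longrightarrow> mdist m (X \<omega>) (Z \<omega>) \<le> \<delta>" "0 \<le> \<delta>"
  shows "\<bar>(LINT \<omega>|M. f (X \<omega>)) - (LINT \<omega>|M. f (Z \<omega>))\<bar> \<le> L * \<delta> + 2 * B * \<eta>"
proof -
  have L: "0 \<le> L" "0 \<le> B" and fB: "\<And>x. x \<in> mspace m \<Longrightarrow> \<bar>f x\<bar> \<le> B"
    using f by (auto simp: bounded_Lipschitz_def)
  have int: "integrable M (\<lambda>\<omega>. f (X \<omega>))" "integrable M (\<lambda>\<omega>. f (Z \<omega>))"
    using fB by (auto intro!: integrable_bounded_compose[OF X] integrable_bounded_compose[OF Z]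
        bounded_Lipschitz_measurable[OF f])
  have int2: "integrable M (\<lambda>\<omega>. L * \<delta> + 2 * B * indicator (space M - E) \<omega>)"
    using E by (intro Bochner_Integration.integrable_add integrable_mult_right) (auto simp: emeasure_eq_measure)
  have "\<bar>(LINT \<omega>|M. f (X \<omega>)) - (LINT \<omega>|M. f (Z \<omega>))\<bar> = \<bar>LINT \<omega>|M. f (X \<omega>) - f (Z \<omega>)\<bar>"
    using int by simp
  also have "\<dots> \<le> (LINT \<omega>|M. \<bar>f (X \<omega>) - f (Z \<omega>)\<bar>)" by (rule integral_abs_bound)
  also have "\<dots> \<le> (LINT \<omega>|M. L * \<delta> + 2 * B * indicator (space M - E) \<omega>)"
  proof (rule integral_mono_AE)
    show "AE \<omega> in M. \<bar>f (X \<omega>) - f (Z \<omega>)\<bar> \<le> L * \<delta> + 2 * B * indicator (space M - E) \<omega>"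
      using \<delta>(1) AE_space
    proof eventually_elim
      case (elim \<omega>)
      have X': "X \<omega> \<in> mspace m" and Z': "Z \<omega> \<in> mspace m"
        using measurable_space[OF X elim(2)] measurable_space[OF Z elim(2)] by simp_all
      show ?case
      proof (cases "\<omega> \<in> E")
        case True
        have "\<bar>f (X \<omega>) - f (Z \<omega>)\<bar> \<le> L * mdist m (X \<omega>) (Z \<omega>)"
          using f X' Z' by (auto simp: bounded_Lipschitz_def)
        also have "\<dots> \<le> L * \<delta>" using elim True L by (intro mult_left_mono) auto
        finally show ?thesis using True by simp
      next
        case False
        have "0 \<le> L * \<delta>" using L \<delta> by simp
        then show ?thesis using False elim(2) fB[OF X'] fB[OF Z'] by simp
      qed
    qed
  qed (use int int2 in auto)
  also have "\<dots> = L * \<delta> + 2 * B * prob (space M - E)"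
    using E by (subst Bochner_Integration.integral_add) (auto simp: emeasure_eq_measure prob_space)
  also have "\<dots> \<le> L * \<delta> + 2 * B * \<eta>" using E L by (intro add_left_mono mult_left_mono) auto
  finally show ?thesis .
qed

text \<open>Differences of consecutive ramps, so that the sum telescopes.\<close>

lemma Lipschitz_partition_of_unity:
  fixes c d \<delta> :: real
  assumes "c < d" "0 < \<delta>"
  obtains K :: nat and p :: "nat \<Rightarrow> real" and \<psi> :: "nat \<Rightarrow> real \<Rightarrow> real" and L :: real
  where "\<And>k. k \<le> K \<Longrightarrow> p k \<in> {c<..<d}" "\<And>k r. 0 \<le> \<psi> k r" "\<And>r. (\<Sum>k\<le>K. \<psi> k r) = 1"
    "\<And>k r s. \<bar>\<psi> k r - \<psi> k s\<bar> \<le> L * \<bar>r - s\<bar>"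
    "\<And>k r. k \<le> K \<Longrightarrow> r \<in> {c..d} \<Longrightarrow> \<psi> k r \<noteq> 0 \<Longrightarrow> \<bar>r - p k\<bar> \<le> \<delta>"
proof -
  obtain K :: nat where K: "(d - c) / \<delta> < real K" using reals_Archimedean2 by blast
  \<comment> \<open>There are \<open>K + 2\<close> cells for \<open>K + 1\<close> nodes
    \<open>p k\<close>, so every node lies strictly inside \<open>{c<..<d}\<close>; functions given
    only on the open interval can be evaluated there.\<close>
  define h where "h = (d - c) / (real K + 2)"
  have h: "0 < h" using assms by (simp add: h_def)
  have h\<delta>: "h \<le> \<delta>"
  proof -
    have "d - c \<le> \<delta> * (real K + 2)" using K assms by (simp add: field_simps)
    then show ?thesis unfolding h_def by (subst pos_divide_le_eq) auto
  qed
  have d: "d = c + h * (real K + 2)" using assms by (simp add: h_def)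
  \<comment> \<open>Ramp 0 is frozen at 1 and every ramp beyond \<open>K\<close> at 0, so the
    telescoping sum is exactly 1 on the whole line, also outside \<open>{c..d}\<close>.\<close>
  define \<rho> where "\<rho> k r = (if k = 0 then 1 else if K < k then 0 else max 0 (min 1 ((r - c) / h - real k)))"
    for k and r :: real
  define \<psi> where "\<psi> k r = \<rho> k r - \<rho> (Suc k) r" for k r
  define p where "p k = c + h * (real k + 1)" for k
  have lip: "\<bar>\<rho> k r - \<rho> k s\<bar> \<le> 1 / h * \<bar>r - s\<bar>" for k r s
  proof -
    have "\<bar>\<rho> k r - \<rho> k s\<bar> \<le> \<bar>(r - c) / h - (s - c) / h\<bar>" by (auto simp: \<rho>_def)
    also have "\<dots> = 1 / h * \<bar>r - s\<bar>"
      using h by (simp add: diff_divide_distrib[symmetric] abs_divide)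
    finally show ?thesis .
  qed
  show ?thesis
  proof (rule that[of K p \<psi> "2 / h"])
    show "p k \<in> {c<..<d}" if "k \<le> K" for k using h that by (simp add: p_def d)
    show "0 \<le> \<psi> k r" for k r by (auto simp: \<psi>_def \<rho>_def)
    show "(\<Sum>k\<le>K. \<psi> k r) = 1" for r
      unfolding \<psi>_def by (subst sum_telescope) (simp add: \<rho>_def)
    show "\<bar>\<psi> k r - \<psi> k s\<bar> \<le> 2 / h * \<bar>r - s\<bar>" for k r s
      using lip[of k r s] lip[of "Suc k" r s] by (simp add: \<psi>_def)
    show "\<bar>r - p k\<bar> \<le> \<delta>" if k: "k \<le> K" and r: "r \<in> {c..d}" and nz: "\<psi> k r \<noteq> 0" for k r
    proof -
      define x where "x = (r - c) / h"
      have r': "r = c + h * x" using h by (simp add: x_def)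
      have "0 \<le> x" using r h by (simp add: x_def)
      moreover have "x \<le> real K + 2" using r h by (simp add: d r')
      ultimately have "\<bar>x - (real k + 1)\<bar> \<le> 1"
        using nz k unfolding \<psi>_def \<rho>_def x_def[symmetric] by (auto split: if_splits simp: max_def min_def)
      then have "h * \<bar>x - (real k + 1)\<bar> \<le> h * 1" using h by (intro mult_left_mono) auto
      moreover have "r - p k = h * (x - (real k + 1))" by (simp add: r' p_def algebra_simps)
      ultimately have "\<bar>r - p k\<bar> \<le> h" using h by (simp only: abs_mult abs_of_pos mult_1_right)
      then show ?thesis using h\<delta> by simp
    qed
  qed
qed

section \<open>Random elements of the function spaces\<close>

lemma mdist_C_metric_le:
  assumes "0 \<le> e" "\<And>x. x \<in> D \<Longrightarrow> \<bar>f x - g x\<bar> \<le> e"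
  shows "mdist (C_metric D) f g \<le> e"
  unfolding C_metric_def using assms by (intro mdist_cfunspace_le) (auto simp: dist_real_def)

lemma C_metric_abs_diff_le:
  assumes "f \<in> mspace (C_metric D)" "g \<in> mspace (C_metric D)" "x \<in> D"
  shows "\<bar>f x - g x\<bar> \<le> mdist (C_metric D) f g"
  using mdist_cfunspace_imp_mdist_le[of f "top_of_set D" euclidean_metric g _ x] assms
  by (auto simp: C_metric_def dist_real_def)

lemma mspace_C_metric:
  "mspace (C_metric D) = {f. f \<in> extensional D \<and> bounded (f ` D) \<and> continuous_on D f}"
  by (auto simp: C_metric_def)

lemma restrict_in_C_metric:
  assumes "continuous_on D f" "bounded (f ` D)"
  shows "restrict f D \<in> mspace (C_metric D)"
  using assms by (auto simp: mspace_C_metric cong: continuous_on_cong)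

lemma uniformly_continuous_in_C_metric:
  assumes "uniformly_continuous_on D f" "bounded (D :: real set)"
  shows "restrict f D \<in> mspace (C_metric D)"
  using assms uniformly_continuous_imp_continuous
  by (intro restrict_in_C_metric bounded_uniformly_continuous_image) auto

text \<open>The Lipschitz bound makes \<Psi> continuous on the countable product of lines, whose
  Borel sets are generated by the coordinates. So a map that depends on finitely many real random
  variables is Borel measurable without any separability of the target.\<close>

lemma measurable_finite_dimensional:
  fixes \<Psi> :: "(nat \<Rightarrow> real) \<Rightarrow> 's"
  assumes \<xi>: "\<And>k. \<xi> k \<in> borel_measurable M"
    and \<Psi>: "\<And>y. \<Psi> y \<in> mspace m"
    and lip: "\<And>y z. mdist m (\<Psi> y) (\<Psi> z) \<le> (\<Sum>k<n. C k * \<bar>y k - z k\<bar>)"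
  shows "(\<lambda>\<omega>. \<Psi> (\<lambda>k. \<xi> k \<omega>)) \<in> measurable M (borel_sigma (mtopology_of m))"
proof (rule measurable_borel_sigmaI)
  interpret m: Metric_space "mspace m" "mdist m" by simp
  show "\<Psi> (\<lambda>k. \<xi> k \<omega>) \<in> topspace (mtopology_of m)" for \<omega> using \<Psi> by simp
  fix U assume U: "openin (mtopology_of m) U"
  have "open (\<Psi> -` U)"
  proof (subst open_subopen, intro ballI)
    fix y assume "y \<in> \<Psi> -` U"
    then obtain r where r: "0 < r" "m.mball (\<Psi> y) r \<subseteq> U"
      using U by (auto simp: mtopology_of_def m.openin_mtopology)
    define T where "T = {z. (\<Sum>k<n. C k * \<bar>y k - z k\<bar>) < r}"
    have "continuous_on UNIV (\<lambda>z :: nat \<Rightarrow> real. \<Sum>k<n. C k * \<bar>y k - z k\<bar>)"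
      by (intro continuous_intros continuous_on_subset[OF continuous_on_product_coordinates]) auto
    then have "open T" unfolding T_def by (rule open_Collect_less[OF _ continuous_on_const])
    moreover have "y \<in> T" using r by (simp add: T_def)
    moreover have "T \<subseteq> \<Psi> -` U"
    proof
      fix z assume "z \<in> T"
      then have "\<Psi> z \<in> m.mball (\<Psi> y) r" using lip[of y z] \<Psi> by (simp add: T_def)
      then show "z \<in> \<Psi> -` U" using r by auto
    qed
    ultimately show "\<exists>T. open T \<and> y \<in> T \<and> T \<subseteq> \<Psi> -` U" by blast
  qed
  moreover have "(\<lambda>\<omega> k. \<xi> k \<omega>) \<in> borel_measurable M"
    by (rule measurable_coordinatewise_then_product) (rule \<xi>)
  ultimately have "(\<lambda>\<omega> k. \<xi> k \<omega>) -` (\<Psi> -` U) \<inter> space M \<in> sets M"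
    by (intro measurable_sets[of _ M borel]) auto
  then show "(\<lambda>\<omega>. \<Psi> (\<lambda>k. \<xi> k \<omega>)) -` U \<inter> space M \<in> sets M" by (simp add: vimage_def)
qed

text \<open>A uniformly continuous path is the uniform limit of its interpolations by a partition of
  unity, and each interpolation depends on finitely many values of the path. Measurability at single
  points would not suffice by itself, because the space is not separable.\<close>

lemma measurable_C_metric:
  fixes v :: "real \<Rightarrow> 'w \<Rightarrow> real"
  assumes "a < b" and D: "D = {a<..<b}"
    and v: "\<And>x. x \<in> D \<Longrightarrow> v x \<in> borel_measurable M"
    and uc: "\<And>\<omega>. \<omega> \<in> space M \<Longrightarrow> uniformly_continuous_on D (\<lambda>x. v x \<omega>)"
  shows "(\<lambda>\<omega>. \<lambda>x\<in>D. v x \<omega>) \<in> measurable M (borel_sigma (mtopology_of (C_metric D)))"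
proof -
  have bD: "bounded D" by (simp add: D)
  have "\<exists>K (p :: nat \<Rightarrow> real) \<psi> L. (\<forall>k\<le>K. p k \<in> D) \<and> (\<forall>k r. 0 \<le> \<psi> k r) \<and> (\<forall>r. (\<Sum>k\<le>K. \<psi> k r) = (1::real)) \<and>
      (\<forall>k r s. \<bar>\<psi> k r - \<psi> k s\<bar> \<le> L * \<bar>r - s\<bar>) \<and>
      (\<forall>k\<le>K. \<forall>r\<in>{a..b}. \<psi> k r \<noteq> 0 \<longrightarrow> \<bar>r - p k\<bar> \<le> inverse (real (Suc n)))" for n
    by (rule Lipschitz_partition_of_unity[OF \<open>a < b\<close>, of "inverse (real (Suc n))"]) (simp, unfold D, blast)
  then obtain K and p :: "nat \<Rightarrow> nat \<Rightarrow> real" and \<psi> L where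
    P: "\<And>n k. k \<le> K n \<Longrightarrow> p n k \<in> D" "\<And>n k r. 0 \<le> \<psi> n k r" "\<And>n r. (\<Sum>k\<le>K n. \<psi> n k r) = (1::real)"
      "\<And>n k r s. \<bar>\<psi> n k r - \<psi> n k s\<bar> \<le> L n * \<bar>r - s\<bar>"
      "\<And>n k r. k \<le> K n \<Longrightarrow> r \<in> {a..b} \<Longrightarrow> \<psi> n k r \<noteq> 0 \<Longrightarrow> \<bar>r - p n k\<bar> \<le> inverse (real (Suc n))"
    by metis
  define \<Psi> where "\<Psi> n y = (\<lambda>x\<in>D. \<Sum>k\<le>K n. \<psi> n k x * y k)" for n and y :: "nat \<Rightarrow> real"
  have \<psi>1: "\<psi> n k x \<le> 1" if "k \<le> K n" for n k x
    using member_le_sum[of k "{..K n}" "\<lambda>k. \<psi> n k x"] P(2,3) that by auto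
  have cont: "continuous_on D (\<psi> n k)" for n k
  proof -
    have "0 \<le> L n" using order_trans[OF abs_ge_zero P(4)[of n k 0 1]] by simp
    then have "(L n)-lipschitz_on D (\<psi> n k)" using P(4) by (auto intro!: lipschitz_onI simp: dist_real_def)
    then show ?thesis by (rule lipschitz_on_continuous_on)
  qed
  have \<Psi>_space: "\<Psi> n y \<in> mspace (C_metric D)" for n y
    unfolding \<Psi>_def
  proof (rule restrict_in_C_metric)
    show "continuous_on D (\<lambda>x. \<Sum>k\<le>K n. \<psi> n k x * y k)" by (intro continuous_intros cont)
    have "norm (\<Sum>k\<le>K n. \<psi> n k x * y k) \<le> (\<Sum>k\<le>K n. \<bar>y k\<bar>)" for x
      using P(2) \<psi>1 by (intro sum_norm_le) (auto simp: abs_mult intro!: mult_left_le_one_le)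
    then show "bounded ((\<lambda>x. \<Sum>k\<le>K n. \<psi> n k x * y k) ` D)" by (auto simp: bounded_iff)
  qed
  \<comment> \<open>Only the nodes with \<open>k \<le> K n\<close> lie in \<open>D\<close>, where
    \<open>v\<close> is known to be measurable; the other coordinates are set to 0.\<close>
  define \<xi> where "\<xi> n k = (if k \<le> K n then v (p n k) else (\<lambda>_. 0))" for n k
  define X where "X n \<omega> = \<Psi> n (\<lambda>k. \<xi> n k \<omega>)" for n \<omega>
  show ?thesis
  proof (rule measurable_borel_sigma_limit[of X])
    show "X n \<in> measurable M (borel_sigma (mtopology_of (C_metric D)))" for n
      unfolding X_def
    proof (rule measurable_finite_dimensional[where n = "Suc (K n)" and C = "\<lambda>_. 1"])
      show "\<xi> n k \<in> borel_measurable M" for k using v P(1) by (simp add: \<xi>_def)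
      show "\<Psi> n y \<in> mspace (C_metric D)" for y by (rule \<Psi>_space)
      show "mdist (C_metric D) (\<Psi> n y) (\<Psi> n z) \<le> (\<Sum>k<Suc (K n). 1 * \<bar>y k - z k\<bar>)" for y z
      proof (rule mdist_C_metric_le)
        fix x assume x: "x \<in> D"
        have "\<bar>\<Psi> n y x - \<Psi> n z x\<bar> = \<bar>\<Sum>k\<le>K n. \<psi> n k x * (y k - z k)\<bar>"
          using x by (simp add: \<Psi>_def sum_subtractf right_diff_distrib)
        also have "\<dots> \<le> (\<Sum>k\<le>K n. \<bar>\<psi> n k x * (y k - z k)\<bar>)" by (rule sum_abs)
        also have "\<dots> \<le> (\<Sum>k\<le>K n. 1 * \<bar>y k - z k\<bar>)"
        proof (rule sum_mono)
          fix k assume "k \<in> {..K n}"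
          then show "\<bar>\<psi> n k x * (y k - z k)\<bar> \<le> 1 * \<bar>y k - z k\<bar>"
            unfolding abs_mult using P(2)[of n k x] \<psi>1[of k n x] by (intro mult_right_mono) auto
        qed
        finally show "\<bar>\<Psi> n y x - \<Psi> n z x\<bar> \<le> (\<Sum>k<Suc (K n). 1 * \<bar>y k - z k\<bar>)"
          by (simp only: lessThan_Suc_atMost)
      qed (simp add: sum_nonneg)
    qed
    fix \<omega> assume \<omega>: "\<omega> \<in> space M"
    show "(\<lambda>x\<in>D. v x \<omega>) \<in> mspace (C_metric D)"
      by (rule uniformly_continuous_in_C_metric[OF uc[OF \<omega>] bD])
    show "(\<lambda>n. mdist (C_metric D) (X n \<omega>) (\<lambda>x\<in>D. v x \<omega>)) \<longlonglongrightarrow> 0"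
    proof (rule LIMSEQ_I)
      fix e :: real assume e: "0 < e"
      obtain \<delta> where \<delta>: "0 < \<delta>" "\<And>x y. x \<in> D \<Longrightarrow> y \<in> D \<Longrightarrow> dist y x < \<delta> \<Longrightarrow> dist (v y \<omega>) (v x \<omega>) < e / 2"
        using uc[OF \<omega>] e unfolding uniformly_continuous_on_def by (meson half_gt_zero)
      obtain n0 where n0: "inverse (real (Suc n0)) < \<delta>" using reals_Archimedean[OF \<delta>(1)] by blast
      have "norm (mdist (C_metric D) (X n \<omega>) (\<lambda>x\<in>D. v x \<omega>) - 0) < e" if n: "n0 \<le> n" for n
      proof -
        have "mdist (C_metric D) (X n \<omega>) (\<lambda>x\<in>D. v x \<omega>) \<le> e / 2"
        proof (rule mdist_C_metric_le)
          fix x assume x: "x \<in> D"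
          have "X n \<omega> x - v x \<omega> = (\<Sum>k\<le>K n. \<psi> n k x * v (p n k) \<omega>) - (\<Sum>k\<le>K n. \<psi> n k x) * v x \<omega>"
            using x by (simp add: X_def \<Psi>_def \<xi>_def P(3))
          also have "\<dots> = (\<Sum>k\<le>K n. \<psi> n k x * (v (p n k) \<omega> - v x \<omega>))"
            by (simp add: sum_distrib_right sum_subtractf right_diff_distrib)
          also have "\<bar>\<dots>\<bar> \<le> (\<Sum>k\<le>K n. \<bar>\<psi> n k x * (v (p n k) \<omega> - v x \<omega>)\<bar>)" by (rule sum_abs)
          also have "\<dots> \<le> (\<Sum>k\<le>K n. \<psi> n k x * (e / 2))"
          proof (rule sum_mono)
            fix k assume k: "k \<in> {..K n}"
            show "\<bar>\<psi> n k x * (v (p n k) \<omega> - v x \<omega>)\<bar> \<le> \<psi> n k x * (e / 2)"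
            proof (cases "\<psi> n k x = 0")
              case False
              have "\<bar>x - p n k\<bar> \<le> inverse (real (Suc n))" using P(5)[of k n x] k x False by (auto simp: D)
              also have "\<dots> \<le> inverse (real (Suc n0))" using n by simp
              also have "\<dots> < \<delta>" by (rule n0)
              finally have "dist (v (p n k) \<omega>) (v x \<omega>) < e / 2"
                using k x P(1) by (intro \<delta>) (auto simp: dist_real_def)
              then have "\<bar>v (p n k) \<omega> - v x \<omega>\<bar> \<le> e / 2" by (simp only: dist_real_def less_imp_le)
              then have "\<psi> n k x * \<bar>v (p n k) \<omega> - v x \<omega>\<bar> \<le> \<psi> n k x * (e / 2)"
                by (rule mult_left_mono) (rule P(2))
              then show ?thesis using P(2)[of n k x] by (simp only: abs_mult abs_of_nonneg)
            qed simp
          qed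
          also have "\<dots> = e / 2" by (simp only: sum_distrib_right[symmetric] P(3))
          finally show "\<bar>X n \<omega> x - (\<lambda>x\<in>D. v x \<omega>) x\<bar> \<le> e / 2" using x by simp
        qed (use e in simp)
        moreover have "0 \<le> mdist (C_metric D) (X n \<omega>) (\<lambda>x\<in>D. v x \<omega>)" by simp
        ultimately show ?thesis using e by simp
      qed
      then show "\<exists>no. \<forall>n\<ge>no. norm (mdist (C_metric D) (X n \<omega>) (\<lambda>x\<in>D. v x \<omega>) - 0) < e" by blast
    qed
  qed
qed

lemma L1_class_in_L1_space: "set_integrable lborel D u \<Longrightarrow> L1_class D u \<in> L1_space D"
  unfolding L1_class_def L1_space_def by (rule quotientI) simp

text \<open>The representatives chosen by \<open>SOME\<close> agree almost everywhere with
  \<open>u\<close> and \<open>v\<close>, so the distance may be computed from any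
  representatives.\<close>

lemma L1_dist_L1_class:
  assumes u: "set_integrable lborel D u" and v: "set_integrable lborel D v"
  shows "L1_dist D (L1_class D u) (L1_class D v) = (LINT x:D|lborel. \<bar>u x - v x\<bar>)"
proof -
  have AE: "set_integrable lborel D (SOME u'. u' \<in> L1_class D u)"
    "AE x in lborel. x \<in> D \<longrightarrow> (SOME u'. u' \<in> L1_class D u) x = u x"
    if u: "set_integrable lborel D u" for u
  proof -
    show "set_integrable lborel D (SOME u'. u' \<in> L1_class D u)"
      using L1_representative(1)[OF L1_class_in_L1_space[OF u]] .
    from L1_class_eq_iff[OF this u] L1_representative(2)[OF L1_class_in_L1_space[OF u]]
    show "AE x in lborel. x \<in> D \<longrightarrow> (SOME u'. u' \<in> L1_class D u) x = u x" by simp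
  qed
  show ?thesis unfolding L1_dist_def set_lebesgue_integral_def
  proof (rule integral_cong_AE)
    show "AE x in lborel. indicat_real D x *\<^sub>R \<bar>(SOME u'. u' \<in> L1_class D u) x - (SOME v'. v' \<in> L1_class D v) x\<bar>
        = indicat_real D x *\<^sub>R \<bar>u x - v x\<bar>"
      using AE(2)[OF u] AE(2)[OF v] by eventually_elim (auto simp: indicator_def)
  qed (use set_integrable_abs_diff[OF AE(1)[OF u] AE(1)[OF v]] set_integrable_abs_diff[OF u v]
      in \<open>auto simp: set_integrable_def dest: borel_measurable_integrable\<close>)
qed

lemma set_integrable_bounded_continuous:
  assumes D: "D = {a<..<b :: real}" and f: "continuous_on D f" "bounded (f ` D)"
  shows "set_integrable lborel D (f :: real \<Rightarrow> real)"
proof -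
  obtain B where B: "\<And>x. x \<in> D \<Longrightarrow> norm (f x) \<le> B" using f(2) by (auto simp: bounded_iff)
  show ?thesis unfolding set_integrable_def
  proof (rule Bochner_Integration.integrable_bound[where f = "\<lambda>x. indicator D x * B"])
    show "integrable lborel (\<lambda>x. indicator D x * B)"
      by (intro integrable_mult_left integrable_real_indicator) (auto simp: D intro!: emeasure_bounded_finite[unfolded infinity_ennreal_def])
    show "(\<lambda>x. indicat_real D x *\<^sub>R f x) \<in> borel_measurable lborel"
      using borel_measurable_continuous_on_indicator[OF _ f(1)] by (simp add: D)
    show "AE x in lborel. norm (indicat_real D x *\<^sub>R f x) \<le> norm (indicator D x * B)"
      by (rule AE_I2) (use B in \<open>auto simp: indicator_def intro!: order_trans[OF _ abs_ge_self]\<close>)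
  qed
qed

lemma L1_dist_le_C_metric:
  assumes ab: "a < b" and D: "D = {a<..<b}"
    and f: "f \<in> mspace (C_metric D)" and g: "g \<in> mspace (C_metric D)"
  shows "L1_dist D (L1_class D f) (L1_class D g) \<le> (b - a) * mdist (C_metric D) f g"
proof -
  have i: "set_integrable lborel D f" "set_integrable lborel D g"
    using f g by (auto simp: mspace_C_metric intro!: set_integrable_bounded_continuous[OF D])
  have "(LINT x:D|lborel. \<bar>f x - g x\<bar>) \<le> (LINT x:D|lborel. mdist (C_metric D) f g)"
    using C_metric_abs_diff_le[OF f g]
    by (intro set_integral_mono set_integrable_abs_diff i)
      (auto simp: D set_integrable_def
        intro!: emeasure_bounded_finite[unfolded infinity_ennreal_def] integrable_mult_left integrable_real_indicator)
  also have "\<dots> = (b - a) * mdist (C_metric D) f g"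
    using ab by (simp add: D set_lebesgue_integral_def)
  finally show ?thesis by (simp add: L1_dist_L1_class i)
qed

lemma continuous_map_L1_class:
  assumes ab: "a < b" and D: "D = {a<..<b}"
  shows "continuous_map (mtopology_of (C_metric D)) (mtopology_of (L1_metric D)) (L1_class D)"
  using L1_dist_le_C_metric[OF ab D]
  by (intro Lipschitz_continuous_imp_continuous_map)
    (auto simp: Lipschitz_continuous_map_def mspace_C_metric intro!: L1_class_in_L1_space
      set_integrable_bounded_continuous[OF D])

section \<open>Moments of integrals of the random field\<close>

lemma abs_mult_le_squares: "\<bar>u * v\<bar> \<le> u\<^sup>2 + v\<^sup>2" for u v :: real
proof -
  have "2 * \<bar>u * v\<bar> \<le> u\<^sup>2 + v\<^sup>2"
    using sum_squares_bound[of "\<bar>u\<bar>" "\<bar>v\<bar>"] by (simp add: abs_mult)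
  then show ?thesis by linarith
qed

text \<open>Fubini's theorem on two copies of the parameter space times the probability space. The
  parameter space is arbitrary because the lemma serves twice: with points of an interval for second
  moments, and with pairs of points for fourth moments.\<close>

lemma (in prob_space) second_moment_of_integral:
  fixes Q :: "'p \<Rightarrow> 'a \<Rightarrow> real"
  assumes \<nu>: "finite_measure \<nu>"
    and Qm: "(\<lambda>(p, \<omega>). Q p \<omega>) \<in> borel_measurable (\<nu> \<Otimes>\<^sub>M M)"
    and Q2: "\<And>p. p \<in> space \<nu> \<Longrightarrow> integrable M (\<lambda>\<omega>. (Q p \<omega>)\<^sup>2)"
    and C: "\<And>p. p \<in> space \<nu> \<Longrightarrow> expectation (\<lambda>\<omega>. (Q p \<omega>)\<^sup>2) \<le> C"
  shows "AE \<omega> in M. integrable \<nu> (\<lambda>p. Q p \<omega>)"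
    and "integrable M (\<lambda>\<omega>. (LINT p|\<nu>. Q p \<omega>)\<^sup>2)"
    and "expectation (\<lambda>\<omega>. (LINT p|\<nu>. Q p \<omega>)\<^sup>2)
      = (LINT p|\<nu>. LINT p'|\<nu>. expectation (\<lambda>\<omega>. Q p \<omega> * Q p' \<omega>))"
proof -
  interpret \<nu>: finite_measure \<nu> by fact
  interpret \<nu>M: pair_sigma_finite \<nu> M ..
  interpret \<nu>\<nu>: pair_sigma_finite \<nu> \<nu> ..
  interpret \<Pi>: finite_measure "\<nu> \<Otimes>\<^sub>M \<nu>" by (rule finite_measure_pair_measure) fact+
  interpret \<Pi>M: pair_sigma_finite "\<nu> \<Otimes>\<^sub>M \<nu>" M ..
  note Qm[measurable]
  have Qp[measurable]: "Q p \<in> borel_measurable M" if "p \<in> space \<nu>" for p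
    using measurable_compose[OF measurable_Pair1'[OF that] Qm] by simp
  define f where "f = (\<lambda>((p, p'), \<omega>). Q p \<omega> * Q p' \<omega>)"
  have [measurable]: "(\<lambda>((p, p'), \<omega>). Q p \<omega>) \<in> borel_measurable ((\<nu> \<Otimes>\<^sub>M \<nu>) \<Otimes>\<^sub>M M)"
    using measurable_compose[of "\<lambda>((p, p'), \<omega>). (p, \<omega>)" "(\<nu> \<Otimes>\<^sub>M \<nu>) \<Otimes>\<^sub>M M" "\<nu> \<Otimes>\<^sub>M M", OF _ Qm]
    by (simp add: case_prod_beta')
  have [measurable]: "(\<lambda>((p, p'), \<omega>). Q p' \<omega>) \<in> borel_measurable ((\<nu> \<Otimes>\<^sub>M \<nu>) \<Otimes>\<^sub>M M)"
    using measurable_compose[of "\<lambda>((p, p'), \<omega>). (p', \<omega>)" "(\<nu> \<Otimes>\<^sub>M \<nu>) \<Otimes>\<^sub>M M" "\<nu> \<Otimes>\<^sub>M M", OF _ Qm]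
    by (simp add: case_prod_beta')
  have fm[measurable]: "f \<in> borel_measurable ((\<nu> \<Otimes>\<^sub>M \<nu>) \<Otimes>\<^sub>M M)"
  proof -
    have "f = (\<lambda>z. (\<lambda>((p, p'), \<omega>). Q p \<omega>) z * (\<lambda>((p, p'), \<omega>). Q p' \<omega>) z)"
      by (auto simp: f_def fun_eq_iff)
    also have "\<dots> \<in> borel_measurable ((\<nu> \<Otimes>\<^sub>M \<nu>) \<Otimes>\<^sub>M M)" by measurable
    finally show ?thesis .
  qed
  have int_sq: "(\<integral>\<^sup>+\<omega>. ennreal ((Q p \<omega>)\<^sup>2) \<partial>M) \<le> ennreal C" if "p \<in> space \<nu>" for p
    using nn_integral_eq_integral[OF Q2[OF that]] C[OF that] by (simp add: ennreal_leI)
  have prod_le: "(\<integral>\<^sup>+\<omega>. ennreal (norm (Q p \<omega> * Q p' \<omega>)) \<partial>M) \<le> ennreal C + ennreal C"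
    if p: "p \<in> space \<nu>" "p' \<in> space \<nu>" for p p'
  proof -
    have "(\<integral>\<^sup>+\<omega>. ennreal (norm (Q p \<omega> * Q p' \<omega>)) \<partial>M)
        \<le> (\<integral>\<^sup>+\<omega>. ennreal ((Q p \<omega>)\<^sup>2) + ennreal ((Q p' \<omega>)\<^sup>2) \<partial>M)"
    proof (rule nn_integral_mono)
      fix \<omega>
      have "norm (Q p \<omega> * Q p' \<omega>) \<le> (Q p \<omega>)\<^sup>2 + (Q p' \<omega>)\<^sup>2"
        using abs_mult_le_squares by simp
      then show "ennreal (norm (Q p \<omega> * Q p' \<omega>)) \<le> ennreal ((Q p \<omega>)\<^sup>2) + ennreal ((Q p' \<omega>)\<^sup>2)"
        by (simp add: ennreal_plus[symmetric] ennreal_leI del: ennreal_plus)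
    qed
    also have "\<dots> = (\<integral>\<^sup>+\<omega>. ennreal ((Q p \<omega>)\<^sup>2) \<partial>M) + (\<integral>\<^sup>+\<omega>. ennreal ((Q p' \<omega>)\<^sup>2) \<partial>M)"
      by (rule nn_integral_add) (use p in measurable)
    also have "\<dots> \<le> ennreal C + ennreal C" by (intro add_mono int_sq p)
    finally show ?thesis .
  qed
  have fi: "integrable ((\<nu> \<Otimes>\<^sub>M \<nu>) \<Otimes>\<^sub>M M) f"
  proof (rule integrableI_bounded)
    have "(\<integral>\<^sup>+z. ennreal (norm (f z)) \<partial>((\<nu> \<Otimes>\<^sub>M \<nu>) \<Otimes>\<^sub>M M))
        = (\<integral>\<^sup>+z. \<integral>\<^sup>+\<omega>. ennreal (norm (f (z, \<omega>))) \<partial>M \<partial>(\<nu> \<Otimes>\<^sub>M \<nu>))"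
      by (rule nn_integral_fst[symmetric]) measurable
    also have "\<dots> \<le> (\<integral>\<^sup>+z. ennreal C + ennreal C \<partial>(\<nu> \<Otimes>\<^sub>M \<nu>))"
      by (rule nn_integral_mono) (auto simp: f_def space_pair_measure intro!: prod_le[unfolded real_norm_def])
    also have "\<dots> < \<infinity>" using \<Pi>.emeasure_finite[of "space (\<nu> \<Otimes>\<^sub>M \<nu>)"]
      by (auto simp: ennreal_mult_eq_top_iff less_top[symmetric])
    finally show "(\<integral>\<^sup>+z. ennreal (norm (f z)) \<partial>((\<nu> \<Otimes>\<^sub>M \<nu>) \<Otimes>\<^sub>M M)) < \<infinity>" .
  qed (rule fm)
  have Qi: "integrable (\<nu> \<Otimes>\<^sub>M M) (\<lambda>(p, \<omega>). Q p \<omega>)"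
  proof (rule integrableI_bounded)
    have "(\<integral>\<^sup>+z. ennreal (norm (case z of (p, \<omega>) \<Rightarrow> Q p \<omega>)) \<partial>(\<nu> \<Otimes>\<^sub>M M))
        = (\<integral>\<^sup>+p. \<integral>\<^sup>+\<omega>. ennreal (norm (Q p \<omega>)) \<partial>M \<partial>\<nu>)"
      using Qm by (subst nn_integral_fst[symmetric]) auto
    also have "\<dots> \<le> (\<integral>\<^sup>+p. 1 + ennreal C \<partial>\<nu>)"
    proof (rule nn_integral_mono)
      fix p assume p: "p \<in> space \<nu>"
      have "(\<integral>\<^sup>+\<omega>. ennreal (norm (Q p \<omega>)) \<partial>M) \<le> (\<integral>\<^sup>+\<omega>. 1 + ennreal ((Q p \<omega>)\<^sup>2) \<partial>M)"
      proof (rule nn_integral_mono)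
        fix \<omega>
        have "norm (Q p \<omega>) \<le> 1 + (Q p \<omega>)\<^sup>2"
          using sum_squares_bound[of "\<bar>Q p \<omega>\<bar>" 1] by simp
        then have "ennreal (norm (Q p \<omega>)) \<le> ennreal (1 + (Q p \<omega>)\<^sup>2)" by (rule ennreal_leI)
        then show "ennreal (norm (Q p \<omega>)) \<le> 1 + ennreal ((Q p \<omega>)\<^sup>2)" by simp
      qed
      also have "\<dots> = 1 + (\<integral>\<^sup>+\<omega>. ennreal ((Q p \<omega>)\<^sup>2) \<partial>M)"
        using p by (subst nn_integral_add) (auto simp: emeasure_space_1)
      also have "\<dots> \<le> 1 + ennreal C" by (intro add_mono int_sq p order_refl)
      finally show "(\<integral>\<^sup>+\<omega>. ennreal (norm (Q p \<omega>)) \<partial>M) \<le> 1 + ennreal C" .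
    qed
    also have "\<dots> < \<infinity>" using \<nu>.emeasure_finite[of "space \<nu>"]
      by (auto simp: ennreal_mult_eq_top_iff less_top[symmetric])
    finally show "(\<integral>\<^sup>+z. ennreal (norm (case z of (p, \<omega>) \<Rightarrow> Q p \<omega>)) \<partial>(\<nu> \<Otimes>\<^sub>M M)) < \<infinity>" .
  qed (rule Qm)
  show AE1: "AE \<omega> in M. integrable \<nu> (\<lambda>p. Q p \<omega>)"
    using \<nu>M.AE_integrable_snd[of "\<lambda>p \<omega>. Q p \<omega>"] Qi by simp
  have AE2: "AE \<omega> in M. integrable (\<nu> \<Otimes>\<^sub>M \<nu>) (\<lambda>z. f (z, \<omega>))"
    using \<Pi>M.AE_integrable_snd[of "\<lambda>z \<omega>. f (z, \<omega>)"] fi by simp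
  have sq: "AE \<omega> in M. (LINT z|(\<nu> \<Otimes>\<^sub>M \<nu>). f (z, \<omega>)) = (LINT p|\<nu>. Q p \<omega>)\<^sup>2"
    using AE2
  proof eventually_elim
    case (elim \<omega>)
    have "(LINT z|(\<nu> \<Otimes>\<^sub>M \<nu>). f (z, \<omega>)) = (LINT p|\<nu>. LINT p'|\<nu>. f ((p, p'), \<omega>))"
      by (rule \<nu>\<nu>.integral_fst'[OF elim, symmetric])
    also have "\<dots> = (LINT p|\<nu>. Q p \<omega>)\<^sup>2" by (simp add: f_def power2_eq_square)
    finally show ?case .
  qed
  have int_snd: "integrable M (\<lambda>\<omega>. LINT z|(\<nu> \<Otimes>\<^sub>M \<nu>). f (z, \<omega>))"
    using \<Pi>M.integrable_snd[of "\<lambda>z \<omega>. f (z, \<omega>)"] fi by simp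
  have [measurable]: "(\<lambda>\<omega>. (LINT p|\<nu>. Q p \<omega>)) \<in> borel_measurable M"
    using measurable_compose[OF measurable_pair_swap'[of M \<nu>] Qm]
    by (intro \<nu>.borel_measurable_lebesgue_integral) (simp add: case_prod_beta')
  show "integrable M (\<lambda>\<omega>. (LINT p|\<nu>. Q p \<omega>)\<^sup>2)"
    by (rule iffD1[OF integrable_cong_AE[OF _ _ sq] int_snd]) (use int_snd in auto)
  have "expectation (\<lambda>\<omega>. (LINT p|\<nu>. Q p \<omega>)\<^sup>2) = (LINT \<omega>|M. LINT z|(\<nu> \<Otimes>\<^sub>M \<nu>). f (z, \<omega>))"
    by (rule integral_cong_AE) (use sq int_snd in \<open>auto elim: eventually_mono\<close>)
  also have "\<dots> = (LINT z|(\<nu> \<Otimes>\<^sub>M \<nu>). LINT \<omega>|M. f (z, \<omega>))"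
    using \<Pi>M.Fubini_integral[of "\<lambda>z \<omega>. f (z, \<omega>)"] fi by simp
  also have "\<dots> = (LINT p|\<nu>. LINT p'|\<nu>. LINT \<omega>|M. f ((p, p'), \<omega>))"
    by (rule \<nu>\<nu>.integral_fst'[symmetric], rule \<Pi>M.integrable_fst'[OF fi])
  also have "\<dots> = (LINT p|\<nu>. LINT p'|\<nu>. expectation (\<lambda>\<omega>. Q p \<omega> * Q p' \<omega>))"
    by (simp add: f_def)
  finally show "expectation (\<lambda>\<omega>. (LINT p|\<nu>. Q p \<omega>)\<^sup>2)
      = (LINT p|\<nu>. LINT p'|\<nu>. expectation (\<lambda>\<omega>. Q p \<omega> * Q p' \<omega>))" .
qed

text \<open>Adjacent transpositions generate all permutations of four arguments. It reduces the
  four-point bound to ordered points.\<close>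

lemma symmetric_4_from_sorted:
  fixes P :: "'a::linorder \<Rightarrow> 'a \<Rightarrow> 'a \<Rightarrow> 'a \<Rightarrow> bool"
  assumes s12: "\<And>a b c d. P a b c d \<Longrightarrow> P b a c d" and s23: "\<And>a b c d. P a b c d \<Longrightarrow> P a c b d"
    and s34: "\<And>a b c d. P a b c d \<Longrightarrow> P a b d c"
    and sorted: "\<And>a b c d. a \<le> b \<Longrightarrow> b \<le> c \<Longrightarrow> c \<le> d \<Longrightarrow> P a b c d"
  shows "P a b c d"
proof -
  have 1: "P a b c d" if "a \<le> b" "b \<le> c" for a b c d
    using that sorted s12 s23 s34 by (metis linear)
  have 2: "P a b c d" if "a \<le> b" for a b c d
    using that 1 s12 s23 by (metis linear)
  show ?thesis using 2 s12 by (metis linear)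
qed

locale mixing_field = prob_space M for M :: "'w measure" +
  fixes q :: "real \<Rightarrow> 'w \<Rightarrow> real" and \<phi> :: "real \<Rightarrow> real"
  assumes q_measurable: "(\<lambda>(x, \<omega>). q x \<omega>) \<in> borel_measurable (borel \<Otimes>\<^sub>M M)"
    and q_integrable: "\<And>x. integrable M (q x)" and q_mean: "\<And>x. expectation (q x) = 0"
    and q_stationary: "strictly_stationary M q"
    and R_integrable: "integrable lborel (correlation M q)"
    and q6: "\<And>x. integrable M (\<lambda>\<omega>. q x \<omega> ^ 6)"
    and \<phi>_nonneg: "\<And>r. 0 \<le> r \<Longrightarrow> 0 \<le> \<phi> r"
    and \<phi>_antimono: "antimono_on {0..} \<phi>"
    and \<phi>_integrable: "set_integrable lborel {0..} (\<lambda>r. sqrt (\<phi> r))"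
    and mixing: "\<And>A B \<zeta> \<xi>. A \<in> sets borel \<Longrightarrow> B \<in> sets borel \<Longrightarrow> A \<noteq> {} \<Longrightarrow> B \<noteq> {} \<Longrightarrow>
      \<zeta> \<in> borel_measurable (field_sigma M q A) \<Longrightarrow> \<xi> \<in> borel_measurable (field_sigma M q B) \<Longrightarrow>
      integrable M (\<lambda>\<omega>. (\<zeta> \<omega>)\<^sup>2) \<Longrightarrow> integrable M (\<lambda>\<omega>. (\<xi> \<omega>)\<^sup>2) \<Longrightarrow>
      \<bar>expectation (\<lambda>\<omega>. (\<zeta> \<omega> - expectation \<zeta>) * (\<xi> \<omega> - expectation \<xi>))\<bar>
        \<le> \<phi> (2 * setdist A B) * sqrt (expectation (\<lambda>\<omega>. (\<zeta> \<omega>)\<^sup>2) * expectation (\<lambda>\<omega>. (\<xi> \<omega>)\<^sup>2))"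
begin

abbreviation R :: "real \<Rightarrow> real" where "R \<equiv> correlation M q"

lemma q_measurable_lborel [measurable]: "(\<lambda>(x, \<omega>). q x \<omega>) \<in> borel_measurable (lborel \<Otimes>\<^sub>M M)"
  using q_measurable by (simp cong: measurable_cong_sets sets_pair_measure_cong)

lemma q_rv [measurable]: "q x \<in> borel_measurable M"
  using q_integrable by (rule borel_measurable_integrable)

lemma stationary_expectation:
  assumes "finite J" and g: "g \<in> borel_measurable (PiM J (\<lambda>_. borel))"
  shows "expectation (\<lambda>\<omega>. g (\<lambda>x\<in>J. q (x + h) \<omega>)) = (expectation (\<lambda>\<omega>. g (\<lambda>x\<in>J. q x \<omega>)) :: real)"
proof -
  have [measurable]: "(\<lambda>\<omega>. \<lambda>x\<in>J. q (x + h) \<omega>) \<in> measurable M (PiM J (\<lambda>_. borel))" for h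
    by (rule measurable_restrict) simp
  have [measurable]: "(\<lambda>\<omega>. \<lambda>x\<in>J. q x \<omega>) \<in> measurable M (PiM J (\<lambda>_. borel))"
    by (rule measurable_restrict) simp
  have "expectation (\<lambda>\<omega>. g (\<lambda>x\<in>J. q (x + h) \<omega>))
      = integral\<^sup>L (distr M (PiM J (\<lambda>_. borel)) (\<lambda>\<omega>. \<lambda>x\<in>J. q (x + h) \<omega>)) g"
    using g by (simp add: integral_distr)
  also have "distr M (PiM J (\<lambda>_. borel)) (\<lambda>\<omega>. \<lambda>x\<in>J. q (x + h) \<omega>)
      = distr M (PiM J (\<lambda>_. borel)) (\<lambda>\<omega>. \<lambda>x\<in>J. q x \<omega>)"
    using q_stationary \<open>finite J\<close> by (simp add: strictly_stationary_def)
  also have "integral\<^sup>L \<dots> g = expectation (\<lambda>\<omega>. g (\<lambda>x\<in>J. q x \<omega>))"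
    using g by (simp add: integral_distr)
  finally show ?thesis .
qed

lemma moment_stationary: "expectation (\<lambda>\<omega>. q x \<omega> ^ n) = expectation (\<lambda>\<omega>. q 0 \<omega> ^ n)"
  using stationary_expectation[of "{0}" "\<lambda>y. y 0 ^ n" x] by simp

lemma q_cov: "expectation (\<lambda>\<omega>. q s \<omega> * q t \<omega>) = R (t - s)"
  using stationary_expectation[of "{0, t - s}" "\<lambda>y. y 0 * y (t - s)" s] by (simp add: correlation_def)

lemma q_power_integrable: "n \<le> 6 \<Longrightarrow> integrable M (\<lambda>\<omega>. q x \<omega> ^ n)"
proof (rule Bochner_Integration.integrable_bound[of M "\<lambda>\<omega>. 1 + q x \<omega> ^ 6"])
  show "integrable M (\<lambda>\<omega>. 1 + q x \<omega> ^ 6)" using q6 by simp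
  assume n: "n \<le> 6"
  have "\<bar>y\<bar> ^ n \<le> 1 + y ^ 6" for y :: real
  proof (cases "\<bar>y\<bar> \<le> 1")
    case True
    then have "\<bar>y\<bar> ^ n \<le> 1" by (simp add: power_le_one)
    then show ?thesis using zero_le_even_power[of 6 y] by (simp add: add_increasing2)
  next
    case False
    then have "\<bar>y\<bar> ^ n \<le> \<bar>y\<bar> ^ 6" using n by (intro power_increasing) auto
    also have "\<dots> = y ^ 6" by (simp add: power_even_abs)
    finally show ?thesis by simp
  qed
  then show "AE \<omega> in M. norm (q x \<omega> ^ n) \<le> norm (1 + q x \<omega> ^ 6)"
    by (intro AE_I2) (auto simp: power_abs intro: order_trans[OF _ abs_ge_self])
qed simp

abbreviation m2 :: real where "m2 \<equiv> expectation (\<lambda>\<omega>. (q 0 \<omega>)\<^sup>2)"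
abbreviation m6 :: real where "m6 \<equiv> expectation (\<lambda>\<omega>. q 0 \<omega> ^ 6)"

lemma m2_nonneg: "0 \<le> m2" and m6_nonneg: "0 \<le> m6"
  by (auto intro!: Bochner_Integration.integral_nonneg)

text \<open>The inequality of arithmetic and geometric means for three squares. Six moments enter
  here: separating one point from three others by mixing requires a square integrable triple
  product.\<close>

lemma product3_square:
  shows "integrable M (\<lambda>\<omega>. (q x \<omega> * q y \<omega> * q z \<omega>)\<^sup>2)"
    and "expectation (\<lambda>\<omega>. (q x \<omega> * q y \<omega> * q z \<omega>)\<^sup>2) \<le> m6"
proof -
  have le: "(u * v * w)\<^sup>2 \<le> (u ^ 6 + v ^ 6 + w ^ 6) / 3" for u v w :: real
  proof -
    have amgm: "3 * (a * b * c) \<le> a ^ 3 + b ^ 3 + c ^ 3" if "0 \<le> a" "0 \<le> b" "0 \<le> c" for a b c :: real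
    proof -
      have "a ^ 3 + b ^ 3 + c ^ 3 - 3 * (a * b * c)
          = (a + b + c) * ((a - b)\<^sup>2 + (b - c)\<^sup>2 + (c - a)\<^sup>2) / 2"
        by (simp add: power2_eq_square power3_eq_cube algebra_simps)
      moreover have "\<dots> \<ge> 0" using that by simp
      ultimately show ?thesis by linarith
    qed
    from amgm[of "u\<^sup>2" "v\<^sup>2" "w\<^sup>2"] show ?thesis
      by (simp add: power_mult_distrib power_mult[symmetric])
  qed
  have int: "integrable M (\<lambda>\<omega>. (q x \<omega> ^ 6 + q y \<omega> ^ 6 + q z \<omega> ^ 6) / 3)"
    using q6 by simp
  show 1: "integrable M (\<lambda>\<omega>. (q x \<omega> * q y \<omega> * q z \<omega>)\<^sup>2)"
    by (rule Bochner_Integration.integrable_bound[OF int])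
      (auto intro!: AE_I2 order_trans[OF le] simp del: abs_divide divide_le_eq_numeral1 le_divide_eq_numeral1)
  have "expectation (\<lambda>\<omega>. (q x \<omega> * q y \<omega> * q z \<omega>)\<^sup>2)
      \<le> expectation (\<lambda>\<omega>. (q x \<omega> ^ 6 + q y \<omega> ^ 6 + q z \<omega> ^ 6) / 3)"
    by (rule integral_mono[OF 1 int]) (rule le)
  also have "\<dots> = m6" using q6 by (simp add: moment_stationary[of x 6] moment_stationary[of y 6] moment_stationary[of z 6])
  finally show "expectation (\<lambda>\<omega>. (q x \<omega> * q y \<omega> * q z \<omega>)\<^sup>2) \<le> m6" .
qed

lemma subalgebra_field_sigma: "subalgebra M (field_sigma M q A)"
proof -
  have "{q x -` S \<inter> space M |x S. x \<in> A \<and> S \<in> sets borel} \<subseteq> sets M"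
    using measurable_sets[OF q_rv] by auto
  then show ?thesis
    unfolding subalgebra_def field_sigma_def
    by (auto simp: space_measure_of_conv sets_measure_of_conv intro: sets.sigma_sets_subset[THEN subsetD])
qed

lemma q_measurable_field_sigma: "x \<in> A \<Longrightarrow> q x \<in> borel_measurable (field_sigma M q A)"
  unfolding field_sigma_def by (intro measurableI) (auto simp: sets_measure_of_conv space_measure_of_conv)

lemma field_sigma_mono:
  assumes "A \<subseteq> B" "\<zeta> \<in> borel_measurable (field_sigma M q A)"
  shows "\<zeta> \<in> borel_measurable (field_sigma M q B)"
proof -
  have "sets (field_sigma M q A) \<subseteq> sets (field_sigma M q B)"
    using assms(1) unfolding field_sigma_def sets_measure_of_conv
    by (auto intro!: sigma_sets_mono')
  moreover have "space (field_sigma M q A) = space (field_sigma M q B)"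
    by (simp add: field_sigma_def space_measure_of_conv)
  ultimately show ?thesis using assms(2) by (auto simp: measurable_def)
qed

text \<open>Since \<phi> is decreasing, every lower bound \<open>g\<close> for the distance may
  replace \<open>setdist A B\<close>. This form also writes the centred covariance as a difference
  of expectations.\<close>

lemma covariance_bound:
  assumes A: "A \<in> sets borel" "A \<noteq> {}" and B: "B \<in> sets borel" "B \<noteq> {}"
    and g: "0 \<le> g" "\<And>x y. x \<in> A \<Longrightarrow> y \<in> B \<Longrightarrow> g \<le> \<bar>x - y\<bar>"
    and \<zeta>: "\<zeta> \<in> borel_measurable (field_sigma M q A)" "integrable M (\<lambda>\<omega>. (\<zeta> \<omega>)\<^sup>2)"
    and \<xi>: "\<xi> \<in> borel_measurable (field_sigma M q B)" "integrable M (\<lambda>\<omega>. (\<xi> \<omega>)\<^sup>2)"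
  shows "\<bar>expectation (\<lambda>\<omega>. \<zeta> \<omega> * \<xi> \<omega>) - expectation \<zeta> * expectation \<xi>\<bar>
    \<le> \<phi> (2 * g) * sqrt (expectation (\<lambda>\<omega>. (\<zeta> \<omega>)\<^sup>2) * expectation (\<lambda>\<omega>. (\<xi> \<omega>)\<^sup>2))"
proof -
  have m: "\<zeta> \<in> borel_measurable M" "\<xi> \<in> borel_measurable M"
    using measurable_from_subalg[OF subalgebra_field_sigma] \<zeta>(1) \<xi>(1) by auto
  have i: "integrable M \<zeta>" "integrable M \<xi>"
    using square_integrable_imp_integrable m \<zeta>(2) \<xi>(2) by auto
  have ip: "integrable M (\<lambda>\<omega>. \<zeta> \<omega> * \<xi> \<omega>)"
  proof (rule Bochner_Integration.integrable_bound[of M "\<lambda>\<omega>. (\<zeta> \<omega>)\<^sup>2 + (\<xi> \<omega>)\<^sup>2"])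
    show "AE \<omega> in M. norm (\<zeta> \<omega> * \<xi> \<omega>) \<le> norm ((\<zeta> \<omega>)\<^sup>2 + (\<xi> \<omega>)\<^sup>2)"
    proof (rule AE_I2)
      fix \<omega> show "norm (\<zeta> \<omega> * \<xi> \<omega>) \<le> norm ((\<zeta> \<omega>)\<^sup>2 + (\<xi> \<omega>)\<^sup>2)"
        using abs_mult_le_squares[of "\<zeta> \<omega>" "\<xi> \<omega>"] by simp
    qed
  qed (use m \<zeta> \<xi> in auto)
  have "expectation (\<lambda>\<omega>. (\<zeta> \<omega> - expectation \<zeta>) * (\<xi> \<omega> - expectation \<xi>))
      = expectation (\<lambda>\<omega>. \<zeta> \<omega> * \<xi> \<omega> - expectation \<xi> * \<zeta> \<omega> - (expectation \<zeta> * \<xi> \<omega> - expectation \<zeta> * expectation \<xi>))"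
    by (rule Bochner_Integration.integral_cong) (auto simp: algebra_simps)
  also have "\<dots> = expectation (\<lambda>\<omega>. \<zeta> \<omega> * \<xi> \<omega>) - expectation \<zeta> * expectation \<xi>"
    using i ip by (simp add: prob_space)
  finally have eq: "expectation (\<lambda>\<omega>. (\<zeta> \<omega> - expectation \<zeta>) * (\<xi> \<omega> - expectation \<xi>))
    = expectation (\<lambda>\<omega>. \<zeta> \<omega> * \<xi> \<omega>) - expectation \<zeta> * expectation \<xi>" .
  have gs: "g \<le> setdist A B" using A B g(2) by (intro le_setdistI) (auto simp: dist_real_def)
  then have "\<phi> (2 * setdist A B) \<le> \<phi> (2 * g)"
    using \<phi>_antimono g(1) by (auto simp: monotone_on_def)
  then have "\<phi> (2 * setdist A B) * sqrt (expectation (\<lambda>\<omega>. (\<zeta> \<omega>)\<^sup>2) * expectation (\<lambda>\<omega>. (\<xi> \<omega>)\<^sup>2))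
      \<le> \<phi> (2 * g) * sqrt (expectation (\<lambda>\<omega>. (\<zeta> \<omega>)\<^sup>2) * expectation (\<lambda>\<omega>. (\<xi> \<omega>)\<^sup>2))"
    by (intro mult_right_mono) auto
  with mixing[OF A(1) B(1) A(2) B(2) \<zeta>(1) \<xi>(1) \<zeta>(2) \<xi>(2)] show ?thesis by (simp add: eq)
qed

text \<open>The square root comes from the geometric mean of two mixing estimates in
  \<open>four_point_bound\<close>; the factor 2 is that of the mixing hypothesis. Integrability of
  \<open>sqrt \<phi>\<close> makes \<open>h\<close> integrable on the line.\<close>

definition h :: "real \<Rightarrow> real" where "h r = sqrt (\<phi> (2 * \<bar>r\<bar>))"

lemma h_nonneg: "0 \<le> h r" by (simp add: h_def \<phi>_nonneg)

lemma h_even: "h (- r) = h r" "h (x - y) = h (y - x)" by (simp_all add: h_def abs_minus_commute)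

text \<open>For ordered points, mixing can separate the smallest point from the other three or the
  largest from the other three, and the product of means vanishes since \<open>q\<close> is centred.
  This gives two bounds, one for each outer gap. Summing over all three pairings makes the
  right-hand side symmetric, so that ordering the points loses nothing.\<close>

lemma four_point_bound:
  "\<bar>expectation (\<lambda>\<omega>. q a \<omega> * q b \<omega> * (q c \<omega> * q d \<omega>))\<bar>
    \<le> sqrt (m2 * m6) * (h (a - b) * h (c - d) + h (a - c) * h (b - d) + h (a - d) * h (b - c))"
\<comment> \<open>Case 4 is the ordered one. The other cases are the adjacent transpositions, which
  only permute the three pairings.\<close>
proof (rule symmetric_4_from_sorted[of _ a b c d], goal_cases)
  case (4 a b c d)
  define E where "E = \<bar>expectation (\<lambda>\<omega>. q a \<omega> * q b \<omega> * (q c \<omega> * q d \<omega>))\<bar>"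
  have sq: "sqrt (expectation (\<lambda>\<omega>. (q x \<omega>)\<^sup>2) * expectation (\<lambda>\<omega>. (q y \<omega> * q z \<omega> * q w \<omega>)\<^sup>2)) \<le> sqrt (m2 * m6)"
    for x y z w
    using product3_square(2)[of y z w] m2_nonneg by (auto simp: moment_stationary[of x 2] intro!: mult_left_mono)
  have one_three: "\<bar>expectation (\<lambda>\<omega>. q x \<omega> * (q y \<omega> * q z \<omega> * q w \<omega>))\<bar> \<le> sqrt (m2 * m6) * \<phi> (2 * g)"
    if "0 \<le> g" "g \<le> \<bar>x - y\<bar>" "g \<le> \<bar>x - z\<bar>" "g \<le> \<bar>x - w\<bar>" for x y z w g
  proof -
    have [measurable]: "q y \<in> borel_measurable (field_sigma M q {y, z, w})"
      "q z \<in> borel_measurable (field_sigma M q {y, z, w})"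
      "q w \<in> borel_measurable (field_sigma M q {y, z, w})"
      by (auto intro!: q_measurable_field_sigma)
    have "\<bar>expectation (\<lambda>\<omega>. q x \<omega> * (q y \<omega> * q z \<omega> * q w \<omega>))
        - expectation (q x) * expectation (\<lambda>\<omega>. q y \<omega> * q z \<omega> * q w \<omega>)\<bar>
      \<le> \<phi> (2 * g) * sqrt (expectation (\<lambda>\<omega>. (q x \<omega>)\<^sup>2) * expectation (\<lambda>\<omega>. (q y \<omega> * q z \<omega> * q w \<omega>)\<^sup>2))"
      by (rule covariance_bound[of "{x}" "{y, z, w}"])
        (use that q_power_integrable[of 2] product3_square(1) in \<open>auto intro!: q_measurable_field_sigma\<close>)
    also have "\<dots> \<le> \<phi> (2 * g) * sqrt (m2 * m6)"
      using that by (intro mult_left_mono sq \<phi>_nonneg) auto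
    finally show ?thesis by (simp add: q_mean mult.commute)
  qed
  have e1: "E \<le> sqrt (m2 * m6) * \<phi> (2 * \<bar>a - b\<bar>)"
    using one_three[of "\<bar>a - b\<bar>" a b c d] 4 by (simp add: E_def mult.assoc)
  have e2: "E \<le> sqrt (m2 * m6) * \<phi> (2 * \<bar>c - d\<bar>)"
    using one_three[of "\<bar>c - d\<bar>" d a b c] 4 by (simp add: E_def mult_ac)
  \<comment> \<open>Both bounds hold at once, hence so does their geometric mean, which splits into
    one factor \<open>h\<close> for each outer gap.\<close>
  have "E = sqrt (E * E)" by (simp add: E_def)
  also have "\<dots> \<le> sqrt ((sqrt (m2 * m6) * \<phi> (2 * \<bar>a - b\<bar>)) * (sqrt (m2 * m6) * \<phi> (2 * \<bar>c - d\<bar>)))"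
    using e1 e2 m2_nonneg m6_nonneg by (intro real_sqrt_le_mono mult_mono) (auto simp: E_def \<phi>_nonneg)
  also have "\<dots> = sqrt (m2 * m6) * (h (a - b) * h (c - d))"
  proof -
    have "sqrt ((s * u) * (s * v)) = s * (sqrt u * sqrt v)" if "0 \<le> s" for s u v :: real
    proof -
      have "(s * u) * (s * v) = s\<^sup>2 * (u * v)" by (simp add: power2_eq_square)
      then show ?thesis using that by (simp add: real_sqrt_mult)
    qed
    then show ?thesis using m2_nonneg m6_nonneg by (simp add: h_def)
  qed
  also have "\<dots> \<le> sqrt (m2 * m6) * (h (a - b) * h (c - d) + h (a - c) * h (b - d) + h (a - d) * h (b - c))"
    using m2_nonneg m6_nonneg h_nonneg by (intro mult_left_mono) auto
  finally show ?case by (simp add: E_def)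
next
  case (1 a b c d) then show ?case by (simp add: mult_ac h_even(2)[of b a] add_ac)
next
  case (2 a b c d) then show ?case by (simp add: mult_ac h_even(2)[of c b] add_ac)
next
  case (3 a b c d) then show ?case by (simp add: mult_ac h_even(2)[of d c] add_ac)
qed

end

text \<open>Valid also for a function that is not integrable, since its Bochner integral is 0 by
  convention.\<close>

lemma ennreal_abs_integral_le: "ennreal \<bar>LINT x|M. f x\<bar> \<le> (\<integral>\<^sup>+x. ennreal \<bar>f x\<bar> \<partial>M)" for f :: "_ \<Rightarrow> real"
  using integral_norm_bound_ennreal[of M f]
  by (cases "integrable M f") (auto simp: not_integrable_integral_eq)

lemma emeasure_Ioc_real: "emeasure lborel {s<..t :: real} = ennreal (t - s)"
  by (cases "s \<le> t") (auto simp: ennreal_neg)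

lemma finite_measure_restrict_Ioc: "finite_measure (restrict_space lborel {s<..t :: real})"
  by (rule finite_measureI)
    (simp add: emeasure_restrict_space space_restrict_space emeasure_Ioc_real)

lemma set_integral_restrict_Ioc:
  "(LINT y:{s<..t}|lborel. f y) = (LINT y|restrict_space lborel {s<..t :: real}. f y)" for f :: "real \<Rightarrow> real"
  by (simp add: integral_restrict_space set_lebesgue_integral_def)

lemma set_integrable_restrict_Ioc:
  "set_integrable lborel {s<..t} f \<longleftrightarrow> integrable (restrict_space lborel {s<..t :: real}) f" for f :: "real \<Rightarrow> real"
  by (simp add: integrable_restrict_space set_integrable_def)

lemma emeasure_space_restrict_Ioc:
  "s \<le> t \<Longrightarrow> emeasure (restrict_space lborel {s<..t :: real}) {s<..t} = ennreal (t - s)"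
  by (simp add: emeasure_restrict_space)

section \<open>Second and fourth moments of integrals over intervals\<close>

context mixing_field
begin

text \<open>Half-open intervals let adjacent integrals add up without common end points. On the null
  set of paths that are not integrable the value is 0 by convention.\<close>

definition I :: "real \<Rightarrow> real \<Rightarrow> 'w \<Rightarrow> real" where
  "I s t \<omega> = (LINT y:{s<..t}|lborel. q y \<omega>)"

abbreviation \<nu> :: "real \<Rightarrow> real \<Rightarrow> real measure" where
  "\<nu> s t \<equiv> restrict_space lborel {s<..t}"

lemma space_\<nu>: "space (\<nu> s t) = {s<..t}" by (simp add: space_restrict_space)

lemma I_eq: "I s t \<omega> = (LINT y|\<nu> s t. q y \<omega>)"
  by (simp add: I_def set_integral_restrict_Ioc)

lemma q_measurable_\<nu>: "(\<lambda>(x, \<omega>). q x \<omega>) \<in> borel_measurable (\<nu> s t \<Otimes>\<^sub>M M)"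
proof -
  have [measurable]: "fst \<in> measurable (\<nu> s t \<Otimes>\<^sub>M M) lborel"
    by (rule measurable_compose[OF measurable_fst]) (simp add: measurable_restrict_space1)
  have "(\<lambda>z. (fst z, snd z)) \<in> measurable (\<nu> s t \<Otimes>\<^sub>M M) (lborel \<Otimes>\<^sub>M M)" by measurable
  from measurable_compose[OF this q_measurable_lborel] show ?thesis by (simp add: case_prod_beta')
qed

lemma I_rv [measurable]: "I s t \<in> borel_measurable M"
proof -
  have "(\<lambda>(\<omega>, y). indicator {s<..t} y *\<^sub>R q y \<omega>) \<in> borel_measurable (M \<Otimes>\<^sub>M lborel)"
    using measurable_compose[OF measurable_pair_swap'[of M lborel] q_measurable_lborel]
    by (simp add: case_prod_beta')
  then show ?thesis unfolding I_def[abs_def] set_lebesgue_integral_def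
    by (rule lborel.borel_measurable_lebesgue_integral)
qed

lemma AE_q_integrable: "AE \<omega> in M. set_integrable lborel {s<..t} (\<lambda>y. q y \<omega>)"
  and I_square_integrable: "integrable M (\<lambda>\<omega>. (I s t \<omega>)\<^sup>2)"
  and I_square_eq: "expectation (\<lambda>\<omega>. (I s t \<omega>)\<^sup>2) = (LINT x|\<nu> s t. LINT y|\<nu> s t. R (y - x))"
proof -
  note * = second_moment_of_integral[OF finite_measure_restrict_Ioc q_measurable_\<nu>, of s t m2]
  have 1: "integrable M (\<lambda>\<omega>. (q p \<omega>)\<^sup>2)" "expectation (\<lambda>\<omega>. (q p \<omega>)\<^sup>2) \<le> m2" for p
    using q_power_integrable[of 2 p] moment_stationary[of p 2] by simp_all
  show "AE \<omega> in M. set_integrable lborel {s<..t} (\<lambda>y. q y \<omega>)"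
    using *(1)[OF 1] by (simp add: set_integrable_restrict_Ioc)
  show "integrable M (\<lambda>\<omega>. (I s t \<omega>)\<^sup>2)"
    using *(2)[OF 1] by (simp add: I_eq)
  show "expectation (\<lambda>\<omega>. (I s t \<omega>)\<^sup>2) = (LINT x|\<nu> s t. LINT y|\<nu> s t. R (y - x))"
    using *(3)[OF 1] by (simp add: I_eq q_cov)
qed

lemma I_integrable: "integrable M (I s t)"
  by (rule square_integrable_imp_integrable[OF I_rv I_square_integrable])

lemma I_mean: "expectation (I s t) = 0"
proof -
  interpret \<nu>: finite_measure "\<nu> s t" by (rule finite_measure_restrict_Ioc)
  interpret \<nu>M: pair_sigma_finite "\<nu> s t" M ..
  have "integrable (\<nu> s t \<Otimes>\<^sub>M M) (\<lambda>(x, \<omega>). q x \<omega>)"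
  proof (rule \<nu>M.Fubini_integrable[OF q_measurable_\<nu>])
    have "(LINT \<omega>|M. norm (q x \<omega>)) \<le> 1 + m2" for x
    proof -
      have "(LINT \<omega>|M. norm (q x \<omega>)) \<le> (LINT \<omega>|M. 1 + q x \<omega> ^ 2)"
      proof (rule integral_mono)
        show "norm (q x \<omega>) \<le> 1 + q x \<omega> ^ 2" for \<omega>
          using abs_mult_le_squares[of "q x \<omega>" 1] by simp
      qed (use q_integrable q_power_integrable[of 2 x] in auto)
      also have "\<dots> = 1 + m2"
        using q_power_integrable[of 2 x] moment_stationary[of x 2] by (simp add: prob_space)
      finally show ?thesis .
    qed
    then show "integrable (\<nu> s t) (\<lambda>x. LINT \<omega>|M. norm (case (x, \<omega>) of (x, \<omega>) \<Rightarrow> q x \<omega>))"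
      using q_measurable_\<nu>[of s t]
      by (intro \<nu>.integrable_const_bound[of _ "1 + m2"] borel_measurable_lebesgue_integral)
        (auto simp: case_prod_beta')
  qed (use q_integrable in auto)
  from \<nu>M.Fubini_integral[OF this] show ?thesis by (simp add: I_eq[abs_def] q_mean)
qed

abbreviation RI :: real where "RI \<equiv> (LINT r|lborel. \<bar>R r\<bar>)"

text \<open>With \<open>r = y - x\<close> and the order of integration exchanged, the weight of
  \<open>R r\<close> is the length of the intersection of the interval with its translate by
  \<open>- r\<close>, namely \<open>max 0 (t - s - |r|)\<close>.\<close>

lemma I_square_overlap:
  assumes "s \<le> t"
  shows "expectation (\<lambda>\<omega>. (I s t \<omega>)\<^sup>2) = (LINT r|lborel. R r * max 0 (t - s - \<bar>r\<bar>))"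
proof -
  let ?i = "indicator {s<..t} :: real \<Rightarrow> real"
  have Rm[measurable]: "R \<in> borel_measurable borel"
    using borel_measurable_integrable[OF R_integrable] by simp
  have "expectation (\<lambda>\<omega>. (I s t \<omega>)\<^sup>2) = (LINT x|lborel. ?i x * (LINT y|lborel. ?i y * R (y - x)))"
    by (simp add: I_square_eq integral_restrict_space)
  also have "(\<lambda>x. LINT y|lborel. ?i y * R (y - x)) = (\<lambda>x. LINT r|lborel. ?i (x + r) * R r)"
  proof
    fix x show "(LINT y|lborel. ?i y * R (y - x)) = (LINT r|lborel. ?i (x + r) * R r)"
      using lborel_integral_real_affine[of 1 "\<lambda>y. ?i y * R (y - x)" x] by simp
  qed
  also have "(LINT x|lborel. ?i x * (LINT r|lborel. ?i (x + r) * R r))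
      = (LINT x|lborel. LINT r|lborel. ?i x * ?i (x + r) * R r)"
    by (simp add: mult.assoc)
  also have "\<dots> = (LINT r|lborel. LINT x|lborel. ?i x * ?i (x + r) * R r)"
  proof (rule lborel_pair.Fubini_integral[symmetric])
    have "integrable (lborel \<Otimes>\<^sub>M lborel) (\<lambda>(x, r). ?i x * R r)"
    proof (rule lborel_pair.Fubini_integrable)
      show "integrable lborel (\<lambda>x. LINT r|lborel. norm (case (x, r) of (x, r) \<Rightarrow> ?i x * R r))"
        by (auto simp: abs_mult emeasure_Ioc_real less_top[symmetric] intro!: integrable_mult_left integrable_real_indicator)
      show "AE x in lborel. integrable lborel (\<lambda>r. case (x, r) of (x, r) \<Rightarrow> ?i x * R r)"
        using R_integrable by simp
    qed measurable
    then show "integrable (lborel \<Otimes>\<^sub>M lborel) (\<lambda>(x, r). ?i x * ?i (x + r) * R r)"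
      by (rule Bochner_Integration.integrable_bound)
        (auto simp: indicator_def intro!: AE_I2)
  qed
  also have "\<dots> = (LINT r|lborel. R r * max 0 (t - s - \<bar>r\<bar>))"
  proof (rule Bochner_Integration.integral_cong[OF refl])
    fix r
    have "(LINT x|lborel. ?i x * ?i (x + r) * R r) = (LINT x|lborel. indicator {max s (s - r)<..min t (t - r)} x) * R r"
      unfolding integral_mult_left_zero[symmetric]
      by (intro Bochner_Integration.integral_cong refl) (auto simp: indicator_def)
    also have "(LINT x|lborel. indicator {max s (s - r)<..min t (t - r)} x) = max 0 (t - s - \<bar>r\<bar>)"
    proof -
      have "measure lborel {l<..u} = max 0 (u - l)" for l u :: real
        by (cases "l \<le> u") auto
      moreover have "max 0 (min t (t - r) - max s (s - r)) = max 0 (t - s - \<bar>r\<bar>)"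
        by linarith
      ultimately show ?thesis by simp
    qed
    finally show "(LINT x|lborel. ?i x * ?i (x + r) * R r) = R r * max 0 (t - s - \<bar>r\<bar>)" by (simp add: mult.commute)
  qed
  finally show ?thesis .
qed

lemma I_square_le:
  assumes "s \<le> t"
  shows "expectation (\<lambda>\<omega>. (I s t \<omega>)\<^sup>2) \<le> RI * (t - s)"
proof -
  have "expectation (\<lambda>\<omega>. (I s t \<omega>)\<^sup>2) \<le> (LINT r|lborel. \<bar>R r\<bar> * (t - s))"
    unfolding I_square_overlap[OF assms]
  proof (rule integral_mono')
    show "integrable lborel (\<lambda>r. \<bar>R r\<bar> * (t - s))" using R_integrable by simp
    fix r
    have "R r * max 0 (t - s - \<bar>r\<bar>) \<le> \<bar>R r\<bar> * max 0 (t - s - \<bar>r\<bar>)" by (intro mult_right_mono) auto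
    also have "\<dots> \<le> \<bar>R r\<bar> * (t - s)" using assms by (intro mult_left_mono) auto
    finally show "R r * max 0 (t - s - \<bar>r\<bar>) \<le> \<bar>R r\<bar> * (t - s)" .
    show "0 \<le> \<bar>R r\<bar> * (t - s)" using assms by simp
  qed
  then show ?thesis by simp
qed

text \<open>Scaling turns the overlap weight into \<open>max 0 (t - s - \<epsilon> * |r|)\<close>,
  which tends to \<open>t - s\<close> and is dominated by it. Dominated convergence is applied along
  arbitrary sequences.\<close>

lemma I_variance_tendsto:
  assumes "s \<le> t"
  shows "((\<lambda>\<epsilon>. \<epsilon> * expectation (\<lambda>\<omega>. (I (s / \<epsilon>) (t / \<epsilon>) \<omega>)\<^sup>2)) \<longlongrightarrow> (t - s) * (LINT r|lborel. R r)) (at_right 0)"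
proof (rule tendsto_at_right_sequentially[of 0 1])
  fix S :: "nat \<Rightarrow> real" assume S: "\<And>n. 0 < S n" "S \<longlonglongrightarrow> 0"
  have [measurable]: "R \<in> borel_measurable borel"
    using borel_measurable_integrable[OF R_integrable] by simp
  have "(\<lambda>n. LINT r|lborel. R r * max 0 (t - s - S n * \<bar>r\<bar>)) \<longlonglongrightarrow> (LINT r|lborel. R r * (t - s))"
  proof (rule integral_dominated_convergence[where w = "\<lambda>r. \<bar>R r\<bar> * (t - s)"])
    show "AE r in lborel. (\<lambda>n. R r * max 0 (t - s - S n * \<bar>r\<bar>)) \<longlonglongrightarrow> R r * (t - s)"
    proof (rule AE_I2)
      fix r
      have "(\<lambda>n. R r * max 0 (t - s - S n * \<bar>r\<bar>)) \<longlonglongrightarrow> R r * max 0 (t - s - 0 * \<bar>r\<bar>)"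
        by (intro tendsto_intros S)
      then show "(\<lambda>n. R r * max 0 (t - s - S n * \<bar>r\<bar>)) \<longlonglongrightarrow> R r * (t - s)" using assms by simp
    qed
    show "AE r in lborel. norm (R r * max 0 (t - s - S n * \<bar>r\<bar>)) \<le> \<bar>R r\<bar> * (t - s)" for n
    proof (rule AE_I2)
      fix r
      have "0 \<le> S n * \<bar>r\<bar>" using S(1)[of n] by simp
      then have "\<bar>max 0 (t - s - S n * \<bar>r\<bar>)\<bar> \<le> t - s" using assms by auto
      then show "norm (R r * max 0 (t - s - S n * \<bar>r\<bar>)) \<le> \<bar>R r\<bar> * (t - s)"
        unfolding real_norm_def abs_mult by (rule mult_left_mono) simp
    qed
  qed (use R_integrable in auto)
  moreover have "S n * expectation (\<lambda>\<omega>. (I (s / S n) (t / S n) \<omega>)\<^sup>2) = (LINT r|lborel. R r * max 0 (t - s - S n * \<bar>r\<bar>))" for n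
  proof -
    have "S n * max 0 (t / S n - s / S n - \<bar>r\<bar>) = max 0 (t - s - S n * \<bar>r\<bar>)" for r
      using S(1)[of n] by (simp add: max_mult_distrib_left right_diff_distrib)
    then have "S n * (R r * max 0 (t / S n - s / S n - \<bar>r\<bar>)) = R r * max 0 (t - s - S n * \<bar>r\<bar>)" for r
      by (metis mult.left_commute)
    then have "S n * (LINT r|lborel. R r * max 0 (t / S n - s / S n - \<bar>r\<bar>))
        = (LINT r|lborel. R r * max 0 (t - s - S n * \<bar>r\<bar>))"
      unfolding integral_mult_right_zero[symmetric] by (rule Bochner_Integration.integral_cong[OF refl])
    then show ?thesis
      using assms S(1)[of n] I_square_overlap[of "s / S n" "t / S n"] by (simp add: divide_right_mono)
  qed
  ultimately show "(\<lambda>n. S n * expectation (\<lambda>\<omega>. (I (s / S n) (t / S n) \<omega>)\<^sup>2)) \<longlonglongrightarrow> (t - s) * (LINT r|lborel. R r)"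
    by (simp add: mult.commute)
qed simp

lemma h_measurable [measurable]: "h \<in> borel_measurable borel"
  and h_integrable: "integrable lborel h"
proof -
  define g where "g r = indicator {0..} r * sqrt (\<phi> r)" for r :: real
  have g: "integrable lborel g"
    using \<phi>_integrable by (simp add: set_integrable_def g_def[abs_def])
  then have [measurable]: "g \<in> borel_measurable borel"
    using borel_measurable_integrable by force
  have hg: "h = (\<lambda>r. g (2 * \<bar>r\<bar>))" by (auto simp: h_def g_def fun_eq_iff)
  show hm: "h \<in> borel_measurable borel" unfolding hg by measurable
  have g0: "0 \<le> g r" for r by (auto simp: g_def indicator_def \<phi>_nonneg)
  \<comment> \<open>\<open>h\<close> is even, so one dilated copy of \<open>g\<close> for each half
    line majorizes it.\<close>
  have "integrable lborel (\<lambda>r. g (0 + 2 * r) + g (0 + (- 2) * r))"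
    by (intro Bochner_Integration.integrable_add lborel_integrable_real_affine g) auto
  then show "integrable lborel h"
  proof (rule Bochner_Integration.integrable_bound)
    have "h r \<le> g (2 * r) + g (- 2 * r)" for r
      using g0[of "2 * r"] g0[of "- 2 * r"] by (cases "0 \<le> r") (auto simp: hg)
    then show "AE r in lborel. norm (h r) \<le> norm (g (0 + 2 * r) + g (0 + (- 2) * r))"
      using h_nonneg g0 by (intro AE_I2) (auto intro: order_trans[OF _ abs_ge_self])
  qed (use hm in auto)
qed

abbreviation H :: real where "H \<equiv> (LINT r|lborel. h r)"

lemma nn_integral_h: "(\<integral>\<^sup>+y. ennreal (h (x - y)) \<partial>\<nu> s t) \<le> ennreal H"
proof -
  have "(\<integral>\<^sup>+y. ennreal (h (x - y)) \<partial>\<nu> s t) = (\<integral>\<^sup>+y. ennreal (h (x - y)) * indicator {s<..t} y \<partial>lborel)"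
    by (simp add: nn_integral_restrict_space)
  also have "\<dots> \<le> (\<integral>\<^sup>+y. ennreal (h (x - y)) \<partial>lborel)"
    by (intro nn_integral_mono) (auto simp: indicator_def)
  also have "\<dots> = (\<integral>\<^sup>+y. ennreal (h y) \<partial>lborel)"
    using nn_integral_real_affine[of "\<lambda>y. ennreal (h y)" "- 1" x] by simp
  also have "\<dots> = ennreal H"
    by (rule nn_integral_eq_integral[OF h_integrable]) (simp add: h_nonneg)
  finally show ?thesis .
qed

text \<open>The four points have three pairings, and the double integral of each is at most
  \<open>H^2 * (t - s)^2\<close>; the square root is the factor in
  \<open>four_point_bound\<close>.\<close>

definition C4 :: real where "C4 = 3 * sqrt (m2 * m6) * H\<^sup>2"

lemma C4_nonneg: "0 \<le> C4"
  using m2_nonneg m6_nonneg by (auto simp: C4_def)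

text \<open>The fourth power is the square of the integral of \<open>q a * q b\<close> over pairs,
  so \<open>second_moment_of_integral\<close> on the product space leaves an integral of four-point
  functions. The majorants are integrated in \<open>ennreal\<close>, which settles integrability and
  size together.\<close>

lemma I_fourth_integrable: "integrable M (\<lambda>\<omega>. I s t \<omega> ^ 4)"
  and I_fourth_le: "s \<le> t \<Longrightarrow> expectation (\<lambda>\<omega>. I s t \<omega> ^ 4) \<le> C4 * (t - s)\<^sup>2"
proof -
  interpret \<nu>: finite_measure "\<nu> s t" by (rule finite_measure_restrict_Ioc)
  interpret \<nu>\<nu>: pair_sigma_finite "\<nu> s t" "\<nu> s t" ..
  define Q where "Q = (\<lambda>(a, b) \<omega>. q a \<omega> * q b \<omega>)"
  have fin: "finite_measure (\<nu> s t \<Otimes>\<^sub>M \<nu> s t)"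
    by (rule finite_measure_pair_measure) (rule finite_measure_restrict_Ioc)+
  have Qm: "(\<lambda>(z, \<omega>). Q z \<omega>) \<in> borel_measurable ((\<nu> s t \<Otimes>\<^sub>M \<nu> s t) \<Otimes>\<^sub>M M)"
  proof -
    have 1: "(\<lambda>((a, b), \<omega>). q a \<omega>) \<in> borel_measurable ((\<nu> s t \<Otimes>\<^sub>M \<nu> s t) \<Otimes>\<^sub>M M)"
      using measurable_compose[of "\<lambda>((a, b), \<omega>). (a, \<omega>)" "(\<nu> s t \<Otimes>\<^sub>M \<nu> s t) \<Otimes>\<^sub>M M" "\<nu> s t \<Otimes>\<^sub>M M", OF _ q_measurable_\<nu>]
      by (simp add: case_prod_beta')
    have 2: "(\<lambda>((a, b), \<omega>). q b \<omega>) \<in> borel_measurable ((\<nu> s t \<Otimes>\<^sub>M \<nu> s t) \<Otimes>\<^sub>M M)"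
      using measurable_compose[of "\<lambda>((a, b), \<omega>). (b, \<omega>)" "(\<nu> s t \<Otimes>\<^sub>M \<nu> s t) \<Otimes>\<^sub>M M" "\<nu> s t \<Otimes>\<^sub>M M", OF _ q_measurable_\<nu>]
      by (simp add: case_prod_beta')
    from borel_measurable_times[OF 1 2] show ?thesis
      by (simp add: Q_def case_prod_beta')
  qed
  \<comment> \<open>This crude uniform bound only opens the way to Fubini's theorem; the size in
    \<open>t - s\<close> comes from \<open>four_point_bound\<close>.\<close>
  have Q2: "integrable M (\<lambda>\<omega>. (Q z \<omega>)\<^sup>2)" "expectation (\<lambda>\<omega>. (Q z \<omega>)\<^sup>2) \<le> 2 * expectation (\<lambda>\<omega>. q 0 \<omega> ^ 4)" for z
  proof -
    obtain a b where z: "z = (a, b)" by (cases z)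
    have i: "integrable M (\<lambda>\<omega>. q a \<omega> ^ 4 + q b \<omega> ^ 4)"
      using q_power_integrable[of 4] by simp
    have le: "(Q z \<omega>)\<^sup>2 \<le> q a \<omega> ^ 4 + q b \<omega> ^ 4" for \<omega>
      using abs_mult_le_squares[of "(q a \<omega>)\<^sup>2" "(q b \<omega>)\<^sup>2"] by (simp add: z Q_def power_mult_distrib)
    show 1: "integrable M (\<lambda>\<omega>. (Q z \<omega>)\<^sup>2)"
      by (rule Bochner_Integration.integrable_bound[OF i])
        (auto simp: z Q_def intro!: AE_I2 order_trans[OF le[unfolded z Q_def prod.case]])
    have "expectation (\<lambda>\<omega>. (Q z \<omega>)\<^sup>2) \<le> expectation (\<lambda>\<omega>. q a \<omega> ^ 4 + q b \<omega> ^ 4)"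
      by (rule integral_mono[OF 1 i le])
    also have "\<dots> = 2 * expectation (\<lambda>\<omega>. q 0 \<omega> ^ 4)"
      using q_power_integrable[of 4] by (simp add: moment_stationary[of a 4] moment_stationary[of b 4])
    finally show "expectation (\<lambda>\<omega>. (Q z \<omega>)\<^sup>2) \<le> 2 * expectation (\<lambda>\<omega>. q 0 \<omega> ^ 4)" .
  qed
  note sm = second_moment_of_integral[OF fin Qm Q2]
  have sq: "AE \<omega> in M. (LINT z|(\<nu> s t \<Otimes>\<^sub>M \<nu> s t). Q z \<omega>)\<^sup>2 = I s t \<omega> ^ 4"
    using sm(1)
  proof eventually_elim
    case (elim \<omega>)
    have "(LINT z|(\<nu> s t \<Otimes>\<^sub>M \<nu> s t). Q z \<omega>) = (LINT a|\<nu> s t. LINT b|\<nu> s t. Q (a, b) \<omega>)"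
      by (rule \<nu>\<nu>.integral_fst'[OF elim, symmetric])
    also have "\<dots> = (I s t \<omega>)\<^sup>2" by (simp add: Q_def I_eq power2_eq_square)
    finally show ?case by simp
  qed
  show "integrable M (\<lambda>\<omega>. I s t \<omega> ^ 4)"
    by (rule iffD1[OF integrable_cong_AE[OF _ _ sq] sm(2)]) (use sm(2) in auto)
  assume st: "s \<le> t"
  let ?C = "ennreal (sqrt (m2 * m6))"
  have \<nu>st: "emeasure (\<nu> s t) (space (\<nu> s t)) = ennreal (t - s)"
    using st by (simp add: space_\<nu> emeasure_space_restrict_Ioc)
  have [measurable]: "h \<in> borel_measurable lborel" using h_measurable by simp
  have [measurable]: "(\<lambda>x. x) \<in> measurable (\<nu> s t) borel" by (simp add: measurable_restrict_space1)
  have hm: "(\<lambda>y. ennreal (h (x - y))) \<in> borel_measurable (\<nu> s t)" for x by measurable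
  have H0: "0 \<le> H" by (intro Bochner_Integration.integral_nonneg h_nonneg)
  \<comment> \<open>For fixed \<open>a\<close> and \<open>b\<close>, the pairing that keeps them
    together integrates to \<open>h (a - b) * H * (t - s)\<close>, and each of the two crossed
    pairings to at most \<open>H * H\<close>.\<close>
  have inner: "(\<integral>\<^sup>+z'. ennreal \<bar>expectation (\<lambda>\<omega>. Q (a, b) \<omega> * Q z' \<omega>)\<bar> \<partial>(\<nu> s t \<Otimes>\<^sub>M \<nu> s t))
      \<le> ?C * (ennreal (h (a - b)) * (ennreal H * ennreal (t - s)) + 2 * (ennreal H * ennreal H))" for a b
  proof -
    define f1 where "f1 c d = ennreal (h (a - b)) * ennreal (h (c - d))" for c d
    define f2 where "f2 c d = ennreal (h (a - c)) * ennreal (h (b - d))" for c d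
    define f3 where "f3 c d = ennreal (h (a - d)) * ennreal (h (b - c))" for c d
    have m[measurable]: "(\<lambda>z. f1 (fst z) (snd z)) \<in> borel_measurable (\<nu> s t \<Otimes>\<^sub>M \<nu> s t)"
      "(\<lambda>z. f2 (fst z) (snd z)) \<in> borel_measurable (\<nu> s t \<Otimes>\<^sub>M \<nu> s t)"
      "(\<lambda>z. f3 (fst z) (snd z)) \<in> borel_measurable (\<nu> s t \<Otimes>\<^sub>M \<nu> s t)"
      unfolding f1_def f2_def f3_def by measurable
    have "(\<integral>\<^sup>+z'. ennreal \<bar>expectation (\<lambda>\<omega>. Q (a, b) \<omega> * Q z' \<omega>)\<bar> \<partial>(\<nu> s t \<Otimes>\<^sub>M \<nu> s t))
        \<le> (\<integral>\<^sup>+z'. ?C * (f1 (fst z') (snd z') + f2 (fst z') (snd z') + f3 (fst z') (snd z')) \<partial>(\<nu> s t \<Otimes>\<^sub>M \<nu> s t))"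
    proof (rule nn_integral_mono)
      fix z' :: "real \<times> real"
      obtain c d where z': "z' = (c, d)" by (cases z')
      have "ennreal \<bar>expectation (\<lambda>\<omega>. Q (a, b) \<omega> * Q z' \<omega>)\<bar>
          \<le> ennreal (sqrt (m2 * m6) * (h (a - b) * h (c - d) + h (a - c) * h (b - d) + h (a - d) * h (b - c)))"
        using four_point_bound[of a b c d] by (intro ennreal_leI) (simp add: Q_def z')
      also have "\<dots> = ?C * (f1 (fst z') (snd z') + f2 (fst z') (snd z') + f3 (fst z') (snd z'))"
        using m2_nonneg m6_nonneg h_nonneg by (simp add: z' f1_def f2_def f3_def ennreal_mult)
      finally show "ennreal \<bar>expectation (\<lambda>\<omega>. Q (a, b) \<omega> * Q z' \<omega>)\<bar>
        \<le> ?C * (f1 (fst z') (snd z') + f2 (fst z') (snd z') + f3 (fst z') (snd z'))" .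
    qed
    also have "\<dots> = ?C * ((\<integral>\<^sup>+c. \<integral>\<^sup>+d. f1 c d \<partial>\<nu> s t \<partial>\<nu> s t) + (\<integral>\<^sup>+c. \<integral>\<^sup>+d. f2 c d \<partial>\<nu> s t \<partial>\<nu> s t)
        + (\<integral>\<^sup>+c. \<integral>\<^sup>+d. f3 c d \<partial>\<nu> s t \<partial>\<nu> s t))"
      using \<nu>.nn_integral_fst[OF m(1)] \<nu>.nn_integral_fst[OF m(2)] \<nu>.nn_integral_fst[OF m(3)]
      by (simp add: nn_integral_cmult nn_integral_add)
    also have "\<dots> \<le> ?C * (ennreal (h (a - b)) * (ennreal H * ennreal (t - s)) + ennreal H * ennreal H + ennreal H * ennreal H)"
    proof (intro mult_left_mono add_mono)
      have "(\<integral>\<^sup>+c. \<integral>\<^sup>+d. f1 c d \<partial>\<nu> s t \<partial>\<nu> s t) \<le> (\<integral>\<^sup>+c. ennreal (h (a - b)) * ennreal H \<partial>\<nu> s t)"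
        unfolding f1_def by (intro nn_integral_mono) (simp add: nn_integral_cmult hm nn_integral_h mult_left_mono)
      then show "(\<integral>\<^sup>+c. \<integral>\<^sup>+d. f1 c d \<partial>\<nu> s t \<partial>\<nu> s t) \<le> ennreal (h (a - b)) * (ennreal H * ennreal (t - s))"
        using \<nu>st by (simp add: mult.assoc)
      have "(\<integral>\<^sup>+c. \<integral>\<^sup>+d. f2 c d \<partial>\<nu> s t \<partial>\<nu> s t) \<le> (\<integral>\<^sup>+c. ennreal (h (a - c)) * ennreal H \<partial>\<nu> s t)"
        unfolding f2_def by (intro nn_integral_mono) (simp add: nn_integral_cmult hm nn_integral_h mult_left_mono)
      also have "\<dots> \<le> ennreal H * ennreal H"
        by (simp add: nn_integral_multc hm nn_integral_h mult_right_mono)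
      finally show "(\<integral>\<^sup>+c. \<integral>\<^sup>+d. f2 c d \<partial>\<nu> s t \<partial>\<nu> s t) \<le> ennreal H * ennreal H" .
      have "(\<integral>\<^sup>+c. \<integral>\<^sup>+d. f3 c d \<partial>\<nu> s t \<partial>\<nu> s t) \<le> (\<integral>\<^sup>+c. ennreal H * ennreal (h (b - c)) \<partial>\<nu> s t)"
        unfolding f3_def by (intro nn_integral_mono) (simp add: nn_integral_multc hm nn_integral_h mult_right_mono)
      also have "\<dots> \<le> ennreal H * ennreal H"
        by (simp add: nn_integral_cmult hm nn_integral_h mult_left_mono)
      finally show "(\<integral>\<^sup>+c. \<integral>\<^sup>+d. f3 c d \<partial>\<nu> s t \<partial>\<nu> s t) \<le> ennreal H * ennreal H" .
    qed simp
    finally show ?thesis by (simp add: mult_2 add.assoc)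
  qed
  have "ennreal (expectation (\<lambda>\<omega>. I s t \<omega> ^ 4)) = ennreal (expectation (\<lambda>\<omega>. (LINT z|(\<nu> s t \<Otimes>\<^sub>M \<nu> s t). Q z \<omega>)\<^sup>2))"
    using sq by (intro arg_cong[of _ _ ennreal] integral_cong_AE) (use sm(2) in \<open>auto elim: eventually_mono\<close>)
  also have "\<dots> \<le> ennreal \<bar>LINT z|(\<nu> s t \<Otimes>\<^sub>M \<nu> s t). LINT z'|(\<nu> s t \<Otimes>\<^sub>M \<nu> s t). expectation (\<lambda>\<omega>. Q z \<omega> * Q z' \<omega>)\<bar>"
    unfolding sm(3) by (intro ennreal_leI abs_ge_self)
  also have "\<dots> \<le> (\<integral>\<^sup>+z. \<integral>\<^sup>+z'. ennreal \<bar>expectation (\<lambda>\<omega>. Q z \<omega> * Q z' \<omega>)\<bar> \<partial>(\<nu> s t \<Otimes>\<^sub>M \<nu> s t) \<partial>(\<nu> s t \<Otimes>\<^sub>M \<nu> s t))"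
    by (rule order_trans[OF ennreal_abs_integral_le nn_integral_mono]) (rule ennreal_abs_integral_le)
  also have "\<dots> \<le> (\<integral>\<^sup>+z. ?C * (ennreal (h (fst z - snd z)) * (ennreal H * ennreal (t - s)) + 2 * (ennreal H * ennreal H)) \<partial>(\<nu> s t \<Otimes>\<^sub>M \<nu> s t))"
    using inner by (intro nn_integral_mono) (auto simp: split_paired_all)
  also have "\<dots> = (\<integral>\<^sup>+a. \<integral>\<^sup>+b. ?C * (ennreal (h (a - b)) * (ennreal H * ennreal (t - s)) + 2 * (ennreal H * ennreal H)) \<partial>\<nu> s t \<partial>\<nu> s t)"
    by (subst \<nu>.nn_integral_fst[symmetric]) auto
  also have "\<dots> \<le> (\<integral>\<^sup>+a. ?C * (ennreal H * (ennreal H * ennreal (t - s)) + 2 * (ennreal H * ennreal H) * ennreal (t - s)) \<partial>\<nu> s t)"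
  proof (rule nn_integral_mono)
    fix a
    have "(\<integral>\<^sup>+b. ?C * (ennreal (h (a - b)) * (ennreal H * ennreal (t - s)) + 2 * (ennreal H * ennreal H)) \<partial>\<nu> s t)
        = ?C * ((\<integral>\<^sup>+b. ennreal (h (a - b)) \<partial>\<nu> s t) * (ennreal H * ennreal (t - s)) + 2 * (ennreal H * ennreal H) * ennreal (t - s))"
      using hm[of a] \<nu>st by (simp add: nn_integral_cmult nn_integral_add nn_integral_multc)
    also have "\<dots> \<le> ?C * (ennreal H * (ennreal H * ennreal (t - s)) + 2 * (ennreal H * ennreal H) * ennreal (t - s))"
      by (intro mult_left_mono add_mono mult_right_mono nn_integral_h order_refl) simp_all
    finally show "(\<integral>\<^sup>+b. ?C * (ennreal (h (a - b)) * (ennreal H * ennreal (t - s)) + 2 * (ennreal H * ennreal H)) \<partial>\<nu> s t)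
      \<le> ?C * (ennreal H * (ennreal H * ennreal (t - s)) + 2 * (ennreal H * ennreal H) * ennreal (t - s))" .
  qed
  also have "\<dots> = ennreal (C4 * (t - s)\<^sup>2)"
    using st H0 m2_nonneg m6_nonneg
  proof -
    have "?C * (ennreal H * (ennreal H * ennreal (t - s)) + 2 * (ennreal H * ennreal H) * ennreal (t - s)) * ennreal (t - s)
        = ennreal (sqrt (m2 * m6) * (H * (H * (t - s)) + 2 * (H * H) * (t - s)) * (t - s))"
    proof -
      have "ennreal (H * (H * (t - s)) + 2 * (H * H) * (t - s))
          = ennreal (H * (H * (t - s))) + ennreal (2 * (H * H) * (t - s))"
        using st H0 by (intro ennreal_plus) simp_all
      also have "\<dots> = ennreal H * (ennreal H * ennreal (t - s)) + 2 * (ennreal H * ennreal H) * ennreal (t - s)"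
        using st H0 by (simp only: ennreal_mult mult_nonneg_nonneg zero_le_numeral ennreal_numeral diff_ge_0_iff_ge)
      finally show ?thesis
        using st H0 m2_nonneg m6_nonneg by (simp only: ennreal_mult mult_nonneg_nonneg add_nonneg_nonneg
            zero_le_numeral diff_ge_0_iff_ge real_sqrt_ge_zero)
    qed
    also have "sqrt (m2 * m6) * (H * (H * (t - s)) + 2 * (H * H) * (t - s)) * (t - s) = C4 * (t - s)\<^sup>2"
      by (simp add: C4_def power2_eq_square)
    finally show ?thesis using \<nu>st by simp
  qed
  finally show "expectation (\<lambda>\<omega>. I s t \<omega> ^ 4) \<le> C4 * (t - s)\<^sup>2"
    using C4_nonneg by (simp add: ennreal_le_iff)
qed

end

context mixing_field
begin

section \<open>Mixing for integrals of the field\<close>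

text \<open>Null sets are allowed because \<open>field_sigma\<close> is generated by single
  evaluations and is not completed, whereas an integral over an interval involves uncountably many
  of them.\<close>

definition adapted :: "real set \<Rightarrow> ('w \<Rightarrow> 'b::topological_space) \<Rightarrow> bool" where
  "adapted A \<zeta> \<longleftrightarrow> (\<exists>\<zeta>' \<in> borel_measurable (field_sigma M q A). AE \<omega> in M. \<zeta> \<omega> = \<zeta>' \<omega>)"

lemma adapted_mono: "A \<subseteq> B \<Longrightarrow> adapted A \<zeta> \<Longrightarrow> adapted B \<zeta>"
  unfolding adapted_def using field_sigma_mono by blast

lemma adapted_compose:
  assumes "f \<in> borel_measurable borel" "adapted A \<zeta>"
  shows "adapted A (\<lambda>\<omega>. f (\<zeta> \<omega>))"
proof -
  obtain \<zeta>' where "\<zeta>' \<in> borel_measurable (field_sigma M q A)" "AE \<omega> in M. \<zeta> \<omega> = \<zeta>' \<omega>"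
    using assms(2) by (auto simp: adapted_def)
  then show ?thesis unfolding adapted_def using assms(1)
    by (intro bexI[of _ "\<lambda>\<omega>. f (\<zeta>' \<omega>)"]) (auto elim!: eventually_mono)
qed

lemma adapted_mult:
  fixes \<zeta> \<xi> :: "'w \<Rightarrow> complex"
  assumes "adapted A \<zeta>" "adapted A \<xi>"
  shows "adapted A (\<lambda>\<omega>. \<zeta> \<omega> * \<xi> \<omega>)"
proof -
  obtain \<zeta>' \<xi>' where [measurable]: "\<zeta>' \<in> borel_measurable (field_sigma M q A)" "\<xi>' \<in> borel_measurable (field_sigma M q A)"
    and eq: "AE \<omega> in M. \<zeta> \<omega> = \<zeta>' \<omega>" "AE \<omega> in M. \<xi> \<omega> = \<xi>' \<omega>"
    using assms by (auto simp: adapted_def)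
  have "AE \<omega> in M. \<zeta> \<omega> * \<xi> \<omega> = \<zeta>' \<omega> * \<xi>' \<omega>" using eq by eventually_elim simp
  then show ?thesis unfolding adapted_def by (intro bexI[of _ "\<lambda>\<omega>. \<zeta>' \<omega> * \<xi>' \<omega>"]) measurable
qed

lemma adapted_const: "adapted A (\<lambda>_. c)"
  unfolding adapted_def by (intro bexI[of _ "\<lambda>_. c"]) auto

text \<open>
  The difference of the integral and its conditional expectation is orthogonal to every \<open>q y\<close>,
  hence to the integral, hence to itself.
\<close>

lemma I_adapted: "adapted {s<..t} (I s t)"
proof -
  let ?F = "field_sigma M q {s<..t}"
  interpret F: finite_measure_subalgebra M ?F
    by unfold_locales (rule subalgebra_field_sigma)
  interpret \<nu>: finite_measure "\<nu> s t" by (rule finite_measure_restrict_Ioc)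
  interpret \<nu>M: pair_sigma_finite "\<nu> s t" M ..
  define c where "c = real_cond_exp M ?F (I s t)"
  have cF[measurable]: "c \<in> borel_measurable ?F" by (simp add: c_def)
  have cM[measurable]: "c \<in> borel_measurable M"
    using measurable_from_subalg[OF subalgebra_field_sigma cF] .
  have convex: "convex_on UNIV (\<lambda>x :: real. x\<^sup>2)" by (rule convex_power2)
  have c2: "integrable M (\<lambda>\<omega>. (c \<omega>)\<^sup>2)" unfolding c_def
    by (rule F.integrable_convex_cond_exp[OF I_integrable, where I = UNIV])
      (use I_square_integrable convex in auto)
  define Z where "Z \<omega> = I s t \<omega> - c \<omega>" for \<omega>
  have Zm[measurable]: "Z \<in> borel_measurable M" unfolding Z_def[abs_def] by measurable
  have prod_int: "integrable M (\<lambda>\<omega>. f \<omega> * g \<omega>)"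
    if "f \<in> borel_measurable M" "g \<in> borel_measurable M"
      "integrable M (\<lambda>\<omega>. (f \<omega>)\<^sup>2)" "integrable M (\<lambda>\<omega>. (g \<omega>)\<^sup>2)" for f g :: "'w \<Rightarrow> real"
    by (rule Bochner_Integration.integrable_bound[of M "\<lambda>\<omega>. (f \<omega>)\<^sup>2 + (g \<omega>)\<^sup>2"])
      (use that abs_mult_le_squares in auto)
  have orth: "expectation (\<lambda>\<omega>. Z \<omega> * f \<omega>) = 0"
    if f: "f \<in> borel_measurable ?F" "integrable M (\<lambda>\<omega>. (f \<omega>)\<^sup>2)" for f
  proof -
    have fM: "f \<in> borel_measurable M" using measurable_from_subalg[OF subalgebra_field_sigma f(1)] .
    have i1: "integrable M (\<lambda>\<omega>. f \<omega> * I s t \<omega>)" by (intro prod_int fM I_rv f I_square_integrable)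
    have i2: "integrable M (\<lambda>\<omega>. f \<omega> * c \<omega>)" by (intro prod_int fM cM f c2)
    have "expectation (\<lambda>\<omega>. Z \<omega> * f \<omega>) = expectation (\<lambda>\<omega>. f \<omega> * I s t \<omega>) - expectation (\<lambda>\<omega>. f \<omega> * c \<omega>)"
      unfolding Bochner_Integration.integral_diff[OF i1 i2, symmetric]
      by (simp add: Z_def left_diff_distrib right_diff_distrib mult.commute)
    also have "expectation (\<lambda>\<omega>. f \<omega> * c \<omega>) = expectation (\<lambda>\<omega>. f \<omega> * I s t \<omega>)"
      unfolding c_def by (rule F.real_cond_exp_intg(2)[OF i1 f(1) I_rv])
    finally show ?thesis by simp
  qed
  have Z2: "integrable M (\<lambda>\<omega>. (Z \<omega>)\<^sup>2)"
  proof -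
    have "integrable M (\<lambda>\<omega>. (I s t \<omega>)\<^sup>2 + (c \<omega>)\<^sup>2 - 2 * (I s t \<omega> * c \<omega>))"
      by (intro Bochner_Integration.integrable_add Bochner_Integration.integrable_diff
          integrable_mult_right prod_int I_rv cM c2 I_square_integrable)
    then show ?thesis by (simp add: Z_def power2_diff mult.assoc)
  qed
  have "integrable (\<nu> s t \<Otimes>\<^sub>M M) (\<lambda>(y, \<omega>). Z \<omega> * q y \<omega>)"
  proof (rule \<nu>M.Fubini_integrable)
    show m: "(\<lambda>(y, \<omega>). Z \<omega> * q y \<omega>) \<in> borel_measurable (\<nu> s t \<Otimes>\<^sub>M M)"
      using q_measurable_\<nu>[of s t] by (simp add: case_prod_beta')
    have "(LINT \<omega>|M. norm (Z \<omega> * q y \<omega>)) \<le> expectation (\<lambda>\<omega>. (Z \<omega>)\<^sup>2) + m2" for y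
    proof -
      have "(LINT \<omega>|M. norm (Z \<omega> * q y \<omega>)) \<le> (LINT \<omega>|M. (Z \<omega>)\<^sup>2 + (q y \<omega>)\<^sup>2)"
        using q_power_integrable[of 2 y] Z2 abs_mult_le_squares
        by (intro integral_mono integrable_norm prod_int) auto
      then show ?thesis using q_power_integrable[of 2 y] Z2 moment_stationary[of y 2] by simp
    qed
    then show "integrable (\<nu> s t) (\<lambda>y. LINT \<omega>|M. norm (case (y, \<omega>) of (y, \<omega>) \<Rightarrow> Z \<omega> * q y \<omega>))"
      using m
      by (intro \<nu>.integrable_const_bound[of _ "expectation (\<lambda>\<omega>. (Z \<omega>)\<^sup>2) + m2"] borel_measurable_lebesgue_integral)
        (auto simp: case_prod_beta')
    show "AE y in \<nu> s t. integrable M (\<lambda>\<omega>. case (y, \<omega>) of (y, \<omega>) \<Rightarrow> Z \<omega> * q y \<omega>)"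
      using q_power_integrable[of 2] Z2 by (auto intro!: AE_I2 prod_int)
  qed
  from \<nu>M.Fubini_integral[OF this]
  have "expectation (\<lambda>\<omega>. Z \<omega> * I s t \<omega>) = (LINT y|\<nu> s t. expectation (\<lambda>\<omega>. Z \<omega> * q y \<omega>))"
    by (simp add: I_eq[abs_def])
  also have "\<dots> = (LINT y|\<nu> s t. 0)"
    by (intro Bochner_Integration.integral_cong refl orth q_measurable_field_sigma)
      (use q_power_integrable[of 2] in \<open>auto simp: space_\<nu>\<close>)
  finally have ZI: "expectation (\<lambda>\<omega>. Z \<omega> * I s t \<omega>) = 0" by simp
  have "expectation (\<lambda>\<omega>. (Z \<omega>)\<^sup>2) = expectation (\<lambda>\<omega>. Z \<omega> * I s t \<omega> - Z \<omega> * c \<omega>)"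
    by (intro Bochner_Integration.integral_cong refl) (simp add: Z_def power2_eq_square right_diff_distrib)
  also have "\<dots> = expectation (\<lambda>\<omega>. Z \<omega> * I s t \<omega>) - expectation (\<lambda>\<omega>. Z \<omega> * c \<omega>)"
    by (intro Bochner_Integration.integral_diff prod_int Z2 c2 I_square_integrable) measurable
  also have "\<dots> = 0" using ZI orth[OF cF c2] by simp
  finally have "AE \<omega> in M. (Z \<omega>)\<^sup>2 = 0"
    using integral_nonneg_eq_0_iff_AE[OF Z2] by simp
  then have "AE \<omega> in M. I s t \<omega> = c \<omega>" by eventually_elim (simp add: Z_def)
  with cF show ?thesis unfolding adapted_def by blast
qed

text \<open>The real and the imaginary part of the complex covariance are each a combination of two
  real covariances bounded by \<open>\<phi> (2 * g)\<close>; this accounts for the constant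
  4.\<close>

lemma adapted_covariance_bound:
  fixes \<zeta> \<xi> :: "'w \<Rightarrow> complex"
  assumes A: "A \<in> sets borel" "A \<noteq> {}" and B: "B \<in> sets borel" "B \<noteq> {}"
    and g: "0 \<le> g" "\<And>x y. x \<in> A \<Longrightarrow> y \<in> B \<Longrightarrow> g \<le> \<bar>x - y\<bar>"
    and \<zeta>: "adapted A \<zeta>" "\<zeta> \<in> borel_measurable M" "\<And>\<omega>. cmod (\<zeta> \<omega>) \<le> 1"
    and \<xi>: "adapted B \<xi>" "\<xi> \<in> borel_measurable M" "\<And>\<omega>. cmod (\<xi> \<omega>) \<le> 1"
  shows "cmod (expectation (\<lambda>\<omega>. \<zeta> \<omega> * \<xi> \<omega>) - expectation \<zeta> * expectation \<xi>) \<le> 4 * \<phi> (2 * g)"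
proof -
  obtain \<zeta>' where [measurable]: "\<zeta>' \<in> borel_measurable (field_sigma M q A)" and \<zeta>': "AE \<omega> in M. \<zeta> \<omega> = \<zeta>' \<omega>"
    using \<zeta>(1) by (auto simp: adapted_def)
  obtain \<xi>' where [measurable]: "\<xi>' \<in> borel_measurable (field_sigma M q B)" and \<xi>': "AE \<omega> in M. \<xi> \<omega> = \<xi>' \<omega>"
    using \<xi>(1) by (auto simp: adapted_def)
  note [measurable] = \<zeta>(2) \<xi>(2)
  have real: "\<bar>expectation (\<lambda>\<omega>. f (\<zeta> \<omega>) * k (\<xi> \<omega>)) - expectation (\<lambda>\<omega>. f (\<zeta> \<omega>)) * expectation (\<lambda>\<omega>. k (\<xi> \<omega>))\<bar> \<le> \<phi> (2 * g)"
    if fm[measurable]: "f \<in> borel_measurable borel" "k \<in> borel_measurable borel"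
      and fb: "\<And>z. \<bar>f z\<bar> \<le> cmod z" "\<And>z. \<bar>k z\<bar> \<le> cmod z" for f k :: "complex \<Rightarrow> real"
  proof -
    have [measurable]: "\<zeta>' \<in> borel_measurable M" "\<xi>' \<in> borel_measurable M"
      by (rule measurable_from_subalg[OF subalgebra_field_sigma]; measurable)+
    have le1: "(f (\<zeta> \<omega>))\<^sup>2 \<le> 1" "(k (\<xi> \<omega>))\<^sup>2 \<le> 1" for \<omega>
      using fb(1)[of "\<zeta> \<omega>"] \<zeta>(3)[of \<omega>] fb(2)[of "\<xi> \<omega>"] \<xi>(3)[of \<omega>]
      by (auto simp: abs_square_le_1)
    have b1: "AE \<omega> in M. (f (\<zeta>' \<omega>))\<^sup>2 \<le> 1" using \<zeta>' by eventually_elim (use le1 in metis)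
    have b2: "AE \<omega> in M. (k (\<xi>' \<omega>))\<^sup>2 \<le> 1" using \<xi>' by eventually_elim (use le1 in metis)
    have i1: "integrable M (\<lambda>\<omega>. (f (\<zeta>' \<omega>))\<^sup>2)"
      by (rule integrable_const_bound[of _ 1]) (use b1 in auto)
    have i2: "integrable M (\<lambda>\<omega>. (k (\<xi>' \<omega>))\<^sup>2)"
      by (rule integrable_const_bound[of _ 1]) (use b2 in auto)
    have e1: "expectation (\<lambda>\<omega>. (f (\<zeta>' \<omega>))\<^sup>2) \<le> 1" by (rule integral_le_const[OF i1 b1])
    have e2: "expectation (\<lambda>\<omega>. (k (\<xi>' \<omega>))\<^sup>2) \<le> 1" by (rule integral_le_const[OF i2 b2])
    have "\<bar>expectation (\<lambda>\<omega>. f (\<zeta>' \<omega>) * k (\<xi>' \<omega>)) - expectation (\<lambda>\<omega>. f (\<zeta>' \<omega>)) * expectation (\<lambda>\<omega>. k (\<xi>' \<omega>))\<bar>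
        \<le> \<phi> (2 * g) * sqrt (expectation (\<lambda>\<omega>. (f (\<zeta>' \<omega>))\<^sup>2) * expectation (\<lambda>\<omega>. (k (\<xi>' \<omega>))\<^sup>2))"
      by (rule covariance_bound[OF A B g _ i1 _ i2]) measurable
    also have "\<dots> \<le> \<phi> (2 * g) * 1"
      using e1 e2 g by (intro mult_left_mono \<phi>_nonneg) (auto intro!: mult_le_one)
    finally have "\<bar>expectation (\<lambda>\<omega>. f (\<zeta>' \<omega>) * k (\<xi>' \<omega>)) - expectation (\<lambda>\<omega>. f (\<zeta>' \<omega>)) * expectation (\<lambda>\<omega>. k (\<xi>' \<omega>))\<bar>
        \<le> \<phi> (2 * g)" by simp
    moreover have "expectation (\<lambda>\<omega>. f (\<zeta>' \<omega>) * k (\<xi>' \<omega>)) = expectation (\<lambda>\<omega>. f (\<zeta> \<omega>) * k (\<xi> \<omega>))"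
      using \<zeta>' \<xi>' by (intro integral_cong_AE) (measurable, auto elim: eventually_elim2 eventually_mono)
    moreover have "expectation (\<lambda>\<omega>. f (\<zeta>' \<omega>)) = expectation (\<lambda>\<omega>. f (\<zeta> \<omega>))"
      using \<zeta>' by (intro integral_cong_AE) (measurable, auto elim: eventually_elim2 eventually_mono)
    moreover have "expectation (\<lambda>\<omega>. k (\<xi>' \<omega>)) = expectation (\<lambda>\<omega>. k (\<xi> \<omega>))"
      using \<xi>' by (intro integral_cong_AE) (measurable, auto elim: eventually_elim2 eventually_mono)
    ultimately show ?thesis by simp
  qed
  have \<zeta>i: "integrable M \<zeta>" and \<xi>i: "integrable M \<xi>" and pi: "integrable M (\<lambda>\<omega>. \<zeta> \<omega> * \<xi> \<omega>)"
    using \<zeta>(3) \<xi>(3) by (auto intro!: integrable_const_bound[of _ 1] AE_I2 mult_le_one simp: norm_mult)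
  have ReIm: "integrable M (\<lambda>\<omega>. f (\<zeta> \<omega>) * k (\<xi> \<omega>))" if "f \<in> {Re, Im}" "k \<in> {Re, Im}" for f k
  proof (rule integrable_const_bound[of _ 1])
    have "\<bar>f (\<zeta> \<omega>)\<bar> \<le> 1" "\<bar>k (\<xi> \<omega>)\<bar> \<le> 1" for \<omega>
      using that order_trans[OF abs_Re_le_cmod \<zeta>(3)] order_trans[OF abs_Im_le_cmod \<zeta>(3)]
        order_trans[OF abs_Re_le_cmod \<xi>(3)] order_trans[OF abs_Im_le_cmod \<xi>(3)] by auto
    then show "AE \<omega> in M. norm (f (\<zeta> \<omega>) * k (\<xi> \<omega>)) \<le> 1" by (auto simp: abs_mult intro!: mult_le_one)
  qed (use that in auto)
  define cov where "cov f k = expectation (\<lambda>\<omega>. f (\<zeta> \<omega>) * k (\<xi> \<omega>)) - expectation (\<lambda>\<omega>. f (\<zeta> \<omega>)) * expectation (\<lambda>\<omega>. k (\<xi> \<omega>))"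
    for f k :: "complex \<Rightarrow> real"
  let ?c = "expectation (\<lambda>\<omega>. \<zeta> \<omega> * \<xi> \<omega>) - expectation \<zeta> * expectation \<xi>"
  have "Re ?c = cov Re Re - cov Im Im" "Im ?c = cov Re Im + cov Im Re"
    using \<zeta>i \<xi>i pi ReIm[of Re Re] ReIm[of Im Im] ReIm[of Re Im] ReIm[of Im Re]
    by (simp_all add: cov_def flip: integral_Re integral_Im)
  moreover have "\<bar>cov f k\<bar> \<le> \<phi> (2 * g)" if "f \<in> {Re, Im}" "k \<in> {Re, Im}" for f k
    unfolding cov_def by (rule real) (use that abs_Re_le_cmod abs_Im_le_cmod in auto)
  ultimately have "\<bar>Re ?c\<bar> \<le> 2 * \<phi> (2 * g)" "\<bar>Im ?c\<bar> \<le> 2 * \<phi> (2 * g)"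
    by (smt (verit) insertI1 insertI2)+
  then show ?thesis using cmod_le[of ?c] by linarith
qed

text \<open>Split off the last factor. The earlier blocks all lie in the half line
  \<open>{..s n - g}\<close>, at distance at least \<open>g\<close> from the last one, so each split
  costs one covariance bound; the factors have modulus at most 1 and do not enlarge the earlier
  errors.\<close>

lemma product_mixing:
  fixes f :: "nat \<Rightarrow> real \<Rightarrow> complex"
  assumes st: "\<And>j. s j < t j" "\<And>j. t j + g \<le> s (Suc j)" and g: "0 \<le> g"
    and f: "\<And>j. f j \<in> borel_measurable borel" "\<And>j x. cmod (f j x) \<le> 1"
  shows "cmod (expectation (\<lambda>\<omega>. \<Prod>j<n. f j (I (s j) (t j) \<omega>)) - (\<Prod>j<n. expectation (\<lambda>\<omega>. f j (I (s j) (t j) \<omega>))))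
    \<le> real n * (4 * \<phi> (2 * g))"
proof (induction n)
  case 0 show ?case by (simp add: prob_space)
next
  case (Suc n)
  note f(1)[measurable]
  define X where "X j \<omega> = f j (I (s j) (t j) \<omega>)" for j \<omega>
  have Xm[measurable]: "X j \<in> borel_measurable M" for j unfolding X_def by measurable
  have Xa: "adapted {s j<..t j} (X j)" for j
    unfolding X_def[abs_def] by (rule adapted_compose[OF f(1) I_adapted])
  have X1: "cmod (X j \<omega>) \<le> 1" for j \<omega> by (simp add: X_def f(2))
  have "incseq s" using st g by (intro incseq_SucI) (smt (verit))
  then have tle: "t j \<le> s n - g" if "j < n" for j
    using st(2)[of j] incseqD[of s "Suc j" n] that by simp
  have Pa: "adapted {..s n - g} (\<lambda>\<omega>. \<Prod>j<k. X j \<omega>)" if "k \<le> n" for k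
    using that
  proof (induction k)
    case 0 show ?case by (simp add: adapted_const)
  next
    case (Suc k)
    have "adapted {..s n - g} (X k)"
      by (rule adapted_mono[OF _ Xa]) (use tle[of k] Suc.prems in auto)
    from adapted_mult[OF _ this] Suc show ?case by simp
  qed
  have P1: "cmod (\<Prod>j<k. X j \<omega>) \<le> 1" for k \<omega>
    unfolding prod_norm[symmetric] by (rule prod_le_1) (use X1 in auto)
  have "cmod (expectation (\<lambda>\<omega>. (\<Prod>j<n. X j \<omega>) * X n \<omega>) - expectation (\<lambda>\<omega>. \<Prod>j<n. X j \<omega>) * expectation (X n)) \<le> 4 * \<phi> (2 * g)"
  proof (rule adapted_covariance_bound[of "{..s n - g}" "{s n<..t n}"])
    show "{s n<..t n} \<noteq> {}" using st(1)[of n] by simp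
    show "g \<le> \<bar>x - y\<bar>" if "x \<in> {..s n - g}" "y \<in> {s n<..t n}" for x y using that by auto
  qed (use Pa[of n] P1 Xa X1 g in auto)
  moreover have "cmod (expectation (\<lambda>\<omega>. \<Prod>j<n. X j \<omega>) * expectation (X n) - (\<Prod>j<n. expectation (X j)) * expectation (X n))
      \<le> real n * (4 * \<phi> (2 * g))"
  proof -
    have "cmod (expectation (X n)) \<le> expectation (\<lambda>\<omega>. cmod (X n \<omega>))" by (rule integral_norm_bound)
    also have "\<dots> \<le> 1"
      by (intro integral_le_const integrable_const_bound[of _ 1]) (use X1 in auto)
    finally have "cmod (expectation (X n)) \<le> 1" .
    then have "cmod (expectation (\<lambda>\<omega>. \<Prod>j<n. X j \<omega>) - (\<Prod>j<n. expectation (X j))) * cmod (expectation (X n))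
        \<le> (real n * (4 * \<phi> (2 * g))) * 1"
      using Suc.IH g by (intro mult_mono) (auto simp: X_def[abs_def] \<phi>_nonneg)
    then show ?thesis by (simp add: norm_mult[symmetric] left_diff_distrib)
  qed
  ultimately have "cmod (expectation (\<lambda>\<omega>. (\<Prod>j<n. X j \<omega>) * X n \<omega>) - (\<Prod>j<n. expectation (X j)) * expectation (X n))
      \<le> 4 * \<phi> (2 * g) + real n * (4 * \<phi> (2 * g))"
    using norm_triangle_ineq[of "expectation (\<lambda>\<omega>. (\<Prod>j<n. X j \<omega>) * X n \<omega>) - expectation (\<lambda>\<omega>. \<Prod>j<n. X j \<omega>) * expectation (X n)"
        "expectation (\<lambda>\<omega>. \<Prod>j<n. X j \<omega>) * expectation (X n) - (\<Prod>j<n. expectation (X j)) * expectation (X n)"]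
    by simp
  then show ?case by (simp add: X_def[abs_def] algebra_simps)
qed

text \<open>Because \<phi> is decreasing, \<open>r * sqrt (\<phi> r)\<close> is at most the integral
  of \<open>sqrt \<phi>\<close> over \<open>{0..r}\<close>, which gives decay of order
  \<open>r^(-2)\<close>.\<close>

lemma \<phi>_tendsto_0: "(\<phi> \<longlongrightarrow> 0) at_top"
proof -
  define J where "J = (LINT r:{0..}|lborel. sqrt (\<phi> r))"
  have J: "r * sqrt (\<phi> r) \<le> J" if "0 < r" for r
  proof -
    have "r * sqrt (\<phi> r) = (LINT x|lborel. indicator {0..r} x * sqrt (\<phi> r))" using that by simp
    also have "\<dots> \<le> J" unfolding J_def set_lebesgue_integral_def
    proof (rule integral_mono)
      show "integrable lborel (\<lambda>x. indicat_real {0..} x *\<^sub>R sqrt (\<phi> x))"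
        using \<phi>_integrable by (simp add: set_integrable_def)
      show "indicator {0..r} x * sqrt (\<phi> r) \<le> indicat_real {0..} x *\<^sub>R sqrt (\<phi> x)" for x
        using monotone_onD[OF \<phi>_antimono, of x r] that by (auto simp: indicator_def \<phi>_nonneg)
    qed (use that in simp)
    finally show ?thesis .
  qed
  have "((\<lambda>r. (J / r)\<^sup>2) \<longlongrightarrow> 0) at_top"
    using tendsto_power[OF tendsto_divide_0[OF tendsto_const[of J] filterlim_at_top_imp_at_infinity[OF filterlim_ident]], of 2]
    by simp
  moreover have "\<forall>\<^sub>F r in at_top. norm (\<phi> r) \<le> (J / r)\<^sup>2"
    using eventually_gt_at_top[of 0]
  proof eventually_elim
    case (elim r)
    have "sqrt (\<phi> r) \<le> J / r" using J[OF elim] elim by (simp add: field_simps)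
    then have "(sqrt (\<phi> r))\<^sup>2 \<le> (J / r)\<^sup>2" by (rule power_mono) (use elim in \<open>simp add: \<phi>_nonneg\<close>)
    then show ?case using elim by (simp add: \<phi>_nonneg)
  qed
  ultimately show ?thesis by (rule Lim_null_comparison[rotated])
qed

end

section \<open>The central limit theorem for increments\<close>

lemma norm_diff_chain:
  fixes a b c d :: "'a::real_normed_vector"
  shows "norm (a - d) \<le> norm (a - b) + norm (b - c) + norm (c - d)"
  using norm_triangle_ineq[of "a - b" "b - c"] norm_triangle_ineq[of "a - c" "c - d"] by simp

lemma cmod_iexp_diff_le: "cmod (iexp x - iexp y) \<le> \<bar>x - y\<bar>"
proof -
  have "iexp x - iexp y = iexp y * (iexp (x - y) - 1)"
    by (simp add: right_diff_distrib exp_add[symmetric] ring_distribs)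
  then have "cmod (iexp x - iexp y) = cmod (iexp (x - y) - 1)" by (simp add: norm_mult)
  also have "\<dots> \<le> \<bar>x - y\<bar>" using iexp_approx1[of "x - y" 0] by simp
  finally show ?thesis .
qed

text \<open>Nonnegativity of the variance of \<open>|X|\<close>.\<close>

lemma (in prob_space) expectation_abs_le_sqrt:
  assumes "X \<in> borel_measurable M" "integrable M (\<lambda>\<omega>. (X \<omega>)\<^sup>2)" "expectation (\<lambda>\<omega>. (X \<omega>)\<^sup>2) \<le> V"
  shows "expectation (\<lambda>\<omega>. \<bar>X \<omega>\<bar>) \<le> sqrt V"
proof (rule real_le_rsqrt)
  have i: "integrable M X" by (rule square_integrable_imp_integrable[OF assms(1,2)])
  have "0 \<le> variance (\<lambda>\<omega>. \<bar>X \<omega>\<bar>)" by (rule variance_positive)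
  also have "\<dots> = expectation (\<lambda>\<omega>. (X \<omega>)\<^sup>2) - (expectation (\<lambda>\<omega>. \<bar>X \<omega>\<bar>))\<^sup>2"
    using i assms(2) by (subst variance_eq) auto
  finally show "(expectation (\<lambda>\<omega>. \<bar>X \<omega>\<bar>))\<^sup>2 \<le> V" using assms(3) by simp
qed

context mixing_field
begin

text \<open>By substitution this is \<epsilon>^(-1/2) times the integral of
  \<open>q (y / \<epsilon>)\<close> over \<open>{s<..t}\<close>. The increments of the oscillating
  noise \<open>B\<close> defined later are its negatives.\<close>

definition X :: "real \<Rightarrow> real \<Rightarrow> real \<Rightarrow> 'w \<Rightarrow> real" where
  "X \<epsilon> s t \<omega> = sqrt \<epsilon> * I (s / \<epsilon>) (t / \<epsilon>) \<omega>"

lemma X_rv [measurable]: "X \<epsilon> s t \<in> borel_measurable M"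
  unfolding X_def[abs_def] by measurable

lemma X_square_integrable: "integrable M (\<lambda>\<omega>. (X \<epsilon> s t \<omega>)\<^sup>2)"
  using I_square_integrable by (simp add: X_def power_mult_distrib)

lemma X_integrable: "integrable M (X \<epsilon> s t)"
  by (rule square_integrable_imp_integrable[OF X_rv X_square_integrable])

lemma RI_nonneg: "0 \<le> RI" by (intro Bochner_Integration.integral_nonneg) simp

lemma X_square_eq: "0 < \<epsilon> \<Longrightarrow> expectation (\<lambda>\<omega>. (X \<epsilon> s t \<omega>)\<^sup>2) = \<epsilon> * expectation (\<lambda>\<omega>. (I (s / \<epsilon>) (t / \<epsilon>) \<omega>)\<^sup>2)"
  by (simp add: X_def power_mult_distrib)

lemma X_square_le:
  assumes "0 < \<epsilon>" "s \<le> t"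
  shows "expectation (\<lambda>\<omega>. (X \<epsilon> s t \<omega>)\<^sup>2) \<le> RI * (t - s)"
proof -
  have "expectation (\<lambda>\<omega>. (X \<epsilon> s t \<omega>)\<^sup>2) \<le> \<epsilon> * (RI * (t / \<epsilon> - s / \<epsilon>))"
    unfolding X_square_eq[OF assms(1)] using assms
    by (intro mult_left_mono I_square_le) (auto simp: divide_right_mono)
  also have "\<dots> = RI * (t - s)" using assms by (simp add: diff_divide_distrib[symmetric])
  finally show ?thesis .
qed

lemma X_abs_le:
  assumes "0 < \<epsilon>" "s \<le> t"
  shows "expectation (\<lambda>\<omega>. \<bar>X \<epsilon> s t \<omega>\<bar>) \<le> sqrt (RI * (t - s))"
  by (intro expectation_abs_le_sqrt X_rv X_square_integrable X_square_le assms)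

lemma X_fourth:
  assumes "0 < \<epsilon>" "s \<le> t"
  shows "integrable M (\<lambda>\<omega>. X \<epsilon> s t \<omega> ^ 4)" "expectation (\<lambda>\<omega>. X \<epsilon> s t \<omega> ^ 4) \<le> C4 * (t - s)\<^sup>2"
proof -
  have e: "sqrt \<epsilon> ^ 4 = \<epsilon>\<^sup>2"
    using assms by (metis less_imp_le numeral_Bit0 power_add power2_eq_square real_sqrt_pow2)
  show "integrable M (\<lambda>\<omega>. X \<epsilon> s t \<omega> ^ 4)" using I_fourth_integrable by (simp add: X_def power_mult_distrib)
  have "expectation (\<lambda>\<omega>. X \<epsilon> s t \<omega> ^ 4) = \<epsilon>\<^sup>2 * expectation (\<lambda>\<omega>. I (s / \<epsilon>) (t / \<epsilon>) \<omega> ^ 4)"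
    by (simp add: X_def power_mult_distrib e)
  also have "\<dots> \<le> \<epsilon>\<^sup>2 * (C4 * (t / \<epsilon> - s / \<epsilon>)\<^sup>2)"
    using assms by (intro mult_left_mono I_fourth_le) (auto simp: divide_right_mono)
  also have "\<dots> = C4 * (t - s)\<^sup>2" using assms by (simp add: diff_divide_distrib[symmetric] power_divide)
  finally show "expectation (\<lambda>\<omega>. X \<epsilon> s t \<omega> ^ 4) \<le> C4 * (t - s)\<^sup>2" .
qed

lemma X_add:
  assumes "s \<le> t" "t \<le> u" "0 < \<epsilon>"
  shows "AE \<omega> in M. X \<epsilon> s u \<omega> = X \<epsilon> s t \<omega> + X \<epsilon> t u \<omega>"
  using AE_q_integrable[of "s / \<epsilon>" "u / \<epsilon>"]
proof eventually_elim
  case (elim \<omega>)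
  have st: "s / \<epsilon> \<le> t / \<epsilon>" "t / \<epsilon> \<le> u / \<epsilon>" using assms by (auto simp: divide_right_mono)
  have un: "{s / \<epsilon><..u / \<epsilon>} = {s / \<epsilon><..t / \<epsilon>} \<union> {t / \<epsilon><..u / \<epsilon>}" using st by auto
  have "I (s / \<epsilon>) (u / \<epsilon>) \<omega> = I (s / \<epsilon>) (t / \<epsilon>) \<omega> + I (t / \<epsilon>) (u / \<epsilon>) \<omega>"
    unfolding I_def un
    by (rule set_integral_Un) (use st in \<open>auto intro: set_integrable_subset[OF elim]\<close>)
  then show ?case by (simp add: X_def distrib_left)
qed

text \<open>Remove a piece of length \<open>sqrt \<epsilon>\<close> from the right end of every
  interval. In mean this moves a factor by at most \<open>L * sqrt (RI * sqrt \<epsilon>)\<close>,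
  while on the scale of \<open>q\<close> the gaps have length
  \<open>sqrt \<epsilon> / \<epsilon>\<close>, which tends to infinity, so that
  \<open>product_mixing\<close> applies to what remains.\<close>

lemma asymptotic_independence:
  fixes f :: "nat \<Rightarrow> real \<Rightarrow> complex" and c l :: real
  assumes l: "0 < l" and f1: "\<And>j x. cmod (f j x) \<le> 1"
    and lip: "\<And>j x y. cmod (f j x - f j y) \<le> L * \<bar>x - y\<bar>"
  defines "Y \<equiv> \<lambda>\<epsilon> j. X \<epsilon> (c + real j * l) (c + real (Suc j) * l)"
  shows "((\<lambda>\<epsilon>. expectation (\<lambda>\<omega>. \<Prod>j<n. f j (Y \<epsilon> j \<omega>)) - (\<Prod>j<n. expectation (\<lambda>\<omega>. f j (Y \<epsilon> j \<omega>)))) \<longlongrightarrow> 0) (at_right 0)"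
proof -
  have L0: "0 \<le> L" using order_trans[OF norm_ge_zero lip[of 0 1 0]] by simp
  have "L-lipschitz_on UNIV (f j)" for j
    using lip L0 by (auto intro!: lipschitz_onI simp: dist_norm)
  then have fm[measurable]: "f j \<in> borel_measurable borel" for j
    by (intro borel_measurable_continuous_onI lipschitz_on_continuous_on)
  have Ym[measurable]: "Y \<epsilon> j \<in> borel_measurable M" for \<epsilon> j unfolding Y_def by measurable
  \<comment> \<open>The shortened blocks are inserted twice, in the expectation of the product and
    in the product of the expectations; hence the factor 2.\<close>
  define bound where "bound \<epsilon> = 2 * (real n * (L * sqrt (RI * sqrt \<epsilon>))) + real n * (4 * \<phi> (2 * (sqrt \<epsilon> / \<epsilon>)))" for \<epsilon>
  \<comment> \<open>This keeps the removed piece shorter than the block.\<close>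
  have "\<forall>\<^sub>F \<epsilon> in at_right 0. \<epsilon> \<in> {0<..<l\<^sup>2}" by (rule eventually_at_right_real) (use l in simp)
  then have "\<forall>\<^sub>F \<epsilon> in at_right 0. norm (expectation (\<lambda>\<omega>. \<Prod>j<n. f j (Y \<epsilon> j \<omega>)) - (\<Prod>j<n. expectation (\<lambda>\<omega>. f j (Y \<epsilon> j \<omega>)))) \<le> bound \<epsilon>"
  proof eventually_elim
    case (elim \<epsilon>)
    then have e: "0 < \<epsilon>" and "sqrt \<epsilon> < sqrt (l\<^sup>2)" by (auto simp del: real_sqrt_abs)
    then have el: "sqrt \<epsilon> < l" using l by simp
    define Y' where "Y' j = X \<epsilon> (c + real j * l) (c + real (Suc j) * l - sqrt \<epsilon>)" for j
    have Y'm[measurable]: "Y' j \<in> borel_measurable M" for j unfolding Y'_def by measurable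
    have int: "complex_integrable M (\<lambda>\<omega>. f j (Y \<epsilon> j \<omega>))" "complex_integrable M (\<lambda>\<omega>. f j (Y' j \<omega>))" for j
      using f1 by (auto intro!: integrable_const_bound[of _ 1])
    have pr1: "cmod (\<Prod>j<n. f j (x j)) \<le> 1" for x :: "nat \<Rightarrow> real"
      unfolding prod_norm[symmetric] by (rule prod_le_1) (use f1 in auto)
    have pint: "complex_integrable M (\<lambda>\<omega>. \<Prod>j<n. f j (Y \<epsilon> j \<omega>))" "complex_integrable M (\<lambda>\<omega>. \<Prod>j<n. f j (Y' j \<omega>))"
      using pr1 by (auto intro!: integrable_const_bound[of _ 1])
    have dint: "integrable M (\<lambda>\<omega>. cmod (f j (Y \<epsilon> j \<omega>) - f j (Y' j \<omega>)))" for j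
      by (intro integrable_norm Bochner_Integration.integrable_diff int)
    have diff: "expectation (\<lambda>\<omega>. cmod (f j (Y \<epsilon> j \<omega>) - f j (Y' j \<omega>))) \<le> L * sqrt (RI * sqrt \<epsilon>)" for j
    proof -
      let ?Z = "X \<epsilon> (c + real (Suc j) * l - sqrt \<epsilon>) (c + real (Suc j) * l)"
      have "AE \<omega> in M. Y \<epsilon> j \<omega> = Y' j \<omega> + ?Z \<omega>"
        unfolding Y_def Y'_def by (rule X_add) (use e el in \<open>auto simp: distrib_right\<close>)
      then have "AE \<omega> in M. cmod (f j (Y \<epsilon> j \<omega>) - f j (Y' j \<omega>)) \<le> L * \<bar>?Z \<omega>\<bar>"
        by eventually_elim (use lip in \<open>metis add_diff_cancel_left'\<close>)
      then have "expectation (\<lambda>\<omega>. cmod (f j (Y \<epsilon> j \<omega>) - f j (Y' j \<omega>))) \<le> expectation (\<lambda>\<omega>. L * \<bar>?Z \<omega>\<bar>)"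
        by (intro integral_mono_AE dint) (use X_integrable in auto)
      also have "\<dots> \<le> L * sqrt (RI * sqrt \<epsilon>)"
        using X_abs_le[OF e, of "c + real (Suc j) * l - sqrt \<epsilon>" "c + real (Suc j) * l"] e L0
        by (auto intro!: mult_left_mono)
      finally show ?thesis .
    qed
    have d1: "cmod (expectation (\<lambda>\<omega>. \<Prod>j<n. f j (Y \<epsilon> j \<omega>)) - expectation (\<lambda>\<omega>. \<Prod>j<n. f j (Y' j \<omega>)))
        \<le> real n * (L * sqrt (RI * sqrt \<epsilon>))"
    proof -
      have "cmod (expectation (\<lambda>\<omega>. \<Prod>j<n. f j (Y \<epsilon> j \<omega>)) - expectation (\<lambda>\<omega>. \<Prod>j<n. f j (Y' j \<omega>)))
          = cmod (expectation (\<lambda>\<omega>. (\<Prod>j<n. f j (Y \<epsilon> j \<omega>)) - (\<Prod>j<n. f j (Y' j \<omega>))))"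
        using pint by simp
      also have "\<dots> \<le> expectation (\<lambda>\<omega>. cmod ((\<Prod>j<n. f j (Y \<epsilon> j \<omega>)) - (\<Prod>j<n. f j (Y' j \<omega>))))"
        by (rule integral_norm_bound)
      also have "\<dots> \<le> expectation (\<lambda>\<omega>. \<Sum>j<n. cmod (f j (Y \<epsilon> j \<omega>) - f j (Y' j \<omega>)))"
        using f1 by (intro integral_mono integrable_norm Bochner_Integration.integrable_diff pint
            Bochner_Integration.integrable_sum dint norm_prod_diff) auto
      also have "\<dots> = (\<Sum>j<n. expectation (\<lambda>\<omega>. cmod (f j (Y \<epsilon> j \<omega>) - f j (Y' j \<omega>))))"
        using dint by simp
      also have "\<dots> \<le> real n * (L * sqrt (RI * sqrt \<epsilon>))"
        using sum_bounded_above[of "{..<n}", OF diff] by simp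
      finally show ?thesis .
    qed
    have le1: "cmod (expectation (\<lambda>\<omega>. f j (Z \<omega>))) \<le> 1" if "complex_integrable M (\<lambda>\<omega>. f j (Z \<omega>))" for Z j
    proof -
      have "cmod (expectation (\<lambda>\<omega>. f j (Z \<omega>))) \<le> expectation (\<lambda>\<omega>. cmod (f j (Z \<omega>)))" by (rule integral_norm_bound)
      also have "\<dots> \<le> 1" by (intro integral_le_const) (use f1 that in auto)
      finally show ?thesis .
    qed
    have d2: "cmod ((\<Prod>j<n. expectation (\<lambda>\<omega>. f j (Y \<epsilon> j \<omega>))) - (\<Prod>j<n. expectation (\<lambda>\<omega>. f j (Y' j \<omega>))))
        \<le> real n * (L * sqrt (RI * sqrt \<epsilon>))"
    proof -
      have "cmod ((\<Prod>j<n. expectation (\<lambda>\<omega>. f j (Y \<epsilon> j \<omega>))) - (\<Prod>j<n. expectation (\<lambda>\<omega>. f j (Y' j \<omega>))))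
          \<le> (\<Sum>j<n. cmod (expectation (\<lambda>\<omega>. f j (Y \<epsilon> j \<omega>)) - expectation (\<lambda>\<omega>. f j (Y' j \<omega>))))"
        using le1 int by (intro norm_prod_diff) auto
      also have "\<dots> \<le> (\<Sum>j<n. L * sqrt (RI * sqrt \<epsilon>))"
      proof (rule sum_mono)
        fix j
        have "cmod (expectation (\<lambda>\<omega>. f j (Y \<epsilon> j \<omega>)) - expectation (\<lambda>\<omega>. f j (Y' j \<omega>)))
            = cmod (expectation (\<lambda>\<omega>. f j (Y \<epsilon> j \<omega>) - f j (Y' j \<omega>)))" using int by simp
        also have "\<dots> \<le> expectation (\<lambda>\<omega>. cmod (f j (Y \<epsilon> j \<omega>) - f j (Y' j \<omega>)))" by (rule integral_norm_bound)
        also note diff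
        finally show "cmod (expectation (\<lambda>\<omega>. f j (Y \<epsilon> j \<omega>)) - expectation (\<lambda>\<omega>. f j (Y' j \<omega>))) \<le> L * sqrt (RI * sqrt \<epsilon>)" .
      qed
      finally show ?thesis by simp
    qed
    have d3: "cmod (expectation (\<lambda>\<omega>. \<Prod>j<n. f j (Y' j \<omega>)) - (\<Prod>j<n. expectation (\<lambda>\<omega>. f j (Y' j \<omega>))))
        \<le> real n * (4 * \<phi> (2 * (sqrt \<epsilon> / \<epsilon>)))"
      unfolding Y'_def X_def
      by (rule product_mixing[where f = "\<lambda>j x. f j (sqrt \<epsilon> * x)"])
        (use e el f1 in \<open>auto simp: divide_strict_right_mono distrib_right add_divide_distrib[symmetric]\<close>)
    show ?case unfolding bound_def using d1 d3
      order_trans[OF eq_refl[OF norm_minus_commute] d2]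
      norm_diff_chain[of "expectation (\<lambda>\<omega>. \<Prod>j<n. f j (Y \<epsilon> j \<omega>))" "\<Prod>j<n. expectation (\<lambda>\<omega>. f j (Y \<epsilon> j \<omega>))"
        "expectation (\<lambda>\<omega>. \<Prod>j<n. f j (Y' j \<omega>))" "\<Prod>j<n. expectation (\<lambda>\<omega>. f j (Y' j \<omega>))"]
      by linarith
  qed
  moreover have "(bound \<longlongrightarrow> 0) (at_right 0)"
  proof -
    have "filterlim sqrt (at_right 0) (at_right 0)"
      unfolding filterlim_at using tendsto_real_sqrt[OF tendsto_ident_at, of 0 "{0<..}"]
      by (auto intro!: eventually_mono[OF eventually_at_right_less[of "0 :: real"]])
    then have "filterlim (\<lambda>\<epsilon>::real. 2 * inverse (sqrt \<epsilon>)) at_top (at_right 0)"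
      by (intro filterlim_tendsto_pos_mult_at_top[OF tendsto_const]
          filterlim_compose[OF filterlim_inverse_at_top_right]) auto
    moreover have "\<forall>\<^sub>F \<epsilon> :: real in at_right 0. 2 * inverse (sqrt \<epsilon>) = 2 * (sqrt \<epsilon> / \<epsilon>)"
      using eventually_at_right_less[of 0] by eventually_elim (simp add: field_simps)
    ultimately have "filterlim (\<lambda>\<epsilon>::real. 2 * (sqrt \<epsilon> / \<epsilon>)) at_top (at_right 0)"
      by (simp cong: filterlim_cong)
    from filterlim_compose[OF \<phi>_tendsto_0 this]
    have "((\<lambda>\<epsilon>. 2 * (real n * (L * sqrt (RI * sqrt \<epsilon>))) + real n * (4 * \<phi> (2 * (sqrt \<epsilon> / \<epsilon>))))
        \<longlongrightarrow> 2 * (real n * (L * sqrt (RI * sqrt 0))) + real n * (4 * 0)) (at_right 0)"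
      by (intro tendsto_intros)
    then show ?thesis by (simp add: bound_def[abs_def])
  qed
  ultimately show ?thesis by (rule Lim_null_comparison)
qed

abbreviation \<sigma>2 :: real where "\<sigma>2 \<equiv> (LINT r|lborel. R r)"

lemma X_variance_tendsto:
  assumes "s \<le> t"
  shows "((\<lambda>\<epsilon>. expectation (\<lambda>\<omega>. (X \<epsilon> s t \<omega>)\<^sup>2)) \<longlongrightarrow> \<sigma>2 * (t - s)) (at_right 0)"
proof (rule Lim_transform_eventually)
  show "((\<lambda>\<epsilon>. \<epsilon> * expectation (\<lambda>\<omega>. (I (s / \<epsilon>) (t / \<epsilon>) \<omega>)\<^sup>2)) \<longlongrightarrow> \<sigma>2 * (t - s)) (at_right 0)"
    using I_variance_tendsto[OF assms] by (simp add: mult.commute)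
  show "\<forall>\<^sub>F \<epsilon> in at_right 0. \<epsilon> * expectation (\<lambda>\<omega>. (I (s / \<epsilon>) (t / \<epsilon>) \<omega>)\<^sup>2) = expectation (\<lambda>\<omega>. (X \<epsilon> s t \<omega>)\<^sup>2)"
    using eventually_at_right_less[of "0 :: real"] by eventually_elim (simp add: X_square_eq)
qed

lemma \<sigma>2_nonneg: "0 \<le> \<sigma>2"
  using tendsto_lowerbound[OF X_variance_tendsto[of 0 1], of 0] by simp

text \<open>The error is of order \<open>(t - s)^(3/2)\<close>, hence negligible when summed over
  \<open>n\<close> blocks of length proportional to \<open>1 / n\<close>. The absolute third moment
  is interpolated between the second and the fourth.\<close>

lemma iexp_second_order:
  assumes "0 < \<epsilon>" "s < t"
  shows "cmod (expectation (\<lambda>\<omega>. iexp (\<theta> * X \<epsilon> s t \<omega>)) - complex_of_real (1 - \<theta>\<^sup>2 * expectation (\<lambda>\<omega>. (X \<epsilon> s t \<omega>)\<^sup>2) / 2))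
    \<le> \<bar>\<theta>\<bar> ^ 3 * (RI + C4) * ((t - s) * sqrt (t - s))"
proof -
  let ?x = "X \<epsilon> s t" and ?l = "t - s"
  have l: "0 < ?l" using assms by simp
  note x2 = X_square_integrable[of \<epsilon> s t] and x1 = X_integrable[of \<epsilon> s t]
  note x4 = X_fourth[OF assms(1) less_imp_le[OF assms(2)]]
  have mean: "expectation ?x = 0" by (simp add: X_def[abs_def] I_mean)
  let ?p = "\<lambda>\<omega>. \<Sum>k\<le>2. (\<i> * complex_of_real (\<theta> * ?x \<omega>)) ^ k / fact k"
  have p: "?p \<omega> = 1 + \<i> * complex_of_real (\<theta> * ?x \<omega>) - complex_of_real (\<theta>\<^sup>2 * (?x \<omega>)\<^sup>2 / 2)" for \<omega>
    by (simp add: numeral_2_eq_2 power_mult_distrib)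
  have pint: "complex_integrable M ?p" unfolding p
    by (intro Bochner_Integration.integrable_add Bochner_Integration.integrable_diff integrable_mult_right
        integrable_of_real integrable_divide x1 x2) simp
  have eint: "complex_integrable M (\<lambda>\<omega>. iexp (\<theta> * ?x \<omega>))"
    by (rule integrable_const_bound[of _ 1]) auto
  have Ep: "expectation ?p = complex_of_real (1 - \<theta>\<^sup>2 * expectation (\<lambda>\<omega>. (?x \<omega>)\<^sup>2) / 2)"
  proof -
    have "expectation ?p = 1 + \<i> * complex_of_real (expectation (\<lambda>\<omega>. \<theta> * ?x \<omega>))
        - complex_of_real (expectation (\<lambda>\<omega>. \<theta>\<^sup>2 * (?x \<omega>)\<^sup>2 / 2))"
      unfolding p integral_of_real[symmetric]
      by (subst Bochner_Integration.integral_diff, simp_all add: x1 x2 prob_space del: of_real_mult of_real_divide)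
    then show ?thesis by (simp add: mean)
  qed
  \<comment> \<open>With the weight \<open>sqrt (t - s)\<close> both terms have mean of order
    \<open>(t - s)^(3/2)\<close>.\<close>
  have cube: "\<bar>u\<bar> ^ 3 \<le> sqrt ?l * u\<^sup>2 + u ^ 4 / sqrt ?l" for u :: real
  proof -
    have s: "0 < sqrt ?l" using l by simp
    have "sqrt ?l * \<bar>u\<bar> \<le> (sqrt ?l)\<^sup>2 + u\<^sup>2" using abs_mult_le_squares[of "sqrt ?l" u] s by (simp add: abs_mult)
    then have "u\<^sup>2 * (sqrt ?l * \<bar>u\<bar>) \<le> u\<^sup>2 * ((sqrt ?l)\<^sup>2 + u\<^sup>2)" by (rule mult_left_mono) simp
    then have "sqrt ?l * \<bar>u\<bar> ^ 3 \<le> sqrt ?l * (sqrt ?l * u\<^sup>2 + u ^ 4 / sqrt ?l)"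
      using s by (simp add: power2_eq_square power3_eq_cube power4_eq_xxxx abs_mult[symmetric] algebra_simps)
    then show ?thesis using s by (simp only: mult_le_cancel_left_pos)
  qed
  have "cmod (expectation (\<lambda>\<omega>. iexp (\<theta> * ?x \<omega>)) - expectation ?p)
      = cmod (expectation (\<lambda>\<omega>. iexp (\<theta> * ?x \<omega>) - ?p \<omega>))"
    using pint eint by simp
  also have "\<dots> \<le> expectation (\<lambda>\<omega>. cmod (iexp (\<theta> * ?x \<omega>) - ?p \<omega>))" by (rule integral_norm_bound)
  also have "\<dots> \<le> expectation (\<lambda>\<omega>. \<bar>\<theta>\<bar> ^ 3 * (sqrt ?l * (?x \<omega>)\<^sup>2 + ?x \<omega> ^ 4 / sqrt ?l))"
  proof (rule integral_mono)
    show "integrable M (\<lambda>\<omega>. cmod (iexp (\<theta> * ?x \<omega>) - ?p \<omega>))"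
      using eint pint by (intro integrable_norm Bochner_Integration.integrable_diff)
    show "integrable M (\<lambda>\<omega>. \<bar>\<theta>\<bar> ^ 3 * (sqrt ?l * (?x \<omega>)\<^sup>2 + ?x \<omega> ^ 4 / sqrt ?l))"
      using x2 x4(1) by simp
    fix \<omega>
    have "cmod (iexp (\<theta> * ?x \<omega>) - ?p \<omega>) \<le> \<bar>\<theta> * ?x \<omega>\<bar> ^ Suc 2 / fact (Suc 2)" by (rule iexp_approx1)
    also have "\<dots> \<le> \<bar>\<theta> * ?x \<omega>\<bar> ^ 3 / 6" by (simp add: fact_numeral)
    also have "\<dots> \<le> \<bar>\<theta> * ?x \<omega>\<bar> ^ 3" by simp
    also have "\<dots> = \<bar>\<theta>\<bar> ^ 3 * \<bar>?x \<omega>\<bar> ^ 3" by (simp add: abs_mult power_mult_distrib)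
    also have "\<dots> \<le> \<bar>\<theta>\<bar> ^ 3 * (sqrt ?l * (?x \<omega>)\<^sup>2 + ?x \<omega> ^ 4 / sqrt ?l)"
      by (intro mult_left_mono cube) simp
    finally show "cmod (iexp (\<theta> * ?x \<omega>) - ?p \<omega>) \<le> \<bar>\<theta>\<bar> ^ 3 * (sqrt ?l * (?x \<omega>)\<^sup>2 + ?x \<omega> ^ 4 / sqrt ?l)" .
  qed
  also have "\<dots> = \<bar>\<theta>\<bar> ^ 3 * (sqrt ?l * expectation (\<lambda>\<omega>. (?x \<omega>)\<^sup>2) + expectation (\<lambda>\<omega>. ?x \<omega> ^ 4) / sqrt ?l)"
    using x2 x4(1) by simp
  also have "\<dots> \<le> \<bar>\<theta>\<bar> ^ 3 * (sqrt ?l * (RI * ?l) + C4 * ?l\<^sup>2 / sqrt ?l)"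
    using X_square_le[OF assms(1), of s t] assms(2) x4(2)
    by (intro mult_left_mono add_mono divide_right_mono) auto
  also have "C4 * ?l\<^sup>2 / sqrt ?l = C4 * (?l * sqrt ?l)"
    using l real_div_sqrt[of ?l] by (metis less_imp_le power2_eq_square times_divide_eq_right)
  finally show ?thesis unfolding Ep by (simp add: algebra_simps)
qed

text \<open>The number \<open>n\<close> of blocks is fixed before \<epsilon> tends to 0. The error
  has four quarters: the exponential limit and the Taylor remainder, made small by \<open>n\<close>,
  then the dependence between blocks and the deviation of the block variances, made small by
  \<epsilon>.\<close>

lemma char_tendsto:
  assumes st: "s < t"
  shows "((\<lambda>\<epsilon>. expectation (\<lambda>\<omega>. iexp (\<theta> * X \<epsilon> s t \<omega>))) \<longlongrightarrow> complex_of_real (exp (- \<theta>\<^sup>2 * \<sigma>2 * (t - s) / 2))) (at_right 0)"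
proof (rule tendstoI)
  fix e :: real assume e: "0 < e"
  define a where "a = \<theta>\<^sup>2 * \<sigma>2 * (t - s) / 2"
  \<comment> \<open>The Taylor remainders of \<open>n\<close> blocks of length
    \<open>(t - s) / n\<close> add up to \<open>K / sqrt n\<close>.\<close>
  define K where "K = \<bar>\<theta>\<bar> ^ 3 * (RI + C4) * ((t - s) * sqrt (t - s))"
  have a0: "0 \<le> a" using st \<sigma>2_nonneg by (simp add: a_def)
  have "(\<lambda>n. (1 + (- a) / real n) ^ n) \<longlonglongrightarrow> exp (- a)" by (rule tendsto_exp_limit_sequentially)
  then have "\<forall>\<^sub>F n in sequentially. \<bar>(1 + (- a) / real n) ^ n - exp (- a)\<bar> < e / 4"
    using tendstoD[of "\<lambda>n. (1 + (- a) / real n) ^ n" "exp (- a)" sequentially "e / 4"] e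
    unfolding dist_real_def by (meson divide_pos_pos zero_less_numeral)
  moreover have "(\<lambda>n. K * (1 / sqrt (real n))) \<longlonglongrightarrow> K * 0"
    by (intro tendsto_intros tendsto_divide_0[OF tendsto_const] filterlim_at_top_imp_at_infinity
        filterlim_compose[OF sqrt_at_top filterlim_real_sequentially])
  then have "\<forall>\<^sub>F n in sequentially. K * (1 / sqrt (real n)) < e / 4"
    by (rule order_tendstoD) (use e in simp)
  \<comment> \<open>This makes \<open>1 - a / n\<close> of modulus at most 1, as required when
    products of \<open>n\<close> factors are compared termwise.\<close>
  moreover have "\<forall>\<^sub>F n in sequentially. a / 2 < real n \<and> 0 < n"
    by (intro eventually_conj eventually_gt_at_top) (rule filterlim_real_sequentially[unfolded filterlim_at_top_dense, rule_format])
  ultimately have "\<forall>\<^sub>F n in sequentially. \<bar>(1 + (- a) / real n) ^ n - exp (- a)\<bar> < e / 4 \<and> K * (1 / sqrt (real n)) < e / 4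
      \<and> a / 2 < real n \<and> 0 < n"
    by eventually_elim auto
  then obtain n where n: "\<bar>(1 + (- a) / real n) ^ n - exp (- a)\<bar> < e / 4" "K * (1 / sqrt (real n)) < e / 4"
      "a / 2 < real n" "0 < n"
    by (auto simp: eventually_sequentially)
  define l where "l = (t - s) / real n"
  have l: "0 < l" using st n by (simp add: l_def)
  have nl: "real n * l = t - s" using n by (simp add: l_def)
  define Y where "Y \<epsilon> j = X \<epsilon> (s + real j * l) (s + real (Suc j) * l)" for \<epsilon> j
  define b where "b = complex_of_real (1 - \<theta>\<^sup>2 * \<sigma>2 * l / 2)"
  have al: "a / real n = \<theta>\<^sup>2 * \<sigma>2 * l / 2" by (simp add: a_def l_def)
  have "0 \<le> a / real n" "a / real n \<le> 2" using n a0 by (auto simp: divide_le_eq)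
  then have b1: "cmod b \<le> 1" unfolding b_def al[symmetric] norm_of_real by linarith
  have "((\<lambda>\<epsilon>. expectation (\<lambda>\<omega>. \<Prod>j<n. iexp (\<theta> * Y \<epsilon> j \<omega>)) - (\<Prod>j<n. expectation (\<lambda>\<omega>. iexp (\<theta> * Y \<epsilon> j \<omega>)))) \<longlongrightarrow> 0) (at_right 0)"
    unfolding Y_def
    by (rule asymptotic_independence[OF l, where f = "\<lambda>_ x. iexp (\<theta> * x)" and L = "\<bar>\<theta>\<bar>"])
      (use cmod_iexp_diff_le[of "\<theta> * _" "\<theta> * _"] in \<open>simp_all add: abs_mult[symmetric] right_diff_distrib\<close>)
  then have "\<forall>\<^sub>F \<epsilon> in at_right 0. cmod (expectation (\<lambda>\<omega>. \<Prod>j<n. iexp (\<theta> * Y \<epsilon> j \<omega>)) - (\<Prod>j<n. expectation (\<lambda>\<omega>. iexp (\<theta> * Y \<epsilon> j \<omega>)))) < e / 4"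
    using tendstoD[of _ _ _ "e / 4"] e by (fastforce simp: dist_norm)
  moreover have "((\<lambda>\<epsilon>. \<Sum>j<n. \<theta>\<^sup>2 / 2 * \<bar>expectation (\<lambda>\<omega>. (Y \<epsilon> j \<omega>)\<^sup>2) - \<sigma>2 * l\<bar>) \<longlongrightarrow> (\<Sum>j<n. \<theta>\<^sup>2 / 2 * \<bar>\<sigma>2 * l - \<sigma>2 * l\<bar>)) (at_right 0)"
  proof (intro tendsto_intros)
    fix j
    show "((\<lambda>\<epsilon>. expectation (\<lambda>\<omega>. (Y \<epsilon> j \<omega>)\<^sup>2)) \<longlongrightarrow> \<sigma>2 * l) (at_right 0)"
      using X_variance_tendsto[of "s + real j * l" "s + real (Suc j) * l"] l by (simp add: Y_def distrib_right)
  qed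
  then have "\<forall>\<^sub>F \<epsilon> in at_right 0. (\<Sum>j<n. \<theta>\<^sup>2 / 2 * \<bar>expectation (\<lambda>\<omega>. (Y \<epsilon> j \<omega>)\<^sup>2) - \<sigma>2 * l\<bar>) < e / 4"
    by (rule order_tendstoD) (use e in simp)
  ultimately show "\<forall>\<^sub>F \<epsilon> in at_right 0. dist (expectation (\<lambda>\<omega>. iexp (\<theta> * X \<epsilon> s t \<omega>))) (complex_of_real (exp (- \<theta>\<^sup>2 * \<sigma>2 * (t - s) / 2))) < e"
    using eventually_at_right_less[of "0 :: real"]
  proof eventually_elim
    case (elim \<epsilon>)
    have sum: "AE \<omega> in M. X \<epsilon> s (s + real k * l) \<omega> = (\<Sum>j<k. Y \<epsilon> j \<omega>)" for k
    proof (induction k)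
      case 0 show ?case by (simp add: X_def I_def set_lebesgue_integral_def)
    next
      case (Suc k)
      have "AE \<omega> in M. X \<epsilon> s (s + real (Suc k) * l) \<omega> = X \<epsilon> s (s + real k * l) \<omega> + Y \<epsilon> k \<omega>"
        unfolding Y_def by (rule X_add) (use l elim in \<open>auto simp: distrib_right\<close>)
      with Suc show ?case by eventually_elim simp
    qed
    have 1: "expectation (\<lambda>\<omega>. iexp (\<theta> * X \<epsilon> s t \<omega>)) = expectation (\<lambda>\<omega>. \<Prod>j<n. iexp (\<theta> * Y \<epsilon> j \<omega>))"
    proof (rule integral_cong_AE)
      show "AE \<omega> in M. iexp (\<theta> * X \<epsilon> s t \<omega>) = (\<Prod>j<n. iexp (\<theta> * Y \<epsilon> j \<omega>))"
        using sum[of n] by eventually_elim (simp add: nl exp_sum[symmetric] sum_distrib_left)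
    qed (simp_all add: Y_def)
    have le1: "cmod (expectation (\<lambda>\<omega>. iexp (\<theta> * Y \<epsilon> j \<omega>))) \<le> 1" for j
    proof -
      have "cmod (expectation (\<lambda>\<omega>. iexp (\<theta> * Y \<epsilon> j \<omega>))) \<le> expectation (\<lambda>\<omega>. cmod (iexp (\<theta> * Y \<epsilon> j \<omega>)))"
        by (rule integral_norm_bound)
      then show ?thesis by (simp add: prob_space)
    qed
    have "cmod ((\<Prod>j<n. expectation (\<lambda>\<omega>. iexp (\<theta> * Y \<epsilon> j \<omega>))) - (\<Prod>j<n. b))
        \<le> (\<Sum>j<n. cmod (expectation (\<lambda>\<omega>. iexp (\<theta> * Y \<epsilon> j \<omega>)) - b))"
      using le1 b1 by (intro norm_prod_diff) auto
    also have "\<dots> \<le> (\<Sum>j<n. \<bar>\<theta>\<bar> ^ 3 * (RI + C4) * (l * sqrt l) + \<theta>\<^sup>2 / 2 * \<bar>expectation (\<lambda>\<omega>. (Y \<epsilon> j \<omega>)\<^sup>2) - \<sigma>2 * l\<bar>)"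
    proof (rule sum_mono)
      fix j
      let ?v = "expectation (\<lambda>\<omega>. (Y \<epsilon> j \<omega>)\<^sup>2)"
      have "cmod (expectation (\<lambda>\<omega>. iexp (\<theta> * Y \<epsilon> j \<omega>)) - complex_of_real (1 - \<theta>\<^sup>2 * ?v / 2)) \<le> \<bar>\<theta>\<bar> ^ 3 * (RI + C4) * (l * sqrt l)"
        using iexp_second_order[of \<epsilon> "s + real j * l" "s + real (Suc j) * l" \<theta>] elim l by (simp add: Y_def distrib_right)
      moreover have "cmod (complex_of_real (1 - \<theta>\<^sup>2 * ?v / 2) - b) = \<theta>\<^sup>2 / 2 * \<bar>?v - \<sigma>2 * l\<bar>"
      proof -
        have "(1 - \<theta>\<^sup>2 * ?v / 2) - (1 - \<theta>\<^sup>2 * \<sigma>2 * l / 2) = - (\<theta>\<^sup>2 / 2 * (?v - \<sigma>2 * l))" by (simp add: algebra_simps)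
        then show ?thesis unfolding b_def of_real_diff[symmetric] norm_of_real by (simp add: abs_mult)
      qed
      ultimately show "cmod (expectation (\<lambda>\<omega>. iexp (\<theta> * Y \<epsilon> j \<omega>)) - b) \<le> \<bar>\<theta>\<bar> ^ 3 * (RI + C4) * (l * sqrt l) + \<theta>\<^sup>2 / 2 * \<bar>?v - \<sigma>2 * l\<bar>"
        using norm_triangle_ineq[of "expectation (\<lambda>\<omega>. iexp (\<theta> * Y \<epsilon> j \<omega>)) - complex_of_real (1 - \<theta>\<^sup>2 * ?v / 2)"
            "complex_of_real (1 - \<theta>\<^sup>2 * ?v / 2) - b"] by simp
    qed
    also have "\<dots> = K * (1 / sqrt (real n)) + (\<Sum>j<n. \<theta>\<^sup>2 / 2 * \<bar>expectation (\<lambda>\<omega>. (Y \<epsilon> j \<omega>)\<^sup>2) - \<sigma>2 * l\<bar>)"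
      using n(4) by (simp add: sum.distrib K_def l_def real_sqrt_divide)
    finally have 2: "cmod ((\<Prod>j<n. expectation (\<lambda>\<omega>. iexp (\<theta> * Y \<epsilon> j \<omega>))) - b ^ n) < e / 4 + e / 4"
      using n(2) elim(2) unfolding prod_constant card_lessThan by linarith
    have bn: "b ^ n = complex_of_real ((1 + (- a) / real n) ^ n)" by (simp add: b_def al)
    have exa: "exp (- \<theta>\<^sup>2 * \<sigma>2 * (t - s) / 2) = exp (- a)" by (simp add: a_def)
    have 3: "cmod (b ^ n - complex_of_real (exp (- \<theta>\<^sup>2 * \<sigma>2 * (t - s) / 2))) < e / 4"
      unfolding bn exa of_real_diff[symmetric] norm_of_real by (rule n(1))
    show ?case unfolding dist_norm 1 using elim(1) 2 3
      norm_diff_chain[of "expectation (\<lambda>\<omega>. \<Prod>j<n. iexp (\<theta> * Y \<epsilon> j \<omega>))" "complex_of_real (exp (- \<theta>\<^sup>2 * \<sigma>2 * (t - s) / 2))"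
        "\<Prod>j<n. expectation (\<lambda>\<omega>. iexp (\<theta> * Y \<epsilon> j \<omega>))" "b ^ n"] by linarith
  qed
qed

end

text \<open>Tensor products of a one-dimensional partition of unity interpolate \<open>F\<close> at
  the nodes. In the cube of half-width \<open>r\<close> the Lipschitz bound gives the first error
  term; outside it some coordinate exceeds \<open>r\<close>, and the trivial error
  \<open>2 * B\<close> is absorbed by a Chebyshev factor. Product functions are wanted because their
  expectations factor under independence.\<close>

lemma product_interpolation:
  fixes F :: "(nat \<Rightarrow> real) \<Rightarrow> real"
  assumes B: "\<And>x. \<bar>F x\<bar> \<le> B" and L: "\<And>x y. \<bar>F x - F y\<bar> \<le> L * (\<Sum>j<m. \<bar>x j - y j\<bar>)" "0 \<le> L"
    and \<delta>: "0 < \<delta>" and r: "0 < r"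
  obtains K :: nat and \<psi> :: "nat \<Rightarrow> real \<Rightarrow> real" and w :: "(nat \<Rightarrow> nat) \<Rightarrow> real" and C :: real
  where "\<And>k x. 0 \<le> \<psi> k x" "\<And>k x. k \<le> K \<Longrightarrow> \<psi> k x \<le> 1" "\<And>k x y. \<bar>\<psi> k x - \<psi> k y\<bar> \<le> C * \<bar>x - y\<bar>"
    "\<And>x. \<bar>F x - (\<Sum>k\<in>PiE {..<m} (\<lambda>_. {..K}). w k * (\<Prod>j<m. \<psi> (k j) (x j)))\<bar>
      \<le> L * (real m * \<delta>) + 2 * B * (\<Sum>j<m. (x j)\<^sup>2) / r\<^sup>2"
proof -
  obtain K :: nat and p \<psi> C where P: "\<And>k. k \<le> K \<Longrightarrow> p k \<in> {- r<..<r}" "\<And>k x. 0 \<le> \<psi> k x"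
      "\<And>x. (\<Sum>k\<le>K. \<psi> k x) = 1" "\<And>k x y. \<bar>\<psi> k x - \<psi> k y\<bar> \<le> C * \<bar>x - y\<bar>"
      "\<And>k x. k \<le> K \<Longrightarrow> x \<in> {- r..r} \<Longrightarrow> \<psi> k x \<noteq> 0 \<Longrightarrow> \<bar>x - p k\<bar> \<le> \<delta>"
    using Lipschitz_partition_of_unity[of "- r" r \<delta>] r \<delta> by (metis neg_less_pos)
  have \<psi>1: "\<psi> k x \<le> 1" if "k \<le> K" for k x
    using member_le_sum[of k "{..K}" "\<lambda>k. \<psi> k x"] P(2,3) that by auto
  define w where "w k = F (\<lambda>j. p (k j))" for k :: "nat \<Rightarrow> nat"
  let ?S = "PiE {..<m} (\<lambda>_. {..K})"
  have B0: "0 \<le> B" using order_trans[OF abs_ge_zero B] .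
  show ?thesis
  proof (rule that[of \<psi> K C w])
    fix x :: "nat \<Rightarrow> real"
    let ?\<Psi> = "\<lambda>k. \<Prod>j<m. \<psi> (k j) (x j)"
    let ?D = "L * (real m * \<delta>) + 2 * B * (\<Sum>j<m. (x j)\<^sup>2) / r\<^sup>2"
    have one: "(\<Sum>k\<in>?S. ?\<Psi> k) = 1"
      using prod_sum_PiE[of "{..<m}" "\<lambda>_. {..K}" "\<lambda>j k. \<psi> k (x j)"] by (simp add: P(3))
    have \<Psi>0: "0 \<le> ?\<Psi> k" for k by (intro prod_nonneg) (simp add: P(2))
    have bd: "\<bar>(F x - w k) * ?\<Psi> k\<bar> \<le> ?D * ?\<Psi> k" if k: "k \<in> ?S" for k
    proof (cases "?\<Psi> k = 0")
      case False
      have nn: "0 \<le> L * (real m * \<delta>)" "0 \<le> 2 * B * (\<Sum>j<m. (x j)\<^sup>2) / r\<^sup>2"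
        using L \<delta> B0 by (auto intro!: mult_nonneg_nonneg divide_nonneg_nonneg sum_nonneg)
      have "\<bar>F x - w k\<bar> \<le> ?D"
      proof (cases "\<forall>j<m. \<bar>x j\<bar> \<le> r")
        case True
        have "\<bar>x j - p (k j)\<bar> \<le> \<delta>" if "j < m" for j
          using False True that k by (intro P(5)) (auto simp: PiE_iff)
        then have "(\<Sum>j<m. \<bar>x j - p (k j)\<bar>) \<le> real m * \<delta>"
          using sum_bounded_above[of "{..<m}" "\<lambda>j. \<bar>x j - p (k j)\<bar>" \<delta>] by simp
        then have "L * (\<Sum>j<m. \<bar>x j - p (k j)\<bar>) \<le> L * (real m * \<delta>)" using L(2) by (rule mult_left_mono)
        then show ?thesis using L(1)[of x "\<lambda>j. p (k j)"] nn by (simp add: w_def)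
      next
        case False
        then obtain i where i: "i < m" "r < \<bar>x i\<bar>" by auto
        have "r\<^sup>2 \<le> \<bar>x i\<bar>\<^sup>2" using i r by (intro power_mono) auto
        also have "\<dots> \<le> (\<Sum>j<m. (x j)\<^sup>2)" using member_le_sum[of i "{..<m}" "\<lambda>j. (x j)\<^sup>2"] i by simp
        finally have "1 \<le> (\<Sum>j<m. (x j)\<^sup>2) / r\<^sup>2" using r by simp
        then have "2 * B * 1 \<le> 2 * B * ((\<Sum>j<m. (x j)\<^sup>2) / r\<^sup>2)" using B0 by (intro mult_left_mono) auto
        moreover have "\<bar>F x - w k\<bar> \<le> 2 * B" using B[of x] B[of "\<lambda>j. p (k j)"] by (simp add: w_def)
        ultimately show ?thesis using nn by simp
      qed
      then show ?thesis unfolding abs_mult using \<Psi>0[of k] by (simp add: mult_right_mono)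
    next
      case True
      then show ?thesis by (simp only: mult_zero_right abs_zero order_refl)
    qed
    have "F x - (\<Sum>k\<in>?S. w k * ?\<Psi> k) = (\<Sum>k\<in>?S. (F x - w k) * ?\<Psi> k)"
      by (simp add: left_diff_distrib sum_subtractf sum_distrib_left[symmetric] one)
    also have "\<bar>\<dots>\<bar> \<le> (\<Sum>k\<in>?S. ?D * ?\<Psi> k)"
      by (rule order_trans[OF sum_abs sum_mono]) (rule bd)
    also have "\<dots> = ?D" by (simp only: sum_distrib_left[symmetric] one mult_1_right)
    finally show "\<bar>F x - (\<Sum>k\<in>?S. w k * ?\<Psi> k)\<bar> \<le> ?D" .
  qed (use P \<psi>1 in auto)
qed

lemma borel_measurable_Lipschitz_coordinates:
  fixes F :: "(nat \<Rightarrow> real) \<Rightarrow> real"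
  assumes L: "\<And>x y. \<bar>F x - F y\<bar> \<le> L * (\<Sum>j<m. \<bar>x j - y j\<bar>)" "0 \<le> L"
    and \<xi>: "\<And>j. \<xi> j \<in> borel_measurable M"
  shows "(\<lambda>\<omega>. F (\<lambda>j. \<xi> j \<omega>)) \<in> borel_measurable M"
proof -
  have "(\<lambda>\<omega>. F (\<lambda>j. \<xi> j \<omega>)) \<in> measurable M (borel_sigma (mtopology_of euclidean_metric))"
    using L by (intro measurable_finite_dimensional[where n = m and C = "\<lambda>_. L"] \<xi>)
      (auto simp: dist_real_def sum_distrib_left)
  then show ?thesis by (simp add: borel_sigma_euclidean)
qed

lemma (in prob_space) expectation_product_sum:
  fixes \<psi> :: "nat \<Rightarrow> real \<Rightarrow> real" and \<eta> :: "nat \<Rightarrow> 'a \<Rightarrow> real" and m K :: nat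
  assumes \<eta>[measurable]: "\<And>j. \<eta> j \<in> borel_measurable M"
    and \<psi>: "\<And>k. \<psi> k \<in> borel_measurable borel" "\<And>k x. 0 \<le> \<psi> k x" "\<And>k x. k \<le> K \<Longrightarrow> \<psi> k x \<le> 1"
  defines "S \<equiv> PiE {..<m} (\<lambda>_. {..K})"
  shows "integrable M (\<lambda>\<omega>. \<Sum>k\<in>S. w k * (\<Prod>j<m. \<psi> (k j) (\<eta> j \<omega>)))"
    and "expectation (\<lambda>\<omega>. \<Sum>k\<in>S. w k * (\<Prod>j<m. \<psi> (k j) (\<eta> j \<omega>)))
      = (\<Sum>k\<in>S. w k * expectation (\<lambda>\<omega>. \<Prod>j<m. \<psi> (k j) (\<eta> j \<omega>)))"
proof -
  note \<psi>(1)[measurable]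
  have i: "integrable M (\<lambda>\<omega>. \<Prod>j<m. \<psi> (k j) (\<eta> j \<omega>))" if "k \<in> S" for k
  proof (rule integrable_const_bound[of _ 1])
    have "\<bar>\<Prod>j<m. \<psi> (k j) (x j)\<bar> \<le> 1" for x
      unfolding abs_prod by (rule prod_le_1) (use \<psi>(2,3) that in \<open>auto simp: S_def PiE_iff\<close>)
    then show "AE \<omega> in M. norm (\<Prod>j<m. \<psi> (k j) (\<eta> j \<omega>)) \<le> 1" by simp
  qed measurable
  then show "integrable M (\<lambda>\<omega>. \<Sum>k\<in>S. w k * (\<Prod>j<m. \<psi> (k j) (\<eta> j \<omega>)))"
    "expectation (\<lambda>\<omega>. \<Sum>k\<in>S. w k * (\<Prod>j<m. \<psi> (k j) (\<eta> j \<omega>)))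
      = (\<Sum>k\<in>S. w k * expectation (\<lambda>\<omega>. \<Prod>j<m. \<psi> (k j) (\<eta> j \<omega>)))"
    by simp_all
qed

lemma (in prob_space) expectation_interpolation_error:
  fixes F G :: "(nat \<Rightarrow> real) \<Rightarrow> real" and \<eta> :: "nat \<Rightarrow> 'a \<Rightarrow> real"
  assumes F: "integrable M (\<lambda>\<omega>. F (\<lambda>j. \<eta> j \<omega>))" and G: "integrable M (\<lambda>\<omega>. G (\<lambda>j. \<eta> j \<omega>))"
    and s2: "\<And>j. j < m \<Longrightarrow> integrable M (\<lambda>\<omega>. (\<eta> j \<omega>)\<^sup>2)"
    and sV: "(\<Sum>j<m. expectation (\<lambda>\<omega>. (\<eta> j \<omega>)\<^sup>2)) \<le> V" and b: "0 \<le> b"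
    and FG: "\<And>x. \<bar>F x - G x\<bar> \<le> a + b * (\<Sum>j<m. (x j)\<^sup>2)"
  shows "\<bar>expectation (\<lambda>\<omega>. F (\<lambda>j. \<eta> j \<omega>)) - expectation (\<lambda>\<omega>. G (\<lambda>j. \<eta> j \<omega>))\<bar> \<le> a + b * V"
proof -
  have Di: "integrable M (\<lambda>\<omega>. a + b * (\<Sum>j<m. (\<eta> j \<omega>)\<^sup>2))"
    using s2 by (intro Bochner_Integration.integrable_add integrable_mult_right Bochner_Integration.integrable_sum) auto
  have "\<bar>expectation (\<lambda>\<omega>. F (\<lambda>j. \<eta> j \<omega>)) - expectation (\<lambda>\<omega>. G (\<lambda>j. \<eta> j \<omega>))\<bar>
      = \<bar>expectation (\<lambda>\<omega>. F (\<lambda>j. \<eta> j \<omega>) - G (\<lambda>j. \<eta> j \<omega>))\<bar>" using F G by simp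
  also have "\<dots> \<le> expectation (\<lambda>\<omega>. \<bar>F (\<lambda>j. \<eta> j \<omega>) - G (\<lambda>j. \<eta> j \<omega>)\<bar>)" by (rule integral_abs_bound)
  also have "\<dots> \<le> expectation (\<lambda>\<omega>. a + b * (\<Sum>j<m. (\<eta> j \<omega>)\<^sup>2))"
    using FG by (intro integral_mono Di integrable_abs Bochner_Integration.integrable_diff F G) auto
  also have "\<dots> = a + b * (\<Sum>j<m. expectation (\<lambda>\<omega>. (\<eta> j \<omega>)\<^sup>2))"
    using s2 by (subst Bochner_Integration.integral_add) (auto simp: prob_space)
  also have "\<dots> \<le> a + b * V" using sV b by (intro add_left_mono mult_left_mono)
  finally show ?thesis .
qed

section \<open>Joint weak convergence of finitely many increments\<close>

context mixing_field
begin

text \<open>Levy's continuity theorem along an arbitrary sequence of positive numbers tending to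
  0.\<close>

lemma increment_weak_convergence:
  fixes \<xi> :: "'v \<Rightarrow> real" and \<psi> :: "real \<Rightarrow> real"
  assumes N: "prob_space N" and \<xi>: "\<xi> \<in> borel_measurable N"
    and ch: "\<And>\<theta>. (CLINT \<omega>|N. iexp (\<theta> * \<xi> \<omega>)) = complex_of_real (exp (- \<theta>\<^sup>2 * \<sigma>2 * (t - s) / 2))"
    and \<psi>: "\<And>x. isCont \<psi> x" "\<And>x. \<bar>\<psi> x\<bar> \<le> B" and st: "s < t"
  shows "((\<lambda>\<epsilon>. expectation (\<lambda>\<omega>. \<psi> (X \<epsilon> s t \<omega>))) \<longlongrightarrow> (LINT \<omega>|N. \<psi> (\<xi> \<omega>))) (at_right 0)"
proof (rule tendsto_at_right_sequentially[of 0 1])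
  interpret N: prob_space N by fact
  fix S :: "nat \<Rightarrow> real" assume S: "\<And>n. 0 < S n" "S \<longlonglongrightarrow> 0"
  have Sl: "filterlim S (at_right 0) sequentially"
    using S by (auto simp: filterlim_at less_imp_neq[symmetric])
  have [measurable]: "\<psi> \<in> borel_measurable borel"
    using \<psi>(1) by (intro borel_measurable_continuous_onI continuous_at_imp_continuous_on) auto
  note \<xi>[measurable]
  have "weak_conv_m (\<lambda>n. distr M borel (X (S n) s t)) (distr N borel \<xi>)"
  proof (rule levy_continuity)
    show "real_distribution (distr M borel (X (S n) s t))" for n by simp
    show "real_distribution (distr N borel \<xi>)" by simp
    fix \<theta>
    have "(\<lambda>n. expectation (\<lambda>\<omega>. iexp (\<theta> * X (S n) s t \<omega>))) \<longlonglongrightarrow> complex_of_real (exp (- \<theta>\<^sup>2 * \<sigma>2 * (t - s) / 2))"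
      by (rule filterlim_compose[OF char_tendsto[OF st] Sl])
    then show "(\<lambda>n. char (distr M borel (X (S n) s t)) \<theta>) \<longlonglongrightarrow> char (distr N borel \<xi>) \<theta>"
      using ch[of \<theta>] by (simp add: char_def integral_distr)
  qed
  from weak_conv_imp_integral_bdd_continuous_conv[OF _ _ this \<psi>(1), of B]
  have "(\<lambda>n. integral\<^sup>L (distr M borel (X (S n) s t)) \<psi>) \<longlonglongrightarrow> integral\<^sup>L (distr N borel \<xi>) \<psi>"
    using \<psi>(2) by simp
  then show "(\<lambda>n. expectation (\<lambda>\<omega>. \<psi> (X (S n) s t \<omega>))) \<longlonglongrightarrow> (LINT \<omega>|N. \<psi> (\<xi> \<omega>))"
    by (simp add: integral_distr)
qed simp

text \<open>By interpolation it suffices to treat products of functions of single increments. Their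
  expectations factor exactly for the independent \<xi> and asymptotically for the increments of the
  field, and each factor converges.\<close>

theorem joint_increment_convergence:
  fixes F :: "(nat \<Rightarrow> real) \<Rightarrow> real" and \<xi> :: "nat \<Rightarrow> 'v \<Rightarrow> real"
  assumes N: "prob_space N" and \<xi>: "\<And>j. \<xi> j \<in> borel_measurable N"
    and indep: "prob_space.indep_vars N (\<lambda>_. borel) \<xi> {..<m}"
    and ch: "\<And>j \<theta>. j < m \<Longrightarrow> (CLINT \<omega>|N. iexp (\<theta> * \<xi> j \<omega>)) = complex_of_real (exp (- \<theta>\<^sup>2 * \<sigma>2 * l / 2))"
    and sq: "\<And>j. j < m \<Longrightarrow> integrable N (\<lambda>\<omega>. (\<xi> j \<omega>)\<^sup>2)" and l: "0 < l"
    and B: "\<And>x. \<bar>F x\<bar> \<le> B" and L: "\<And>x y. \<bar>F x - F y\<bar> \<le> L * (\<Sum>j<m. \<bar>x j - y j\<bar>)" "0 \<le> L"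
  shows "((\<lambda>\<epsilon>. expectation (\<lambda>\<omega>. F (\<lambda>j. X \<epsilon> (c + real j * l) (c + real (Suc j) * l) \<omega>)))
    \<longlongrightarrow> (LINT \<omega>|N. F (\<lambda>j. \<xi> j \<omega>))) (at_right 0)"
proof (rule tendstoI)
  fix e :: real assume e: "0 < e"
  interpret N: prob_space N by fact
  note \<xi>[measurable]
  define Y where "Y \<epsilon> j = X \<epsilon> (c + real j * l) (c + real (Suc j) * l)" for \<epsilon> j
  have Ym[measurable]: "Y \<epsilon> j \<in> borel_measurable M" for \<epsilon> j by (simp add: Y_def)
  have B0: "0 \<le> B" using order_trans[OF abs_ge_zero B] .
  \<comment> \<open>A common bound for the sum of second moments under \<open>M\<close> and under
    \<open>N\<close>, so that one cube serves both.\<close>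
  define V where "V = real m * (RI * l) + (\<Sum>j<m. LINT \<omega>|N. (\<xi> j \<omega>)\<^sup>2)"
  have V0: "0 \<le> V" using l RI_nonneg by (auto simp: V_def intro!: add_nonneg_nonneg sum_nonneg)
  \<comment> \<open>\<delta> and \<open>r\<close> make each of the two interpolation errors at most
    \<open>e / 8\<close>. One comparison under each measure uses \<open>e / 2\<close> in total, and
    the other half is left for the limit of the product functions.\<close>
  define \<delta> where "\<delta> = e / (8 * (L * real m + 1))"
  have \<delta>0: "0 < \<delta>" using e L(2) by (auto simp: \<delta>_def intro!: divide_pos_pos add_nonneg_pos)
  have \<delta>: "L * (real m * \<delta>) \<le> e / 8"
  proof -
    have "L * (real m * \<delta>) = (L * real m) / (L * real m + 1) * (e / 8)" by (simp add: \<delta>_def algebra_simps)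
    also have "\<dots> \<le> 1 * (e / 8)"
      using e L(2) by (intro mult_right_mono) (auto simp: divide_le_eq add_nonneg_pos)
    finally show ?thesis by simp
  qed
  define r where "r = sqrt ((2 * B * V + 1) * 8 / e)"
  have rr: "0 < (2 * B * V + 1) * 8 / e" using e B0 V0 by (auto intro!: divide_pos_pos mult_pos_pos add_nonneg_pos)
  then have r0: "0 < r" by (simp add: r_def)
  have r: "2 * B * V / r\<^sup>2 \<le> e / 8"
  proof -
    have r2: "r\<^sup>2 = (2 * B * V + 1) * 8 / e" using rr by (simp add: r_def)
    have "2 * B * V / r\<^sup>2 = (2 * B * V) / (2 * B * V + 1) * (e / 8)" unfolding r2 by simp
    also have "\<dots> \<le> 1 * (e / 8)"
      using e B0 V0 by (intro mult_right_mono) (auto simp: divide_le_eq add_nonneg_pos)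
    finally show ?thesis by simp
  qed
  obtain K :: nat and \<psi> :: "nat \<Rightarrow> real \<Rightarrow> real" and w :: "(nat \<Rightarrow> nat) \<Rightarrow> real" and C :: real
    where P: "\<And>k x. 0 \<le> \<psi> k x" "\<And>k x. k \<le> K \<Longrightarrow> \<psi> k x \<le> 1"
      "\<And>k x y. \<bar>\<psi> k x - \<psi> k y\<bar> \<le> C * \<bar>x - y\<bar>"
      "\<And>x. \<bar>F x - (\<Sum>k\<in>PiE {..<m} (\<lambda>_. {..K}). w k * (\<Prod>j<m. \<psi> (k j) (x j)))\<bar>
      \<le> L * (real m * \<delta>) + 2 * B * (\<Sum>j<m. (x j)\<^sup>2) / r\<^sup>2"
    by (rule product_interpolation[OF B L \<delta>0 r0]) (rule that; assumption)
  let ?S = "PiE {..<m} (\<lambda>_. {..K :: nat})"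
  have C0: "0 \<le> C" using order_trans[OF abs_ge_zero P(3)[of 0 0 1]] by simp
  have "C-lipschitz_on UNIV (\<psi> k)" for k
    using P(3) C0 by (auto intro!: lipschitz_onI simp: dist_real_def)
  then have \<psi>c: "continuous_on UNIV (\<psi> k)" for k by (rule lipschitz_on_continuous_on)
  then have \<psi>m[measurable]: "\<psi> k \<in> borel_measurable borel" for k by (rule borel_measurable_continuous_onI)
  define G where "G x = (\<Sum>k\<in>?S. w k * (\<Prod>j<m. \<psi> (k j) (x j)))" for x :: "nat \<Rightarrow> real"
  have FG: "\<bar>F x - G x\<bar> \<le> L * (real m * \<delta>) + 2 * B / r\<^sup>2 * (\<Sum>j<m. (x j)\<^sup>2)" for x
    using P(4)[of x] by (simp add: G_def)
  have b0: "0 \<le> 2 * B / r\<^sup>2" using B0 by simp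
  have small: "L * (real m * \<delta>) + 2 * B / r\<^sup>2 * V \<le> e / 4" using \<delta> r by simp
  have lim: "((\<lambda>\<epsilon>. expectation (\<lambda>\<omega>. G (\<lambda>j. Y \<epsilon> j \<omega>))) \<longlongrightarrow> (LINT \<omega>|N. G (\<lambda>j. \<xi> j \<omega>))) (at_right 0)"
  proof -
    have lim_k: "((\<lambda>\<epsilon>. expectation (\<lambda>\<omega>. \<Prod>j<m. \<psi> (k j) (Y \<epsilon> j \<omega>))) \<longlongrightarrow> (LINT \<omega>|N. (\<Prod>j<m. \<psi> (k j) (\<xi> j \<omega>)))) (at_right 0)"
      if k: "k \<in> ?S" for k
    proof -
      \<comment> \<open>\<open>asymptotic_independence\<close> asks for bounded factors at every
        index, but \<open>k j \<le> K\<close> is known only for \<open>j < m\<close>; the factors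
        are extended by 0.\<close>
      define \<kappa> where "\<kappa> j = (if j < m then \<psi> (k j) else (\<lambda>_. 0))" for j
      have \<kappa>1: "\<bar>\<kappa> j x\<bar> \<le> 1" for j x using P(1,2) k by (auto simp: \<kappa>_def PiE_iff)
      have \<kappa>L: "\<bar>\<kappa> j x - \<kappa> j y\<bar> \<le> C * \<bar>x - y\<bar>" for j x y using P(3) C0 by (auto simp: \<kappa>_def)
      have [measurable]: "\<kappa> j \<in> borel_measurable borel" for j by (simp add: \<kappa>_def)
      have \<kappa>i: "integrable M (\<lambda>\<omega>. \<kappa> j (Y \<epsilon> j \<omega>))" "integrable N (\<lambda>\<omega>. \<kappa> j (\<xi> j \<omega>))" for j \<epsilon>
        using \<kappa>1 by (auto intro!: integrable_const_bound[of _ 1] N.integrable_const_bound[of _ 1])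
      have prod_eq: "(\<Prod>j<m. \<psi> (k j) (x j)) = (\<Prod>j<m. \<kappa> j (x j))" for x
        by (rule prod.cong) (auto simp: \<kappa>_def)
      have "((\<lambda>\<epsilon>. expectation (\<lambda>\<omega>. \<Prod>j<m. complex_of_real (\<kappa> j (Y \<epsilon> j \<omega>))) - (\<Prod>j<m. expectation (\<lambda>\<omega>. complex_of_real (\<kappa> j (Y \<epsilon> j \<omega>))))) \<longlongrightarrow> 0) (at_right 0)"
        unfolding Y_def
        by (rule asymptotic_independence[OF l, where f = "\<lambda>j x. complex_of_real (\<kappa> j x)" and L = C])
          (use \<kappa>1 \<kappa>L in \<open>auto simp flip: of_real_diff\<close>)
      then have "((\<lambda>\<epsilon>. complex_of_real (expectation (\<lambda>\<omega>. \<Prod>j<m. \<kappa> j (Y \<epsilon> j \<omega>)) - (\<Prod>j<m. expectation (\<lambda>\<omega>. \<kappa> j (Y \<epsilon> j \<omega>))))) \<longlongrightarrow> of_real 0) (at_right 0)"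
        by (simp flip: of_real_prod)
      then have 1: "((\<lambda>\<epsilon>. expectation (\<lambda>\<omega>. \<Prod>j<m. \<kappa> j (Y \<epsilon> j \<omega>)) - (\<Prod>j<m. expectation (\<lambda>\<omega>. \<kappa> j (Y \<epsilon> j \<omega>)))) \<longlongrightarrow> 0) (at_right 0)"
        by (simp only: tendsto_of_real_iff)
      have 2: "((\<lambda>\<epsilon>. \<Prod>j<m. expectation (\<lambda>\<omega>. \<kappa> j (Y \<epsilon> j \<omega>))) \<longlongrightarrow> (\<Prod>j<m. LINT \<omega>|N. \<kappa> j (\<xi> j \<omega>))) (at_right 0)"
      proof (rule tendsto_prod)
        fix j assume "j \<in> {..<m}"
        then have j: "j < m" by simp
        show "((\<lambda>\<epsilon>. expectation (\<lambda>\<omega>. \<kappa> j (Y \<epsilon> j \<omega>))) \<longlongrightarrow> (LINT \<omega>|N. \<kappa> j (\<xi> j \<omega>))) (at_right 0)"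
          unfolding Y_def
        proof (rule increment_weak_convergence[OF N \<xi>])
          show "isCont (\<kappa> j) x" for x
            using \<psi>c j by (simp add: \<kappa>_def continuous_on_eq_continuous_at)
          show "(CLINT \<omega>|N. iexp (\<theta> * \<xi> j \<omega>)) = complex_of_real (exp (- \<theta>\<^sup>2 * \<sigma>2 * (c + real (Suc j) * l - (c + real j * l)) / 2))" for \<theta>
            using ch[OF j, of \<theta>] by (simp add: distrib_right)
        qed (use \<kappa>1 l in auto)
      qed
      have 3: "(LINT \<omega>|N. (\<Prod>j<m. \<kappa> j (\<xi> j \<omega>))) = (\<Prod>j<m. LINT \<omega>|N. \<kappa> j (\<xi> j \<omega>))"
        by (rule N.indep_vars_lebesgue_integral) (use \<kappa>i in \<open>auto intro!: N.indep_vars_compose2[OF indep]\<close>)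
      show ?thesis unfolding prod_eq 3 using tendsto_add[OF 1 2] by simp
    qed
    show ?thesis
      unfolding G_def by (subst expectation_product_sum(2)[OF Ym \<psi>m P(1)], erule P(2),
          subst N.expectation_product_sum(2)[OF \<xi> \<psi>m P(1)], erule P(2))
        (intro tendsto_sum tendsto_mult tendsto_const lim_k)
  qed
  have "\<forall>\<^sub>F \<epsilon> in at_right 0. dist (expectation (\<lambda>\<omega>. G (\<lambda>j. Y \<epsilon> j \<omega>))) (LINT \<omega>|N. G (\<lambda>j. \<xi> j \<omega>)) < e / 2"
    using tendstoD[OF lim, of "e / 2"] e by simp
  then show "\<forall>\<^sub>F \<epsilon> in at_right 0. dist (expectation (\<lambda>\<omega>. F (\<lambda>j. X \<epsilon> (c + real j * l) (c + real (Suc j) * l) \<omega>))) (LINT \<omega>|N. F (\<lambda>j. \<xi> j \<omega>)) < e"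
    using eventually_at_right_less[of "0 :: real"]
  proof eventually_elim
    case (elim \<epsilon>)
    have "\<bar>(LINT \<omega>|N. F (\<lambda>j. \<xi> j \<omega>)) - (LINT \<omega>|N. G (\<lambda>j. \<xi> j \<omega>))\<bar> \<le> L * (real m * \<delta>) + 2 * B / r\<^sup>2 * V"
    proof (rule N.expectation_interpolation_error[OF _ _ sq _ b0 FG])
      show "integrable N (\<lambda>\<omega>. F (\<lambda>j. \<xi> j \<omega>))"
        using B by (intro N.integrable_const_bound[of _ B] borel_measurable_Lipschitz_coordinates[OF L \<xi>]) auto
      show "integrable N (\<lambda>\<omega>. G (\<lambda>j. \<xi> j \<omega>))"
        unfolding G_def by (rule N.expectation_product_sum(1)[OF \<xi> \<psi>m P(1)]) (rule P(2))
      show "(\<Sum>j<m. LINT \<omega>|N. (\<xi> j \<omega>)\<^sup>2) \<le> V" using l RI_nonneg by (simp add: V_def)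
    qed
    moreover have "\<bar>expectation (\<lambda>\<omega>. F (\<lambda>j. Y \<epsilon> j \<omega>)) - expectation (\<lambda>\<omega>. G (\<lambda>j. Y \<epsilon> j \<omega>))\<bar> \<le> L * (real m * \<delta>) + 2 * B / r\<^sup>2 * V"
    proof (rule expectation_interpolation_error[OF _ _ _ _ b0 FG])
      show "integrable M (\<lambda>\<omega>. F (\<lambda>j. Y \<epsilon> j \<omega>))"
        using B by (intro integrable_const_bound[of _ B] borel_measurable_Lipschitz_coordinates[OF L Ym]) auto
      show "integrable M (\<lambda>\<omega>. G (\<lambda>j. Y \<epsilon> j \<omega>))"
        unfolding G_def by (rule expectation_product_sum(1)[OF Ym \<psi>m P(1)]) (rule P(2))
      show "integrable M (\<lambda>\<omega>. (Y \<epsilon> j \<omega>)\<^sup>2)" for j unfolding Y_def by (rule X_square_integrable)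
      have "expectation (\<lambda>\<omega>. (Y \<epsilon> j \<omega>)\<^sup>2) \<le> RI * l" for j
        using X_square_le[OF elim(2), of "c + real j * l" "c + real (Suc j) * l"] l by (simp add: Y_def distrib_right)
      then have "(\<Sum>j<m. expectation (\<lambda>\<omega>. (Y \<epsilon> j \<omega>)\<^sup>2)) \<le> real m * (RI * l)"
        using sum_bounded_above[of "{..<m}" "\<lambda>j. expectation (\<lambda>\<omega>. (Y \<epsilon> j \<omega>)\<^sup>2)" "RI * l"] by simp
      then show "(\<Sum>j<m. expectation (\<lambda>\<omega>. (Y \<epsilon> j \<omega>)\<^sup>2)) \<le> V"
        by (auto simp: V_def intro!: add_increasing2 sum_nonneg)
    qed
    ultimately show ?case using elim(1) small unfolding dist_real_def Y_def by linarith
  qed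
qed

end

section \<open>Integrals of Lipschitz functions against rough increments\<close>

locale dyadic =
  fixes a b :: real
  assumes ab: "a < b"
begin

definition grid :: "nat \<Rightarrow> nat \<Rightarrow> real" where "grid k j = a + real j * ((b - a) / 2 ^ k)"
text \<open>Midpoints lie in the open interval, where the integrands are controlled; the grid itself
  contains the end points \<open>a\<close> and \<open>b\<close>.\<close>

definition mid :: "nat \<Rightarrow> nat \<Rightarrow> real" where "mid k j = a + (real j + 1 / 2) * ((b - a) / 2 ^ k)"

abbreviation (input) incr :: "(real \<Rightarrow> real \<Rightarrow> real) \<Rightarrow> nat \<Rightarrow> nat \<Rightarrow> real" where
  "incr \<beta> k j \<equiv> \<beta> (grid k j) (grid k (Suc j))"

definition RS :: "nat \<Rightarrow> (real \<Rightarrow> real \<Rightarrow> real) \<Rightarrow> (real \<Rightarrow> real) \<Rightarrow> real" where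
  "RS k \<beta> h = (\<Sum>j<2 ^ k. h (mid k j) * incr \<beta> k j)"
definition NV :: "nat \<Rightarrow> (real \<Rightarrow> real \<Rightarrow> real) \<Rightarrow> real" where
  "NV k \<beta> = (\<Sum>j<2 ^ k. \<bar>incr \<beta> k j\<bar>)"
text \<open>Up to the factor \<open>L * (b - a)\<close> this majorizes all changes of the Riemann
  sums from level \<open>n\<close> on. The indices differ by one because a refinement involves the
  increments of the finer grid and the mesh of the coarser one.\<close>

definition TV :: "nat \<Rightarrow> (real \<Rightarrow> real \<Rightarrow> real) \<Rightarrow> ennreal" where
  "TV n \<beta> = (\<Sum>k. ennreal (NV (Suc (n + k)) \<beta> / 2 ^ (n + k)))"

text \<open>The value \<open>0\<close> where the dyadic variation is infinite makes \<open>RF\<close> total.\<close>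

definition RF :: "(real \<Rightarrow> real \<Rightarrow> real) \<Rightarrow> (real \<Rightarrow> real) \<Rightarrow> real" where
  "RF \<beta> h = (if TV 0 \<beta> < \<top> then lim (\<lambda>k. RS k \<beta> h) else 0)"

definition additive_increments :: "(real \<Rightarrow> real \<Rightarrow> real) \<Rightarrow> bool" where
  "additive_increments \<beta> \<longleftrightarrow> (\<forall>s t u. a \<le> s \<longrightarrow> s \<le> t \<longrightarrow> t \<le> u \<longrightarrow> u \<le> b \<longrightarrow> \<beta> s u = \<beta> s t + \<beta> t u)"

definition Lipschitz_on :: "real \<Rightarrow> (real \<Rightarrow> real) \<Rightarrow> bool" where
  "Lipschitz_on L h \<longleftrightarrow> 0 \<le> L \<and> (\<forall>x\<in>{a<..<b}. \<forall>y\<in>{a<..<b}. \<bar>h x - h y\<bar> \<le> L * \<bar>x - y\<bar>)"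

lemma spacing_pos: "0 < (b - a) / 2 ^ k" using ab by simp

lemma grid_mono: "i \<le> j \<Longrightarrow> grid k i \<le> grid k j"
  unfolding grid_def using spacing_pos[of k] by (intro add_left_mono mult_right_mono) auto

lemma grid_0 [simp]: "grid k 0 = a" and grid_last [simp]: "grid k (2 ^ k) = b"
  by (simp_all add: grid_def)

lemma grid_in: "j \<le> 2 ^ k \<Longrightarrow> a \<le> grid k j \<and> grid k j \<le> b"
  using grid_mono[of 0 j k] grid_mono[of j "2 ^ k" k] by simp

lemma grid_Suc: "grid k (Suc j) = grid k j + (b - a) / 2 ^ k"
proof -
  have "a + real (Suc j) * d = a + real j * d + d" for d :: real by (simp add: distrib_right)
  then show ?thesis unfolding grid_def .
qed

lemma mid_grid: "mid k j = grid k j + (b - a) / 2 ^ k / 2" "mid k j = grid k (Suc j) - (b - a) / 2 ^ k / 2"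
proof -
  define d where "d = (b - a) / 2 ^ k"
  show "mid k j = grid k j + (b - a) / 2 ^ k / 2" "mid k j = grid k (Suc j) - (b - a) / 2 ^ k / 2"
    unfolding grid_def mid_def d_def[symmetric] by (simp_all add: distrib_right)
qed

lemma mid_in:
  assumes "j < 2 ^ k"
  shows "mid k j \<in> {a<..<b}"
proof -
  define d where "d = (b - a) / 2 ^ k"
  have "0 < d" using spacing_pos by (simp add: d_def)
  moreover have "mid k j = grid k j + d / 2" "mid k j = grid k (Suc j) - d / 2"
    using mid_grid[of k j] unfolding d_def by auto
  ultimately show ?thesis using grid_in[of j k] grid_in[of "Suc j" k] assms by simp
qed

lemma grid_double: "grid (Suc k) (2 * j) = grid k j"
  by (simp add: grid_def field_simps)

lemma mid_double: "\<bar>mid (Suc k) (2 * j) - mid k j\<bar> \<le> (b - a) / 2 ^ k"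
  "\<bar>mid (Suc k) (Suc (2 * j)) - mid k j\<bar> \<le> (b - a) / 2 ^ k"
proof -
  have "mid (Suc k) (2 * j) - mid k j = - ((b - a) / 2 ^ k / 4)"
    "mid (Suc k) (Suc (2 * j)) - mid k j = (b - a) / 2 ^ k / 4"
    by (simp_all add: mid_def field_simps)
  then show "\<bar>mid (Suc k) (2 * j) - mid k j\<bar> \<le> (b - a) / 2 ^ k"
    "\<bar>mid (Suc k) (Suc (2 * j)) - mid k j\<bar> \<le> (b - a) / 2 ^ k"
    using spacing_pos[of k] by simp_all
qed

lemma sum_double: "(\<Sum>j<2 ^ Suc k. f j) = (\<Sum>j<2 ^ k. f (2 * j) + f (Suc (2 * j)))" for f :: "nat \<Rightarrow> real"
proof -
  have "(\<Sum>j<2 ^ Suc k. f j) = (\<Sum>m<2 ^ k. sum f {m * 2..<m * 2 + 2})"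
    using sum.nat_group[of f 2 "2 ^ k"] by (simp add: mult.commute)
  also have "\<dots> = (\<Sum>j<2 ^ k. f (2 * j) + f (Suc (2 * j)))"
    by (intro sum.cong refl) (simp add: numeral_2_eq_2 mult.commute)
  finally show ?thesis .
qed

lemma NV_nonneg: "0 \<le> NV k \<beta>" by (simp add: NV_def sum_nonneg)

text \<open>Additivity writes a coarse increment as the sum of its two halves, so only the shift of
  the evaluation point remains, and it is at most one coarse mesh.\<close>

lemma RS_step:
  assumes \<beta>: "additive_increments \<beta>" and h: "Lipschitz_on L h"
  shows "\<bar>RS (Suc k) \<beta> h - RS k \<beta> h\<bar> \<le> L * (b - a) * (NV (Suc k) \<beta> / 2 ^ k)"
proof -
  let ?c = "(b - a) / 2 ^ k"
  have L: "0 \<le> L" using h by (simp add: Lipschitz_on_def)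
  have split: "incr \<beta> k j = incr \<beta> (Suc k) (2 * j) + incr \<beta> (Suc k) (Suc (2 * j))" if "j < 2 ^ k" for j
  proof -
    have "grid k (Suc j) = grid (Suc k) (Suc (Suc (2 * j)))" using grid_double[of k "Suc j"] by simp
    moreover have "a \<le> grid k j" "grid (Suc k) (Suc (Suc (2 * j))) \<le> b"
      using grid_in[of j k] grid_in[of "Suc (Suc (2 * j))" "Suc k"] that by auto
    moreover have "grid k j \<le> grid (Suc k) (Suc (2 * j))"
      using grid_mono[of "2 * j" "Suc (2 * j)" "Suc k"] grid_double[of k j] by simp
    moreover have "grid (Suc k) (Suc (2 * j)) \<le> grid (Suc k) (Suc (Suc (2 * j)))" by (rule grid_mono) simp
    ultimately show ?thesis using \<beta> grid_double[of k j] unfolding additive_increments_def by metis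
  qed
  have mid2: "mid (Suc k) (2 * j) \<in> {a<..<b}" "mid (Suc k) (Suc (2 * j)) \<in> {a<..<b}" if "j < 2 ^ k" for j
    using that by (auto intro!: mid_in simp del: greaterThanLessThan_iff)
  have eq: "RS (Suc k) \<beta> h - RS k \<beta> h = (\<Sum>j<2 ^ k. (h (mid (Suc k) (2 * j)) - h (mid k j)) * incr \<beta> (Suc k) (2 * j)
      + (h (mid (Suc k) (Suc (2 * j))) - h (mid k j)) * incr \<beta> (Suc k) (Suc (2 * j)))"
    unfolding RS_def sum_double sum_subtractf[symmetric]
    by (intro sum.cong refl) (simp add: split algebra_simps)
  have "\<bar>RS (Suc k) \<beta> h - RS k \<beta> h\<bar> \<le> (\<Sum>j<2 ^ k. L * ?c * \<bar>incr \<beta> (Suc k) (2 * j)\<bar> + L * ?c * \<bar>incr \<beta> (Suc k) (Suc (2 * j))\<bar>)"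
    unfolding eq
  proof (rule order_trans[OF sum_abs sum_mono])
    fix j :: nat assume j: "j \<in> {..<2 ^ k}"
    have d: "\<bar>h x - h (mid k j)\<bar> \<le> L * ?c" if "x \<in> {a<..<b}" "\<bar>x - mid k j\<bar> \<le> ?c" for x
    proof -
      have "\<bar>h x - h (mid k j)\<bar> \<le> L * \<bar>x - mid k j\<bar>"
        using h mid_in[of j k] j that by (simp add: Lipschitz_on_def)
      also have "\<dots> \<le> L * ?c" using that L by (intro mult_left_mono)
      finally show ?thesis .
    qed
    show "\<bar>(h (mid (Suc k) (2 * j)) - h (mid k j)) * incr \<beta> (Suc k) (2 * j)
      + (h (mid (Suc k) (Suc (2 * j))) - h (mid k j)) * incr \<beta> (Suc k) (Suc (2 * j))\<bar>
      \<le> L * ?c * \<bar>incr \<beta> (Suc k) (2 * j)\<bar> + L * ?c * \<bar>incr \<beta> (Suc k) (Suc (2 * j))\<bar>"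
    proof (rule order_trans[OF abs_triangle_ineq add_mono])
      have j': "j < 2 ^ k" using j by simp
      show "\<bar>(h (mid (Suc k) (2 * j)) - h (mid k j)) * incr \<beta> (Suc k) (2 * j)\<bar> \<le> L * ?c * \<bar>incr \<beta> (Suc k) (2 * j)\<bar>"
        unfolding abs_mult by (intro mult_right_mono d mid2 j' mid_double abs_ge_zero)
      show "\<bar>(h (mid (Suc k) (Suc (2 * j))) - h (mid k j)) * incr \<beta> (Suc k) (Suc (2 * j))\<bar> \<le> L * ?c * \<bar>incr \<beta> (Suc k) (Suc (2 * j))\<bar>"
        unfolding abs_mult by (intro mult_right_mono d mid2 j' mid_double abs_ge_zero)
    qed
  qed
  also have "\<dots> = L * (b - a) * (NV (Suc k) \<beta> / 2 ^ k)"
  proof -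
    have "(\<Sum>j<2 ^ k. L * ?c * x j + L * ?c * y j) = L * (b - a) * ((\<Sum>j<2 ^ k. x j + y j) / 2 ^ k)" for x y :: "nat \<Rightarrow> real"
    proof -
      have "(\<Sum>j<2 ^ k. L * ?c * x j + L * ?c * y j) = L * ?c * (\<Sum>j<2 ^ k. x j + y j)"
        by (simp only: sum_distrib_left distrib_left)
      then show ?thesis by (simp only: times_divide_eq_left times_divide_eq_right)
    qed
    then show ?thesis by (simp only: NV_def sum_double)
  qed
  finally show ?thesis .
qed

lemma RS_partial_tail:
  assumes "additive_increments \<beta>" "Lipschitz_on L h"
  shows "ennreal \<bar>RS (n + m) \<beta> h - RS n \<beta> h\<bar> \<le> ennreal (L * (b - a)) * TV n \<beta>"
proof -
  have L0: "0 \<le> L * (b - a)" using assms ab by (simp add: Lipschitz_on_def)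
  have "\<bar>RS (n + m) \<beta> h - RS n \<beta> h\<bar> \<le> (\<Sum>k<m. L * (b - a) * (NV (Suc (n + k)) \<beta> / 2 ^ (n + k)))"
  proof (induction m)
    case (Suc m)
    then show ?case using RS_step[OF assms, of "n + m"] by simp
  qed simp
  then have "ennreal \<bar>RS (n + m) \<beta> h - RS n \<beta> h\<bar> \<le> ennreal (L * (b - a) * (\<Sum>k<m. NV (Suc (n + k)) \<beta> / 2 ^ (n + k)))"
    by (intro ennreal_leI) (simp add: sum_distrib_left)
  also have "\<dots> = ennreal (L * (b - a)) * (\<Sum>k<m. ennreal (NV (Suc (n + k)) \<beta> / 2 ^ (n + k)))"
    using L0 NV_nonneg by (simp add: ennreal_mult sum_nonneg sum_ennreal)
  also have "\<dots> \<le> ennreal (L * (b - a)) * TV n \<beta>"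
    unfolding TV_def by (intro mult_left_mono sum_le_suminf) auto
  finally show ?thesis .
qed

lemma RS_tail:
  assumes "additive_increments \<beta>" "Lipschitz_on L h" "(\<lambda>k. RS k \<beta> h) \<longlonglongrightarrow> r"
  shows "ennreal \<bar>r - RS n \<beta> h\<bar> \<le> ennreal (L * (b - a)) * TV n \<beta>"
proof (rule LIMSEQ_le_const2)
  show "(\<lambda>m. ennreal \<bar>RS (n + m) \<beta> h - RS n \<beta> h\<bar>) \<longlonglongrightarrow> ennreal \<bar>r - RS n \<beta> h\<bar>"
    using LIMSEQ_ignore_initial_segment[OF assms(3), of n]
    by (intro tendsto_ennrealI tendsto_intros) (simp add: add.commute)
  show "\<exists>N. \<forall>m\<ge>N. ennreal \<bar>RS (n + m) \<beta> h - RS n \<beta> h\<bar> \<le> ennreal (L * (b - a)) * TV n \<beta>"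
    using RS_partial_tail[OF assms(1,2)] by blast
qed

lemma TV_mono: "TV (Suc n) \<beta> \<le> TV n \<beta>"
proof -
  let ?f = "\<lambda>k. ennreal (NV (Suc (n + k)) \<beta> / 2 ^ (n + k))"
  have "(\<Sum>k. ?f (Suc k)) \<le> (\<Sum>k. ?f k)"
  proof (rule suminf_le_const[OF summableI])
    fix m
    have "(\<Sum>k<m. ?f (Suc k)) = sum ?f (Suc ` {..<m})" by (subst sum.reindex) auto
    also have "\<dots> \<le> (\<Sum>k. ?f k)" by (intro sum_le_suminf) auto
    finally show "(\<Sum>k<m. ?f (Suc k)) \<le> (\<Sum>k. ?f k)" .
  qed
  then show ?thesis by (simp add: TV_def)
qed

lemma TV_antimono: "n \<le> m \<Longrightarrow> TV m \<beta> \<le> TV n \<beta>"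
  by (rule lift_Suc_antimono_le[of "\<lambda>n. TV n \<beta>", OF TV_mono])

text \<open>A single term of the series. It controls the Riemann sum at a fixed level in terms of
  the sup norm of the integrand.\<close>

lemma NV_le_TV: "ennreal (NV (Suc n) \<beta>) \<le> 2 ^ n * TV 0 \<beta>"
proof -
  have "ennreal (NV (Suc n) \<beta> / 2 ^ n) \<le> TV 0 \<beta>"
    using sum_le_suminf[of "\<lambda>k. ennreal (NV (Suc (0 + k)) \<beta> / 2 ^ (0 + k))" "{n}"] by (simp add: TV_def)
  then have "2 ^ n * ennreal (NV (Suc n) \<beta> / 2 ^ n) \<le> 2 ^ n * TV 0 \<beta>" by (rule mult_left_mono) simp
  moreover have "2 ^ n * ennreal (NV (Suc n) \<beta> / 2 ^ n) = ennreal (NV (Suc n) \<beta>)"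
  proof -
    have "ennreal (2 ^ n * (NV (Suc n) \<beta> / 2 ^ n)) = ennreal (2 ^ n) * ennreal (NV (Suc n) \<beta> / 2 ^ n)"
      by (rule ennreal_mult) (auto simp: NV_nonneg)
    then show ?thesis by (simp add: ennreal_power[symmetric])
  qed
  ultimately show ?thesis by simp
qed

lemma RS_tendsto_RF:
  assumes \<beta>: "additive_increments \<beta>" and h: "Lipschitz_on L h" and fin: "TV 0 \<beta> < \<top>"
  shows "(\<lambda>k. RS k \<beta> h) \<longlonglongrightarrow> RF \<beta> h"
proof -
  have "summable (\<lambda>k. NV (Suc k) \<beta> / 2 ^ k)"
    using fin by (intro summable_suminf_not_top) (auto simp: TV_def NV_nonneg less_top)
  then have "summable (\<lambda>k. L * (b - a) * (NV (Suc k) \<beta> / 2 ^ k))" by (rule summable_mult)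
  then have "summable (\<lambda>k. RS (Suc k) \<beta> h - RS k \<beta> h)"
    by (rule summable_comparison_test') (use RS_step[OF \<beta> h] in auto)
  then have "convergent (\<lambda>n. \<Sum>k<n. RS (Suc k) \<beta> h - RS k \<beta> h)" by (rule summable_iff_convergent[THEN iffD1])
  then have "convergent (\<lambda>n. RS n \<beta> h - RS 0 \<beta> h)" 
    by (simp only: sum_lessThan_telescope[of "\<lambda>k. RS k \<beta> h"])
  then have "convergent (\<lambda>n. RS n \<beta> h)" using convergent_diff_const_right_iff[of "\<lambda>n. RS n \<beta> h"] by simp
  then show ?thesis using fin by (simp add: RF_def convergent_LIMSEQ_iff)
qed

lemma RF_tail:
  assumes \<beta>: "additive_increments \<beta>" and h: "Lipschitz_on L h" and fin: "TV 0 \<beta> < \<top>"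
  shows "ennreal \<bar>RF \<beta> h - RS n \<beta> h\<bar> \<le> ennreal (L * (b - a)) * TV n \<beta>"
  by (rule RS_tail[OF \<beta> h RS_tendsto_RF[OF assms]])

lemma TV_tendsto_0:
  assumes fin: "TV 0 \<beta> < \<top>"
  shows "(\<lambda>n. enn2real (TV n \<beta>)) \<longlonglongrightarrow> 0"
proof -
  let ?f = "\<lambda>k. NV (Suc k) \<beta> / 2 ^ k"
  have s: "summable ?f"
    using fin by (intro summable_suminf_not_top) (auto simp: TV_def NV_nonneg less_top)
  have "TV n \<beta> = ennreal (\<Sum>k. ?f (k + n))" for n
    unfolding TV_def using s summable_ignore_initial_segment[of ?f n]
    by (subst suminf_ennreal2) (auto simp: NV_nonneg add.commute)
  moreover have "0 \<le> (\<Sum>k. ?f (k + n))" for n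
    using s by (intro suminf_nonneg summable_ignore_initial_segment[of ?f n]) (auto simp: NV_nonneg)
  ultimately have "enn2real (TV n \<beta>) = (\<Sum>k. ?f (k + n))" for n
    by (simp only: enn2real_ennreal)
  then have "enn2real (TV n \<beta>) = suminf ?f - sum ?f {..<n}" for n
    using suminf_minus_initial_segment[OF s, of n] by (simp only:)
  moreover have "(\<lambda>n. suminf ?f - sum ?f {..<n}) \<longlonglongrightarrow> suminf ?f - suminf ?f"
    by (intro tendsto_intros summable_LIMSEQ s)
  ultimately show ?thesis by simp
qed

lemma RS_diff_le:
  assumes "\<And>y. y \<in> {a<..<b} \<Longrightarrow> \<bar>h y - h' y\<bar> \<le> C"
  shows "\<bar>RS k \<beta> h - RS k \<beta> h'\<bar> \<le> C * NV k \<beta>"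
proof -
  have "RS k \<beta> h - RS k \<beta> h' = (\<Sum>j<2 ^ k. (h (mid k j) - h' (mid k j)) * incr \<beta> k j)"
    by (simp add: RS_def sum_subtractf left_diff_distrib)
  also have "\<bar>\<dots>\<bar> \<le> (\<Sum>j<2 ^ k. C * \<bar>incr \<beta> k j\<bar>)"
    using assms mid_in by (intro order_trans[OF sum_abs sum_mono]) (auto simp: abs_mult intro!: mult_right_mono)
  finally show ?thesis by (simp add: NV_def sum_distrib_left)
qed

text \<open>If the dyadic variation is finite, a level \<open>n\<close> approximates
  \<open>RF\<close> uniformly in \<open>x\<close>, and the Riemann sums of that level are Lipschitz
  in \<open>x\<close>; otherwise \<open>RF\<close> is constantly 0. So the property holds for every
  path, which \<open>measurable_C_metric\<close> requires.\<close>

lemma RF_uniformly_continuous: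
  assumes \<beta>: "additive_increments \<beta>"
    and K: "\<And>x. x \<in> {a<..<b} \<Longrightarrow> Lipschitz_on L (\<kappa> x)"
    and K': "\<And>x x' y. x \<in> {a<..<b} \<Longrightarrow> x' \<in> {a<..<b} \<Longrightarrow> y \<in> {a<..<b} \<Longrightarrow> \<bar>\<kappa> x y - \<kappa> x' y\<bar> \<le> L * \<bar>x - x'\<bar>"
  shows "uniformly_continuous_on {a<..<b} (\<lambda>x. RF \<beta> (\<kappa> x))"
proof (cases "TV 0 \<beta> < \<top>")
  case False
  then show ?thesis by (simp add: RF_def uniformly_continuous_on_const)
next
  case True
  have L0: "0 \<le> L" using K[of "(a + b) / 2"] ab by (simp add: Lipschitz_on_def)
  show ?thesis unfolding uniformly_continuous_on_def
  proof (intro allI impI)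
    fix e :: real assume e: "0 < e"
    have "(\<lambda>n. L * (b - a) * enn2real (TV n \<beta>)) \<longlonglongrightarrow> L * (b - a) * 0"
      by (intro tendsto_intros TV_tendsto_0 True)
    then have "\<forall>\<^sub>F n in sequentially. L * (b - a) * enn2real (TV n \<beta>) < e / 3"
      by (rule order_tendstoD) (use e in simp)
    then obtain n where n: "L * (b - a) * enn2real (TV n \<beta>) < e / 3" by (auto simp: eventually_sequentially)
    have tail: "\<bar>RF \<beta> (\<kappa> x) - RS n \<beta> (\<kappa> x)\<bar> < e / 3" if "x \<in> {a<..<b}" for x
    proof -
      have "TV n \<beta> < \<top>" using TV_antimono[of 0 n \<beta>] True by (auto elim: le_less_trans)
      then have "ennreal (L * (b - a)) * TV n \<beta> = ennreal (L * (b - a) * enn2real (TV n \<beta>))"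
        using L0 ab by (simp add: ennreal_mult)
      then have "\<bar>RF \<beta> (\<kappa> x) - RS n \<beta> (\<kappa> x)\<bar> \<le> L * (b - a) * enn2real (TV n \<beta>)"
        using RF_tail[OF \<beta> K[OF that] True, of n] L0 ab by (simp add: ennreal_le_iff)
      then show ?thesis using n by simp
    qed
    define \<delta> where "\<delta> = e / (3 * (L * NV n \<beta> + 1))"
    have d: "0 < \<delta>" using e L0 NV_nonneg[of n \<beta>] by (auto simp: \<delta>_def intro!: divide_pos_pos add_nonneg_pos)
    have d2: "L * NV n \<beta> * \<delta> \<le> e / 3"
    proof -
      have "L * NV n \<beta> * \<delta> = (L * NV n \<beta>) / (L * NV n \<beta> + 1) * (e / 3)" by (simp add: \<delta>_def algebra_simps)
      also have "\<dots> \<le> 1 * (e / 3)"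
        using e L0 NV_nonneg[of n \<beta>] by (intro mult_right_mono) (auto simp: divide_le_eq add_nonneg_pos)
      finally show ?thesis by simp
    qed
    show "\<exists>d>0. \<forall>x\<in>{a<..<b}. \<forall>x'\<in>{a<..<b}. dist x' x < d \<longrightarrow> dist (RF \<beta> (\<kappa> x')) (RF \<beta> (\<kappa> x)) < e"
    proof (intro exI[of _ \<delta>] conjI ballI impI d)
      fix x x' assume x: "x \<in> {a<..<b}" "x' \<in> {a<..<b}" and dx: "dist x' x < \<delta>"
      have "\<bar>RS n \<beta> (\<kappa> x') - RS n \<beta> (\<kappa> x)\<bar> \<le> L * \<bar>x' - x\<bar> * NV n \<beta>"
        using K'[OF x(2) x(1)] by (rule RS_diff_le)
      also have "\<dots> \<le> L * \<delta> * NV n \<beta>"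
        using dx L0 NV_nonneg[of n \<beta>] by (intro mult_right_mono mult_left_mono) (auto simp: dist_real_def)
      also have "\<dots> \<le> e / 3" using d2 by (simp add: mult_ac)
      finally show "dist (RF \<beta> (\<kappa> x')) (RF \<beta> (\<kappa> x)) < e"
        using tail[OF x(1)] tail[OF x(2)] unfolding dist_real_def by linarith
    qed
  qed
qed

lemma NV_measurable:
  assumes "\<And>s t. (\<lambda>\<omega>. \<beta> \<omega> s t) \<in> borel_measurable M"
  shows "(\<lambda>\<omega>. NV k (\<beta> \<omega>)) \<in> borel_measurable M"
  unfolding NV_def using assms by measurable

lemma TV_measurable:
  assumes "\<And>s t. (\<lambda>\<omega>. \<beta> \<omega> s t) \<in> borel_measurable M"
  shows "(\<lambda>\<omega>. TV n (\<beta> \<omega>)) \<in> borel_measurable M"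
proof -
  note [measurable] = NV_measurable[of \<beta>, OF assms]
  show ?thesis unfolding TV_def by measurable
qed

lemma RS_measurable:
  assumes "\<And>s t. (\<lambda>\<omega>. \<beta> \<omega> s t) \<in> borel_measurable M"
  shows "(\<lambda>\<omega>. RS k (\<beta> \<omega>) h) \<in> borel_measurable M"
  unfolding RS_def using assms by measurable

lemma RF_measurable:
  assumes "\<And>s t. (\<lambda>\<omega>. \<beta> \<omega> s t) \<in> borel_measurable M"
  shows "(\<lambda>\<omega>. RF (\<beta> \<omega>) h) \<in> borel_measurable M"
proof -
  note [measurable] = TV_measurable[OF assms, of 0] borel_measurable_lim_metric[OF RS_measurable[OF assms]]
  have "{\<omega> \<in> space M. TV 0 (\<beta> \<omega>) < \<top>} \<in> sets M" by measurable
  then show ?thesis unfolding RF_def by (intro measurable_If) measurable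
qed

text \<open>At level \<open>k\<close> there are \<open>2^k\<close> increments of mean size of order
  \<open>2^(-k/2)\<close>, weighted by about \<open>2^(-k)\<close>; hence the ratio
  \<open>2^(-1/2)\<close>.\<close>

definition geom :: real where "geom = (\<Sum>k. sqrt (1 / 2) ^ k)"

lemma geom_summable: "summable (\<lambda>k. sqrt (1 / 2) ^ k)"
  by (rule summable_geometric) (simp add: real_sqrt_lt_1_iff)

lemma geom_nonneg: "0 \<le> geom" unfolding geom_def by (intro suminf_nonneg geom_summable) simp

lemma nn_integral_NV:
  assumes m: "\<And>s t. (\<lambda>\<omega>. \<beta> \<omega> s t) \<in> borel_measurable M"
    and c: "\<And>s t. a \<le> s \<Longrightarrow> s \<le> t \<Longrightarrow> t \<le> b \<Longrightarrow> (\<integral>\<^sup>+\<omega>. ennreal \<bar>\<beta> \<omega> s t\<bar> \<partial>M) \<le> ennreal (c * sqrt (t - s))"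
    and c0: "0 \<le> c"
  shows "(\<integral>\<^sup>+\<omega>. ennreal (NV k (\<beta> \<omega>)) \<partial>M) \<le> ennreal (2 ^ k * (c * sqrt ((b - a) / 2 ^ k)))"
proof -
  have "(\<integral>\<^sup>+\<omega>. ennreal (NV k (\<beta> \<omega>)) \<partial>M) = (\<Sum>j<2 ^ k. \<integral>\<^sup>+\<omega>. ennreal \<bar>incr (\<beta> \<omega>) k j\<bar> \<partial>M)"
    unfolding NV_def using m by (subst nn_integral_sum[symmetric]) (auto simp: sum_ennreal)
  also have "\<dots> \<le> (\<Sum>j<(2 :: nat) ^ k. ennreal (c * sqrt ((b - a) / 2 ^ k)))"
  proof (rule sum_mono)
    fix j :: nat assume "j \<in> {..<2 ^ k}"
    then show "(\<integral>\<^sup>+\<omega>. ennreal \<bar>incr (\<beta> \<omega>) k j\<bar> \<partial>M) \<le> ennreal (c * sqrt ((b - a) / 2 ^ k))"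
      using c[of "grid k j" "grid k (Suc j)"] grid_in[of j k] grid_in[of "Suc j" k] grid_mono[of j "Suc j" k]
      by (simp add: grid_Suc)
  qed
  also have "\<dots> = ennreal (\<Sum>j<(2::nat) ^ k. c * sqrt ((b - a) / 2 ^ k))"
    using c0 ab by (intro sum_ennreal) auto
  also have "\<dots> = ennreal (2 ^ k * (c * sqrt ((b - a) / 2 ^ k)))" by simp
  finally show ?thesis .
qed

text \<open>The factor 2 is the quotient of the \<open>2^(n+k+1)\<close> cells of the finer grid by
  the weight \<open>2^(n+k)\<close>. One further factor \<open>sqrt (1 / 2)\<close> is estimated by
  1.\<close>

lemma nn_integral_TV:
  assumes m: "\<And>s t. (\<lambda>\<omega>. \<beta> \<omega> s t) \<in> borel_measurable M"
    and c: "\<And>s t. a \<le> s \<Longrightarrow> s \<le> t \<Longrightarrow> t \<le> b \<Longrightarrow> (\<integral>\<^sup>+\<omega>. ennreal \<bar>\<beta> \<omega> s t\<bar> \<partial>M) \<le> ennreal (c * sqrt (t - s))"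
    and c0: "0 \<le> c"
  shows "(\<integral>\<^sup>+\<omega>. TV n (\<beta> \<omega>) \<partial>M) \<le> ennreal (2 * c * sqrt (b - a) * geom * sqrt (1 / 2) ^ n)"
proof -
  let ?r = "sqrt (1 / 2)"
  have r: "sqrt (1 / 2 ^ k) = ?r ^ k" for k by (simp add: real_sqrt_power[symmetric] power_divide)
  have r1: "?r \<le> 1" by simp
  have nvm[measurable]: "(\<lambda>\<omega>. NV k (\<beta> \<omega>)) \<in> borel_measurable M" for k by (rule NV_measurable[OF m])
  have "(\<integral>\<^sup>+\<omega>. TV n (\<beta> \<omega>) \<partial>M) = (\<Sum>k. \<integral>\<^sup>+\<omega>. ennreal (NV (Suc (n + k)) (\<beta> \<omega>) / 2 ^ (n + k)) \<partial>M)"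
    unfolding TV_def using nvm by (intro nn_integral_suminf) measurable
  also have "\<dots> \<le> (\<Sum>k. ennreal (2 * c * sqrt (b - a) * ?r ^ n * ?r ^ k))"
  proof (rule suminf_le)
    fix k
    have "(\<integral>\<^sup>+\<omega>. ennreal (NV (Suc (n + k)) (\<beta> \<omega>) / 2 ^ (n + k)) \<partial>M)
        = (\<integral>\<^sup>+\<omega>. ennreal (1 / 2 ^ (n + k)) * ennreal (NV (Suc (n + k)) (\<beta> \<omega>)) \<partial>M)"
      by (intro nn_integral_cong) (simp add: ennreal_mult'[symmetric] NV_nonneg)
    also have "\<dots> = ennreal (1 / 2 ^ (n + k)) * (\<integral>\<^sup>+\<omega>. ennreal (NV (Suc (n + k)) (\<beta> \<omega>)) \<partial>M)"
      by (intro nn_integral_cmult) measurable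
    also have "\<dots> \<le> ennreal (1 / 2 ^ (n + k)) * ennreal (2 ^ Suc (n + k) * (c * sqrt ((b - a) / 2 ^ Suc (n + k))))"
      by (intro mult_left_mono nn_integral_NV[OF m c c0]) auto
    also have "\<dots> = ennreal (1 / 2 ^ (n + k) * (2 ^ Suc (n + k) * (c * sqrt ((b - a) / 2 ^ Suc (n + k)))))"
      using c0 ab by (intro ennreal_mult[symmetric]) auto
    also have "\<dots> \<le> ennreal (2 * c * sqrt (b - a) * ?r ^ n * ?r ^ k)"
    proof (rule ennreal_leI)
      have "sqrt ((b - a) / 2 ^ Suc (n + k)) = sqrt (b - a) * (?r ^ n * ?r ^ k * ?r)"
        using r[of "Suc (n + k)"] real_sqrt_mult[of "b - a" "1 / 2 ^ Suc (n + k)"] by (simp add: power_add mult_ac)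
      also have "\<dots> \<le> sqrt (b - a) * (?r ^ n * ?r ^ k * 1)"
        using ab r1 by (intro mult_left_mono) auto
      finally have "2 * c * sqrt ((b - a) / 2 ^ Suc (n + k)) \<le> 2 * c * (sqrt (b - a) * (?r ^ n * ?r ^ k * 1))"
        using c0 by (intro mult_left_mono) auto
      then show "1 / 2 ^ (n + k) * (2 ^ Suc (n + k) * (c * sqrt ((b - a) / 2 ^ Suc (n + k)))) \<le> 2 * c * sqrt (b - a) * ?r ^ n * ?r ^ k"
        by (simp add: mult_ac)
    qed
    finally show "(\<integral>\<^sup>+\<omega>. ennreal (NV (Suc (n + k)) (\<beta> \<omega>) / 2 ^ (n + k)) \<partial>M) \<le> ennreal (2 * c * sqrt (b - a) * ?r ^ n * ?r ^ k)" .
  qed auto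
  also have "\<dots> = ennreal (\<Sum>k. 2 * c * sqrt (b - a) * ?r ^ n * ?r ^ k)"
    using c0 ab by (intro suminf_ennreal2 summable_mult geom_summable) auto
  also have "(\<Sum>k. 2 * c * sqrt (b - a) * ?r ^ n * ?r ^ k) = 2 * c * sqrt (b - a) * ?r ^ n * geom"
    unfolding geom_def by (rule suminf_mult[OF geom_summable])
  finally show ?thesis by (simp add: mult_ac)
qed

end

section \<open>Random fields given by Lipschitz kernels and rough increments\<close>

context dyadic
begin

abbreviation D :: "real set" where "D \<equiv> {a<..<b}"
abbreviation C_borel :: "(real \<Rightarrow> real) measure" where "C_borel \<equiv> borel_sigma (mtopology_of (C_metric D))"

definition Lipschitz_kernel :: "real \<Rightarrow> real \<Rightarrow> (real \<Rightarrow> real \<Rightarrow> real) \<Rightarrow> bool" where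
  "Lipschitz_kernel L C \<kappa> \<longleftrightarrow> 0 \<le> L \<and> 0 \<le> C \<and> (\<forall>x\<in>D. Lipschitz_on L (\<kappa> x)) \<and>
    (\<forall>x\<in>D. \<forall>x'\<in>D. \<forall>y\<in>D. \<bar>\<kappa> x y - \<kappa> x' y\<bar> \<le> L * \<bar>x - x'\<bar>) \<and> (\<forall>x\<in>D. \<forall>y\<in>D. \<bar>\<kappa> x y\<bar> \<le> C)"

lemma RS_uniformly_continuous:
  assumes "Lipschitz_kernel L C \<kappa>"
  shows "uniformly_continuous_on D (\<lambda>x. RS k \<beta> (\<kappa> x))"
proof -
  have "(L * NV k \<beta>)-lipschitz_on D (\<lambda>x. RS k \<beta> (\<kappa> x))"
  proof (rule lipschitz_onI)
    fix x x' assume "x \<in> D" "x' \<in> D"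
    then have "\<bar>RS k \<beta> (\<kappa> x) - RS k \<beta> (\<kappa> x')\<bar> \<le> L * \<bar>x - x'\<bar> * NV k \<beta>"
      using assms by (intro RS_diff_le) (auto simp: Lipschitz_kernel_def)
    then show "dist (RS k \<beta> (\<kappa> x)) (RS k \<beta> (\<kappa> x')) \<le> L * NV k \<beta> * dist x x'"
      by (simp add: dist_real_def mult_ac)
  qed (use assms NV_nonneg in \<open>auto simp: Lipschitz_kernel_def\<close>)
  then show ?thesis by (rule lipschitz_on_uniformly_continuous)
qed

lemma RF_kernel_uniformly_continuous:
  assumes "Lipschitz_kernel L C \<kappa>" "additive_increments \<beta>"
  shows "uniformly_continuous_on D (\<lambda>x. RF \<beta> (\<kappa> x))"
  using assms by (intro RF_uniformly_continuous[of _ L]) (auto simp: Lipschitz_kernel_def)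

lemma RS_field_measurable:
  assumes "Lipschitz_kernel L C \<kappa>" and m: "\<And>s t. (\<lambda>\<omega>. \<beta> \<omega> s t) \<in> borel_measurable M"
  shows "(\<lambda>\<omega>. \<lambda>x\<in>D. RS k (\<beta> \<omega>) (\<kappa> x)) \<in> measurable M C_borel"
  by (rule measurable_C_metric[OF ab refl]) (auto intro!: RS_measurable m RS_uniformly_continuous[OF assms(1)])

lemma RF_field_measurable:
  assumes "Lipschitz_kernel L C \<kappa>" and m: "\<And>s t. (\<lambda>\<omega>. \<beta> \<omega> s t) \<in> borel_measurable M"
    and "\<And>\<omega>. additive_increments (\<beta> \<omega>)"
  shows "(\<lambda>\<omega>. \<lambda>x\<in>D. RF (\<beta> \<omega>) (\<kappa> x)) \<in> measurable M C_borel"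
  by (rule measurable_C_metric[OF ab refl]) (auto intro!: RF_measurable m RF_kernel_uniformly_continuous assms)

lemma RF_field_mdist:
  assumes K: "Lipschitz_kernel L C \<kappa>" and \<beta>: "additive_increments \<beta>" and fin: "TV 0 \<beta> < \<top>"
  shows "ennreal (mdist (C_metric D) (\<lambda>x\<in>D. RF \<beta> (\<kappa> x)) (\<lambda>x\<in>D. RS n \<beta> (\<kappa> x))) \<le> ennreal (L * (b - a)) * TV n \<beta>"
proof -
  have "TV n \<beta> < \<top>" using TV_antimono[of 0 n \<beta>] fin by (auto elim: le_less_trans)
  moreover have L0: "0 \<le> L * (b - a)" using K ab by (simp add: Lipschitz_kernel_def)
  ultimately have eq: "ennreal (L * (b - a)) * TV n \<beta> = ennreal (L * (b - a) * enn2real (TV n \<beta>))"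
    by (simp add: ennreal_mult)
  have "mdist (C_metric D) (\<lambda>x\<in>D. RF \<beta> (\<kappa> x)) (\<lambda>x\<in>D. RS n \<beta> (\<kappa> x)) \<le> L * (b - a) * enn2real (TV n \<beta>)"
  proof (rule mdist_C_metric_le)
    fix x assume x: "x \<in> D"
    have "Lipschitz_on L (\<kappa> x)" using K x by (simp add: Lipschitz_kernel_def)
    from RF_tail[OF \<beta> this fin, of n]
    show "\<bar>(\<lambda>x\<in>D. RF \<beta> (\<kappa> x)) x - (\<lambda>x\<in>D. RS n \<beta> (\<kappa> x)) x\<bar> \<le> L * (b - a) * enn2real (TV n \<beta>)"
      unfolding eq using x L0 by (simp add: ennreal_le_iff)
  qed (use L0 in simp)
  then show ?thesis unfolding eq by (rule ennreal_leI)
qed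

text \<open>The quantitative property that oscillating integrals and Brownian increments share; it
  is enough to make the mean of \<open>TV\<close> finite. Additivity is required for every path, so
  that \<open>RF\<close> is well behaved before any null set is discarded.\<close>

definition moment_increments :: "'w measure \<Rightarrow> real \<Rightarrow> ('w \<Rightarrow> real \<Rightarrow> real \<Rightarrow> real) \<Rightarrow> bool" where
  "moment_increments M c \<beta> \<longleftrightarrow> 0 \<le> c \<and> (\<forall>s t. (\<lambda>\<omega>. \<beta> \<omega> s t) \<in> borel_measurable M) \<and> (\<forall>\<omega>. additive_increments (\<beta> \<omega>)) \<and>
    (\<forall>s t. a \<le> s \<longrightarrow> s \<le> t \<longrightarrow> t \<le> b \<longrightarrow> (\<integral>\<^sup>+\<omega>. ennreal \<bar>\<beta> \<omega> s t\<bar> \<partial>M) \<le> ennreal (c * sqrt (t - s)))"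

lemma moment_TV:
  assumes "moment_increments M c \<beta>"
  shows "(\<integral>\<^sup>+\<omega>. TV n (\<beta> \<omega>) \<partial>M) \<le> ennreal (2 * c * sqrt (b - a) * geom * sqrt (1 / 2) ^ n)"
  using assms by (intro nn_integral_TV) (auto simp: moment_increments_def)

lemma moment_TV_measurable:
  assumes "moment_increments M c \<beta>"
  shows "(\<lambda>\<omega>. TV n (\<beta> \<omega>)) \<in> borel_measurable M"
  using assms by (intro TV_measurable) (auto simp: moment_increments_def)

lemma moment_AE_finite:
  assumes "moment_increments M c \<beta>"
  shows "AE \<omega> in M. TV 0 (\<beta> \<omega>) < \<top>"
proof -
  have "(\<integral>\<^sup>+\<omega>. TV 0 (\<beta> \<omega>) \<partial>M) \<noteq> \<infinity>"
    using moment_TV[OF assms, of 0] by (auto simp: top_unique)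
  then have "AE \<omega> in M. TV 0 (\<beta> \<omega>) \<noteq> \<infinity>"
    by (intro nn_integral_PInf_AE moment_TV_measurable[OF assms])
  then show ?thesis by eventually_elim (simp add: less_top)
qed

lemma bounded_Lipschitz_RF_RS:
  assumes M: "prob_space M" and K: "Lipschitz_kernel L C \<kappa>" and \<beta>: "moment_increments M c \<beta>"
    and f: "bounded_Lipschitz (C_metric D) B Lf f"
  shows "\<bar>(LINT \<omega>|M. f (\<lambda>x\<in>D. RF (\<beta> \<omega>) (\<kappa> x))) - (LINT \<omega>|M. f (\<lambda>x\<in>D. RS n (\<beta> \<omega>) (\<kappa> x)))\<bar>
    \<le> Lf * (L * (b - a) * (2 * c * sqrt (b - a) * geom * sqrt (1 / 2) ^ n))"
proof (rule prob_space.bounded_Lipschitz_expectation_diff[OF M _ _ f])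
  have L0: "0 \<le> L * (b - a)" using K ab by (simp add: Lipschitz_kernel_def)
  have c: "0 \<le> c" using \<beta> by (simp add: moment_increments_def)
  note m[measurable] = moment_TV_measurable[OF \<beta>]
  show "(\<lambda>\<omega>. \<lambda>x\<in>D. RF (\<beta> \<omega>) (\<kappa> x)) \<in> measurable M C_borel"
    using \<beta> by (intro RF_field_measurable[OF K]) (auto simp: moment_increments_def)
  show "(\<lambda>\<omega>. \<lambda>x\<in>D. RS n (\<beta> \<omega>) (\<kappa> x)) \<in> measurable M C_borel"
    using \<beta> by (intro RS_field_measurable[OF K]) (auto simp: moment_increments_def)
  show "(\<lambda>\<omega>. ennreal (L * (b - a)) * TV n (\<beta> \<omega>)) \<in> borel_measurable M" by measurable
  show "AE \<omega> in M. ennreal (mdist (C_metric D) (\<lambda>x\<in>D. RF (\<beta> \<omega>) (\<kappa> x)) (\<lambda>x\<in>D. RS n (\<beta> \<omega>) (\<kappa> x)))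
      \<le> ennreal (L * (b - a)) * TV n (\<beta> \<omega>)"
    using moment_AE_finite[OF \<beta>]
    by eventually_elim (use \<beta> in \<open>auto simp: moment_increments_def intro!: RF_field_mdist[OF K]\<close>)
  have "(\<integral>\<^sup>+\<omega>. ennreal (L * (b - a)) * TV n (\<beta> \<omega>) \<partial>M) = ennreal (L * (b - a)) * (\<integral>\<^sup>+\<omega>. TV n (\<beta> \<omega>) \<partial>M)"
    by (rule nn_integral_cmult) measurable
  also have "\<dots> \<le> ennreal (L * (b - a)) * ennreal (2 * c * sqrt (b - a) * geom * sqrt (1 / 2) ^ n)"
    by (intro mult_left_mono moment_TV[OF \<beta>]) simp
  also have "\<dots> = ennreal (L * (b - a) * (2 * c * sqrt (b - a) * geom * sqrt (1 / 2) ^ n))"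
    using L0 c ab geom_nonneg by (intro ennreal_mult[symmetric]) auto
  finally show "(\<integral>\<^sup>+\<omega>. ennreal (L * (b - a)) * TV n (\<beta> \<omega>) \<partial>M) \<le> ennreal (L * (b - a) * (2 * c * sqrt (b - a) * geom * sqrt (1 / 2) ^ n))" .
  show "0 \<le> L * (b - a) * (2 * c * sqrt (b - a) * geom * sqrt (1 / 2) ^ n)"
    using c ab geom_nonneg by (intro mult_nonneg_nonneg[OF L0]) auto
qed

text \<open>
  Level-\<open>n\<close> Riemann sums are continuous functions of finitely many increments, and they approximate
  the fields uniformly in \<open>\<epsilon>\<close>; no separate tightness argument is needed.
\<close>

theorem field_convergence:
  fixes \<beta> :: "real \<Rightarrow> 'w \<Rightarrow> real \<Rightarrow> real \<Rightarrow> real" and \<gamma> :: "'v \<Rightarrow> real \<Rightarrow> real \<Rightarrow> real"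
  assumes M: "prob_space M" and N: "prob_space N" and K: "Lipschitz_kernel L C \<kappa>"
    and \<beta>: "\<And>\<epsilon>. 0 < \<epsilon> \<Longrightarrow> moment_increments M c (\<beta> \<epsilon>)" and \<gamma>: "moment_increments N c' \<gamma>"
    and fd: "\<And>k (F :: (nat \<Rightarrow> real) \<Rightarrow> real) B Lf. (\<And>x. \<bar>F x\<bar> \<le> B) \<Longrightarrow> (\<And>x y. \<bar>F x - F y\<bar> \<le> Lf * (\<Sum>j<2 ^ k. \<bar>x j - y j\<bar>)) \<Longrightarrow> 0 \<le> Lf \<Longrightarrow>
      ((\<lambda>\<epsilon>. LINT \<omega>|M. F (\<lambda>j. \<beta> \<epsilon> \<omega> (grid k j) (grid k (Suc j)))) \<longlongrightarrow> (LINT \<omega>|N. F (\<lambda>j. \<gamma> \<omega> (grid k j) (grid k (Suc j))))) (at_right 0)"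
    and f: "bounded_Lipschitz (C_metric D) B Lf f"
  shows "((\<lambda>\<epsilon>. LINT \<omega>|M. f (\<lambda>x\<in>D. RF (\<beta> \<epsilon> \<omega>) (\<kappa> x))) \<longlongrightarrow> (LINT \<omega>|N. f (\<lambda>x\<in>D. RF (\<gamma> \<omega>) (\<kappa> x)))) (at_right 0)"
proof (rule tendstoI)
  fix e :: real assume e: "0 < e"
  have C: "0 \<le> C" "0 \<le> L" and KC: "\<And>x y. x \<in> D \<Longrightarrow> y \<in> D \<Longrightarrow> \<bar>\<kappa> x y\<bar> \<le> C"
    using K by (auto simp: Lipschitz_kernel_def)
  \<comment> \<open>This error depends on the increments only through the moment constant, so one
    level \<open>n\<close> serves all positive \<epsilon>.\<close>
  define A where "A n c = Lf * (L * (b - a) * (2 * c * sqrt (b - a) * geom * sqrt (1 / 2) ^ n))" for n c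
  have A0: "\<forall>\<^sub>F n in sequentially. A n c < e / 4" for c
  proof -
    have "(\<lambda>n. sqrt (1 / 2) ^ n) \<longlonglongrightarrow> 0" by (rule LIMSEQ_realpow_zero) (auto simp: real_sqrt_lt_1_iff)
    then have "(\<lambda>n. Lf * (L * (b - a) * (2 * c * sqrt (b - a) * geom * sqrt (1 / 2) ^ n)))
        \<longlonglongrightarrow> Lf * (L * (b - a) * (2 * c * sqrt (b - a) * geom * 0))" by (intro tendsto_mult tendsto_const)
    then have "(\<lambda>n. A n c) \<longlonglongrightarrow> 0" unfolding A_def by (simp only: mult_zero_right)
    then show ?thesis by (rule order_tendstoD) (use e in simp)
  qed
  have "\<forall>\<^sub>F n in sequentially. A n c < e / 4 \<and> A n c' < e / 4" by (intro eventually_conj A0)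
  then obtain n where n: "A n c < e / 4" "A n c' < e / 4" by (auto simp: eventually_sequentially)
  \<comment> \<open>The Riemann sum of level \<open>n\<close> as a map from the vector of increments
    to paths. It is Lipschitz with constant \<open>C\<close>, the bound of the kernel, which reduces
    \<open>f\<close> to an admissible test function for \<open>fd\<close>.\<close>
  define \<Psi> where "\<Psi> y = (\<lambda>x\<in>D. \<Sum>j<2 ^ n. \<kappa> x (mid n j) * y j)" for y :: "nat \<Rightarrow> real"
  have \<Psi>_space: "\<Psi> y \<in> mspace (C_metric D)" for y
    unfolding \<Psi>_def
  proof (rule uniformly_continuous_in_C_metric)
    have "(L * (\<Sum>j<2 ^ n. \<bar>y j\<bar>))-lipschitz_on D (\<lambda>x. \<Sum>j<2 ^ n. \<kappa> x (mid n j) * y j)"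
    proof (rule lipschitz_onI)
      fix x x' assume x: "x \<in> D" "x' \<in> D"
      have "\<bar>\<Sum>j<2 ^ n. (\<kappa> x (mid n j) - \<kappa> x' (mid n j)) * y j\<bar> \<le> (\<Sum>j<2 ^ n. L * \<bar>x - x'\<bar> * \<bar>y j\<bar>)"
      proof (rule order_trans[OF sum_abs sum_mono])
        fix j :: nat assume "j \<in> {..<2 ^ n}"
        then have "mid n j \<in> D" by (intro mid_in) simp
        then have "\<bar>\<kappa> x (mid n j) - \<kappa> x' (mid n j)\<bar> \<le> L * \<bar>x - x'\<bar>"
          using K x by (auto simp: Lipschitz_kernel_def simp del: greaterThanLessThan_iff)
        then show "\<bar>(\<kappa> x (mid n j) - \<kappa> x' (mid n j)) * y j\<bar> \<le> L * \<bar>x - x'\<bar> * \<bar>y j\<bar>"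
          unfolding abs_mult by (rule mult_right_mono) simp
      qed
      then show "dist (\<Sum>j<2 ^ n. \<kappa> x (mid n j) * y j) (\<Sum>j<2 ^ n. \<kappa> x' (mid n j) * y j) \<le> L * (\<Sum>j<2 ^ n. \<bar>y j\<bar>) * dist x x'"
        unfolding dist_real_def
        by (simp add: sum_subtractf left_diff_distrib right_diff_distrib sum_distrib_left sum_distrib_right mult_ac)
    qed (use C in \<open>auto intro!: mult_nonneg_nonneg sum_nonneg\<close>)
    then show "uniformly_continuous_on D (\<lambda>x. \<Sum>j<2 ^ n. \<kappa> x (mid n j) * y j)" by (rule lipschitz_on_uniformly_continuous)
  qed simp
  have lim: "((\<lambda>\<epsilon>. LINT \<omega>|M. f (\<Psi> (\<lambda>j. \<beta> \<epsilon> \<omega> (grid n j) (grid n (Suc j))))) \<longlongrightarrow>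
      (LINT \<omega>|N. f (\<Psi> (\<lambda>j. \<gamma> \<omega> (grid n j) (grid n (Suc j)))))) (at_right 0)"
  proof (rule fd[of "\<lambda>y. f (\<Psi> y)" B "Lf * C" n])
    show "\<bar>f (\<Psi> x)\<bar> \<le> B" for x using f \<Psi>_space by (simp add: bounded_Lipschitz_def)
    show "0 \<le> Lf * C" using f C by (simp add: bounded_Lipschitz_def)
    fix x y :: "nat \<Rightarrow> real"
    have "mdist (C_metric D) (\<Psi> x) (\<Psi> y) \<le> C * (\<Sum>j<2 ^ n. \<bar>x j - y j\<bar>)"
    proof (rule mdist_C_metric_le)
      fix z assume z: "z \<in> D"
      have "\<bar>\<Sum>j<2 ^ n. \<kappa> z (mid n j) * (x j - y j)\<bar> \<le> (\<Sum>j<2 ^ n. C * \<bar>x j - y j\<bar>)"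
      proof (rule order_trans[OF sum_abs sum_mono])
        fix j :: nat assume "j \<in> {..<2 ^ n}"
        then have "mid n j \<in> D" by (intro mid_in) simp
        then show "\<bar>\<kappa> z (mid n j) * (x j - y j)\<bar> \<le> C * \<bar>x j - y j\<bar>"
          unfolding abs_mult using z by (intro mult_right_mono KC) auto
      qed
      then show "\<bar>\<Psi> x z - \<Psi> y z\<bar> \<le> C * (\<Sum>j<2 ^ n. \<bar>x j - y j\<bar>)"
        using z by (simp add: \<Psi>_def sum_subtractf[symmetric] right_diff_distrib sum_distrib_left)
    qed (use C in \<open>auto intro!: mult_nonneg_nonneg sum_nonneg\<close>)
    then have "Lf * mdist (C_metric D) (\<Psi> x) (\<Psi> y) \<le> Lf * (C * (\<Sum>j<2 ^ n. \<bar>x j - y j\<bar>))"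
      using f by (intro mult_left_mono) (auto simp: bounded_Lipschitz_def)
    moreover have "\<bar>f (\<Psi> x) - f (\<Psi> y)\<bar> \<le> Lf * mdist (C_metric D) (\<Psi> x) (\<Psi> y)"
      using f \<Psi>_space by (simp add: bounded_Lipschitz_def)
    ultimately show "\<bar>f (\<Psi> x) - f (\<Psi> y)\<bar> \<le> Lf * C * (\<Sum>j<2 ^ n. \<bar>x j - y j\<bar>)" by (simp add: mult_ac)
  qed
  have \<Psi>_RS: "\<Psi> (\<lambda>j. \<eta> (grid n j) (grid n (Suc j))) = (\<lambda>x\<in>D. RS n \<eta> (\<kappa> x))" for \<eta>
    by (simp add: \<Psi>_def RS_def)
  have "\<forall>\<^sub>F \<epsilon> in at_right 0. dist (LINT \<omega>|M. f (\<lambda>x\<in>D. RS n (\<beta> \<epsilon> \<omega>) (\<kappa> x))) (LINT \<omega>|N. f (\<lambda>x\<in>D. RS n (\<gamma> \<omega>) (\<kappa> x))) < e / 2"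
    using tendstoD[OF lim, of "e / 2"] e by (simp add: \<Psi>_RS)
  then show "\<forall>\<^sub>F \<epsilon> in at_right 0. dist (LINT \<omega>|M. f (\<lambda>x\<in>D. RF (\<beta> \<epsilon> \<omega>) (\<kappa> x))) (LINT \<omega>|N. f (\<lambda>x\<in>D. RF (\<gamma> \<omega>) (\<kappa> x))) < e"
    using eventually_at_right_less[of "0 :: real"]
  proof eventually_elim
    case (elim \<epsilon>)
    show ?case
      using elim(1) n bounded_Lipschitz_RF_RS[OF M K \<beta>[OF elim(2)] f, of n] bounded_Lipschitz_RF_RS[OF N K \<gamma> f, of n]
      unfolding dist_real_def A_def by linarith
  qed
qed

end

section \<open>The Wiener integral\<close>

locale wiener = prob_space N for N :: "'v measure" +
  fixes W :: "real \<Rightarrow> 'v \<Rightarrow> real"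
  assumes wiener: "standard_wiener_process N W"
begin

lemma W_rv [measurable]: "W t \<in> borel_measurable N"
  using wiener by (simp add: standard_wiener_process_def)

lemma increment_standardized:
  assumes "s < t"
  shows "distr N borel (\<lambda>\<omega>. (W t \<omega> - W s \<omega>) / sqrt (t - s)) = std_normal_distribution"
proof -
  have "distributed N lborel (\<lambda>\<omega>. W t \<omega> - W s \<omega>) (normal_density 0 (sqrt (t - s)))"
    using wiener assms by (simp add: standard_wiener_process_def)
  then have "distributed N lborel (\<lambda>\<omega>. (W t \<omega> - W s \<omega> - 0) / sqrt (t - s)) std_normal_density"
    using assms by (subst (asm) normal_standard_normal_convert) auto
  from distributed_distr_eq_density[OF this]
  have "distr N lborel (\<lambda>\<omega>. (W t \<omega> - W s \<omega>) / sqrt (t - s)) = std_normal_distribution" by simp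
  moreover have "distr N lborel (\<lambda>\<omega>. (W t \<omega> - W s \<omega>) / sqrt (t - s)) = distr N borel (\<lambda>\<omega>. (W t \<omega> - W s \<omega>) / sqrt (t - s))"
    by (rule distr_cong) auto
  ultimately show ?thesis by simp
qed

lemma increment_square:
  shows "integrable N (\<lambda>\<omega>. (W t \<omega> - W s \<omega>)\<^sup>2)" "expectation (\<lambda>\<omega>. (W t \<omega> - W s \<omega>)\<^sup>2) = \<bar>t - s\<bar>"
proof -
  have *: "integrable N (\<lambda>\<omega>. (W t \<omega> - W s \<omega>)\<^sup>2) \<and> expectation (\<lambda>\<omega>. (W t \<omega> - W s \<omega>)\<^sup>2) = t - s" if st: "s < t" for s t
  proof -
    let ?Z = "\<lambda>\<omega>. (W t \<omega> - W s \<omega>) / sqrt (t - s)"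
    have eq: "(W t \<omega> - W s \<omega>)\<^sup>2 = (t - s) * (?Z \<omega>)\<^sup>2" for \<omega> using st by (simp add: power_divide)
    have "integrable (distr N borel ?Z) (\<lambda>x. x\<^sup>2)"
      unfolding increment_standardized[OF st] by (rule integrable_std_normal_distribution_moment)
    then have i: "integrable N (\<lambda>\<omega>. (?Z \<omega>)\<^sup>2)" by (subst (asm) integrable_distr_eq) auto
    have "expectation (\<lambda>\<omega>. (?Z \<omega>)\<^sup>2) = (LINT x|distr N borel ?Z. x\<^sup>2)" by (rule integral_distr[symmetric]) auto
    also have "\<dots> = 1" unfolding increment_standardized[OF st] using std_normal_distribution_even_moments(1)[of 1] by simp
    finally show ?thesis unfolding eq using i by (auto intro!: integrable_mult_right)
  qed
  consider "s < t" | "s = t" | "t < s" by linarith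
  then have "integrable N (\<lambda>\<omega>. (W t \<omega> - W s \<omega>)\<^sup>2) \<and> expectation (\<lambda>\<omega>. (W t \<omega> - W s \<omega>)\<^sup>2) = \<bar>t - s\<bar>"
  proof cases
    case 3
    then show ?thesis using *[of t s] by (simp add: power2_commute[of "W t _"])
  qed (use *[of s t] in auto)
  then show "integrable N (\<lambda>\<omega>. (W t \<omega> - W s \<omega>)\<^sup>2)" "expectation (\<lambda>\<omega>. (W t \<omega> - W s \<omega>)\<^sup>2) = \<bar>t - s\<bar>" by auto
qed

lemma increment_char:
  assumes "s < t"
  shows "(CLINT \<omega>|N. iexp (\<theta> * (W t \<omega> - W s \<omega>))) = complex_of_real (exp (- \<theta>\<^sup>2 * (t - s) / 2))"
proof -
  let ?Z = "\<lambda>\<omega>. (W t \<omega> - W s \<omega>) / sqrt (t - s)"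
  have "(CLINT \<omega>|N. iexp (\<theta> * (W t \<omega> - W s \<omega>))) = (CLINT \<omega>|N. iexp ((\<theta> * sqrt (t - s)) * ?Z \<omega>))"
  proof -
    have eq: "\<theta> * (W t \<omega> - W s \<omega>) = (\<theta> * sqrt (t - s)) * ?Z \<omega>" for \<omega> using assms by simp
    show ?thesis by (simp only: eq)
  qed
  also have "\<dots> = char (distr N borel ?Z) (\<theta> * sqrt (t - s))"
    unfolding char_def by (rule integral_distr[symmetric]) auto
  also have "\<dots> = complex_of_real (exp (- \<theta>\<^sup>2 * (t - s) / 2))"
    unfolding increment_standardized[OF assms] char_std_normal_distribution
    using assms by (simp add: power_mult_distrib)
  finally show ?thesis .
qed

text \<open>Polarization expresses the product through four squared increments, so overlapping
  intervals need not be cut into disjoint pieces. The covariance that results is the length of the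
  overlap.\<close>

lemma increment_product:
  shows "integrable N (\<lambda>\<omega>. (W t \<omega> - W s \<omega>) * (W t' \<omega> - W s' \<omega>))"
    and "s \<le> t \<Longrightarrow> s' \<le> t' \<Longrightarrow> expectation (\<lambda>\<omega>. (W t \<omega> - W s \<omega>) * (W t' \<omega> - W s' \<omega>))
      = (LINT x|lborel. indicator {s<..t} x * indicator {s'<..t'} x)"
proof -
  have eq: "(W t \<omega> - W s \<omega>) * (W t' \<omega> - W s' \<omega>)
      = ((W t \<omega> - W s' \<omega>)\<^sup>2 + (W s \<omega> - W t' \<omega>)\<^sup>2 - (W t \<omega> - W t' \<omega>)\<^sup>2 - (W s \<omega> - W s' \<omega>)\<^sup>2) / 2" for \<omega>
    by (simp add: power2_eq_square algebra_simps)
  show "integrable N (\<lambda>\<omega>. (W t \<omega> - W s \<omega>) * (W t' \<omega> - W s' \<omega>))"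
    unfolding eq using increment_square(1) by simp
  assume st: "s \<le> t" "s' \<le> t'"
  have "expectation (\<lambda>\<omega>. (W t \<omega> - W s \<omega>) * (W t' \<omega> - W s' \<omega>)) = (\<bar>t - s'\<bar> + \<bar>s - t'\<bar> - \<bar>t - t'\<bar> - \<bar>s - s'\<bar>) / 2"
    unfolding eq using increment_square by simp
  also have "\<dots> = max 0 (min t t' - max s s')" using st by (auto simp: abs_if max_def min_def field_simps)
  also have "\<dots> = (LINT x|lborel. indicator {max s s'<..min t t'} x)"
    by (cases "max s s' \<le> min t t'") auto
  also have "\<dots> = (LINT x|lborel. indicator {s<..t} x * indicator {s'<..t'} x)"
    by (intro Bochner_Integration.integral_cong) (auto simp: indicator_def)
  finally show "expectation (\<lambda>\<omega>. (W t \<omega> - W s \<omega>) * (W t' \<omega> - W s' \<omega>))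
      = (LINT x|lborel. indicator {s<..t} x * indicator {s'<..t'} x)" .
qed

text \<open>The intervals in the list may overlap, so both squares are expanded into double sums and
  compared term by term through \<open>increment_product\<close>.\<close>

lemma step_isometry:
  fixes S :: "(real \<times> real \<times> real) list"
  assumes S: "\<forall>(c, s, t) \<in> set S. s \<le> t"
  shows "(\<integral>\<^sup>+\<omega>. ennreal ((step_integral W S \<omega>)\<^sup>2) \<partial>N) = (\<integral>\<^sup>+x. ennreal ((step_function S x)\<^sup>2) \<partial>lborel)"
proof -
  define c s t where "c i = fst (S ! i)" "s i = fst (snd (S ! i))" "t i = snd (snd (S ! i))" for i
  let ?n = "length S"
  have st: "s i \<le> t i" if "i < ?n" for i
    using S that nth_mem[of i S] by (auto simp: c_s_t_def case_prod_beta')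
  define x where "x i \<omega> = W (t i) \<omega> - W (s i) \<omega>" for i \<omega>
  define y where "y i z = (indicator {s i<..t i} z :: real)" for i z
  have si: "step_integral W S \<omega> = (\<Sum>i<?n. c i * x i \<omega>)" for \<omega>
    by (simp add: step_integral_def sum_list_sum_nth atLeast0LessThan case_prod_beta' c_s_t_def x_def)
  have sf: "step_function S z = (\<Sum>i<?n. c i * y i z)" for z
    by (simp add: step_function_def sum_list_sum_nth atLeast0LessThan case_prod_beta' c_s_t_def y_def)
  have sq: "(\<Sum>i<?n. c i * u i)\<^sup>2 = (\<Sum>i<?n. \<Sum>j<?n. (c i * c j) * (u i * u j))" for u :: "nat \<Rightarrow> real"
    by (simp add: power2_eq_square sum_product mult_ac)
  have xi: "integrable N (\<lambda>\<omega>. x i \<omega> * x j \<omega>)" for i j unfolding x_def by (rule increment_product)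
  have yi: "integrable lborel (\<lambda>z. y i z * y j z)" for i j
  proof -
    have "(\<lambda>z. y i z * y j z) = indicator ({s i<..t i} \<inter> {s j<..t j})" by (auto simp: y_def indicator_def fun_eq_iff)
    moreover have "emeasure lborel ({s i<..t i} \<inter> {s j<..t j}) < \<infinity>"
      by (rule emeasure_bounded_finite) (auto intro: bounded_subset[of "{s i<..t i}"])
    ultimately show ?thesis by (simp add: less_top)
  qed
  have iN: "integrable N (\<lambda>\<omega>. (step_integral W S \<omega>)\<^sup>2)" unfolding si sq
    by (intro Bochner_Integration.integrable_sum integrable_mult_right xi)
  have iL: "integrable lborel (\<lambda>z. (step_function S z)\<^sup>2)" unfolding sf sq
    by (intro Bochner_Integration.integrable_sum integrable_mult_right yi)
  have "expectation (\<lambda>\<omega>. (step_integral W S \<omega>)\<^sup>2) = (\<Sum>i<?n. \<Sum>j<?n. (c i * c j) * expectation (\<lambda>\<omega>. x i \<omega> * x j \<omega>))"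
    unfolding si sq using xi by (simp add: Bochner_Integration.integral_sum Bochner_Integration.integrable_sum)
  also have "\<dots> = (\<Sum>i<?n. \<Sum>j<?n. (c i * c j) * (LINT z|lborel. y i z * y j z))"
    using st by (intro sum.cong refl) (simp add: x_def y_def increment_product(2))
  also have "\<dots> = (LINT z|lborel. (step_function S z)\<^sup>2)"
    unfolding sf sq using yi by (simp add: Bochner_Integration.integral_sum Bochner_Integration.integrable_sum)
  finally show ?thesis
    using nn_integral_eq_integral[OF iN] nn_integral_eq_integral[OF iL] by simp
qed

end

lemma step_integral_diff:
  "step_integral W S \<omega> - step_integral W S' \<omega> = step_integral W (S @ map (\<lambda>(c, s, t). (- c, s, t)) S') \<omega>"
  unfolding step_integral_def by (induction S') (auto simp: case_prod_beta')

lemma step_function_diff: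
  "step_function S x - step_function S' x = step_function (S @ map (\<lambda>(c, s, t). (- c, s, t)) S') x"
  unfolding step_function_def by (induction S') (auto simp: case_prod_beta')

lemma step_function_measurable [measurable]: "step_function S \<in> borel_measurable borel"
proof -
  have "(\<lambda>x. \<Sum>(c, s, t) \<leftarrow> S. c * indicator {s<..t} x) \<in> borel_measurable (borel :: real measure)"
    by (induction S) (auto simp: case_prod_beta')
  then show ?thesis by (simp add: step_function_def[abs_def])
qed

lemma step_function_outside:
  assumes "\<forall>(c, s, t) \<in> set S. a \<le> s \<and> s \<le> t \<and> t \<le> b" "x \<notin> {a<..b}"
  shows "step_function S x = 0"
  using assms unfolding step_function_def by (induction S) (auto simp: indicator_def)

lemma square_diff_le: "ennreal ((u - v)\<^sup>2) \<le> 2 * ennreal ((w - u)\<^sup>2) + 2 * ennreal ((w - v)\<^sup>2)" for u v w :: real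
proof -
  have "(u - v)\<^sup>2 + ((w - u) + (w - v))\<^sup>2 = 2 * (w - u)\<^sup>2 + 2 * (w - v)\<^sup>2"
    by (simp add: power2_eq_square algebra_simps)
  then have "(u - v)\<^sup>2 \<le> 2 * (w - u)\<^sup>2 + 2 * (w - v)\<^sup>2" using zero_le_power2[of "(w - u) + (w - v)"] by linarith
  then have "ennreal ((u - v)\<^sup>2) \<le> ennreal (2 * (w - u)\<^sup>2 + 2 * (w - v)\<^sup>2)" by (rule ennreal_leI)
  then show ?thesis by (simp add: ennreal_mult)
qed

lemma nn_integral_square_diff:
  fixes u v w :: "'a \<Rightarrow> real"
  assumes [measurable]: "u \<in> borel_measurable M" "v \<in> borel_measurable M" "w \<in> borel_measurable M"
  shows "(\<integral>\<^sup>+x. ennreal ((u x - v x)\<^sup>2) \<partial>M) \<le> 2 * (\<integral>\<^sup>+x. ennreal ((w x - u x)\<^sup>2) \<partial>M) + 2 * (\<integral>\<^sup>+x. ennreal ((w x - v x)\<^sup>2) \<partial>M)"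
proof -
  have "(\<integral>\<^sup>+x. ennreal ((u x - v x)\<^sup>2) \<partial>M) \<le> (\<integral>\<^sup>+x. 2 * ennreal ((w x - u x)\<^sup>2) + 2 * ennreal ((w x - v x)\<^sup>2) \<partial>M)"
    by (rule nn_integral_mono) (rule square_diff_le)
  also have "\<dots> = 2 * (\<integral>\<^sup>+x. ennreal ((w x - u x)\<^sup>2) \<partial>M) + 2 * (\<integral>\<^sup>+x. ennreal ((w x - v x)\<^sup>2) \<partial>M)"
    by (subst nn_integral_add) (auto simp: nn_integral_cmult)
  finally show ?thesis .
qed

context wiener
begin

lemma step_integral_rv [measurable]: "step_integral W S \<in> borel_measurable N"
proof -
  have "(\<lambda>\<omega>. \<Sum>(c, s, t) \<leftarrow> S. c * (W t \<omega> - W s \<omega>)) \<in> borel_measurable N"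
    by (induction S) (auto simp: case_prod_beta')
  then show ?thesis by (simp add: step_integral_def[abs_def])
qed

lemma step_isometry_diff:
  assumes S: "\<forall>(c, s, t) \<in> set S. a \<le> s \<and> s \<le> t \<and> t \<le> b" and S': "\<forall>(c, s, t) \<in> set S'. a \<le> s \<and> s \<le> t \<and> t \<le> b"
  shows "(\<integral>\<^sup>+\<omega>. ennreal ((step_integral W S \<omega> - step_integral W S' \<omega>)\<^sup>2) \<partial>N)
    = (\<integral>\<^sup>+x\<in>{a<..<b}. ennreal ((step_function S x - step_function S' x)\<^sup>2) \<partial>lborel)"
proof -
  have "(\<integral>\<^sup>+\<omega>. ennreal ((step_integral W S \<omega> - step_integral W S' \<omega>)\<^sup>2) \<partial>N)
      = (\<integral>\<^sup>+x. ennreal ((step_function S x - step_function S' x)\<^sup>2) \<partial>lborel)"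
    unfolding step_integral_diff step_function_diff by (rule step_isometry) (use S S' in auto)
  also have "\<dots> = (\<integral>\<^sup>+x\<in>{a<..<b}. ennreal ((step_function S x - step_function S' x)\<^sup>2) \<partial>lborel)"
  proof (rule nn_integral_cong_AE)
    show "AE x in lborel. ennreal ((step_function S x - step_function S' x)\<^sup>2)
        = ennreal ((step_function S x - step_function S' x)\<^sup>2) * indicator {a<..<b} x"
      \<comment> \<open>A step function may be nonzero at \<open>b\<close>, which the open interval
        omits.\<close>
      using AE_lborel_singleton[of b]
    proof eventually_elim
      case (elim x)
      then show ?case
        using step_function_outside[OF S, of x] step_function_outside[OF S', of x] by (auto simp: indicator_def)
    qed
  qed
  finally show ?thesis .
qed

text \<open>The two integrals are connected through their approximating step integrals. The isometry
  turns the difference of the step integrals into the difference of the step functions, and both of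
  these tend to \<open>h\<close>. Each triangle inequality for squares costs a factor 2.\<close>

lemma wiener_integral_unique:
  assumes Z: "has_wiener_integral N W a b h Z" and Z': "has_wiener_integral N W a b h Z'"
  shows "AE \<omega> in N. Z \<omega> = Z' \<omega>"
proof -
  obtain S where S: "\<And>k :: nat. \<forall>(c, s, t) \<in> set (S k). a \<le> s \<and> s \<le> t \<and> t \<le> b"
    and Sh: "(\<lambda>k. \<integral>\<^sup>+x\<in>{a<..<b}. ennreal ((step_function (S k) x - h x)\<^sup>2) \<partial>lborel) \<longlonglongrightarrow> 0"
    and SZ: "(\<lambda>k. \<integral>\<^sup>+\<omega>. ennreal ((step_integral W (S k) \<omega> - Z \<omega>)\<^sup>2) \<partial>N) \<longlonglongrightarrow> 0"
    using Z unfolding has_wiener_integral_def by blast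
  obtain S' where S': "\<And>k :: nat. \<forall>(c, s, t) \<in> set (S' k). a \<le> s \<and> s \<le> t \<and> t \<le> b"
    and Sh': "(\<lambda>k. \<integral>\<^sup>+x\<in>{a<..<b}. ennreal ((step_function (S' k) x - h x)\<^sup>2) \<partial>lborel) \<longlonglongrightarrow> 0"
    and SZ': "(\<lambda>k. \<integral>\<^sup>+\<omega>. ennreal ((step_integral W (S' k) \<omega> - Z' \<omega>)\<^sup>2) \<partial>N) \<longlonglongrightarrow> 0"
    using Z' unfolding has_wiener_integral_def by blast
  have [measurable]: "Z \<in> borel_measurable N" "Z' \<in> borel_measurable N"
    using Z Z' by (auto simp: has_wiener_integral_def)
  define h' where "h' x = indicator {a<..<b} x * h x" for x
  have [measurable]: "h' \<in> borel_measurable lborel"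
    using Z by (simp add: has_wiener_integral_def L2_def set_borel_measurable_def h'_def[abs_def])
  define sf where "sf S x = indicator {a<..<b} x * step_function S x" for S x
  have [measurable]: "sf S \<in> borel_measurable lborel" for S unfolding sf_def[abs_def] by simp
  have conv: "(\<integral>\<^sup>+x\<in>{a<..<b}. ennreal ((step_function S x - h x)\<^sup>2) \<partial>lborel) = (\<integral>\<^sup>+x. ennreal ((sf S x - h' x)\<^sup>2) \<partial>lborel)" for S
    by (intro nn_integral_cong) (auto simp: sf_def h'_def indicator_def)
  define A where "A k = (\<integral>\<^sup>+\<omega>. ennreal ((step_integral W (S k) \<omega> - Z \<omega>)\<^sup>2) \<partial>N)" for k
  define A' where "A' k = (\<integral>\<^sup>+\<omega>. ennreal ((step_integral W (S' k) \<omega> - Z' \<omega>)\<^sup>2) \<partial>N)" for k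
  define B where "B k = (\<integral>\<^sup>+x. ennreal ((sf (S k) x - h' x)\<^sup>2) \<partial>lborel)" for k
  define B' where "B' k = (\<integral>\<^sup>+x. ennreal ((sf (S' k) x - h' x)\<^sup>2) \<partial>lborel)" for k
  have "(\<integral>\<^sup>+\<omega>. ennreal ((Z \<omega> - Z' \<omega>)\<^sup>2) \<partial>N) \<le> 2 * A k + 2 * (2 * (2 * B k + 2 * B' k) + 2 * A' k)" for k
  proof -
    have 1: "(\<integral>\<^sup>+\<omega>. ennreal ((Z \<omega> - Z' \<omega>)\<^sup>2) \<partial>N) \<le> 2 * A k + 2 * (\<integral>\<^sup>+\<omega>. ennreal ((step_integral W (S k) \<omega> - Z' \<omega>)\<^sup>2) \<partial>N)"
      unfolding A_def by (rule nn_integral_square_diff) measurable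
    have 2: "(\<integral>\<^sup>+\<omega>. ennreal ((step_integral W (S k) \<omega> - Z' \<omega>)\<^sup>2) \<partial>N)
        \<le> 2 * (\<integral>\<^sup>+\<omega>. ennreal ((step_integral W (S' k) \<omega> - step_integral W (S k) \<omega>)\<^sup>2) \<partial>N) + 2 * A' k"
      unfolding A'_def by (rule nn_integral_square_diff) measurable
    have 3: "(\<integral>\<^sup>+\<omega>. ennreal ((step_integral W (S' k) \<omega> - step_integral W (S k) \<omega>)\<^sup>2) \<partial>N) \<le> 2 * B k + 2 * B' k"
    proof -
      have "(\<integral>\<^sup>+\<omega>. ennreal ((step_integral W (S' k) \<omega> - step_integral W (S k) \<omega>)\<^sup>2) \<partial>N)
          = (\<integral>\<^sup>+x\<in>{a<..<b}. ennreal ((step_function (S' k) x - step_function (S k) x)\<^sup>2) \<partial>lborel)"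
        by (rule step_isometry_diff[OF S' S])
      also have "\<dots> = (\<integral>\<^sup>+x. ennreal ((sf (S k) x - sf (S' k) x)\<^sup>2) \<partial>lborel)"
        by (intro nn_integral_cong) (auto simp: sf_def indicator_def power2_commute)
      also have "\<dots> \<le> 2 * (\<integral>\<^sup>+x. ennreal ((h' x - sf (S k) x)\<^sup>2) \<partial>lborel) + 2 * (\<integral>\<^sup>+x. ennreal ((h' x - sf (S' k) x)\<^sup>2) \<partial>lborel)"
        by (rule nn_integral_square_diff) measurable
      finally show ?thesis unfolding B_def B'_def by (simp add: power2_commute)
    qed
    have "2 * (\<integral>\<^sup>+\<omega>. ennreal ((step_integral W (S k) \<omega> - Z' \<omega>)\<^sup>2) \<partial>N) \<le> 2 * (2 * (2 * B k + 2 * B' k) + 2 * A' k)"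
      by (rule mult_left_mono[OF order_trans[OF 2 add_right_mono[OF mult_left_mono[OF 3]]]]) auto
    with 1 show ?thesis by (meson add_left_mono order_trans)
  qed
  moreover have "(\<lambda>k. 2 * A k + 2 * (2 * (2 * B k + 2 * B' k) + 2 * A' k)) \<longlonglongrightarrow> 2 * 0 + 2 * (2 * (2 * 0 + 2 * 0) + 2 * 0)"
    using Sh Sh' SZ SZ' unfolding conv A_def A'_def B_def B'_def
    by (intro tendsto_add ennreal_tendsto_cmult) auto
  ultimately have "(\<integral>\<^sup>+\<omega>. ennreal ((Z \<omega> - Z' \<omega>)\<^sup>2) \<partial>N) \<le> 0"
    using LIMSEQ_le_const[of _ 0 "\<integral>\<^sup>+\<omega>. ennreal ((Z \<omega> - Z' \<omega>)\<^sup>2) \<partial>N"] by (simp del: ennreal_eq_0_iff)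
  then have "AE \<omega> in N. ennreal ((Z \<omega> - Z' \<omega>)\<^sup>2) = 0"
    by (subst nn_integral_0_iff_AE[symmetric]) auto
  then show ?thesis by eventually_elim simp
qed

end

section \<open>Dyadic limits as Wiener integrals\<close>

context dyadic
begin

lemma L2_bounded_continuous:
  assumes "continuous_on D h" "\<And>x. x \<in> D \<Longrightarrow> \<bar>h x\<bar> \<le> C"
  shows "h \<in> L2 D"
proof -
  have "set_integrable lborel D (\<lambda>x. (h x)\<^sup>2)"
  proof (rule set_integrable_bounded_continuous[OF refl])
    show "continuous_on D (\<lambda>x. (h x)\<^sup>2)" by (intro continuous_intros assms)
    have "norm ((h x)\<^sup>2) \<le> C\<^sup>2" if "x \<in> D" for x
      using assms(2)[OF that] by (auto intro!: power2_le_iff_abs_le[THEN iffD2] simp: abs_le_square_iff[symmetric])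
    then show "bounded ((\<lambda>x. (h x)\<^sup>2) ` D)" unfolding bounded_iff by blast
  qed
  then show ?thesis using borel_measurable_continuous_on_indicator[OF _ assms(1)]
    by (simp add: L2_def set_borel_measurable_def)
qed

lemma Lipschitz_on_continuous: "Lipschitz_on L h \<Longrightarrow> continuous_on D h"
  by (rule lipschitz_on_continuous_on[of L]) (auto simp: Lipschitz_on_def dist_real_def intro!: lipschitz_onI)

text \<open>Coded so that its \<open>step_integral\<close> against \<open>W\<close> is the midpoint
  sum \<open>RS k\<close>.\<close>

definition riemann_step :: "nat \<Rightarrow> (real \<Rightarrow> real) \<Rightarrow> (real \<times> real \<times> real) list" where
  "riemann_step k h = map (\<lambda>j. (h (mid k j), grid k j, grid k (Suc j))) [0..<2 ^ k]"

lemma riemann_step_in: "\<forall>(c, s, t) \<in> set (riemann_step k h). a \<le> s \<and> s \<le> t \<and> t \<le> b"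
proof -
  have "a \<le> grid k j \<and> grid k j \<le> grid k (Suc j) \<and> grid k (Suc j) \<le> b" if "j < 2 ^ k" for j
    using that grid_in[of j k] grid_in[of "Suc j" k] grid_mono[of j "Suc j" k] by simp
  then show ?thesis by (auto simp: riemann_step_def)
qed

lemma step_integral_riemann_step: "step_integral W (riemann_step k h) \<omega> = RS k (\<lambda>s t. W t \<omega> - W s \<omega>) h"
  by (simp add: step_integral_def riemann_step_def RS_def interv_sum_list_conv_sum_set_nat atLeast0LessThan o_def)

lemma grid_cover: "x \<in> D \<Longrightarrow> (\<Sum>j<2 ^ k. indicator {grid k j<..grid k (Suc j)} x) = (1 :: real)"
proof -
  have "(\<Sum>j<n. indicator {grid k j<..grid k (Suc j)} x) = (indicator {grid k 0<..grid k n} x :: real)" for n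
  proof (induction n)
    case (Suc n)
    then show ?case using grid_mono[of 0 n k] grid_mono[of n "Suc n" k]
      by (auto simp: indicator_def simp del: grid_0)
  qed simp
  moreover assume "x \<in> D"
  ultimately show ?thesis by (simp add: indicator_def)
qed

lemma step_function_riemann_step:
  assumes h: "Lipschitz_on L h" and x: "x \<in> D"
  shows "\<bar>step_function (riemann_step k h) x - h x\<bar> \<le> L * ((b - a) / 2 ^ k)"
proof -
  let ?i = "\<lambda>j. indicator {grid k j<..grid k (Suc j)} x :: real"
  have "step_function (riemann_step k h) x = (\<Sum>j<2 ^ k. h (mid k j) * ?i j)"
    by (simp add: step_function_def riemann_step_def interv_sum_list_conv_sum_set_nat atLeast0LessThan o_def)
  moreover have "h x = (\<Sum>j<2 ^ k. h x * ?i j)"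
    unfolding sum_distrib_left[symmetric] grid_cover[OF x] by simp
  ultimately have "step_function (riemann_step k h) x - h x = (\<Sum>j<2 ^ k. (h (mid k j) - h x) * ?i j)"
    by (simp add: sum_subtractf left_diff_distrib)
  then have "\<bar>step_function (riemann_step k h) x - h x\<bar> \<le> (\<Sum>j<2 ^ k. \<bar>(h (mid k j) - h x) * ?i j\<bar>)"
    by (simp only: sum_abs)
  also have "\<dots> \<le> (\<Sum>j<2 ^ k. L * ((b - a) / 2 ^ k) * ?i j)"
  proof (rule sum_mono)
    fix j :: nat assume j: "j \<in> {..<2 ^ k}"
    show "\<bar>(h (mid k j) - h x) * ?i j\<bar> \<le> L * ((b - a) / 2 ^ k) * ?i j"
    proof (cases "x \<in> {grid k j<..grid k (Suc j)}")
      case True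
      define d where "d = (b - a) / 2 ^ k"
      have "mid k j = grid k j + d / 2" "mid k j = grid k (Suc j) - d / 2" using mid_grid[of k j] unfolding d_def by auto
      then have "\<bar>mid k j - x\<bar> \<le> d" using True by auto
      moreover have "\<bar>h (mid k j) - h x\<bar> \<le> L * \<bar>mid k j - x\<bar>"
        using h x mid_in[of j k] j by (simp add: Lipschitz_on_def)
      ultimately have "\<bar>h (mid k j) - h x\<bar> \<le> L * d"
        using h by (meson Lipschitz_on_def mult_left_mono order_trans)
      then show ?thesis using True by (simp add: d_def)
    qed simp
  qed
  also have "\<dots> = L * ((b - a) / 2 ^ k)" unfolding sum_distrib_left[symmetric] grid_cover[OF x] by simp
  finally show ?thesis .
qed

end

context dyadic
begin

lemma wiener_increments:
  assumes "wiener N W"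
  shows "moment_increments N 1 (\<lambda>\<omega> s t. W t \<omega> - W s \<omega>)"
proof -
  interpret wiener N W by fact
  have "(\<integral>\<^sup>+\<omega>. ennreal \<bar>W t \<omega> - W s \<omega>\<bar> \<partial>N) \<le> ennreal (sqrt (t - s))" if "s \<le> t" for s t
  proof -
    have i: "integrable N (\<lambda>\<omega>. W t \<omega> - W s \<omega>)"
      by (rule square_integrable_imp_integrable) (auto intro: increment_square)
    have "(\<integral>\<^sup>+\<omega>. ennreal \<bar>W t \<omega> - W s \<omega>\<bar> \<partial>N) = ennreal (expectation (\<lambda>\<omega>. \<bar>W t \<omega> - W s \<omega>\<bar>))"
      using i by (intro nn_integral_eq_integral) auto
    also have "\<dots> \<le> ennreal (sqrt (t - s))"
      using that by (intro ennreal_leI expectation_abs_le_sqrt increment_square(1)) (auto simp: increment_square(2))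
    finally show ?thesis .
  qed
  then show ?thesis by (auto simp: moment_increments_def additive_increments_def)
qed

text \<open>The midpoint sums are step integrals and converge almost surely to \<open>RF\<close>.
  Mean square convergence follows from the isometry for two levels \<open>k \<le> j\<close> and
  Fatou's lemma as \<open>j\<close> tends to infinity.\<close>

lemma has_wiener_integral_RF:
  assumes W: "wiener N W" and h: "Lipschitz_on L h" and C: "\<And>x. x \<in> D \<Longrightarrow> \<bar>h x\<bar> \<le> C"
  shows "has_wiener_integral N W a b h (\<lambda>\<omega>. RF (\<lambda>s t. W t \<omega> - W s \<omega>) h)"
proof -
  interpret wiener N W by fact
  let ?\<beta> = "\<lambda>\<omega> s t. W t \<omega> - W s \<omega>"
  note mi = wiener_increments[OF W]
  have add: "additive_increments (?\<beta> \<omega>)" for \<omega> by (simp add: additive_increments_def)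
  have Zm[measurable]: "(\<lambda>\<omega>. RF (?\<beta> \<omega>) h) \<in> borel_measurable N" by (rule RF_measurable) simp
  have RSm[measurable]: "(\<lambda>\<omega>. RS k (?\<beta> \<omega>) h) \<in> borel_measurable N" for k by (rule RS_measurable) simp
  have L0: "0 \<le> L" using h by (simp add: Lipschitz_on_def)
  define d where "d k = L * ((b - a) / 2 ^ k)" for k
  have d0: "0 \<le> d k" for k using L0 ab by (simp add: d_def)
  have sfd: "\<bar>step_function (riemann_step k h) x - h x\<bar> \<le> d k" if "x \<in> D" for x k
    unfolding d_def by (rule step_function_riemann_step[OF h that])
  have d_mono: "d j \<le> d k" if "k \<le> j" for j k
    unfolding d_def using L0 ab that by (intro mult_left_mono divide_left_mono) (auto simp: power_increasing)
  have dlim: "(\<lambda>k. ennreal (c * (d k)\<^sup>2 * (b - a))) \<longlonglongrightarrow> 0" for c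
  proof -
    have "(\<lambda>k. (1 / 2 :: real) ^ k) \<longlonglongrightarrow> 0" by (rule LIMSEQ_realpow_zero) auto
    then have "(\<lambda>k. c * (L * ((b - a) * (1 / 2) ^ k))\<^sup>2 * (b - a)) \<longlonglongrightarrow> c * (L * ((b - a) * 0))\<^sup>2 * (b - a)"
      by (intro tendsto_mult tendsto_const tendsto_power)
    then have "(\<lambda>k. c * (d k)\<^sup>2 * (b - a)) \<longlonglongrightarrow> 0" by (simp add: d_def power_one_over)
    from tendsto_ennrealI[OF this] show ?thesis by simp
  qed
  have const: "(\<integral>\<^sup>+x\<in>D. ennreal c \<partial>lborel) = ennreal (c * (b - a))" if "0 \<le> c" for c
    using that ab by (simp add: nn_integral_cmult_indicator ennreal_mult)
  have sf: "(\<lambda>k. \<integral>\<^sup>+x\<in>D. ennreal ((step_function (riemann_step k h) x - h x)\<^sup>2) \<partial>lborel) \<longlonglongrightarrow> 0"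
  proof (rule tendsto_sandwich[OF _ _ tendsto_const dlim[of 1]])
    show "\<forall>\<^sub>F k in sequentially. (\<integral>\<^sup>+x\<in>D. ennreal ((step_function (riemann_step k h) x - h x)\<^sup>2) \<partial>lborel) \<le> ennreal (1 * (d k)\<^sup>2 * (b - a))"
    proof (rule always_eventually, rule allI)
      fix k
      have "(\<integral>\<^sup>+x\<in>D. ennreal ((step_function (riemann_step k h) x - h x)\<^sup>2) \<partial>lborel) \<le> (\<integral>\<^sup>+x\<in>D. ennreal ((d k)\<^sup>2) \<partial>lborel)"
      proof (rule nn_integral_mono)
        fix x
        show "ennreal ((step_function (riemann_step k h) x - h x)\<^sup>2) * indicator D x \<le> ennreal ((d k)\<^sup>2) * indicator D x"
          using sfd[of x k] d0[of k]
          by (auto simp: indicator_def abs_le_square_iff[symmetric] intro!: ennreal_leI)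
      qed
      then show "(\<integral>\<^sup>+x\<in>D. ennreal ((step_function (riemann_step k h) x - h x)\<^sup>2) \<partial>lborel) \<le> ennreal (1 * (d k)\<^sup>2 * (b - a))"
        by (simp add: const)
    qed
  qed simp
  have si: "(\<integral>\<^sup>+\<omega>. ennreal ((RS k (?\<beta> \<omega>) h - RF (?\<beta> \<omega>) h)\<^sup>2) \<partial>N) \<le> ennreal (4 * (d k)\<^sup>2 * (b - a))" for k
  proof -
    have "(\<integral>\<^sup>+\<omega>. ennreal ((RS k (?\<beta> \<omega>) h - RF (?\<beta> \<omega>) h)\<^sup>2) \<partial>N)
        = (\<integral>\<^sup>+\<omega>. liminf (\<lambda>j. ennreal ((RS k (?\<beta> \<omega>) h - RS j (?\<beta> \<omega>) h)\<^sup>2)) \<partial>N)"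
    proof (rule nn_integral_cong_AE)
      show "AE \<omega> in N. ennreal ((RS k (?\<beta> \<omega>) h - RF (?\<beta> \<omega>) h)\<^sup>2) = liminf (\<lambda>j. ennreal ((RS k (?\<beta> \<omega>) h - RS j (?\<beta> \<omega>) h)\<^sup>2))"
        using moment_AE_finite[OF mi]
      proof eventually_elim
        case (elim \<omega>)
        have "(\<lambda>j. ennreal ((RS k (?\<beta> \<omega>) h - RS j (?\<beta> \<omega>) h)\<^sup>2)) \<longlonglongrightarrow> ennreal ((RS k (?\<beta> \<omega>) h - RF (?\<beta> \<omega>) h)\<^sup>2)"
          by (intro tendsto_ennrealI tendsto_power tendsto_diff tendsto_const RS_tendsto_RF[OF add h elim])
        then show ?case by (intro lim_imp_Liminf[symmetric]) auto
      qed
    qed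
    also have "\<dots> \<le> liminf (\<lambda>j. \<integral>\<^sup>+\<omega>. ennreal ((RS k (?\<beta> \<omega>) h - RS j (?\<beta> \<omega>) h)\<^sup>2) \<partial>N)"
      by (rule nn_integral_liminf) measurable
    also have "\<dots> \<le> ennreal (4 * (d k)\<^sup>2 * (b - a))"
    proof (rule Liminf_le)
      show "\<forall>\<^sub>F j in sequentially. (\<integral>\<^sup>+\<omega>. ennreal ((RS k (?\<beta> \<omega>) h - RS j (?\<beta> \<omega>) h)\<^sup>2) \<partial>N) \<le> ennreal (4 * (d k)\<^sup>2 * (b - a))"
        using eventually_ge_at_top[of k]
      proof eventually_elim
        case (elim j)
        have "(\<integral>\<^sup>+\<omega>. ennreal ((RS k (?\<beta> \<omega>) h - RS j (?\<beta> \<omega>) h)\<^sup>2) \<partial>N)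
            = (\<integral>\<^sup>+x\<in>D. ennreal ((step_function (riemann_step k h) x - step_function (riemann_step j h) x)\<^sup>2) \<partial>lborel)"
          unfolding step_integral_riemann_step[symmetric] by (rule step_isometry_diff[OF riemann_step_in riemann_step_in])
        also have "\<dots> \<le> (\<integral>\<^sup>+x\<in>D. ennreal (4 * (d k)\<^sup>2) \<partial>lborel)"
        proof (rule nn_integral_mono)
          fix x
          \<comment> \<open>Both levels are within \<open>d k\<close> of \<open>h\<close>; this is
            the origin of the constant 4.\<close>
          have "\<bar>step_function (riemann_step k h) x - step_function (riemann_step j h) x\<bar> \<le> \<bar>2 * d k\<bar>" if "x \<in> D"
            using sfd[OF that, of k] sfd[OF that, of j] d_mono[OF elim] d0[of k] by linarith
          then show "ennreal ((step_function (riemann_step k h) x - step_function (riemann_step j h) x)\<^sup>2) * indicator D x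
              \<le> ennreal (4 * (d k)\<^sup>2) * indicator D x"
            unfolding abs_le_square_iff by (auto simp: indicator_def power_mult_distrib intro!: ennreal_leI)
        qed
        also have "\<dots> = ennreal (4 * (d k)\<^sup>2 * (b - a))" by (rule const) simp
        finally show ?case .
      qed
    qed simp
    finally show ?thesis .
  qed
  have "(\<lambda>k. \<integral>\<^sup>+\<omega>. ennreal ((step_integral W (riemann_step k h) \<omega> - RF (?\<beta> \<omega>) h)\<^sup>2) \<partial>N) \<longlonglongrightarrow> 0"
    unfolding step_integral_riemann_step
    by (rule tendsto_sandwich[OF _ _ tendsto_const dlim[of 4]]) (use si in auto)
  with sf have "\<exists>S. (\<forall>k. \<forall>(c, s, t) \<in> set (S k). a \<le> s \<and> s \<le> t \<and> t \<le> b) \<and>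
      (\<lambda>k. \<integral>\<^sup>+x\<in>{a<..<b}. ennreal ((step_function (S k) x - h x)\<^sup>2) \<partial>lborel) \<longlonglongrightarrow> 0 \<and>
      (\<lambda>k. \<integral>\<^sup>+\<omega>. ennreal ((step_integral W (S k) \<omega> - RF (?\<beta> \<omega>) h)\<^sup>2) \<partial>N) \<longlonglongrightarrow> 0"
    by (intro exI[of _ "\<lambda>k. riemann_step k h"] conjI allI riemann_step_in)
  then show ?thesis unfolding has_wiener_integral_def
    by (intro conjI Zm L2_bounded_continuous[OF Lipschitz_on_continuous[OF h] C])
qed

lemma RS_scale: "RS k (\<lambda>s t. c * \<beta> s t) h = c * RS k \<beta> h"
  by (simp add: RS_def sum_distrib_left mult_ac)

lemma TV_scale: "TV n (\<lambda>s t. c * \<beta> s t) = ennreal \<bar>c\<bar> * TV n \<beta>"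
proof -
  have "NV k (\<lambda>s t. c * \<beta> s t) = \<bar>c\<bar> * NV k \<beta>" for k by (simp add: NV_def abs_mult sum_distrib_left)
  then show ?thesis
    unfolding TV_def by (simp add: ennreal_suminf_cmult[symmetric] ennreal_mult'[symmetric] NV_nonneg)
qed

lemma RF_scale:
  assumes "additive_increments \<beta>" "Lipschitz_on L h" "TV 0 \<beta> < \<top>"
  shows "RF (\<lambda>s t. c * \<beta> s t) h = c * RF \<beta> h"
proof -
  have "(\<lambda>k. RS k (\<lambda>s t. c * \<beta> s t) h) \<longlonglongrightarrow> c * RF \<beta> h"
    unfolding RS_scale by (intro tendsto_mult tendsto_const RS_tendsto_RF[OF assms])
  moreover have "TV 0 (\<lambda>s t. c * \<beta> s t) < \<top>"
    using assms(3) by (simp add: TV_scale ennreal_mult_less_top)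
  ultimately show ?thesis by (simp add: RF_def limI)
qed

lemma moment_increments_scale:
  assumes \<beta>: "moment_increments M c \<beta>"
  shows "moment_increments M (\<bar>r\<bar> * c) (\<lambda>\<omega> s t. r * \<beta> \<omega> s t)"
proof -
  have m: "(\<lambda>\<omega>. \<beta> \<omega> s t) \<in> borel_measurable M" for s t using \<beta> by (simp add: moment_increments_def)
  have "(\<integral>\<^sup>+\<omega>. ennreal \<bar>r * \<beta> \<omega> s t\<bar> \<partial>M) \<le> ennreal (\<bar>r\<bar> * c * sqrt (t - s))" if st: "a \<le> s" "s \<le> t" "t \<le> b" for s t
  proof -
    have "(\<integral>\<^sup>+\<omega>. ennreal \<bar>r * \<beta> \<omega> s t\<bar> \<partial>M) = (\<integral>\<^sup>+\<omega>. ennreal \<bar>r\<bar> * ennreal \<bar>\<beta> \<omega> s t\<bar> \<partial>M)"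
      by (simp add: abs_mult ennreal_mult)
    also have "\<dots> = ennreal \<bar>r\<bar> * (\<integral>\<^sup>+\<omega>. ennreal \<bar>\<beta> \<omega> s t\<bar> \<partial>M)"
      using m[of s t] by (intro nn_integral_cmult) measurable
    also have "\<dots> \<le> ennreal \<bar>r\<bar> * ennreal (c * sqrt (t - s))"
      using \<beta> st by (intro mult_left_mono) (auto simp: moment_increments_def)
    also have "\<dots> = ennreal (\<bar>r\<bar> * c * sqrt (t - s))" by (simp add: ennreal_mult'[symmetric] mult.assoc)
    finally show ?thesis .
  qed
  moreover have "additive_increments (\<lambda>s t. r * \<beta> \<omega> s t)" for \<omega>
  proof -
    have "additive_increments (\<beta> \<omega>)" using \<beta> by (simp add: moment_increments_def)
    then show ?thesis unfolding additive_increments_def by (metis distrib_left)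
  qed
  moreover have "0 \<le> \<bar>r\<bar> * c" using \<beta> by (simp add: moment_increments_def)
  ultimately show ?thesis using m unfolding moment_increments_def
    by (intro conjI allI impI borel_measurable_times borel_measurable_const)
qed

text \<open>The factor \<open>- \<sigma>\<close> is built into the increments, so that
  \<open>RF\<close> applied to them is the limit field itself.\<close>

definition white_noise :: "(real \<Rightarrow> 'v \<Rightarrow> real) \<Rightarrow> real \<Rightarrow> 'v \<Rightarrow> real \<Rightarrow> real \<Rightarrow> real" where
  "white_noise W \<sigma> \<omega> s t = - \<sigma> * (W t \<omega> - W s \<omega>)"

lemma white_noise_moment: "wiener N W \<Longrightarrow> moment_increments N \<bar>\<sigma>\<bar> (white_noise W \<sigma>)"
  using moment_increments_scale[OF wiener_increments[of N W], of "- \<sigma>"] by (simp add: white_noise_def[abs_def])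

text \<open>The pathwise functional \<open>RF\<close> is continuous in \<open>x\<close> for every
  path and agrees almost surely, for each fixed \<open>x\<close>, with the Wiener integral of the
  kernel.\<close>

lemma continuous_wiener_field_exists:
  assumes W: "wiener N W" and K: "Lipschitz_kernel L C \<kappa>"
  shows "continuous_wiener_field N W a b \<sigma> \<kappa> (\<lambda>x \<omega>. RF (white_noise W \<sigma> \<omega>) (\<kappa> x))"
  unfolding continuous_wiener_field_def
proof (intro conjI ballI)
  let ?\<beta> = "\<lambda>\<omega> s t. W t \<omega> - W s \<omega>"
  have add: "additive_increments (?\<beta> \<omega>)" for \<omega> by (simp add: additive_increments_def)
  fix x assume x: "x \<in> D"
  have h: "Lipschitz_on L (\<kappa> x)" and C: "\<And>y. y \<in> D \<Longrightarrow> \<bar>\<kappa> x y\<bar> \<le> C" using K x by (auto simp: Lipschitz_kernel_def)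
  have "AE \<omega> in N. RF (white_noise W \<sigma> \<omega>) (\<kappa> x) = - \<sigma> * RF (?\<beta> \<omega>) (\<kappa> x)"
    using moment_AE_finite[OF wiener_increments[OF W]]
    by eventually_elim (use RF_scale[OF add h, of _ "- \<sigma>"] in \<open>simp add: white_noise_def[abs_def]\<close>)
  then show "\<exists>Z. has_wiener_integral N W a b (\<kappa> x) Z \<and> (AE \<omega> in N. RF (white_noise W \<sigma> \<omega>) (\<kappa> x) = - \<sigma> * Z \<omega>)"
    using has_wiener_integral_RF[OF W h C] by blast
next
  have "continuous_on D (\<lambda>x. RF (white_noise W \<sigma> \<omega>) (\<kappa> x))" for \<omega>
    by (intro uniformly_continuous_imp_continuous RF_kernel_uniformly_continuous[OF K])
      (simp add: additive_increments_def white_noise_def algebra_simps)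
  then show "AE \<omega> in N. continuous_on D (\<lambda>x. RF (white_noise W \<sigma> \<omega>) (\<kappa> x))" by simp
qed

lemma continuous_agree_on_rationals:
  fixes f g :: "real \<Rightarrow> real"
  assumes f: "continuous_on D f" and g: "continuous_on D g"
    and eq: "\<And>x. x \<in> D \<inter> \<rat> \<Longrightarrow> f x = g x" and x: "x \<in> D"
  shows "f x = g x"
proof (rule ccontr)
  assume ne: "f x \<noteq> g x"
  let ?U = "D \<inter> (\<lambda>x. f x - g x) -` (- {0})"
  have "open ?U"
    by (rule continuous_open_preimage) (auto intro!: continuous_intros f g)
  moreover have "x \<in> ?U" using x ne by simp
  ultimately obtain e where e: "0 < e" "ball x e \<subseteq> ?U" by (meson open_contains_ball)
  obtain r where r: "r \<in> \<rat>" "x < r" "r < x + e" using Rats_dense_in_real[of x "x + e"] e by auto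
  then have "r \<in> ?U" using e by (intro subsetD[OF e(2)]) (auto simp: dist_real_def)
  then show False using eq[of r] r by simp
qed

text \<open>For fixed \<open>x\<close> the Wiener integral is almost surely unique. The null sets of
  the countably many rational points are united, and continuity carries the equality to all of
  \<open>D\<close>.\<close>

lemma continuous_wiener_field_unique:
  assumes W: "wiener N W" and u: "continuous_wiener_field N W a b \<sigma> \<kappa> u" and v: "continuous_wiener_field N W a b \<sigma> \<kappa> v"
  shows "AE \<omega> in N. \<forall>x\<in>D. u x \<omega> = v x \<omega>"
proof -
  interpret wiener N W by fact
  have x: "AE \<omega> in N. u x \<omega> = v x \<omega>" if xD: "x \<in> D" for x
  proof -
    have *: "\<exists>Z. has_wiener_integral N W a b (\<kappa> x) Z \<and> (AE \<omega> in N. w x \<omega> = - \<sigma> * Z \<omega>)"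
      if "continuous_wiener_field N W a b \<sigma> \<kappa> w" for w
      using that xD unfolding continuous_wiener_field_def by (elim conjE) (rule bspec)
    obtain Z where Z: "has_wiener_integral N W a b (\<kappa> x) Z" "AE \<omega> in N. u x \<omega> = - \<sigma> * Z \<omega>"
      using *[OF u] by (elim exE conjE)
    obtain Z' where Z': "has_wiener_integral N W a b (\<kappa> x) Z'" "AE \<omega> in N. v x \<omega> = - \<sigma> * Z' \<omega>"
      using *[OF v] by (elim exE conjE)
    from Z(2) Z'(2) wiener_integral_unique[OF Z(1) Z'(1)] show ?thesis by eventually_elim simp
  qed
  have "countable (D \<inter> \<rat>)" using countable_rat by (rule countable_Int2)
  then have "AE \<omega> in N. \<forall>x\<in>D \<inter> \<rat>. u x \<omega> = v x \<omega>"
    using x by (subst AE_ball_countable) auto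
  moreover have "AE \<omega> in N. continuous_on D (\<lambda>x. u x \<omega>)" "AE \<omega> in N. continuous_on D (\<lambda>x. v x \<omega>)"
    using u v by (auto simp: continuous_wiener_field_def)
  ultimately show ?thesis
  proof eventually_elim
    case (elim \<omega>)
    show ?case
    proof
      fix x assume x: "x \<in> D"
      show "u x \<omega> = v x \<omega>" by (rule continuous_agree_on_rationals[OF elim(2,3) _ x]) (use elim(1) in blast)
    qed
  qed
qed

end

section \<open>Convergence of the leading term\<close>

locale oscillating = dyadic a b + mixing_field M q \<phi>
  for a b :: real and M :: "'w measure" and q :: "real \<Rightarrow> 'w \<Rightarrow> real" and \<phi> :: "real \<Rightarrow> real"
begin

text \<open>The squared norm of the scaled potential in extended form. Its finiteness, which holds
  almost surely, selects the paths for which the pathwise estimates make sense.\<close>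

definition Q2 :: "real \<Rightarrow> 'w \<Rightarrow> ennreal" where
  "Q2 \<epsilon> \<omega> = (\<integral>\<^sup>+y\<in>{a<..b}. ennreal ((q (y / \<epsilon>) \<omega>)\<^sup>2) \<partial>lborel)"

text \<open>The value 0 on paths with infinite \<open>Q2\<close> and outside the probability space
  makes additivity hold for every \<omega>. Intersecting with \<open>{a<..b}\<close> keeps the
  integral over a bounded set for arbitrary \<open>s\<close> and \<open>t\<close>.\<close>

definition B :: "real \<Rightarrow> 'w \<Rightarrow> real \<Rightarrow> real \<Rightarrow> real" where
  "B \<epsilon> \<omega> s t = (if \<omega> \<in> space M \<and> Q2 \<epsilon> \<omega> < \<top> then - (1 / sqrt \<epsilon>) * (LINT y:{s<..t} \<inter> {a<..b}|lborel. q (y / \<epsilon>) \<omega>) else 0)"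

lemma q_scaled_measurable: "(\<lambda>(y, \<omega>). q (y / \<epsilon>) \<omega>) \<in> borel_measurable (lborel \<Otimes>\<^sub>M M)"
  using measurable_compose[of "\<lambda>(y, \<omega>). (y / \<epsilon>, \<omega>)" "lborel \<Otimes>\<^sub>M M" "lborel \<Otimes>\<^sub>M M", OF _ q_measurable_lborel]
  by (simp add: case_prod_beta')

lemma q_scaled_measurable' [measurable]: "(\<lambda>(\<omega>, y). q (y / \<epsilon>) \<omega>) \<in> borel_measurable (M \<Otimes>\<^sub>M lborel)"
  using measurable_compose[OF measurable_pair_swap'[of M lborel] q_scaled_measurable]
  by (simp add: case_prod_beta')

lemma q_section [measurable]: "\<omega> \<in> space M \<Longrightarrow> (\<lambda>y. q (y / \<epsilon>) \<omega>) \<in> borel_measurable borel"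
  using measurable_compose[OF measurable_Pair1' q_scaled_measurable'[of \<epsilon>], of \<omega>] by simp

lemma Q2_measurable [measurable]: "Q2 \<epsilon> \<in> borel_measurable M"
  unfolding Q2_def by (rule lborel.borel_measurable_nn_integral) measurable

lemma Q2_expectation: "(\<integral>\<^sup>+\<omega>. Q2 \<epsilon> \<omega> \<partial>M) = ennreal ((b - a) * m2)"
proof -
  interpret P: pair_sigma_finite M lborel ..
  have "(\<integral>\<^sup>+\<omega>. Q2 \<epsilon> \<omega> \<partial>M) = (\<integral>\<^sup>+y. \<integral>\<^sup>+\<omega>. ennreal ((q (y / \<epsilon>) \<omega>)\<^sup>2) * indicator {a<..b} y \<partial>M \<partial>lborel)"
    unfolding Q2_def by (rule P.Fubini'[symmetric]) measurable
  also have "\<dots> = (\<integral>\<^sup>+y. ennreal m2 * indicator {a<..b} y \<partial>lborel)"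
  proof (rule nn_integral_cong)
    fix y
    have "(\<integral>\<^sup>+\<omega>. ennreal ((q (y / \<epsilon>) \<omega>)\<^sup>2) \<partial>M) = ennreal m2"
      using nn_integral_eq_integral[OF q_power_integrable[of 2 "y / \<epsilon>"]] by (simp add: moment_stationary[of "y / \<epsilon>" 2])
    then show "(\<integral>\<^sup>+\<omega>. ennreal ((q (y / \<epsilon>) \<omega>)\<^sup>2) * indicator {a<..b} y \<partial>M) = ennreal m2 * indicator {a<..b} y"
      by (simp add: nn_integral_multc)
  qed
  also have "\<dots> = ennreal ((b - a) * m2)"
    using ab m2_nonneg by (subst nn_integral_cmult_indicator) (auto simp: ennreal_mult mult.commute)
  finally show ?thesis .
qed

lemma AE_Q2: "AE \<omega> in M. Q2 \<epsilon> \<omega> < \<top>"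
proof -
  have "AE \<omega> in M. Q2 \<epsilon> \<omega> \<noteq> \<infinity>" by (rule nn_integral_PInf_AE) (auto simp: Q2_expectation)
  then show ?thesis by eventually_elim (simp add: less_top)
qed

lemma q_square_integrable:
  assumes "Q2 \<epsilon> \<omega> < \<top>" "\<omega> \<in> space M"
  shows "set_integrable lborel {a<..b} (\<lambda>y. (q (y / \<epsilon>) \<omega>)\<^sup>2)"
    "(LINT y:{a<..b}|lborel. (q (y / \<epsilon>) \<omega>)\<^sup>2) = enn2real (Q2 \<epsilon> \<omega>)"
proof -
  note [measurable] = q_section[OF assms(2), of \<epsilon>]
  have eq: "(\<integral>\<^sup>+y. ennreal (indicator {a<..b} y * (q (y / \<epsilon>) \<omega>)\<^sup>2) \<partial>lborel) = Q2 \<epsilon> \<omega>"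
    unfolding Q2_def by (intro nn_integral_cong) (auto simp: indicator_def)
  show "set_integrable lborel {a<..b} (\<lambda>y. (q (y / \<epsilon>) \<omega>)\<^sup>2)"
    unfolding set_integrable_def
    by (rule integrableI_bounded) (use assms eq in \<open>auto simp: less_top\<close>)
  show "(LINT y:{a<..b}|lborel. (q (y / \<epsilon>) \<omega>)\<^sup>2) = enn2real (Q2 \<epsilon> \<omega>)"
    unfolding set_lebesgue_integral_def eq[symmetric] by (subst integral_eq_nn_integral) auto
qed

lemma q_set_integrable:
  assumes "Q2 \<epsilon> \<omega> < \<top>" "\<omega> \<in> space M"
  shows "set_integrable lborel {a<..b} (\<lambda>y. q (y / \<epsilon>) \<omega>)"
proof -
  note [measurable] = q_section[OF assms(2), of \<epsilon>]
  have "set_integrable lborel {a<..b} (\<lambda>y. 1 + (q (y / \<epsilon>) \<omega>)\<^sup>2)"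
    by (intro set_integral_add q_square_integrable[OF assms])
      (auto simp: set_integrable_def emeasure_Ioc_real intro!: integrable_real_indicator)
  then show ?thesis unfolding set_integrable_def
  proof (rule Bochner_Integration.integrable_bound)
    show "AE y in lborel. norm (indicat_real {a<..b} y *\<^sub>R q (y / \<epsilon>) \<omega>) \<le> norm (indicat_real {a<..b} y *\<^sub>R (1 + (q (y / \<epsilon>) \<omega>)\<^sup>2))"
    proof (rule AE_I2)
      fix y
      show "norm (indicat_real {a<..b} y *\<^sub>R q (y / \<epsilon>) \<omega>) \<le> norm (indicat_real {a<..b} y *\<^sub>R (1 + (q (y / \<epsilon>) \<omega>)\<^sup>2))"
        using abs_mult_le_squares[of "q (y / \<epsilon>) \<omega>" 1] by (simp add: indicator_def)
    qed
  qed measurable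
qed

lemma B_rv [measurable]: "(\<lambda>\<omega>. B \<epsilon> \<omega> s t) \<in> borel_measurable M"
proof -
  have [measurable]: "(\<lambda>\<omega>. LINT y:{s<..t} \<inter> {a<..b}|lborel. q (y / \<epsilon>) \<omega>) \<in> borel_measurable M"
    unfolding set_lebesgue_integral_def by (rule lborel.borel_measurable_lebesgue_integral) measurable
  have "(\<lambda>\<omega>. B \<epsilon> \<omega> s t) \<in> borel_measurable M \<longleftrightarrow> (\<lambda>\<omega>. if Q2 \<epsilon> \<omega> < \<top> then - (1 / sqrt \<epsilon>) * (LINT y:{s<..t} \<inter> {a<..b}|lborel. q (y / \<epsilon>) \<omega>) else 0) \<in> borel_measurable M"
    by (rule measurable_cong) (simp add: B_def)
  then show ?thesis by (rule iffD2) measurable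
qed

lemma B_eq:
  assumes "\<omega> \<in> space M" "Q2 \<epsilon> \<omega> < \<top>" "a \<le> s" "t \<le> b"
  shows "B \<epsilon> \<omega> s t = - (1 / sqrt \<epsilon>) * (LINT y:{s<..t}|lborel. q (y / \<epsilon>) \<omega>)"
proof -
  have "{s<..t} \<inter> {a<..b} = {s<..t}" using assms by auto
  then show ?thesis using assms by (simp add: B_def)
qed

lemma B_X:
  assumes "0 < \<epsilon>" "\<omega> \<in> space M" "Q2 \<epsilon> \<omega> < \<top>" "a \<le> s" "t \<le> b"
  shows "B \<epsilon> \<omega> s t = - X \<epsilon> s t \<omega>"
proof -
  have "(LINT y:{s<..t}|lborel. q (y / \<epsilon>) \<omega>) = \<epsilon> * (LINT z|lborel. indicator {s<..t} (\<epsilon> * z) * q z \<omega>)"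
    unfolding set_lebesgue_integral_def
    using lborel_integral_real_affine[of \<epsilon> "\<lambda>y. indicator {s<..t} y * q (y / \<epsilon>) \<omega>" 0] assms by simp
  also have "(LINT z|lborel. indicator {s<..t} (\<epsilon> * z) * q z \<omega>) = I (s / \<epsilon>) (t / \<epsilon>) \<omega>"
    unfolding I_def set_lebesgue_integral_def using assms
    by (intro Bochner_Integration.integral_cong) (auto simp: indicator_def field_simps)
  finally have "B \<epsilon> \<omega> s t = - (1 / sqrt \<epsilon> * \<epsilon>) * I (s / \<epsilon>) (t / \<epsilon>) \<omega>"
    using assms by (simp add: B_eq)
  moreover have "1 / sqrt \<epsilon> * \<epsilon> = sqrt \<epsilon>" using assms(1) real_div_sqrt[of \<epsilon>] by simp
  ultimately show ?thesis by (simp only: X_def mult_minus_left)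
qed

lemma B_additive:
  "additive_increments (B \<epsilon> \<omega>)"
proof (cases "\<omega> \<in> space M \<and> Q2 \<epsilon> \<omega> < \<top>")
  case True
  then have T: "\<omega> \<in> space M" "Q2 \<epsilon> \<omega> < \<top>" by auto
  show ?thesis unfolding additive_increments_def
  proof (intro allI impI)
    fix s t u assume st: "a \<le> s" "s \<le> t" "t \<le> u" "u \<le> b"
    have un: "{s<..u} = {s<..t} \<union> {t<..u}" using st by auto
    have "(LINT y:{s<..u}|lborel. q (y / \<epsilon>) \<omega>) = (LINT y:{s<..t}|lborel. q (y / \<epsilon>) \<omega>) + (LINT y:{t<..u}|lborel. q (y / \<epsilon>) \<omega>)"
      unfolding un
      by (rule set_integral_Un) (use st in \<open>auto intro: set_integrable_subset[OF q_set_integrable[OF T(2,1)]]\<close>)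
    then show "B \<epsilon> \<omega> s u = B \<epsilon> \<omega> s t + B \<epsilon> \<omega> t u"
      using st T by (simp add: B_eq ring_distribs)
  qed
qed (auto simp: B_def additive_increments_def)

end

context oscillating
begin

lemma B_moment:
  assumes e: "0 < \<epsilon>"
  shows "moment_increments M (sqrt RI) (B \<epsilon>)"
proof -
  have "(\<integral>\<^sup>+\<omega>. ennreal \<bar>B \<epsilon> \<omega> s t\<bar> \<partial>M) \<le> ennreal (sqrt RI * sqrt (t - s))" if st: "a \<le> s" "s \<le> t" "t \<le> b" for s t
  proof -
    have "AE \<omega> in M. B \<epsilon> \<omega> s t = - X \<epsilon> s t \<omega>"
      using AE_Q2[of \<epsilon>] AE_space by eventually_elim (use e st in \<open>simp add: B_X\<close>)
    then have "(\<integral>\<^sup>+\<omega>. ennreal \<bar>B \<epsilon> \<omega> s t\<bar> \<partial>M) = (\<integral>\<^sup>+\<omega>. ennreal \<bar>X \<epsilon> s t \<omega>\<bar> \<partial>M)"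
      by (intro nn_integral_cong_AE) (auto elim: eventually_mono)
    also have "\<dots> = ennreal (expectation (\<lambda>\<omega>. \<bar>X \<epsilon> s t \<omega>\<bar>))"
      using X_integrable by (intro nn_integral_eq_integral) auto
    also have "\<dots> \<le> ennreal (sqrt (RI * (t - s)))" by (intro ennreal_leI X_abs_le e st)
    finally show ?thesis by (simp add: real_sqrt_mult)
  qed
  then show ?thesis using RI_nonneg B_additive B_rv unfolding moment_increments_def
    by (intro conjI allI impI real_sqrt_ge_zero)
qed

text \<open>A Riemann sum against \<open>B\<close> is an ordinary integral of the midpoint step
  function times the potential. The step functions converge uniformly to \<open>h\<close> on
  \<open>D\<close>, and the potential is integrable.\<close>

lemma B_RS_tendsto:
  fixes h :: "real \<Rightarrow> real"
  assumes \<omega>: "\<omega> \<in> space M" "Q2 \<epsilon> \<omega> < \<top>" and h: "Lipschitz_on L h" and C: "\<And>x. x \<in> D \<Longrightarrow> \<bar>h x\<bar> \<le> C"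
  shows "(\<lambda>k. RS k (B \<epsilon> \<omega>) h) \<longlonglongrightarrow> - (1 / sqrt \<epsilon>) * (LINT y:D|lborel. h y * q (y / \<epsilon>) \<omega>)"
proof -
  define g where "g y = indicator {a<..b} y * q (y / \<epsilon>) \<omega>" for y
  have g: "integrable lborel g"
    using q_set_integrable[OF \<omega>(2,1)] by (simp add: set_integrable_def g_def[abs_def])
  have [measurable]: "(\<lambda>y. q (y / \<epsilon>) \<omega>) \<in> borel_measurable borel" using q_section[OF \<omega>(1)] .
  have [measurable]: "(\<lambda>y. indicator D y * h y) \<in> borel_measurable lborel"
    using borel_measurable_continuous_on_indicator[OF _ Lipschitz_on_continuous[OF h]] by simp
  have L0: "0 \<le> L" using h by (simp add: Lipschitz_on_def)
  have RS: "RS k (B \<epsilon> \<omega>) h = - (1 / sqrt \<epsilon>) * (LINT y|lborel. indicator D y * step_function (riemann_step k h) y * g y)" for k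
  proof -
    have "RS k (B \<epsilon> \<omega>) h = - (1 / sqrt \<epsilon>) * (\<Sum>j<2 ^ k. LINT y|lborel. h (mid k j) * indicator {grid k j<..grid k (Suc j)} y * g y)"
    proof -
      have "B \<epsilon> \<omega> (grid k j) (grid k (Suc j)) = - (1 / sqrt \<epsilon>) * (LINT y|lborel. indicator {grid k j<..grid k (Suc j)} y * g y)" if "j < 2 ^ k" for j
        using \<omega> that grid_in[of j k] grid_in[of "Suc j" k]
        by (subst B_eq) (auto simp: set_lebesgue_integral_def g_def indicator_def intro!: Bochner_Integration.integral_cong)
      then show ?thesis unfolding RS_def sum_distrib_left
        by (intro sum.cong refl) (simp add: mult.assoc)
    qed
    also have "(\<Sum>j<2 ^ k. LINT y|lborel. h (mid k j) * indicator {grid k j<..grid k (Suc j)} y * g y)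
        = (LINT y|lborel. (\<Sum>j<2 ^ k. h (mid k j) * indicator {grid k j<..grid k (Suc j)} y * g y))"
    proof (rule Bochner_Integration.integral_sum[symmetric])
      fix j
      have "integrable lborel (\<lambda>y. indicator {grid k j<..grid k (Suc j)} y *\<^sub>R g y)"
        by (rule integrable_mult_indicator[OF _ g]) simp
      then show "integrable lborel (\<lambda>y. h (mid k j) * indicator {grid k j<..grid k (Suc j)} y * g y)"
        by (simp add: mult.assoc)
    qed
    also have "\<dots> = (LINT y|lborel. indicator D y * step_function (riemann_step k h) y * g y)"
    \<comment> \<open>The last cell contains \<open>b\<close>, whereas \<open>D\<close> does not;
      the two integrands may differ at this one point.\<close>
    proof (rule integral_cong_AE)
      have sf: "step_function (riemann_step k h) y = (\<Sum>j<2 ^ k. h (mid k j) * indicator {grid k j<..grid k (Suc j)} y)" for y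
        by (simp add: step_function_def riemann_step_def interv_sum_list_conv_sum_set_nat atLeast0LessThan o_def)
      show "AE y in lborel. (\<Sum>j<2 ^ k. h (mid k j) * indicator {grid k j<..grid k (Suc j)} y * g y)
          = indicator D y * step_function (riemann_step k h) y * g y"
        using AE_lborel_singleton[of b]
        by eventually_elim (auto simp: sf sum_distrib_right[symmetric] g_def indicator_def)
    qed (use borel_measurable_integrable[OF g] in measurable)
    finally show ?thesis .
  qed
  have "(\<lambda>k. LINT y|lborel. indicator D y * step_function (riemann_step k h) y * g y)
      \<longlonglongrightarrow> (LINT y|lborel. indicator D y * h y * g y)"
  proof (rule integral_dominated_convergence[where w = "\<lambda>y. (C + L * (b - a)) * \<bar>g y\<bar>"])
    show "AE y in lborel. (\<lambda>k. indicator D y * step_function (riemann_step k h) y * g y) \<longlonglongrightarrow> indicator D y * h y * g y"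
    proof (rule AE_I2)
      fix y
      show "(\<lambda>k. indicator D y * step_function (riemann_step k h) y * g y) \<longlonglongrightarrow> indicator D y * h y * g y"
      proof (cases "y \<in> D")
        case True
        have lim: "(\<lambda>k. L * ((b - a) * (1 / 2) ^ k)) \<longlonglongrightarrow> 0"
          by (intro tendsto_mult_right_zero LIMSEQ_realpow_zero) auto
        have "norm (step_function (riemann_step k h) y - h y) \<le> L * ((b - a) * (1 / 2) ^ k)" for k
          using step_function_riemann_step[OF h True, of k] by (simp add: power_one_over)
        then have "(\<lambda>k. step_function (riemann_step k h) y - h y) \<longlonglongrightarrow> 0"
          by (intro Lim_null_comparison[OF _ lim] always_eventually allI)
        then have "(\<lambda>k. step_function (riemann_step k h) y) \<longlonglongrightarrow> h y" by (simp add: LIM_zero_iff)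
        then show ?thesis by (intro tendsto_mult tendsto_const)
      qed simp
    qed
    show "AE y in lborel. norm (indicator D y * step_function (riemann_step k h) y * g y) \<le> (C + L * (b - a)) * \<bar>g y\<bar>" for k
    proof (rule AE_I2)
      fix y
      show "norm (indicator D y * step_function (riemann_step k h) y * g y) \<le> (C + L * (b - a)) * \<bar>g y\<bar>"
      proof (cases "y \<in> D")
        case True
        have "L * ((b - a) / 2 ^ k) \<le> L * ((b - a) / 1)"
          using L0 ab by (intro mult_left_mono divide_left_mono) auto
        then have "\<bar>step_function (riemann_step k h) y\<bar> \<le> C + L * (b - a)"
          using step_function_riemann_step[OF h True, of k] C[OF True] by simp
        then show ?thesis using True by (simp add: abs_mult mult_right_mono)
      next
        case False
        have "0 \<le> C" using order_trans[OF abs_ge_zero C[of "(a + b) / 2"]] ab by simp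
        then show ?thesis using False L0 ab by simp
      qed
    qed
    show "integrable lborel (\<lambda>y. (C + L * (b - a)) * \<bar>g y\<bar>)" using g by simp
  qed (use borel_measurable_integrable[OF g] in measurable)
  then have "(\<lambda>k. RS k (B \<epsilon> \<omega>) h) \<longlonglongrightarrow> - (1 / sqrt \<epsilon>) * (LINT y|lborel. indicator D y * h y * g y)"
    unfolding RS by (intro tendsto_mult tendsto_const)
  moreover have "(LINT y|lborel. indicator D y * h y * g y) = (LINT y:D|lborel. h y * q (y / \<epsilon>) \<omega>)"
    unfolding set_lebesgue_integral_def by (intro Bochner_Integration.integral_cong) (auto simp: g_def indicator_def)
  ultimately show ?thesis by simp
qed

text \<open>Both sides are limits of the same Riemann sums. This brings the functional
  \<open>RF\<close> back to the integral in the expansion of the solution.\<close>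

lemma B_RF:
  fixes h :: "real \<Rightarrow> real"
  assumes "\<omega> \<in> space M" "Q2 \<epsilon> \<omega> < \<top>" "TV 0 (B \<epsilon> \<omega>) < \<top>" "Lipschitz_on L h" "\<And>x. x \<in> D \<Longrightarrow> \<bar>h x\<bar> \<le> C"
  shows "RF (B \<epsilon> \<omega>) h = - (1 / sqrt \<epsilon>) * (LINT y:D|lborel. h y * q (y / \<epsilon>) \<omega>)"
  by (rule LIMSEQ_unique[OF RS_tendsto_RF[OF B_additive assms(4,3)] B_RS_tendsto[OF assms(1,2,4,5)]])

text \<open>What has to be checked for \<open>field_convergence\<close> is the joint convergence of
  the increments over one dyadic grid. The cells have equal length, so
  \<open>joint_increment_convergence\<close> applies, and \<sigma> enters through the variance of
  \<xi>.\<close>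

theorem leading_term_convergence:
  fixes \<sigma> :: real and N :: "'v measure"
  assumes K: "Lipschitz_kernel L C \<kappa>" and W: "wiener N W" and \<sigma>: "\<sigma>\<^sup>2 = \<sigma>2"
    and f: "bounded_Lipschitz (C_metric D) Bf Lf f"
  shows "((\<lambda>\<epsilon>. LINT \<omega>|M. f (\<lambda>x\<in>D. RF (B \<epsilon> \<omega>) (\<kappa> x))) \<longlongrightarrow> (LINT \<omega>|N. f (\<lambda>x\<in>D. RF (white_noise W \<sigma> \<omega>) (\<kappa> x)))) (at_right 0)"
proof (rule field_convergence[OF prob_space_axioms _ K B_moment white_noise_moment[OF W] _ f])
  interpret N: wiener N W by fact
  show "prob_space N" by (rule N.prob_space_axioms)
  fix k :: nat and F :: "(nat \<Rightarrow> real) \<Rightarrow> real" and Bd Ld :: real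
  assume FB: "\<And>x. \<bar>F x\<bar> \<le> Bd" and FL: "\<And>x y. \<bar>F x - F y\<bar> \<le> Ld * (\<Sum>j<2 ^ k. \<bar>x j - y j\<bar>)" and Ld: "0 \<le> Ld"
  let ?l = "(b - a) / 2 ^ k"
  define \<xi> where "\<xi> j \<omega> = \<sigma> * (W (grid k (Suc j)) \<omega> - W (grid k j) \<omega>)" for j \<omega>
  have gs: "grid k j < grid k (Suc j)" for j using spacing_pos[of k] by (simp add: grid_Suc)
  have "N.indep_vars (\<lambda>_. borel) (\<lambda>j \<omega>. W (grid k (Suc j)) \<omega> - W (grid k j) \<omega>) {..<2 ^ k}"
  proof -
    have "strict_mono (grid k)" using gs by (rule strict_mono_Suc_iff[THEN iffD2, rule_format])
    then have "strict_mono_on {..2 ^ k} (grid k)" by (simp add: strict_mono_def strict_mono_on_def)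
    then show ?thesis using N.wiener by (simp add: standard_wiener_process_def)
  qed
  then have indep: "N.indep_vars (\<lambda>_. borel) \<xi> {..<2 ^ k}"
    unfolding \<xi>_def[abs_def] by (rule N.indep_vars_compose2[where Y = "\<lambda>_ x. \<sigma> * x"]) simp
  \<comment> \<open>\<open>B\<close> is \<open>- X\<close> and the white noise is
    \<open>- \<xi>\<close>, so the convergence of \<open>X\<close> to \<xi> is tested on
    \<open>F\<close> composed with negation.\<close>
  have "((\<lambda>\<epsilon>. expectation (\<lambda>\<omega>. F (\<lambda>i. - X \<epsilon> (a + real i * ?l) (a + real (Suc i) * ?l) \<omega>))) \<longlongrightarrow> (LINT \<omega>|N. F (\<lambda>j. - \<xi> j \<omega>))) (at_right 0)"
  proof (rule joint_increment_convergence[where F = "\<lambda>x. F (\<lambda>j. - x j)" and B = Bd and L = Ld and m = "2 ^ k" and \<xi> = \<xi>, OF N.prob_space_axioms _ indep])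
    show "\<xi> j \<in> borel_measurable N" for j unfolding \<xi>_def[abs_def] by measurable
    show "(CLINT \<omega>|N. iexp (\<theta> * \<xi> j \<omega>)) = complex_of_real (exp (- \<theta>\<^sup>2 * \<sigma>2 * ?l / 2))" for j \<theta>
      using N.increment_char[OF gs[of j], of "\<theta> * \<sigma>"] unfolding \<xi>_def
      by (simp add: grid_Suc power_mult_distrib \<sigma> mult_ac)
    show "integrable N (\<lambda>\<omega>. (\<xi> j \<omega>)\<^sup>2)" for j
      using N.increment_square(1) by (simp add: \<xi>_def power_mult_distrib)
    show "\<bar>F (\<lambda>j. - x j) - F (\<lambda>j. - y j)\<bar> \<le> Ld * (\<Sum>j<2 ^ k. \<bar>x j - y j\<bar>)" for x y
      using FL[of "\<lambda>j. - x j" "\<lambda>j. - y j"] by (simp add: abs_minus_commute)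
  qed (use FB Ld spacing_pos in auto)
  moreover have "\<forall>\<^sub>F \<epsilon> in at_right 0. expectation (\<lambda>\<omega>. F (\<lambda>i. - X \<epsilon> (a + real i * ?l) (a + real (Suc i) * ?l) \<omega>))
      = (LINT \<omega>|M. F (\<lambda>j. B \<epsilon> \<omega> (grid k j) (grid k (Suc j))))"
    using eventually_at_right_less[of "0 :: real"]
  proof eventually_elim
    case (elim \<epsilon>)
    \<comment> \<open>The Lipschitz bound shows that \<open>F\<close> depends only on the first
      \<open>2^k\<close> coordinates; the identity \<open>B = - X\<close> is available only
      there.\<close>
    have cong: "F x = F y" if "\<And>j. j < 2 ^ k \<Longrightarrow> x j = y j" for x y
      using FL[of x y] that by simp
    show ?case
    proof (rule integral_cong_AE)
      show "AE \<omega> in M. F (\<lambda>i. - X \<epsilon> (a + real i * ?l) (a + real (Suc i) * ?l) \<omega>) = F (\<lambda>j. B \<epsilon> \<omega> (grid k j) (grid k (Suc j)))"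
        using AE_Q2[of \<epsilon>] AE_space
      proof eventually_elim
        case (elim \<omega>)
        have "a \<le> grid k j" "grid k (Suc j) \<le> b" if "j < 2 ^ k" for j
          using grid_in[of j k] grid_in[of "Suc j" k] that by auto
        then have BX: "B \<epsilon> \<omega> (grid k j) (grid k (Suc j)) = - X \<epsilon> (grid k j) (grid k (Suc j)) \<omega>" if "j < 2 ^ k" for j
          using that elim \<open>0 < \<epsilon>\<close> by (intro B_X) auto
        show ?case by (rule cong) (simp only: BX, simp only: grid_def)
      qed
    qed (auto intro!: borel_measurable_Lipschitz_coordinates[OF FL Ld])
  qed
  ultimately have "((\<lambda>\<epsilon>. LINT \<omega>|M. F (\<lambda>j. B \<epsilon> \<omega> (grid k j) (grid k (Suc j)))) \<longlongrightarrow> (LINT \<omega>|N. F (\<lambda>j. - \<xi> j \<omega>))) (at_right 0)"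
    by (rule Lim_transform_eventually)
  then show "((\<lambda>\<epsilon>. LINT \<omega>|M. F (\<lambda>j. B \<epsilon> \<omega> (grid k j) (grid k (Suc j)))) \<longlongrightarrow>
      (LINT \<omega>|N. F (\<lambda>j. white_noise W \<sigma> \<omega> (grid k j) (grid k (Suc j))))) (at_right 0)"
    by (simp add: white_noise_def \<xi>_def)
qed

end

section \<open>Approximation in \<open>L\<^sup>2\<close> by a countable family\<close>

context dyadic
begin

text \<open>Step functions on equal cells, coded by the list of their values; the length of the list
  is the number of cells. Rational lists give a countable dense family in \<open>L2 D\<close>, on
  which the operator norm can be tested measurably.\<close>

definition dyadic_step :: "real list \<Rightarrow> real \<Rightarrow> real" where
  "dyadic_step cs x = (\<Sum>j<length cs. cs ! j * indicator {a + real j * ((b - a) / real (length cs))<..a + real (Suc j) * ((b - a) / real (length cs))} x)"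

lemma dyadic_step_measurable [measurable]: "dyadic_step cs \<in> borel_measurable borel"
  unfolding dyadic_step_def[abs_def] by measurable

lemma set_integrable_const_D: "set_integrable lborel D (\<lambda>_. c :: real)"
  by (rule set_integrable_bounded_continuous[OF refl]) (auto simp: image_constant_conv)

lemma L2_bounded:
  assumes m: "set_borel_measurable lborel D u" and C: "\<And>x. x \<in> D \<Longrightarrow> \<bar>u x\<bar> \<le> C"
  shows "u \<in> L2 D"
proof -
  have "(\<lambda>x. (indicator D x * u x)\<^sup>2) \<in> borel_measurable lborel"
    using m by (simp add: set_borel_measurable_def)
  moreover have "(\<lambda>x. (indicator D x * u x)\<^sup>2) = (\<lambda>x. indicat_real D x *\<^sub>R (u x)\<^sup>2)" by (auto simp: indicator_def fun_eq_iff)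
  ultimately have m2: "(\<lambda>x. indicat_real D x *\<^sub>R (u x)\<^sup>2) \<in> borel_measurable lborel" by simp
  have "(u x)\<^sup>2 \<le> C\<^sup>2" if "x \<in> D" for x using power_mono[OF C[OF that], of 2] by simp
  then have "set_integrable lborel D (\<lambda>x. (u x)\<^sup>2)" unfolding set_integrable_def
    by (intro Bochner_Integration.integrable_bound[OF set_integrable_const_D[of "C\<^sup>2", unfolded set_integrable_def] m2])
      (auto simp: indicator_def)
  then show ?thesis using m by (simp add: L2_def)
qed

lemma dyadic_step_L2: "dyadic_step cs \<in> L2 D"
proof (rule L2_bounded)
  show "\<bar>dyadic_step cs x\<bar> \<le> (\<Sum>j<length cs. \<bar>cs ! j\<bar>)" for x
    unfolding dyadic_step_def by (rule order_trans[OF sum_abs sum_mono]) (auto simp: indicator_def)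
qed (simp add: set_borel_measurable_def)

lemma L2_norm_tendsto_dominated:
  assumes f: "\<And>n. f n \<in> L2 D" and u: "u \<in> L2 D"
    and lim: "AE x in lborel. x \<in> D \<longrightarrow> (\<lambda>n. f n x) \<longlonglongrightarrow> u x"
    and w: "set_integrable lborel D w" "\<And>n. AE x in lborel. x \<in> D \<longrightarrow> (f n x - u x)\<^sup>2 \<le> w x"
  shows "(\<lambda>n. L2_norm D (\<lambda>x. f n x - u x)) \<longlonglongrightarrow> 0"
proof -
  have m: "(\<lambda>x. indicator D x * f n x) \<in> borel_measurable lborel" "(\<lambda>x. indicator D x * u x) \<in> borel_measurable lborel" for n
    using f[of n] u by (simp_all add: L2_def set_borel_measurable_def)
  have "(\<lambda>x. (indicator D x * f n x - indicator D x * u x)\<^sup>2) \<in> borel_measurable lborel" for n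
    using m by measurable
  moreover have "(\<lambda>x. (indicator D x * f n x - indicator D x * u x)\<^sup>2) = (\<lambda>x. indicat_real D x *\<^sub>R (f n x - u x)\<^sup>2)" for n
    by (auto simp: indicator_def fun_eq_iff)
  ultimately have m2: "(\<lambda>x. indicat_real D x *\<^sub>R (f n x - u x)\<^sup>2) \<in> borel_measurable lborel" for n by simp
  have "(\<lambda>n. LINT x|lborel. indicat_real D x *\<^sub>R (f n x - u x)\<^sup>2) \<longlonglongrightarrow> (LINT x|(lborel :: real measure). (0 :: real))"
  proof (rule integral_dominated_convergence[where f = "\<lambda>_ :: real. 0 :: real" and w = "\<lambda>x. indicator D x *\<^sub>R w x"])
    show "AE x in lborel. (\<lambda>n. indicat_real D x *\<^sub>R (f n x - u x)\<^sup>2) \<longlonglongrightarrow> 0"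
      using lim
    proof eventually_elim
      case (elim x)
      show ?case
      proof (cases "x \<in> D")
        case True
        have "(\<lambda>n. (f n x - u x)\<^sup>2) \<longlonglongrightarrow> (u x - u x)\<^sup>2" using elim True by (intro tendsto_power tendsto_diff tendsto_const) auto
        then show ?thesis using True by simp
      qed simp
    qed
    show "AE x in lborel. norm (indicat_real D x *\<^sub>R (f n x - u x)\<^sup>2) \<le> indicator D x *\<^sub>R w x" for n
      using w(2)[of n] by eventually_elim (auto simp: indicator_def)
  qed (use m2 w(1) in \<open>auto simp: set_integrable_def\<close>)
  then show ?thesis unfolding L2_norm_def set_lebesgue_integral_def
    using tendsto_real_sqrt[of _ 0] by simp
qed

lemma dyadic_step_approximates_continuous:
  assumes g: "continuous_on {a..b} g" and e: "0 < e"
  obtains cs where "set cs \<subseteq> \<rat>" "\<And>x. x \<in> D \<Longrightarrow> \<bar>dyadic_step cs x - g x\<bar> \<le> e"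
proof -
  have "uniformly_continuous_on {a..b} g" using g by (intro compact_uniformly_continuous) auto
  then obtain d where d: "0 < d" "\<And>x y. x \<in> {a..b} \<Longrightarrow> y \<in> {a..b} \<Longrightarrow> dist y x < d \<Longrightarrow> dist (g y) (g x) < e / 2"
    using e unfolding uniformly_continuous_on_def by (meson half_gt_zero)
  obtain k where k: "(1 / 2 :: real) ^ k < d / (b - a)"
    using real_arch_pow_inv[of "d / (b - a)" "1 / 2"] d(1) ab by auto
  have kd: "(b - a) / 2 ^ k < d" using k ab by (simp add: power_one_over field_simps)
  have "\<exists>r\<in>\<rat>. g (mid k j) < r \<and> r < g (mid k j) + e / 2" for j
    using Rats_dense_in_real[of "g (mid k j)" "g (mid k j) + e / 2"] e by auto
  then obtain r where r: "\<And>j. r j \<in> \<rat>" "\<And>j. g (mid k j) < r j" "\<And>j. r j < g (mid k j) + e / 2" by metis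
  define cs where "cs = map r [0..<2 ^ k]"
  show ?thesis
  proof (rule that[of cs])
    show "set cs \<subseteq> \<rat>" using r(1) by (auto simp: cs_def)
    fix x assume x: "x \<in> D"
    let ?i = "\<lambda>j. indicator {grid k j<..grid k (Suc j)} x :: real"
    have "dyadic_step cs x = (\<Sum>j<2 ^ k. r j * ?i j)"
      unfolding dyadic_step_def by (simp add: cs_def grid_def)
    moreover have "g x = (\<Sum>j<2 ^ k. g x * ?i j)" unfolding sum_distrib_left[symmetric] grid_cover[OF x] by simp
    ultimately have eq: "dyadic_step cs x - g x = (\<Sum>j<2 ^ k. (r j - g x) * ?i j)"
      by (simp add: sum_subtractf left_diff_distrib)
    have "\<bar>dyadic_step cs x - g x\<bar> \<le> (\<Sum>j<2 ^ k. e * ?i j)" unfolding eq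
    proof (rule order_trans[OF sum_abs sum_mono])
      fix j :: nat assume j: "j \<in> {..<2 ^ k}"
      show "\<bar>(r j - g x) * ?i j\<bar> \<le> e * ?i j"
      proof (cases "x \<in> {grid k j<..grid k (Suc j)}")
        case True
        define s where "s = (b - a) / 2 ^ k"
        have "mid k j = grid k j + s / 2" "mid k j = grid k (Suc j) - s / 2" using mid_grid[of k j] unfolding s_def by auto
        then have "\<bar>mid k j - x\<bar> \<le> s" using True by auto
        then have "dist (mid k j) x < d" using kd by (simp add: s_def dist_real_def)
        then have "dist (g (mid k j)) (g x) < e / 2" using x mid_in[of j k] j by (intro d(2)) auto
        then have "\<bar>r j - g x\<bar> \<le> e" using r(2)[of j] r(3)[of j] unfolding dist_real_def by linarith
        then show ?thesis using True by simp
      qed simp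
    qed
    also have "\<dots> = e" unfolding sum_distrib_left[symmetric] grid_cover[OF x] by simp
    finally show "\<bar>dyadic_step cs x - g x\<bar> \<le> e" .
  qed
qed

text \<open>Three limits: step functions approximate continuous functions uniformly, continuous
  functions approximate a measurable function almost everywhere, and truncation at height
  \<open>m\<close> supplies the domination needed for both the bounded and the general case.\<close>

lemma L2_induct_dense [consumes 1, case_names limit step]:
  assumes u: "u \<in> L2 D"
    and limit: "\<And>f u. (\<And>n :: nat. f n \<in> L2 D) \<Longrightarrow> u \<in> L2 D \<Longrightarrow> (\<lambda>n. L2_norm D (\<lambda>x. f n x - u x)) \<longlonglongrightarrow> 0 \<Longrightarrow> (\<And>n. P (f n)) \<Longrightarrow> P u"
    and step: "\<And>cs. set cs \<subseteq> \<rat> \<Longrightarrow> P (dyadic_step cs)"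
  shows "P u"
proof -
  have cont: "P g" if g: "continuous_on {a..b} g" for g
  proof -
    have "\<exists>cs. set cs \<subseteq> \<rat> \<and> (\<forall>x\<in>D. \<bar>dyadic_step cs x - g x\<bar> \<le> inverse (real (Suc n)))" for n
      by (rule dyadic_step_approximates_continuous[OF g, of "inverse (real (Suc n))"]) auto
    then obtain cs where cs: "\<And>n. set (cs n) \<subseteq> \<rat>" "\<And>n x. x \<in> D \<Longrightarrow> \<bar>dyadic_step (cs n) x - g x\<bar> \<le> inverse (real (Suc n))"
      by metis
    have "bounded (g ` {a..b})" by (intro compact_imp_bounded compact_continuous_image g) simp
    then obtain C where "\<forall>y\<in>g ` {a..b}. norm y \<le> C" unfolding bounded_iff ..
    then have C: "\<bar>g x\<bar> \<le> C" if "x \<in> {a..b}" for x using that by auto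
    have gL2: "g \<in> L2 D"
      by (rule L2_bounded_continuous[of _ C]) (use C g in \<open>auto intro: continuous_on_subset\<close>)
    show ?thesis
    proof (rule limit[of "\<lambda>n. dyadic_step (cs n)"])
      show "(\<lambda>n. L2_norm D (\<lambda>x. dyadic_step (cs n) x - g x)) \<longlonglongrightarrow> 0"
      proof (rule L2_norm_tendsto_dominated[OF dyadic_step_L2 gL2])
        have "(\<lambda>n. dyadic_step (cs n) x - g x) \<longlonglongrightarrow> 0" if "x \<in> D" for x
          by (rule Lim_null_comparison[OF always_eventually LIMSEQ_inverse_real_of_nat]) (use cs(2)[OF that] in auto)
        then show "AE x in lborel. x \<in> D \<longrightarrow> (\<lambda>n. dyadic_step (cs n) x) \<longlonglongrightarrow> g x"
          by (intro AE_I2) (simp add: LIM_zero_iff)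
        show "set_integrable lborel D (\<lambda>_. 1 :: real)" by (rule set_integrable_const_D)
        have "(dyadic_step (cs n) x - g x)\<^sup>2 \<le> 1" if "x \<in> D" for n x
        proof -
          have "inverse (real (Suc n)) \<le> 1" by (simp add: inverse_le_1_iff)
          then show ?thesis using cs(2)[OF that, of n] unfolding abs_square_le_1 by linarith
        qed
        then show "AE x in lborel. x \<in> D \<longrightarrow> (dyadic_step (cs n) x - g x)\<^sup>2 \<le> 1" for n by (intro AE_I2) auto
      qed
    qed (use dyadic_step_L2 gL2 step cs in auto)
  qed
  \<comment> \<open>Extension by 0 gives a function measurable on the whole line.\<close>
  define v where "v x = indicator D x * u x" for x
  have vm: "v \<in> borel_measurable lborel" using u by (simp add: L2_def set_borel_measurable_def v_def[abs_def])
  \<comment> \<open>Passing to the completion gives access to \<open>measurable_on\<close>, the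
    description of measurable functions as limits of continuous ones off a negligible set.\<close>
  then have "v \<in> borel_measurable lebesgue" by (simp add: measurable_completion)
  then have "v measurable_on UNIV" by (simp add: measurable_on_iff_borel_measurable)
  then obtain Ng g where Ng: "negligible Ng" and g: "\<And>n. continuous_on UNIV (g n)"
    and lim: "\<And>x. x \<notin> Ng \<Longrightarrow> (\<lambda>n. g n x) \<longlonglongrightarrow> v x"
    unfolding measurable_on_def by auto
  have AE_lim: "AE x in lborel. (\<lambda>n. g n x) \<longlonglongrightarrow> v x"
  proof -
    have "AE x in lebesgue. x \<notin> Ng" using Ng by (simp add: negligible_iff_null_sets AE_not_in)
    then have "AE x in lebesgue. (\<lambda>n. g n x) \<longlonglongrightarrow> v x" using lim by (auto elim: eventually_mono)
    then show ?thesis by (simp add: AE_completion_iff)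
  qed
  define cl where "cl m y = max (- real m) (min (real m) y)" for m :: nat and y :: real
  have clb: "\<bar>cl m y\<bar> \<le> real m" for m y by (auto simp: cl_def)
  have clm: "set_borel_measurable lborel D (\<lambda>x. cl m (v x))" for m
    using vm unfolding set_borel_measurable_def cl_def by measurable
  have clL2: "(\<lambda>x. cl m (v x)) \<in> L2 D" for m by (rule L2_bounded[OF clm clb])
  have Pcl: "P (\<lambda>x. cl m (v x))" for m
  proof (rule limit[of "\<lambda>n x. cl m (g n x)"])
    show gc: "P (\<lambda>x. cl m (g n x))" for n
      unfolding cl_def by (intro cont continuous_intros continuous_on_subset[OF g]) auto
    show gL: "(\<lambda>x. cl m (g n x)) \<in> L2 D" for n
      unfolding cl_def
      by (rule L2_bounded_continuous[of _ "real m"]) (auto intro!: continuous_intros continuous_on_subset[OF g])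
    show "(\<lambda>n. L2_norm D (\<lambda>x. cl m (g n x) - cl m (v x))) \<longlonglongrightarrow> 0"
    proof (rule L2_norm_tendsto_dominated[OF gL clL2])
      show "AE x in lborel. x \<in> D \<longrightarrow> (\<lambda>n. cl m (g n x)) \<longlonglongrightarrow> cl m (v x)"
        using AE_lim unfolding cl_def by eventually_elim (auto intro!: tendsto_intros)
      show "set_integrable lborel D (\<lambda>_. (2 * real m)\<^sup>2)" by (rule set_integrable_const_D)
      have "\<bar>cl m y - cl m z\<bar> \<le> \<bar>2 * real m\<bar>" for y z using clb[of m y] clb[of m z] by linarith
      then show "AE x in lborel. x \<in> D \<longrightarrow> (cl m (g n x) - cl m (v x))\<^sup>2 \<le> (2 * real m)\<^sup>2" for n
        unfolding abs_le_square_iff by (intro AE_I2) auto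
    qed
  qed (rule clL2)
  show "P u"
  proof (rule limit[OF clL2 u _ Pcl])
    show "(\<lambda>m. L2_norm D (\<lambda>x. cl m (v x) - u x)) \<longlonglongrightarrow> 0"
    proof (rule L2_norm_tendsto_dominated[OF clL2 u])
      have "(\<lambda>m. cl m y) \<longlonglongrightarrow> y" for y
      proof (rule tendsto_eventually)
        obtain m0 :: nat where "\<bar>y\<bar> \<le> real m0" using real_arch_simple by blast
        then show "\<forall>\<^sub>F m in sequentially. cl m y = y"
          unfolding eventually_sequentially cl_def by (intro exI[of _ m0]) auto
      qed
      then show "AE x in lborel. x \<in> D \<longrightarrow> (\<lambda>m. cl m (v x)) \<longlonglongrightarrow> u x" by (intro AE_I2) (simp add: v_def)
      show "set_integrable lborel D (\<lambda>x. (u x)\<^sup>2)" using u by (simp add: L2_def)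
      have "\<bar>cl m y - y\<bar> \<le> \<bar>y\<bar>" for m y by (auto simp: cl_def)
      then show "AE x in lborel. x \<in> D \<longrightarrow> (cl m (v x) - u x)\<^sup>2 \<le> (u x)\<^sup>2" for m
        unfolding abs_le_square_iff by (intro AE_I2) (simp add: v_def)
    qed
  qed
qed

end

section \<open>The operator \<open>\<G> q \<G> q\<close> for a single potential\<close>

lemma L2_Cauchy_Schwarz:
  assumes u: "u \<in> L2 D" and v: "v \<in> L2 D"
  shows "set_integrable lborel D (\<lambda>x. u x * v x)"
    and "(LINT x:D|lborel. \<bar>u x * v x\<bar>) \<le> L2_norm D u * L2_norm D v"
proof -
  define u' v' where "u' x = indicat_real D x * u x" and "v' x = indicat_real D x * v x" for x
  have [measurable]: "u' \<in> borel_measurable lborel" "v' \<in> borel_measurable lborel"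
    using u v by (simp_all add: L2_def set_borel_measurable_def u'_def[abs_def] v'_def[abs_def])
  have sq: "indicat_real D x *\<^sub>R (u x)\<^sup>2 = (u' x)\<^sup>2" "indicat_real D x *\<^sub>R (v x)\<^sup>2 = (v' x)\<^sup>2"
    "indicat_real D x *\<^sub>R (u x * v x) = u' x * v' x" "indicat_real D x *\<^sub>R \<bar>u x * v x\<bar> = \<bar>u' x * v' x\<bar>" for x
    by (simp_all add: u'_def v'_def indicator_def)
  have i2: "integrable lborel (\<lambda>x. (u' x)\<^sup>2)" "integrable lborel (\<lambda>x. (v' x)\<^sup>2)"
    using u v by (simp_all add: L2_def set_integrable_def sq[symmetric])
  have i: "integrable lborel (\<lambda>x. u' x * v' x)"
  proof (rule Bochner_Integration.integrable_bound[OF Bochner_Integration.integrable_add[OF i2]])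
    show "AE x in lborel. norm (u' x * v' x) \<le> norm ((u' x)\<^sup>2 + (v' x)\<^sup>2)"
      using abs_mult_le_squares by (intro AE_I2) simp
  qed measurable
  then show "set_integrable lborel D (\<lambda>x. u x * v x)" unfolding set_integrable_def sq .
  have n: "(\<integral>\<^sup>+x. (ennreal \<bar>u' x\<bar>)\<^sup>2 \<partial>lborel) = ennreal ((L2_norm D u)\<^sup>2)" "(\<integral>\<^sup>+x. (ennreal \<bar>v' x\<bar>)\<^sup>2 \<partial>lborel) = ennreal ((L2_norm D v)\<^sup>2)"
    unfolding L2_norm_def set_lebesgue_integral_def sq
    using i2 by (simp_all add: ennreal_power nn_integral_eq_integral)
  have "(\<integral>\<^sup>+x. ennreal \<bar>u' x\<bar> * ennreal \<bar>v' x\<bar> \<partial>lborel)\<^sup>2 \<le> (\<integral>\<^sup>+x. (ennreal \<bar>u' x\<bar>)\<^sup>2 \<partial>lborel) * (\<integral>\<^sup>+x. (ennreal \<bar>v' x\<bar>)\<^sup>2 \<partial>lborel)"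
    by (rule Cauchy_Schwarz_nn_integral) measurable
  also have "\<dots> = ennreal ((L2_norm D u * L2_norm D v)\<^sup>2)"
    unfolding n by (simp add: ennreal_mult[symmetric] power_mult_distrib)
  also have "(\<integral>\<^sup>+x. ennreal \<bar>u' x\<bar> * ennreal \<bar>v' x\<bar> \<partial>lborel) = ennreal (LINT x|lborel. \<bar>u' x * v' x\<bar>)"
    using nn_integral_eq_integral[OF integrable_abs[OF i]] by (simp add: abs_mult ennreal_mult)
  finally have "(LINT x|lborel. \<bar>u' x * v' x\<bar>)\<^sup>2 \<le> (L2_norm D u * L2_norm D v)\<^sup>2"
    by (simp add: ennreal_power)
  moreover have "0 \<le> L2_norm D u * L2_norm D v"
    by (auto simp: L2_norm_def set_lebesgue_integral_def intro!: mult_nonneg_nonneg integral_nonneg_AE)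
  ultimately show "(LINT x:D|lborel. \<bar>u x * v x\<bar>) \<le> L2_norm D u * L2_norm D v"
    unfolding set_lebesgue_integral_def sq by (rule power2_le_imp_le)
qed

lemma L2_norm_nonneg: "0 \<le> L2_norm D u"
  by (auto simp: L2_norm_def set_lebesgue_integral_def intro!: integral_nonneg_AE)

lemma L2_norm_square: "u \<in> L2 D \<Longrightarrow> (L2_norm D u)\<^sup>2 = (LINT x:D|lborel. (u x)\<^sup>2)"
  unfolding L2_norm_def set_lebesgue_integral_def
  by (intro real_sqrt_pow2 integral_nonneg_AE) auto

lemma L2_scale: "u \<in> L2 D \<Longrightarrow> (\<lambda>x. c * u x) \<in> L2 D"
  by (auto simp: L2_def set_borel_measurable_def power_mult_distrib mult.left_commute intro!: borel_measurable_times)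

lemma L2_norm_scale: "L2_norm D (\<lambda>x. c * u x) = \<bar>c\<bar> * L2_norm D u"
  by (simp add: L2_norm_def power_mult_distrib real_sqrt_mult)

lemma L2_add:
  assumes u: "u \<in> L2 D" and v: "v \<in> L2 D"
  shows "(\<lambda>x. u x + v x) \<in> L2 D" "L2_norm D (\<lambda>x. u x + v x) \<le> L2_norm D u + L2_norm D v"
proof -
  note i = L2_Cauchy_Schwarz[OF u v]
  have ii: "set_integrable lborel D (\<lambda>x. (u x)\<^sup>2 + (v x)\<^sup>2 + 2 * (u x * v x))"
    using u v i(1) by (intro set_integral_add) (simp_all add: L2_def)
  then have "set_integrable lborel D (\<lambda>x. (u x + v x)\<^sup>2)"
    by (simp add: power2_sum mult.assoc)
  moreover have "set_borel_measurable lborel D (\<lambda>x. u x + v x)"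
    using u v by (auto simp: L2_def set_borel_measurable_def distrib_left intro!: borel_measurable_add)
  ultimately show L2: "(\<lambda>x. u x + v x) \<in> L2 D" by (simp add: L2_def)
  have "(LINT x:D|lborel. u x * v x) \<le> (LINT x:D|lborel. \<bar>u x * v x\<bar>)"
    using i(1) by (intro set_integral_mono set_integrable_abs) auto
  then have "(LINT x:D|lborel. u x * v x) \<le> L2_norm D u * L2_norm D v" using i(2) by linarith
  moreover have "(L2_norm D (\<lambda>x. u x + v x))\<^sup>2 = (LINT x:D|lborel. (u x)\<^sup>2 + (v x)\<^sup>2 + 2 * (u x * v x))"
    unfolding L2_norm_square[OF L2] by (simp add: power2_sum mult.assoc)
  moreover have "\<dots> = (LINT x:D|lborel. (u x)\<^sup>2) + (LINT x:D|lborel. (v x)\<^sup>2) + 2 * (LINT x:D|lborel. u x * v x)"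
    using u v i(1) by (simp add: L2_def set_integral_add)
  ultimately have "(L2_norm D (\<lambda>x. u x + v x))\<^sup>2 \<le> (L2_norm D u)\<^sup>2 + (L2_norm D v)\<^sup>2 + 2 * (L2_norm D u * L2_norm D v)"
    unfolding L2_norm_square[OF u] L2_norm_square[OF v] by linarith
  also have "\<dots> = (L2_norm D u + L2_norm D v)\<^sup>2" by (simp add: power2_sum)
  finally show "L2_norm D (\<lambda>x. u x + v x) \<le> L2_norm D u + L2_norm D v"
    by (rule power2_le_imp_le) (simp add: L2_norm_nonneg)
qed

lemma L2_diff: "u \<in> L2 D \<Longrightarrow> v \<in> L2 D \<Longrightarrow> (\<lambda>x. u x - v x) \<in> L2 D"
  using L2_add(1)[of u D "\<lambda>x. - 1 * v x"] L2_scale[of v D "- 1"] by simp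

lemma L2_norm_minus_commute: "L2_norm D (\<lambda>x. u x - v x) = L2_norm D (\<lambda>x. v x - u x)"
  by (simp add: L2_norm_def power2_commute)

lemma L2_norm_diff_le:
  assumes u: "u \<in> L2 D" and v: "v \<in> L2 D"
  shows "\<bar>L2_norm D u - L2_norm D v\<bar> \<le> L2_norm D (\<lambda>x. u x - v x)"
  using L2_add(2)[OF L2_diff[OF u v] v] L2_add(2)[OF L2_diff[OF v u] u]
  by (simp add: L2_norm_minus_commute[of D v u])

lemma L2_norm_cong_AE:
  assumes u: "u \<in> L2 D" and v: "v \<in> L2 D" and eq: "AE x in lborel. x \<in> D \<longrightarrow> u x = v x"
  shows "L2_norm D u = L2_norm D v"
proof -
  have "(LINT x:D|lborel. (u x)\<^sup>2) = (LINT x:D|lborel. (v x)\<^sup>2)"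
    unfolding set_lebesgue_integral_def
  proof (rule integral_cong_AE)
    show "AE x in lborel. indicat_real D x *\<^sub>R (u x)\<^sup>2 = indicat_real D x *\<^sub>R (v x)\<^sup>2"
      using eq by eventually_elim (simp add: indicator_def)
  qed (use u v in \<open>auto simp: L2_def set_integrable_def\<close>)
  then show ?thesis by (simp add: L2_norm_def)
qed

section \<open>Pathwise bounds for a fixed potential\<close>

context dyadic
begin

lemma set_integral_const_D: "(LINT x:D|lborel. (c :: real)) = (b - a) * c"
  using ab by (simp add: set_lebesgue_integral_def)

lemma L2_const: "(\<lambda>_. c) \<in> L2 D"
  by (rule L2_bounded[of _ "\<bar>c\<bar>"]) (auto simp: set_borel_measurable_def)

lemma L1_le_L2:
  assumes "u \<in> L2 D"
  shows "set_integrable lborel D u" "(LINT x:D|lborel. \<bar>u x\<bar>) \<le> sqrt (b - a) * L2_norm D u"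
  using L2_Cauchy_Schwarz[OF L2_const[of 1] assms] set_integral_const_D[of 1] by (simp_all add: L2_norm_def)

lemma L2_norm_le:
  assumes u: "u \<in> L2 D" and C: "0 \<le> C" "AE x in lborel. x \<in> D \<longrightarrow> \<bar>u x\<bar> \<le> C"
  shows "L2_norm D u \<le> sqrt (b - a) * C"
proof -
  have "(LINT x:D|lborel. (u x)\<^sup>2) \<le> (LINT x:D|lborel. C\<^sup>2)"
    unfolding set_lebesgue_integral_def
  proof (rule integral_mono_AE)
    show "AE x in lborel. indicat_real D x *\<^sub>R (u x)\<^sup>2 \<le> indicat_real D x *\<^sub>R C\<^sup>2"
      using C(2) by eventually_elim (use C(1) in \<open>auto simp: indicator_def abs_le_square_iff[symmetric]\<close>)
  qed (use u set_integrable_const_D[of "C\<^sup>2"] in \<open>auto simp: L2_def set_integrable_def\<close>)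
  then have "L2_norm D u \<le> sqrt ((b - a) * C\<^sup>2)"
    unfolding L2_norm_def set_integral_const_D by (rule real_sqrt_le_mono)
  then show ?thesis using C(1) by (simp add: real_sqrt_mult)
qed

lemma L2_Lipschitz:
  assumes "Lipschitz_on L h" "\<And>x. x \<in> D \<Longrightarrow> \<bar>h x\<bar> \<le> C"
  shows "h \<in> L2 D"
  by (rule L2_bounded_continuous[OF Lipschitz_on_continuous[OF assms(1)] assms(2)])

lemma set_integral_continuous_bound:
  fixes h p :: "real \<Rightarrow> real"
  assumes h: "continuous_on D h" and C: "\<And>x. x \<in> D \<Longrightarrow> \<bar>h x\<bar> \<le> C" and p: "set_integrable lborel D p"
  shows "set_integrable lborel D (\<lambda>y. h y * p y)" "\<bar>LINT y:D|lborel. h y * p y\<bar> \<le> C * (LINT y:D|lborel. \<bar>p y\<bar>)"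
proof -
  have [measurable]: "(\<lambda>y. indicat_real D y * h y) \<in> borel_measurable lborel"
    using borel_measurable_continuous_on_indicator[OF _ h] by simp
  have p': "integrable lborel (\<lambda>y. indicat_real D y * p y)" using p by (simp add: set_integrable_def)
  note [measurable] = borel_measurable_integrable[OF p']
  have eq: "indicat_real D y *\<^sub>R (h y * p y) = (indicat_real D y * h y) * (indicat_real D y * p y)" for y
    by (simp add: indicator_def)
  have le: "norm (indicat_real D y *\<^sub>R (h y * p y)) \<le> C * \<bar>indicat_real D y * p y\<bar>" for y
    using C[of y] by (auto simp: indicator_def abs_mult mult_right_mono)
  have i: "integrable lborel (\<lambda>y. C * \<bar>indicat_real D y * p y\<bar>)" using p' by simp
  show si: "set_integrable lborel D (\<lambda>y. h y * p y)"
    unfolding set_integrable_def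
  proof (rule Bochner_Integration.integrable_bound[OF i])
    show "(\<lambda>y. indicat_real D y *\<^sub>R (h y * p y)) \<in> borel_measurable lborel" unfolding eq by measurable
    show "AE y in lborel. norm (indicat_real D y *\<^sub>R (h y * p y)) \<le> norm (C * \<bar>indicat_real D y * p y\<bar>)"
      using le by (intro AE_I2) (metis abs_of_nonneg dual_order.trans abs_ge_self real_norm_def)
  qed
  have "\<bar>LINT y:D|lborel. h y * p y\<bar> \<le> (LINT y|lborel. norm (indicat_real D y *\<^sub>R (h y * p y)))"
    unfolding set_lebesgue_integral_def using integral_norm_bound[of lborel "\<lambda>y. indicat_real D y *\<^sub>R (h y * p y)"] by simp
  also have "\<dots> \<le> (LINT y|lborel. C * \<bar>indicat_real D y * p y\<bar>)"
    using si i le by (intro integral_mono) (auto simp: set_integrable_def)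
  also have "\<dots> = C * (LINT y:D|lborel. \<bar>p y\<bar>)"
    by (simp add: set_lebesgue_integral_def abs_mult)
  finally show "\<bar>LINT y:D|lborel. h y * p y\<bar> \<le> C * (LINT y:D|lborel. \<bar>p y\<bar>)" .
qed

end

text \<open>One path of the random potential is a deterministic \<open>V\<close>. Randomness returns
  later through the bounds on \<open>V\<close> that the estimates assume.\<close>

locale green_potential = dyadic a b for a b :: real +
  fixes G :: "real \<Rightarrow> real \<Rightarrow> real" and LG g0 :: real and V :: "real \<Rightarrow> real"
  assumes K: "Lipschitz_kernel LG g0 G" and V: "V \<in> L2 D"
begin

abbreviation green :: "(real \<Rightarrow> real) \<Rightarrow> real \<Rightarrow> real" where "green \<equiv> green_op D G"

abbreviation mass :: "(real \<Rightarrow> real) \<Rightarrow> real" where "mass p \<equiv> LINT y:D|lborel. \<bar>p y\<bar>"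

definition T :: "(real \<Rightarrow> real) \<Rightarrow> real \<Rightarrow> real" where
  "T v = green (\<lambda>x. V x * green (\<lambda>y. V y * v y) x)"

lemma kernel:
  shows "0 \<le> LG" "0 \<le> g0" "x \<in> D \<Longrightarrow> Lipschitz_on LG (G x)" "x \<in> D \<Longrightarrow> y \<in> D \<Longrightarrow> \<bar>G x y\<bar> \<le> g0"
    "x \<in> D \<Longrightarrow> x' \<in> D \<Longrightarrow> y \<in> D \<Longrightarrow> \<bar>G x y - G x' y\<bar> \<le> LG * \<bar>x - x'\<bar>"
  using K by (auto simp: Lipschitz_kernel_def)

lemma mass_nonneg: "0 \<le> mass p"
  unfolding set_lebesgue_integral_def by (intro integral_nonneg_AE) auto

lemma green_integrable: "x \<in> D \<Longrightarrow> set_integrable lborel D p \<Longrightarrow> set_integrable lborel D (\<lambda>y. G x y * p y)"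
  using set_integral_continuous_bound(1)[OF Lipschitz_on_continuous] kernel by blast

lemma green_bound: "x \<in> D \<Longrightarrow> set_integrable lborel D p \<Longrightarrow> \<bar>green p x\<bar> \<le> g0 * mass p"
  unfolding green_op_def using set_integral_continuous_bound(2)[OF Lipschitz_on_continuous] kernel by blast

lemma green_Lipschitz:
  assumes p: "set_integrable lborel D p"
  shows "Lipschitz_on (LG * mass p) (green p)"
  unfolding Lipschitz_on_def
proof (intro conjI ballI)
  show "0 \<le> LG * mass p" using kernel mass_nonneg by simp
  fix x x' assume x: "x \<in> D" "x' \<in> D"
  have "green p x - green p x' = (LINT y:D|lborel. (G x y - G x' y) * p y)"
    unfolding green_op_def left_diff_distrib by (intro set_integral_diff(2)[symmetric] green_integrable x p)
  also have "\<bar>\<dots>\<bar> \<le> LG * \<bar>x - x'\<bar> * mass p"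
    by (intro set_integral_continuous_bound(2) continuous_on_diff p Lipschitz_on_continuous[OF kernel(3)[OF x(1)]]
        Lipschitz_on_continuous[OF kernel(3)[OF x(2)]] kernel(5) x)
  finally show "\<bar>green p x - green p x'\<bar> \<le> LG * mass p * \<bar>x - x'\<bar>" by (simp add: mult_ac)
qed

lemma green_L2: "set_integrable lborel D p \<Longrightarrow> green p \<in> L2 D"
  using L2_Lipschitz green_Lipschitz green_bound by blast

lemma green_linear:
  assumes x: "x \<in> D" and p: "set_integrable lborel D p" "set_integrable lborel D r"
  shows "green (\<lambda>y. p y + c * r y) x = green p x + c * green r x"
proof -
  have "green (\<lambda>y. p y + c * r y) x = (LINT y:D|lborel. G x y * p y + c * (G x y * r y))"
    by (simp add: green_op_def distrib_left mult.left_commute)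
  then show ?thesis
    using green_integrable[OF x p(1)] green_integrable[OF x p(2)] by (simp add: green_op_def set_integral_add)
qed

lemma green_cong: "(\<And>y. y \<in> D \<Longrightarrow> p y = r y) \<Longrightarrow> green p x = green r x"
  unfolding green_op_def by (intro set_lebesgue_integral_cong) auto

lemma potential_integrable: "v \<in> L2 D \<Longrightarrow> set_integrable lborel D (\<lambda>y. V y * v y)"
  by (rule L2_Cauchy_Schwarz(1)[OF V])

lemma potential_mass: "v \<in> L2 D \<Longrightarrow> mass (\<lambda>y. V y * v y) \<le> L2_norm D V * L2_norm D v"
  by (rule L2_Cauchy_Schwarz(2)[OF V])

lemma potential_mass_bounded:
  assumes "AE x in lborel. x \<in> D \<longrightarrow> \<bar>v x\<bar> \<le> C" "v \<in> L2 D"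
  shows "mass (\<lambda>y. V y * v y) \<le> C * mass V"
proof -
  have "mass (\<lambda>y. V y * v y) \<le> (LINT y:D|lborel. C * \<bar>V y\<bar>)"
    unfolding set_lebesgue_integral_def
  proof (rule integral_mono_AE)
    show "integrable lborel (\<lambda>x. indicat_real D x *\<^sub>R \<bar>V x * v x\<bar>)"
      using set_integrable_abs[OF potential_integrable[OF assms(2)]] by (simp add: set_integrable_def)
    show "integrable lborel (\<lambda>x. indicat_real D x *\<^sub>R (C * \<bar>V x\<bar>))"
      using set_integrable_abs[OF L1_le_L2(1)[OF V]] by (simp add: set_integrable_def mult.left_commute)
    show "AE x in lborel. indicat_real D x *\<^sub>R \<bar>V x * v x\<bar> \<le> indicat_real D x *\<^sub>R (C * \<bar>V x\<bar>)"
      using assms(1) by eventually_elim (auto simp: indicator_def abs_mult mult.commute[of "\<bar>V _\<bar>"] intro: mult_right_mono)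
  qed
  then show ?thesis by simp
qed

lemma inner_L2: "v \<in> L2 D \<Longrightarrow> green (\<lambda>y. V y * v y) \<in> L2 D"
  by (intro green_L2 potential_integrable)

lemma T_Lipschitz: "v \<in> L2 D \<Longrightarrow> Lipschitz_on (LG * mass (\<lambda>x. V x * green (\<lambda>y. V y * v y) x)) (T v)"
  unfolding T_def by (intro green_Lipschitz potential_integrable inner_L2)

lemma T_L2: "v \<in> L2 D \<Longrightarrow> T v \<in> L2 D"
  unfolding T_def by (intro inner_L2)

lemma T_linear:
  assumes x: "x \<in> D" and u: "u \<in> L2 D" and v: "v \<in> L2 D"
  shows "T (\<lambda>y. u y + c * v y) x = T u x + c * T v x"
proof -
  have "T (\<lambda>y. u y + c * v y) x = green (\<lambda>x. V x * green (\<lambda>y. V y * u y) x + c * (V x * green (\<lambda>y. V y * v y) x)) x"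
    unfolding T_def
  proof (rule green_cong)
    fix x assume x: "x \<in> D"
    have "green (\<lambda>y. V y * (u y + c * v y)) x = green (\<lambda>y. V y * u y + c * (V y * v y)) x"
      by (simp add: distrib_left mult.left_commute)
    then show "V x * green (\<lambda>y. V y * (u y + c * v y)) x = V x * green (\<lambda>y. V y * u y) x + c * (V x * green (\<lambda>y. V y * v y) x)"
      by (simp add: green_linear[OF x potential_integrable[OF u] potential_integrable[OF v]] algebra_simps)
  qed
  then show ?thesis unfolding T_def
    by (simp add: green_linear[OF x potential_integrable[OF inner_L2[OF u]] potential_integrable[OF inner_L2[OF v]]])
qed

lemma T_diff: "x \<in> D \<Longrightarrow> u \<in> L2 D \<Longrightarrow> v \<in> L2 D \<Longrightarrow> T (\<lambda>y. u y - v y) x = T u x - T v x"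
  using T_linear[of x u v "- 1"] by simp

lemma T_scale: "x \<in> D \<Longrightarrow> v \<in> L2 D \<Longrightarrow> T (\<lambda>y. c * v y) x = c * T v x"
  using T_linear[of x "\<lambda>_. 0" v c] T_linear[of x "\<lambda>_. 0" "\<lambda>_. 0" "- 1"] L2_const[of 0] by simp

text \<open>A bound without any cancellation. It supplies continuity of \<open>T\<close> on
  \<open>L2 D\<close> for the density argument and for vectors of norm 0.\<close>

definition crude :: real where "crude = g0 * (g0 * mass V * L2_norm D V)"

lemma T_crude:
  assumes v: "v \<in> L2 D" and x: "x \<in> D"
  shows "\<bar>T v x\<bar> \<le> crude * L2_norm D v"
proof -
  let ?m = "mass (\<lambda>y. V y * v y)"
  have "\<bar>T v x\<bar> \<le> g0 * mass (\<lambda>x. V x * green (\<lambda>y. V y * v y) x)"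
    unfolding T_def by (intro green_bound x potential_integrable inner_L2 v)
  also have "\<dots> \<le> g0 * (g0 * ?m * mass V)"
    by (intro mult_left_mono kernel potential_mass_bounded inner_L2 v AE_I2 impI green_bound potential_integrable)
  also have "\<dots> \<le> g0 * (g0 * (L2_norm D V * L2_norm D v) * mass V)"
    by (intro mult_left_mono mult_right_mono kernel potential_mass v mass_nonneg)
  finally show ?thesis by (simp add: crude_def mult_ac)
qed

lemma crude_nonneg: "0 \<le> crude"
  unfolding crude_def using kernel mass_nonneg L2_norm_nonneg by simp

lemma T_norm_crude: "v \<in> L2 D \<Longrightarrow> L2_norm D (T v) \<le> sqrt (b - a) * (crude * L2_norm D v)"
  by (intro L2_norm_le T_L2 AE_I2 impI T_crude mult_nonneg_nonneg crude_nonneg L2_norm_nonneg)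

lemma T_norm_scale: "v \<in> L2 D \<Longrightarrow> L2_norm D (T (\<lambda>x. c * v x)) = \<bar>c\<bar> * L2_norm D (T v)"
  using L2_norm_cong_AE[of "T (\<lambda>x. c * v x)" D "\<lambda>x. c * T v x"]
  by (simp add: T_scale T_L2 L2_scale L2_norm_scale)

lemma operator_norm_le_iff:
  assumes \<rho>: "0 \<le> \<rho>"
  shows "L2_operator_norm D T \<le> ennreal \<rho> \<longleftrightarrow> (\<forall>v\<in>L2 D. L2_norm D (T v) \<le> \<rho> * L2_norm D v)"
proof
  assume R: "\<forall>v\<in>L2 D. L2_norm D (T v) \<le> \<rho> * L2_norm D v"
  have "L2_norm D (T v) \<le> \<rho>" if "v \<in> L2 D" "L2_norm D v \<le> 1" for v
    using R that mult_left_mono[OF that(2) \<rho>] by fastforce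
  then show "L2_operator_norm D T \<le> ennreal \<rho>" unfolding L2_operator_norm_def
    by (intro SUP_least) (auto simp: T_L2 intro: ennreal_leI)
next
  assume L: "L2_operator_norm D T \<le> ennreal \<rho>"
  have unit: "L2_norm D (T v) \<le> \<rho>" if "v \<in> L2 D" "L2_norm D v \<le> 1" for v
  proof -
    have "ennreal (L2_norm D (T v)) \<le> L2_operator_norm D T"
      unfolding L2_operator_norm_def by (rule SUP_upper2[of v]) (use that in \<open>auto simp: T_L2\<close>)
    then show ?thesis using L \<rho> ennreal_le_iff by (metis order_trans)
  qed
  show "\<forall>v\<in>L2 D. L2_norm D (T v) \<le> \<rho> * L2_norm D v"
  proof
    fix v assume v: "v \<in> L2 D"
    show "L2_norm D (T v) \<le> \<rho> * L2_norm D v"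
    \<comment> \<open>Such a \<open>v\<close> cannot be normalized; the crude bound shows that
      \<open>T v\<close> has norm 0 as well.\<close>
    proof (cases "L2_norm D v = 0")
      case True
      then show ?thesis using T_norm_crude[OF v] by simp
    next
      case False
      then have s: "0 < L2_norm D v" using L2_norm_nonneg[of D v] by simp
      have "L2_norm D (T (\<lambda>x. 1 / L2_norm D v * v x)) \<le> \<rho>"
        by (rule unit[OF L2_scale[OF v]]) (use s in \<open>simp only: L2_norm_scale, simp\<close>)
      then show ?thesis unfolding T_norm_scale[OF v] using s by (simp add: field_simps)
    qed
  qed
qed

text \<open>Both sides of the inequality are continuous in \<open>v\<close> for the norm of
  \<open>L2 D\<close>, so a countable dense family decides it. This makes the exceptional event a
  complement of a countable intersection.\<close>

lemma operator_norm_le_iff_countable: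
  assumes \<rho>: "0 \<le> \<rho>"
  shows "L2_operator_norm D T \<le> ennreal \<rho> \<longleftrightarrow> (\<forall>cs\<in>lists \<rat>. L2_norm D (T (dyadic_step cs)) \<le> \<rho> * L2_norm D (dyadic_step cs))"
  unfolding operator_norm_le_iff[OF \<rho>]
proof (intro iffI ballI)
  fix v assume R: "\<forall>cs\<in>lists \<rat>. L2_norm D (T (dyadic_step cs)) \<le> \<rho> * L2_norm D (dyadic_step cs)" and v: "v \<in> L2 D"
  from v show "L2_norm D (T v) \<le> \<rho> * L2_norm D v"
  proof (induction v rule: L2_induct_dense)
    case (limit f u)
    have 1: "(\<lambda>n. L2_norm D (f n)) \<longlonglongrightarrow> L2_norm D u"
    proof (rule LIM_zero_cancel, rule Lim_null_comparison[OF always_eventually limit(3)])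
      show "\<forall>n. norm (L2_norm D (f n) - L2_norm D u) \<le> L2_norm D (\<lambda>x. f n x - u x)"
        using L2_norm_diff_le[OF limit(1,2)] by simp
    qed
    have 2: "(\<lambda>n. L2_norm D (T (f n))) \<longlonglongrightarrow> L2_norm D (T u)"
    proof (rule LIM_zero_cancel, rule Lim_null_comparison)
      show "(\<lambda>n. sqrt (b - a) * (crude * L2_norm D (\<lambda>x. f n x - u x))) \<longlonglongrightarrow> 0"
        by (intro tendsto_mult_right_zero limit(3))
      show "\<forall>\<^sub>F n in sequentially. norm (L2_norm D (T (f n)) - L2_norm D (T u)) \<le> sqrt (b - a) * (crude * L2_norm D (\<lambda>x. f n x - u x))"
      proof (rule always_eventually, rule allI)
        fix n
        note d = L2_diff[OF limit(1)[of n] limit(2)]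
        have "\<bar>L2_norm D (T (f n)) - L2_norm D (T u)\<bar> \<le> L2_norm D (\<lambda>x. T (f n) x - T u x)"
          by (intro L2_norm_diff_le T_L2 limit)
        also have "\<dots> = L2_norm D (T (\<lambda>x. f n x - u x))"
          by (intro L2_norm_cong_AE L2_diff T_L2 limit d AE_I2) (simp add: T_diff limit)
        also have "\<dots> \<le> sqrt (b - a) * (crude * L2_norm D (\<lambda>x. f n x - u x))" by (rule T_norm_crude[OF d])
        finally show "norm (L2_norm D (T (f n)) - L2_norm D (T u)) \<le> sqrt (b - a) * (crude * L2_norm D (\<lambda>x. f n x - u x))" by simp
      qed
    qed
    show ?case by (rule LIMSEQ_le[OF 2 tendsto_mult[OF tendsto_const 1]]) (use limit(4) in auto)
  next
    case (step cs)
    then show ?case using R by (simp add: in_lists_conv_set subset_iff)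
  qed
qed (simp add: dyadic_step_L2)

text \<open>\<open>T\<close> is a contraction with factor \<rho>, and \<open>z\<close> is the
  Neumann iteration started at 0, so the errors decay geometrically. It presents the solution as a
  limit of explicit functionals of the potential.\<close>

lemma iteration_converges:
  assumes \<rho>: "0 \<le> \<rho>" "\<rho> < 1" "L2_operator_norm D T \<le> ennreal \<rho>"
    and r: "r \<in> L2 D" and v: "v \<in> L2 D" "AE x in lborel. x \<in> D \<longrightarrow> v x = r x + T v x"
    and z: "\<And>n. z n \<in> L2 D" "\<And>x. x \<in> D \<Longrightarrow> z 0 x = 0" "\<And>n x. x \<in> D \<Longrightarrow> z (Suc n) x = r x + T (z n) x"
  shows "(\<lambda>n. L2_norm D (\<lambda>x. z n x - v x)) \<longlonglongrightarrow> 0"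
proof -
  have "L2_norm D (\<lambda>x. z n x - v x) \<le> L2_norm D v * \<rho> ^ n" for n
  proof (induction n)
    case 0
    have "L2_norm D (\<lambda>x. z 0 x - v x) = L2_norm D (\<lambda>x. - 1 * v x)"
      using L2_diff[OF z(1) v(1)] L2_scale[OF v(1), of "- 1"] by (intro L2_norm_cong_AE AE_I2) (simp_all add: z(2))
    then show ?case unfolding L2_norm_scale by simp
  next
    case (Suc n)
    have "L2_norm D (\<lambda>x. z (Suc n) x - v x) = L2_norm D (T (\<lambda>x. z n x - v x))"
    proof (rule L2_norm_cong_AE[OF L2_diff[OF z(1) v(1)] T_L2[OF L2_diff[OF z(1) v(1)]]])
      show "AE x in lborel. x \<in> D \<longrightarrow> z (Suc n) x - v x = T (\<lambda>x. z n x - v x) x"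
        using v(2) by eventually_elim (simp add: z T_diff[OF _ z(1) v(1)])
    qed
    also have "\<dots> \<le> \<rho> * L2_norm D (\<lambda>x. z n x - v x)"
      using \<rho>(3) L2_diff[OF z(1) v(1)] unfolding operator_norm_le_iff[OF \<rho>(1)] by blast
    also have "\<dots> \<le> \<rho> * (L2_norm D v * \<rho> ^ n)" by (intro mult_left_mono Suc \<rho>)
    finally show ?case by (simp add: mult_ac)
  qed
  then have le: "norm (L2_norm D (\<lambda>x. z n x - v x)) \<le> L2_norm D v * \<rho> ^ n" for n
    by (simp add: L2_norm_nonneg)
  have "(\<lambda>n. L2_norm D v * \<rho> ^ n) \<longlonglongrightarrow> 0"
    using \<rho> by (intro tendsto_mult_right_zero LIMSEQ_realpow_zero) auto
  then show ?thesis by (rule Lim_null_comparison[OF always_eventually[OF allI[OF le]]])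
qed

text \<open>The outcome of cutting the dyadic series at one level: \<mu> is the price of the Riemann
  sum, paid by the sup norm, and \<tau> the price of the tail, paid by the Lipschitz
  constant.\<close>

definition oscillation_bound :: "real \<Rightarrow> real \<Rightarrow> bool" where
  "oscillation_bound \<mu> \<tau> \<longleftrightarrow> 0 \<le> \<mu> \<and> 0 \<le> \<tau> \<and> (\<forall>h L C. Lipschitz_on L h \<longrightarrow> (\<forall>x\<in>D. \<bar>h x\<bar> \<le> C) \<longrightarrow>
    \<bar>LINT y:D|lborel. h y * V y\<bar> \<le> C * \<mu> + L * \<tau>)"

text \<open>The oscillation bound for the product of \<open>h\<close> with a Green kernel: its sup
  norm is at most \<open>g0 * C\<close>, and the product rule gives the Lipschitz constant
  \<open>g0 * L + LG * C\<close>.\<close>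

definition gain :: "real \<Rightarrow> real \<Rightarrow> real \<Rightarrow> real \<Rightarrow> real" where
  "gain C L \<mu> \<tau> = g0 * C * \<mu> + (g0 * L + LG * C) * \<tau>"

lemma kernel_product:
  assumes h: "Lipschitz_on L h" and C: "\<And>x. x \<in> D \<Longrightarrow> \<bar>h x\<bar> \<le> C"
  shows "Lipschitz_kernel (g0 * L + LG * C) (g0 * C) (\<lambda>x y. G x y * h y)"
proof -
  have L: "0 \<le> L" using h by (simp add: Lipschitz_on_def)
  have C0: "0 \<le> C" using order_trans[OF abs_ge_zero C[of "(a + b) / 2"]] ab by simp
  have K0: "0 \<le> g0 * L + LG * C" using kernel L C0 by simp
  have "Lipschitz_on (g0 * L + LG * C) (\<lambda>y. G x y * h y)" if x: "x \<in> D" for x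
    unfolding Lipschitz_on_def
  proof (intro conjI ballI K0)
    fix y z assume y: "y \<in> D" "z \<in> D"
    have "G x y * h y - G x z * h z = G x y * (h y - h z) + (G x y - G x z) * h z" by (simp add: algebra_simps)
    also have "\<bar>\<dots>\<bar> \<le> g0 * (L * \<bar>y - z\<bar>) + LG * \<bar>y - z\<bar> * C"
      using h kernel(3)[OF x] y
      by (intro order_trans[OF abs_triangle_ineq] add_mono)
        (auto simp: abs_mult Lipschitz_on_def intro!: mult_mono kernel C x mult_nonneg_nonneg)
    finally show "\<bar>G x y * h y - G x z * h z\<bar> \<le> (g0 * L + LG * C) * \<bar>y - z\<bar>" by (simp add: algebra_simps)
  qed
  moreover have "\<bar>G x y * h y\<bar> \<le> g0 * C" if "x \<in> D" "y \<in> D" for x y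
    unfolding abs_mult by (intro mult_mono kernel C that) auto
  moreover have "\<bar>G x y * h y - G x' y * h y\<bar> \<le> (g0 * L + LG * C) * \<bar>x - x'\<bar>" if "x \<in> D" "x' \<in> D" "y \<in> D" for x x' y
  proof -
    have "\<bar>G x y - G x' y\<bar> * \<bar>h y\<bar> \<le> LG * \<bar>x - x'\<bar> * C"
      by (intro mult_mono kernel C that mult_nonneg_nonneg) auto
    moreover have "0 \<le> g0 * L * \<bar>x - x'\<bar>" using kernel L by simp
    ultimately show ?thesis by (simp add: abs_mult[symmetric] algebra_simps)
  qed
  ultimately show ?thesis using K0 C0 kernel by (simp add: Lipschitz_kernel_def)
qed

lemma green_gain:
  assumes o: "oscillation_bound \<mu> \<tau>" and h: "Lipschitz_on L h" and C: "\<And>x. x \<in> D \<Longrightarrow> \<bar>h x\<bar> \<le> C" and x: "x \<in> D"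
  shows "\<bar>green (\<lambda>y. V y * h y) x\<bar> \<le> gain C L \<mu> \<tau>"
proof -
  have "\<bar>LINT y:D|lborel. (G x y * h y) * V y\<bar> \<le> g0 * C * \<mu> + (g0 * L + LG * C) * \<tau>"
    using o kernel_product[OF h C] x unfolding oscillation_bound_def Lipschitz_kernel_def by blast
  then show ?thesis by (simp add: green_op_def gain_def mult_ac)
qed

lemma gain_mono:
  assumes "0 \<le> C" "C \<le> C'" "0 \<le> L" "L \<le> L'" "0 \<le> \<mu>" "0 \<le> \<tau>"
  shows "gain C L \<mu> \<tau> \<le> gain C' L' \<mu> \<tau>"
  unfolding gain_def using assms kernel(1,2) by (intro add_mono mult_right_mono mult_left_mono) auto

lemma gain_nonneg: "0 \<le> C \<Longrightarrow> 0 \<le> L \<Longrightarrow> 0 \<le> \<mu> \<Longrightarrow> 0 \<le> \<tau> \<Longrightarrow> 0 \<le> gain C L \<mu> \<tau>"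
  unfolding gain_def using kernel(1,2) by simp

lemma gain_scale: "gain C L (s * \<mu>) (s * \<tau>) = s * gain C L \<mu> \<tau>"
  by (simp add: gain_def algebra_simps)

text \<open>Cancellation is used in the outer potential only. The inner Green potential enters
  through its sup norm and Lipschitz constant, both bounded by the mass of \<open>V * v\<close>, so
  \<open>v\<close> may be an arbitrary element of \<open>L2 D\<close>.\<close>

lemma T_gain:
  assumes o: "oscillation_bound \<mu> \<tau>" and v: "v \<in> L2 D" and x: "x \<in> D"
  shows "\<bar>T v x\<bar> \<le> gain g0 LG \<mu> \<tau> * mass (\<lambda>y. V y * v y)"
proof -
  let ?m = "mass (\<lambda>y. V y * v y)"
  have "\<bar>T v x\<bar> \<le> gain (g0 * ?m) (LG * ?m) \<mu> \<tau>"
    unfolding T_def by (intro green_gain o green_Lipschitz green_bound potential_integrable v x)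
  then show ?thesis by (simp add: gain_def algebra_simps)
qed

text \<open>Cauchy-Schwarz bounds the mass in \<open>T_gain\<close> by the product of the norms of
  \<open>V\<close> and \<open>v\<close>; a sup bound on \<open>D\<close> costs a factor
  \<open>sqrt (b - a)\<close> in \<open>L2 D\<close>.\<close>

lemma operator_norm_small:
  assumes o: "oscillation_bound \<mu> \<tau>" and s: "sqrt (b - a) * (gain g0 LG \<mu> \<tau> * L2_norm D V) \<le> \<rho>"
  shows "L2_operator_norm D T \<le> ennreal \<rho>"
proof -
  have g: "0 \<le> gain g0 LG \<mu> \<tau>" using kernel o by (simp add: gain_def oscillation_bound_def)
  have "0 \<le> sqrt (b - a) * (gain g0 LG \<mu> \<tau> * L2_norm D V)"
    using ab g L2_norm_nonneg by simp
  then have \<rho>: "0 \<le> \<rho>" using s by linarith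
  show ?thesis unfolding operator_norm_le_iff[OF \<rho>]
  proof
    fix v assume v: "v \<in> L2 D"
    have "L2_norm D (T v) \<le> sqrt (b - a) * (gain g0 LG \<mu> \<tau> * (L2_norm D V * L2_norm D v))"
      by (intro L2_norm_le T_L2 v mult_nonneg_nonneg g L2_norm_nonneg AE_I2 impI
          order_trans[OF T_gain[OF o v] mult_left_mono[OF potential_mass[OF v] g]])
    also have "\<dots> = sqrt (b - a) * (gain g0 LG \<mu> \<tau> * L2_norm D V) * L2_norm D v" by simp
    also have "\<dots> \<le> \<rho> * L2_norm D v" by (intro mult_right_mono s L2_norm_nonneg)
    finally show "L2_norm D (T v) \<le> \<rho> * L2_norm D v" .
  qed
qed

text \<open>Subtracting the unperturbed solution leaves a fixed point equation for
  \<open>u - green f\<close> with an explicit source.\<close>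

lemma perturbation_equation:
  assumes u: "perturbed_solution D G V f u" and u0: "green f \<in> L2 D"
  shows "(\<lambda>x. u x - green f x) \<in> L2 D"
    "AE x in lborel. x \<in> D \<longrightarrow> u x - green f x
      = (T (green f) x - green (\<lambda>y. V y * green f y) x) + T (\<lambda>x. u x - green f x) x"
proof -
  have uL: "u \<in> L2 D" and eq: "AE x in lborel. x \<in> D \<longrightarrow> u x = green f x - green (\<lambda>y. V y * green f y) x + T u x"
    using u by (auto simp: perturbed_solution_def T_def)
  show "(\<lambda>x. u x - green f x) \<in> L2 D" by (rule L2_diff[OF uL u0])
  show "AE x in lborel. x \<in> D \<longrightarrow> u x - green f x
      = (T (green f) x - green (\<lambda>y. V y * green f y) x) + T (\<lambda>x. u x - green f x) x"
    using eq by eventually_elim (simp add: T_diff[OF _ uL u0])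
qed

text \<open>The coarse pair \<open>\<mu>\<close>, \<open>\<tau>\<close> bounds \<open>w\<close> and
  the operator \<open>T\<close>. The fine pair \<open>\<mu>'\<close>, \<open>\<tau>'\<close> is
  reserved for \<open>T (green f)\<close>, the Green potential of \<open>V * w\<close>, where
  \<open>w\<close> is small but its Lipschitz constant is not. Subtracting the first order term
  \<open>- w\<close> leaves \<open>c2\<close> and a term controlled by the mass of
  \<open>V * v\<close>.\<close>

theorem perturbation_estimate:
  assumes u: "perturbed_solution D G V f u" and u0: "Lipschitz_on L0 (green f)" "\<And>x. x \<in> D \<Longrightarrow> \<bar>green f x\<bar> \<le> c0"
    and o: "oscillation_bound \<mu> \<tau>" and o': "oscillation_bound \<mu>' \<tau>'"
    and half: "gain g0 LG \<mu> \<tau> * mass V \<le> 1 / 2"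
    and c1: "c1 = gain c0 L0 \<mu> \<tau>" and c2: "c2 = gain c1 (LG * (c0 * mass V)) \<mu>' \<tau>'"
  shows "AE x in lborel. x \<in> D \<longrightarrow> \<bar>u x - green f x + green (\<lambda>y. V y * green f y) x\<bar>
    \<le> c2 + gain g0 LG \<mu> \<tau> * (2 * ((c1 + c2) * mass V))"
proof -
  have u0L: "green f \<in> L2 D" by (rule L2_Lipschitz[OF u0])
  note v = perturbation_equation[OF u u0L]
  define v where "v x = u x - green f x" for x
  define w where "w = green (\<lambda>y. V y * green f y)"
  note v = v[folded v_def w_def]
  let ?m = "mass (\<lambda>y. V y * v y)" and ?g = "gain g0 LG \<mu> \<tau>"
  have w1: "\<bar>w x\<bar> \<le> c1" if "x \<in> D" for x unfolding w_def c1 by (rule green_gain[OF o u0 that])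
  have m0: "mass (\<lambda>y. V y * green f y) \<le> c0 * mass V"
    by (intro potential_mass_bounded u0L AE_I2 impI u0)
  have "Lipschitz_on (LG * mass (\<lambda>y. V y * green f y)) w"
    unfolding w_def by (intro green_Lipschitz potential_integrable u0L)
  then have wL: "Lipschitz_on (LG * (c0 * mass V)) w"
    using mult_right_mono[OF mult_left_mono[OF m0 kernel(1)] abs_ge_zero] mult_left_mono[OF m0 kernel(1)]
    unfolding Lipschitz_on_def by (meson order_trans)
  have w2: "\<bar>T (green f) x\<bar> \<le> c2" if "x \<in> D" for x
    using green_gain[OF o' wL w1 that] unfolding w_def c2 T_def by simp
  have vb: "AE x in lborel. x \<in> D \<longrightarrow> \<bar>v x\<bar> \<le> c1 + c2 + ?g * ?m"
    using v(2)
  proof eventually_elim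
    case (elim x)
    show ?case
    proof
      assume x: "x \<in> D"
      show "\<bar>v x\<bar> \<le> c1 + c2 + ?g * ?m"
        using elim x w1[OF x] w2[OF x] T_gain[OF o v(1) x] by linarith
    qed
  qed
  \<comment> \<open>The unknown mass occurs on both sides; \<open>half\<close> allows it to be
    absorbed on the left.\<close>
  have "?m \<le> (c1 + c2 + ?g * ?m) * mass V" by (rule potential_mass_bounded[OF vb v(1)])
  also have "\<dots> = (c1 + c2) * mass V + (?g * mass V) * ?m" by (simp add: algebra_simps)
  also have "\<dots> \<le> (c1 + c2) * mass V + 1 / 2 * ?m" by (intro add_left_mono mult_right_mono half mass_nonneg)
  finally have m: "?m \<le> 2 * ((c1 + c2) * mass V)" by simp
  have g: "0 \<le> ?g" using kernel o by (simp add: gain_def oscillation_bound_def)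
  show ?thesis using v(2)
  proof eventually_elim
    case (elim x)
    show ?case
    proof
      assume x: "x \<in> D"
      have "v x + w x = T (green f) x + T v x" using elim x by simp
      moreover have "\<bar>T v x\<bar> \<le> ?g * (2 * ((c1 + c2) * mass V))"
        using T_gain[OF o v(1) x] mult_left_mono[OF m g] by linarith
      ultimately show "\<bar>u x - green f x + green (\<lambda>y. V y * green f y) x\<bar> \<le> c2 + ?g * (2 * ((c1 + c2) * mass V))"
        using w2[OF x] unfolding v_def w_def by linarith
    qed
  qed
qed

text \<open>The bound of \<open>perturbation_estimate\<close> with one factor
  \<open>s = sqrt \<epsilon>\<close> taken out and the mass of the potential replaced by
  \<open>sqrt (b - a) * A\<close>. As a function of \<open>s\<close> it is continuous up to
  0.\<close>

definition error :: "real \<Rightarrow> real \<Rightarrow> real \<Rightarrow> real \<Rightarrow> nat \<Rightarrow> real \<Rightarrow> real" where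
  "error c0 L0 A \<tau> m s =
    (let e = gain (s * gain c0 L0 A ((b - a) * A)) (LG * (c0 * (sqrt (b - a) * A))) (2 ^ m * A) ((b - a) * \<tau>)
     in e + gain g0 LG A ((b - a) * A) * (2 * ((s * gain c0 L0 A ((b - a) * A) + s * e) * (sqrt (b - a) * A))))"

text \<open>At \<open>s = 0\<close> every term vanishes except the product of \<tau> with the
  Lipschitz constant of \<open>w\<close>; in particular \<open>2^m\<close> disappears, so
  \<open>m\<close> may depend on \<tau>.\<close>

lemma error_tendsto:
  "((\<lambda>\<epsilon>. error c0 L0 A \<tau> m (sqrt \<epsilon>)) \<longlongrightarrow> g0 * (LG * (c0 * (sqrt (b - a) * A))) * ((b - a) * \<tau>)) (at_right 0)"
proof -
  have s: "((\<lambda>\<epsilon>. sqrt \<epsilon>) \<longlongrightarrow> 0) (at_right 0)"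
    using tendsto_real_sqrt[OF tendsto_ident_at[of "0 :: real" "{0<..}"]] by simp
  have "isCont (error c0 L0 A \<tau> m) 0" unfolding error_def[abs_def] Let_def gain_def by (intro continuous_intros)
  then have "((\<lambda>\<epsilon>. error c0 L0 A \<tau> m (sqrt \<epsilon>)) \<longlongrightarrow> error c0 L0 A \<tau> m 0) (at_right 0)"
    by (rule isCont_tendsto_compose[OF _ s])
  moreover have "error c0 L0 A \<tau> m 0 = g0 * (LG * (c0 * (sqrt (b - a) * A))) * ((b - a) * \<tau>)"
    by (simp add: error_def gain_def)
  ultimately show ?thesis by simp
qed

text \<open>\<open>gain\<close> is homogeneous in its last two arguments and monotone in the first
  two, so the factor \<open>s\<close> can be extracted and the actual mass of \<open>V\<close>
  replaced by its deterministic bound.\<close>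

lemma scaled_estimate:
  assumes u: "perturbed_solution D G V f u" and u0: "Lipschitz_on L0 (green f)" "\<And>x. x \<in> D \<Longrightarrow> \<bar>green f x\<bar> \<le> c0"
    and pos: "0 < s" "0 \<le> A" "0 \<le> \<tau>" and VA: "L2_norm D V \<le> A"
    and o: "oscillation_bound (s * A) (s * ((b - a) * A))" and o': "oscillation_bound (s * (2 ^ m * A)) (s * ((b - a) * \<tau>))"
    and half: "s * gain g0 LG A ((b - a) * A) * (sqrt (b - a) * A) \<le> 1 / 2"
  shows "AE x in lborel. x \<in> D \<longrightarrow> \<bar>u x - green f x + green (\<lambda>y. V y * green f y) x\<bar> \<le> s * error c0 L0 A \<tau> m s"
proof -
  define k1 k2 r where "k1 = gain c0 L0 A ((b - a) * A)" and "k2 = gain g0 LG A ((b - a) * A)" and "r = sqrt (b - a) * A"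
  define c1 where "c1 = s * k1"
  define e e' where "e = gain c1 (LG * (c0 * r)) (2 ^ m * A) ((b - a) * \<tau>)"
    and "e' = gain c1 (LG * (c0 * mass V)) (2 ^ m * A) ((b - a) * \<tau>)"
  have c0: "0 \<le> c0" using order_trans[OF abs_ge_zero u0(2)[of "(a + b) / 2"]] ab by simp
  have L0: "0 \<le> L0" using u0(1) by (simp add: Lipschitz_on_def)
  have k: "0 \<le> k1" "0 \<le> k2" unfolding k1_def k2_def using pos c0 L0 kernel ab by (auto intro!: gain_nonneg)
  have c1: "0 \<le> c1" using k pos by (simp add: c1_def)
  have mass: "mass V \<le> r"
    unfolding r_def using ab by (intro order_trans[OF L1_le_L2(2)[OF V]] mult_left_mono VA) simp
  have r: "0 \<le> r" using mass mass_nonneg[of V] by linarith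
  have e: "e' \<le> e" "0 \<le> e'"
    unfolding e_def e'_def using c0 c1 mass mass_nonneg[of V] kernel(1,2) pos ab
    by (auto intro!: gain_mono gain_nonneg mult_left_mono)
  have half': "gain g0 LG (s * A) (s * ((b - a) * A)) * mass V \<le> 1 / 2"
  proof -
    have "gain g0 LG (s * A) (s * ((b - a) * A)) * mass V \<le> s * k2 * r"
      unfolding gain_scale k2_def[symmetric] using k pos by (intro mult_left_mono mass) simp
    then show ?thesis using half unfolding k2_def r_def by linarith
  qed
  have bd: "s * e' + s * k2 * (2 * ((c1 + s * e') * mass V)) \<le> s * error c0 L0 A \<tau> m s"
  proof -
    have "s * e' + s * k2 * (2 * ((c1 + s * e') * mass V)) \<le> s * e + s * k2 * (2 * ((c1 + s * e) * r))"
      using k pos e c1 r mass mass_nonneg[of V]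
      by (intro add_mono mult_left_mono mult_mono add_left_mono mult_nonneg_nonneg add_nonneg_nonneg) auto
    also have "\<dots> = s * error c0 L0 A \<tau> m s"
      unfolding error_def Let_def k1_def[symmetric] k2_def[symmetric] r_def[symmetric] c1_def[symmetric] e_def[symmetric]
      by (simp add: distrib_left mult.assoc)
    finally show ?thesis .
  qed
  have "AE x in lborel. x \<in> D \<longrightarrow> \<bar>u x - green f x + green (\<lambda>y. V y * green f y) x\<bar>
      \<le> s * e' + s * k2 * (2 * ((c1 + s * e') * mass V))"
    using perturbation_estimate[OF u u0 o o' half' refl refl]
    unfolding gain_scale k1_def[symmetric] k2_def[symmetric] c1_def[symmetric] e'_def[symmetric] .
  then show ?thesis by eventually_elim (use bd in auto)
qed

end

section \<open>Measurability of the perturbed solution\<close>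

lemma L1_class_restrict:
  assumes "set_integrable lborel D h"
  shows "L1_class D (restrict h D) = L1_class D h"
proof -
  have "set_integrable lborel D (restrict h D)"
    using assms by (subst set_integrable_cong[of _ lborel D D _ h]) auto
  then show ?thesis by (subst L1_class_eq_iff[OF _ assms]) auto
qed

lemma (in dyadic) Lipschitz_on_uniformly_continuous:
  assumes "Lipschitz_on L h"
  shows "uniformly_continuous_on D h"
proof -
  have "L-lipschitz_on D h" using assms by (auto simp: Lipschitz_on_def lipschitz_on_def dist_real_def)
  then show ?thesis by (rule lipschitz_on_uniformly_continuous)
qed

locale oscillating_green = oscillating a b M q \<phi>
  for a b :: real and M :: "'w measure" and q :: "real \<Rightarrow> 'w \<Rightarrow> real" and \<phi> :: "real \<Rightarrow> real" +
  fixes G :: "real \<Rightarrow> real \<Rightarrow> real" and LG g0 :: real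
  assumes green_kernel: "Lipschitz_kernel LG g0 G"
begin

text \<open>The value 0 on bad paths puts the potential in \<open>L2 D\<close> for every \<omega>,
  so the pathwise locale can be interpreted without exceptions.\<close>

definition pot :: "real \<Rightarrow> 'w \<Rightarrow> real \<Rightarrow> real" where
  "pot \<epsilon> \<omega> y = (if \<omega> \<in> space M \<and> Q2 \<epsilon> \<omega> < \<top> then q (y / \<epsilon>) \<omega> else 0)"

lemma pot_eq: "\<omega> \<in> space M \<Longrightarrow> Q2 \<epsilon> \<omega> < \<top> \<Longrightarrow> pot \<epsilon> \<omega> = (\<lambda>y. q (y / \<epsilon>) \<omega>)"
  by (simp add: pot_def fun_eq_iff)

lemma pot_L2: "pot \<epsilon> \<omega> \<in> L2 D"
proof (cases "\<omega> \<in> space M \<and> Q2 \<epsilon> \<omega> < \<top>")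
  case True
  then have "set_integrable lborel D (\<lambda>y. (q (y / \<epsilon>) \<omega>)\<^sup>2)"
    by (intro set_integrable_subset[OF q_square_integrable(1)]) auto
  moreover have "set_borel_measurable lborel D (\<lambda>y. q (y / \<epsilon>) \<omega>)"
    using q_section[of \<omega> \<epsilon>] True by (auto simp: set_borel_measurable_def intro!: borel_measurable_times)
  ultimately show ?thesis using True by (simp add: L2_def pot_eq)
next
  case False
  then have "pot \<epsilon> \<omega> = (\<lambda>_. 0)" by (auto simp: pot_def fun_eq_iff)
  then show ?thesis by (simp add: L2_const)
qed

sublocale P: green_potential a b G LG g0 "pot \<epsilon> \<omega>" for \<epsilon> \<omega>
  by unfold_locales (rule green_kernel pot_L2)+

lemma pot_measurable [measurable]: "(\<lambda>(\<omega>, y). pot \<epsilon> \<omega> y) \<in> borel_measurable (M \<Otimes>\<^sub>M lborel)"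
proof -
  have "(\<lambda>(\<omega>, y). pot \<epsilon> \<omega> y) \<in> borel_measurable (M \<Otimes>\<^sub>M lborel) \<longleftrightarrow>
      (\<lambda>z. if Q2 \<epsilon> (fst z) < \<top> then (case z of (\<omega>, y) \<Rightarrow> q (y / \<epsilon>) \<omega>) else 0) \<in> borel_measurable (M \<Otimes>\<^sub>M lborel)"
    by (rule measurable_cong) (auto simp: space_pair_measure pot_def)
  then show ?thesis by (rule iffD2) measurable
qed

lemma kernel_measurable: "(\<lambda>(x, y). indicator (D \<times> D) (x, y) * G x y) \<in> borel_measurable (lborel \<Otimes>\<^sub>M lborel)"
proof -
  have "continuous_on (D \<times> D) (\<lambda>(x, y). G x y)"
  proof (rule lipschitz_on_continuous_on[of "2 * LG"], rule lipschitz_onI)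
    fix z z' assume z: "z \<in> D \<times> D" "z' \<in> D \<times> D"
    obtain x y x' y' where e: "z = (x, y)" "z' = (x', y')" by (cases z, cases z')
    have 1: "\<bar>G x y - G x' y\<bar> \<le> LG * \<bar>x - x'\<bar>" using z P.kernel(5) unfolding e by blast
    have 2: "\<bar>G x' y - G x' y'\<bar> \<le> LG * \<bar>y - y'\<bar>" using z P.kernel(3)[of x'] unfolding e Lipschitz_on_def by auto
    have "\<bar>x - x'\<bar> \<le> dist z z'" "\<bar>y - y'\<bar> \<le> dist z z'"
      using dist_fst_le[of z z'] dist_snd_le[of z z'] by (auto simp: e dist_real_def)
    then have "LG * \<bar>x - x'\<bar> \<le> LG * dist z z'" "LG * \<bar>y - y'\<bar> \<le> LG * dist z z'"
      using P.kernel(1) by (auto intro: mult_left_mono)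
    then show "dist (case z of (x, y) \<Rightarrow> G x y) (case z' of (x, y) \<Rightarrow> G x y) \<le> 2 * LG * dist z z'"
      using 1 2 unfolding e by (simp add: dist_real_def)
  qed (use P.kernel(1) in simp)
  then have "(\<lambda>z. indicator (D \<times> D) z *\<^sub>R (case z of (x, y) \<Rightarrow> G x y)) \<in> borel_measurable borel"
    by (intro borel_measurable_continuous_on_indicator) (auto simp: borel_prod[symmetric])
  then show ?thesis by (simp add: case_prod_beta' lborel_prod)
qed

text \<open>Joint measurability, with a cutoff because the kernel and the functions are arbitrary
  outside \<open>D\<close>. This property is stable under the Green operator by Fubini's
  theorem.\<close>

definition field_measurable :: "('w \<Rightarrow> real \<Rightarrow> real) \<Rightarrow> bool" where
  "field_measurable p \<longleftrightarrow> (\<lambda>(\<omega>, y). indicator D y * p \<omega> y) \<in> borel_measurable (M \<Otimes>\<^sub>M lborel)"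

lemma field_measurable_green:
  assumes p: "field_measurable p"
  shows "field_measurable (\<lambda>\<omega>. green_op D G (p \<omega>))"
proof -
  have [measurable]: "(\<lambda>(\<omega>, y). indicator D y * p \<omega> y) \<in> borel_measurable (M \<Otimes>\<^sub>M lborel)"
    using p by (simp add: field_measurable_def)
  note [measurable] = kernel_measurable
  have k: "(\<lambda>z. case (snd (fst z), snd z) of (x, y) \<Rightarrow> indicator (D \<times> D) (x, y) * G x y) \<in> borel_measurable ((M \<Otimes>\<^sub>M lborel) \<Otimes>\<^sub>M lborel)"
    by (rule measurable_compose[OF _ kernel_measurable]) measurable
  have l: "(\<lambda>z. case (fst (fst z), snd z) of (\<omega>, y) \<Rightarrow> indicator D y * p \<omega> y) \<in> borel_measurable ((M \<Otimes>\<^sub>M lborel) \<Otimes>\<^sub>M lborel)"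
    by (rule measurable_compose[where N = "M \<Otimes>\<^sub>M lborel"]) measurable
  have m: "(\<lambda>(z, y). indicator (D \<times> D) (snd z, y) * G (snd z) y * (indicator D y * p (fst z) y)) \<in> borel_measurable ((M \<Otimes>\<^sub>M lborel) \<Otimes>\<^sub>M lborel)"
    using borel_measurable_times[OF k l] by (simp add: case_prod_beta')
  have "(\<lambda>z. LINT y|lborel. indicator (D \<times> D) (snd z, y) * G (snd z) y * (indicator D y * p (fst z) y)) \<in> borel_measurable (M \<Otimes>\<^sub>M lborel)"
    by (rule lborel.borel_measurable_lebesgue_integral[OF m])
  moreover have "(\<lambda>z. LINT y|lborel. indicator (D \<times> D) (snd z, y) * G (snd z) y * (indicator D y * p (fst z) y))
      = (\<lambda>(\<omega>, x). indicator D x * green_op D G (p \<omega>) x)"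
  proof (rule ext)
    fix z :: "'w \<times> real"
    obtain \<omega> x where z: "z = (\<omega>, x)" by (cases z)
    show "(LINT y|lborel. indicator (D \<times> D) (snd z, y) * G (snd z) y * (indicator D y * p (fst z) y))
        = (case z of (\<omega>, x) \<Rightarrow> indicator D x * green_op D G (p \<omega>) x)"
    proof (cases "x \<in> D")
      case True
      then show ?thesis unfolding z green_op_def set_lebesgue_integral_def
        by (simp, intro Bochner_Integration.integral_cong) (auto simp: indicator_def)
    next
      case False
      then have "indicator (D \<times> D) (x, y) = (0 :: real)" for y by (simp add: indicator_times)
      then show ?thesis using False by (simp add: z)
    qed
  qed
  ultimately show ?thesis by (simp add: field_measurable_def)
qed

lemma field_measurable_pot:
  assumes "field_measurable p"
  shows "field_measurable (\<lambda>\<omega> y. pot \<epsilon> \<omega> y * p \<omega> y)"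
proof -
  have "(\<lambda>z. (case z of (\<omega>, y) \<Rightarrow> pot \<epsilon> \<omega> y) * (case z of (\<omega>, y) \<Rightarrow> indicator D y * p \<omega> y)) \<in> borel_measurable (M \<Otimes>\<^sub>M lborel)"
    using assms by (intro borel_measurable_times pot_measurable) (simp add: field_measurable_def)
  then show ?thesis unfolding field_measurable_def by (simp add: case_prod_beta' mult.left_commute)
qed

lemma field_measurable_T: "field_measurable p \<Longrightarrow> field_measurable (\<lambda>\<omega>. P.T \<epsilon> \<omega> (p \<omega>))"
  unfolding P.T_def by (intro field_measurable_green field_measurable_pot)

lemma field_measurable_add:
  assumes "field_measurable p" "field_measurable r"
  shows "field_measurable (\<lambda>\<omega> x. p \<omega> x + c * r \<omega> x)"
proof -
  have "(\<lambda>z. (case z of (\<omega>, y) \<Rightarrow> indicator D y * p \<omega> y) + c * (case z of (\<omega>, y) \<Rightarrow> indicator D y * r \<omega> y)) \<in> borel_measurable (M \<Otimes>\<^sub>M lborel)"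
    using assms unfolding field_measurable_def by (intro borel_measurable_add borel_measurable_times borel_measurable_const)
  then show ?thesis unfolding field_measurable_def by (simp add: case_prod_beta' algebra_simps)
qed

lemma field_measurable_const:
  assumes "u \<in> L2 D"
  shows "field_measurable (\<lambda>_. u)"
proof -
  have "(\<lambda>y. indicator D y * u y) \<in> borel_measurable lborel"
    using assms by (simp add: L2_def set_borel_measurable_def)
  then show ?thesis unfolding field_measurable_def by measurable
qed

lemma field_measurable_section:
  assumes "field_measurable p" "x \<in> D"
  shows "(\<lambda>\<omega>. p \<omega> x) \<in> borel_measurable M"
proof -
  have "(\<lambda>\<omega>. case (\<omega>, x) of (\<omega>, y) \<Rightarrow> indicator D y * p \<omega> y) \<in> borel_measurable M"
    by (rule measurable_compose[OF _ assms(1)[unfolded field_measurable_def]]) measurable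
  then show ?thesis using assms(2) by simp
qed

lemma L2_norm_measurable:
  assumes p: "field_measurable p"
  shows "(\<lambda>\<omega>. L2_norm D (p \<omega>)) \<in> borel_measurable M"
proof -
  have "(\<lambda>\<omega>. LINT y|lborel. (indicator D y * p \<omega> y)\<^sup>2) \<in> borel_measurable M"
    using borel_measurable_power[OF p[unfolded field_measurable_def], of 2]
    by (intro lborel.borel_measurable_lebesgue_integral) (simp add: case_prod_beta')
  moreover have "(indicator D y * p \<omega> y)\<^sup>2 = indicat_real D y *\<^sub>R (p \<omega> y)\<^sup>2" for y \<omega>
    by (simp add: indicator_def)
  ultimately show ?thesis unfolding L2_norm_def set_lebesgue_integral_def by simp
qed

text \<open>The version of \<open>exceptional_set\<close> built from \<open>pot\<close>. The two
  agree on paths with finite \<open>Q2\<close>, hence almost surely, and this one is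
  measurable.\<close>

definition exceptional :: "real \<Rightarrow> real \<Rightarrow> 'w set" where
  "exceptional \<rho> \<epsilon> = {\<omega> \<in> space M. ennreal \<rho> < L2_operator_norm D (P.T \<epsilon> \<omega>)}"

lemma exceptional_iff:
  assumes "\<omega> \<in> space M" "Q2 \<epsilon> \<omega> < \<top>"
  shows "\<omega> \<in> exceptional \<rho> \<epsilon> \<longleftrightarrow> \<omega> \<in> exceptional_set M D G q \<rho> \<epsilon>"
  unfolding exceptional_def exceptional_set_def P.T_def[abs_def] using assms by (simp add: pot_eq)

lemma exceptional_sets:
  assumes "0 \<le> \<rho>"
  shows "exceptional \<rho> \<epsilon> \<in> sets M"
proof -
  have "(\<Inter>cs\<in>lists \<rat>. {\<omega> \<in> space M. L2_norm D (P.T \<epsilon> \<omega> (dyadic_step cs)) \<le> \<rho> * L2_norm D (dyadic_step cs)}) \<in> sets M"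
  proof (rule sets.countable_INT')
    show "countable (lists \<rat> :: real list set)" by (intro countable_lists countable_rat)
    have [measurable]: "(\<lambda>\<omega>. L2_norm D (P.T \<epsilon> \<omega> (dyadic_step cs))) \<in> borel_measurable M" for cs
      by (intro L2_norm_measurable field_measurable_T field_measurable_const dyadic_step_L2)
    have "{\<omega> \<in> space M. L2_norm D (P.T \<epsilon> \<omega> (dyadic_step cs)) \<le> \<rho> * L2_norm D (dyadic_step cs)} \<in> sets M" for cs by measurable
    then show "(\<lambda>cs. {\<omega> \<in> space M. L2_norm D (P.T \<epsilon> \<omega> (dyadic_step cs)) \<le> \<rho> * L2_norm D (dyadic_step cs)}) ` lists \<rat> \<subseteq> sets M" by blast
  qed auto
  moreover have "exceptional \<rho> \<epsilon> = space M - (\<Inter>cs\<in>lists \<rat>. {\<omega> \<in> space M. L2_norm D (P.T \<epsilon> \<omega> (dyadic_step cs)) \<le> \<rho> * L2_norm D (dyadic_step cs)})"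
    unfolding exceptional_def not_le[symmetric] P.operator_norm_le_iff_countable[OF assms] by blast
  ultimately show ?thesis by simp
qed

text \<open>The inhomogeneity of the fixed point equation for \<open>u - u0\<close>. The form
  \<open>p + c * r\<close> fits \<open>field_measurable_add\<close>, here and in
  \<open>iterate\<close>.\<close>

definition source :: "(real \<Rightarrow> real) \<Rightarrow> real \<Rightarrow> 'w \<Rightarrow> real \<Rightarrow> real" where
  "source u0 \<epsilon> \<omega> x = P.T \<epsilon> \<omega> u0 x + (- 1) * green_op D G (\<lambda>y. pot \<epsilon> \<omega> y * u0 y) x"

primrec iterate :: "(real \<Rightarrow> real) \<Rightarrow> real \<Rightarrow> nat \<Rightarrow> 'w \<Rightarrow> real \<Rightarrow> real" where
  "iterate u0 \<epsilon> 0 = (\<lambda>\<omega> x. 0)"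
| "iterate u0 \<epsilon> (Suc n) = (\<lambda>\<omega> x. source u0 \<epsilon> \<omega> x + 1 * P.T \<epsilon> \<omega> (iterate u0 \<epsilon> n \<omega>) x)"

context
  fixes u0 :: "real \<Rightarrow> real" and \<epsilon> :: real
  assumes u0: "u0 \<in> L2 D"
begin

lemma source_L2: "source u0 \<epsilon> \<omega> \<in> L2 D"
  unfolding source_def[abs_def] by (intro L2_add L2_scale P.T_L2 P.inner_L2 u0)

lemma iterate_L2: "iterate u0 \<epsilon> n \<omega> \<in> L2 D"
  by (induction n) (auto intro!: L2_const L2_add source_L2 P.T_L2)

lemma source_uniformly_continuous: "uniformly_continuous_on D (source u0 \<epsilon> \<omega>)"
  unfolding source_def[abs_def]
  by (intro uniformly_continuous_on_add uniformly_continuous_on_cmul_left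
      Lipschitz_on_uniformly_continuous[OF P.T_Lipschitz[OF u0]]
      Lipschitz_on_uniformly_continuous[OF P.green_Lipschitz[OF P.potential_integrable[OF u0]]])

lemma iterate_uniformly_continuous: "uniformly_continuous_on D (iterate u0 \<epsilon> n \<omega>)"
proof (cases n)
  case 0
  then show ?thesis by (simp add: uniformly_continuous_on_const)
next
  case (Suc m)
  then show ?thesis
    by (simp add: uniformly_continuous_on_add source_uniformly_continuous
        Lipschitz_on_uniformly_continuous[OF P.T_Lipschitz[OF iterate_L2]])
qed

lemma source_measurable: "field_measurable (source u0 \<epsilon>)"
  unfolding source_def[abs_def]
  by (intro field_measurable_add field_measurable_T field_measurable_green field_measurable_pot field_measurable_const u0)

lemma iterate_measurable: "field_measurable (iterate u0 \<epsilon> n)"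
proof (induction n)
  case 0
  then show ?case by (simp add: field_measurable_const L2_const)
next
  case (Suc n)
  then show ?case by (simp only: iterate.simps) (intro field_measurable_add source_measurable field_measurable_T)
qed

lemma iterate_class_measurable:
  "(\<lambda>\<omega>. L1_class D (\<lambda>x\<in>D. iterate u0 \<epsilon> n \<omega> x / s)) \<in> measurable M (borel_sigma (mtopology_of (L1_metric D)))"
proof (rule measurable_compose[OF _ measurable_borel_sigma_continuous_map[OF continuous_map_L1_class[OF ab refl]]],
    rule measurable_C_metric[OF ab refl])
  fix x assume "x \<in> D"
  then have "(\<lambda>\<omega>. iterate u0 \<epsilon> n \<omega> x) \<in> borel_measurable M" by (rule field_measurable_section[OF iterate_measurable])
  then show "(\<lambda>\<omega>. iterate u0 \<epsilon> n \<omega> x / s) \<in> borel_measurable M" by measurable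
next
  fix \<omega>
  show "uniformly_continuous_on D (\<lambda>x. iterate u0 \<epsilon> n \<omega> x / s)"
    using uniformly_continuous_on_cmul_left[OF iterate_uniformly_continuous, of "1 / s" n \<omega>] by simp
qed

end

lemma perturbed_solution_pot:
  assumes "\<omega> \<in> space M" "Q2 \<epsilon> \<omega> < \<top>"
  shows "(\<lambda>x. modified_potential M D G q \<rho> \<epsilon> x \<omega>) = (if \<omega> \<in> exceptional \<rho> \<epsilon> then (\<lambda>x. 0) else pot \<epsilon> \<omega>)"
  using assms by (simp add: modified_potential_def exceptional_iff pot_eq fun_eq_iff)

text \<open>Outside the exceptional event the solution is the limit of the Neumann iterates, whose
  paths are uniformly continuous and hence measurable in C(D) and in L1. On the exceptional event
  the potential is 0 and the class of the difference is the zero class.\<close>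

lemma solution_measurable:
  assumes \<rho>: "0 < \<rho>" "\<rho> < 1" and f: "f \<in> L2 D"
    and U: "AE \<omega> in M. perturbed_solution D G (\<lambda>x. modified_potential M D G q \<rho> \<epsilon> x \<omega>) f (U \<omega>)"
  obtains X' where "X' \<in> measurable M (borel_sigma (mtopology_of (L1_metric D)))"
    and "AE \<omega> in M. L1_class D (\<lambda>x. (U \<omega> x - green_op D G f x) / s) = X' \<omega>"
proof -
  define u0 where "u0 = green_op D G f"
  have u0: "u0 \<in> L2 D" unfolding u0_def by (intro P.green_L2 L1_le_L2 f)
  note it = iterate_L2[OF u0, of \<epsilon>]
  have AE: "AE \<omega> in M. \<omega> \<in> space M \<and> Q2 \<epsilon> \<omega> < \<top> \<and> perturbed_solution D G (\<lambda>x. modified_potential M D G q \<rho> \<epsilon> x \<omega>) f (U \<omega>)"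
    using AE_space AE_Q2[of \<epsilon>] U by eventually_elim simp
  obtain N where N: "{\<omega> \<in> space M. \<not> (\<omega> \<in> space M \<and> Q2 \<epsilon> \<omega> < \<top> \<and> perturbed_solution D G (\<lambda>x. modified_potential M D G q \<rho> \<epsilon> x \<omega>) f (U \<omega>))} \<subseteq> N"
    "emeasure M N = 0" "N \<in> sets M"
    using AE_E[OF AE] by blast
  have nN: "Q2 \<epsilon> \<omega> < \<top>" "perturbed_solution D G (\<lambda>x. modified_potential M D G q \<rho> \<epsilon> x \<omega>) f (U \<omega>)"
    if "\<omega> \<in> space M" "\<omega> \<notin> N" for \<omega> using N(1) that by auto
  \<comment> \<open>The null set \<open>N\<close> is joined to the exceptional event so that the
    limit below holds at every point of the space, as \<open>measurable_borel_sigma_limit\<close>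
    demands.\<close>
  let ?bad = "exceptional \<rho> \<epsilon> \<union> N" and ?zero = "L1_class D (\<lambda>_. 0)"
  have bad: "?bad \<in> sets M" using exceptional_sets[of \<rho> \<epsilon>] N(3) \<rho> by simp
  define Y where "Y \<omega> = (if \<omega> \<in> ?bad then ?zero else L1_class D (\<lambda>x. (U \<omega> x - u0 x) / s))" for \<omega>
  define Z where "Z n \<omega> = (if \<omega> \<in> ?bad then ?zero else L1_class D (\<lambda>x\<in>D. iterate u0 \<epsilon> n \<omega> x / s))" for n \<omega>
  have zero: "?zero \<in> L1_space D" by (intro L1_class_in_L1_space set_integrable_const_D)
  have Zm: "Z n \<in> measurable M (borel_sigma (mtopology_of (L1_metric D)))" for n
    unfolding Z_def
    by (rule measurable_If_set[OF measurable_const iterate_class_measurable[OF u0]])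
      (use zero bad in \<open>auto simp: sets.Int_space_eq2\<close>)
  have v: "(\<lambda>x. U \<omega> x - u0 x) \<in> L2 D" "(\<lambda>n. L2_norm D (\<lambda>x. iterate u0 \<epsilon> n \<omega> x - (U \<omega> x - u0 x))) \<longlonglongrightarrow> 0"
    if \<omega>: "\<omega> \<in> space M" "\<omega> \<notin> ?bad" for \<omega>
  proof -
    have \<omega>N: "\<omega> \<notin> N" using \<omega> by simp
    have ps: "perturbed_solution D G (pot \<epsilon> \<omega>) f (U \<omega>)"
      using nN[OF \<omega>(1) \<omega>N] \<omega> by (simp add: perturbed_solution_pot)
    note pe = P.perturbation_equation[OF ps u0[unfolded u0_def], folded u0_def]
    show "(\<lambda>x. U \<omega> x - u0 x) \<in> L2 D" by (rule pe(1))
    show "(\<lambda>n. L2_norm D (\<lambda>x. iterate u0 \<epsilon> n \<omega> x - (U \<omega> x - u0 x))) \<longlonglongrightarrow> 0"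
    proof (rule P.iteration_converges[OF _ \<rho>(2) _ source_L2[OF u0] pe(1) _ it])
      show "0 \<le> \<rho>" using \<rho> by simp
      show "L2_operator_norm D (P.T \<epsilon> \<omega>) \<le> ennreal \<rho>" using \<omega> by (auto simp: exceptional_def)
      show "AE x in lborel. x \<in> D \<longrightarrow> U \<omega> x - u0 x = source u0 \<epsilon> \<omega> x + P.T \<epsilon> \<omega> (\<lambda>x. U \<omega> x - u0 x) x"
        using pe(2) by (simp add: source_def)
    qed simp_all
  qed
  have Ysp: "Y \<omega> \<in> L1_space D" if "\<omega> \<in> space M" for \<omega>
    using zero L1_class_in_L1_space[OF set_integrable_divide[OF L1_le_L2(1)[OF v(1)[OF that]]], of s] by (simp add: Y_def)
  have lim: "(\<lambda>n. mdist (L1_metric D) (Z n \<omega>) (Y \<omega>)) \<longlonglongrightarrow> 0" if \<omega>: "\<omega> \<in> space M" for \<omega>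
  proof (cases "\<omega> \<in> ?bad")
    case True
    then have "mdist (L1_metric D) (Z n \<omega>) (Y \<omega>) = 0" for n
      using zero by (simp add: Z_def Y_def Metric_space.mdist_zero[OF Metric_space_L1])
    then show ?thesis by simp
  next
    case False
    note v = v[OF \<omega> False]
    have iv: "set_integrable lborel D (\<lambda>x. (U \<omega> x - u0 x) / s)" and ii: "set_integrable lborel D (\<lambda>x. iterate u0 \<epsilon> n \<omega> x / s)" for n
      using L1_le_L2(1) v(1) it by (auto intro!: set_integrable_divide)
    have "norm (mdist (L1_metric D) (Z n \<omega>) (Y \<omega>)) \<le> sqrt (b - a) * L2_norm D (\<lambda>x. iterate u0 \<epsilon> n \<omega> x - (U \<omega> x - u0 x)) / \<bar>s\<bar>" for n
    proof -
      have "mdist (L1_metric D) (Z n \<omega>) (Y \<omega>) = (LINT x:D|lborel. \<bar>iterate u0 \<epsilon> n \<omega> x / s - (U \<omega> x - u0 x) / s\<bar>)"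
        using False by (simp add: Z_def Y_def L1_class_restrict[OF ii] L1_dist_L1_class[OF ii iv])
      also have "\<dots> = (LINT x:D|lborel. \<bar>iterate u0 \<epsilon> n \<omega> x - (U \<omega> x - u0 x)\<bar>) / \<bar>s\<bar>"
        by (simp add: diff_divide_distrib[symmetric] abs_divide)
      also have "\<dots> \<le> sqrt (b - a) * L2_norm D (\<lambda>x. iterate u0 \<epsilon> n \<omega> x - (U \<omega> x - u0 x)) / \<bar>s\<bar>"
        by (intro divide_right_mono L1_le_L2(2) L2_diff it v) simp
      finally show ?thesis using Metric_space.nonneg[OF Metric_space_L1] by simp
    qed
    moreover have "(\<lambda>n. sqrt (b - a) * L2_norm D (\<lambda>x. iterate u0 \<epsilon> n \<omega> x - (U \<omega> x - u0 x)) / \<bar>s\<bar>) \<longlonglongrightarrow> 0"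
      using tendsto_mult_left[OF v(2), of "sqrt (b - a) / \<bar>s\<bar>"] by simp
    ultimately show ?thesis by (rule Lim_null_comparison[OF always_eventually[OF allI]])
  qed
  show ?thesis
  proof (rule that[of Y])
    show "Y \<in> measurable M (borel_sigma (mtopology_of (L1_metric D)))"
      by (rule measurable_borel_sigma_limit[OF Zm _ lim]) (use Ysp in simp_all)
    have "AE \<omega> in M. \<omega> \<notin> N" using N by (intro AE_not_in) auto
    then show "AE \<omega> in M. L1_class D (\<lambda>x. (U \<omega> x - green_op D G f x) / s) = Y \<omega>"
      using AE_space
    proof eventually_elim
      case (elim \<omega>)
      show ?case
      proof (cases "\<omega> \<in> exceptional \<rho> \<epsilon>")
        case True
        \<comment> \<open>With potential 0 the integral equation reads \<open>u = u0\<close> almost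
          everywhere, in agreement with the value of \<open>Y\<close>.\<close>
        have ps: "perturbed_solution D G (\<lambda>x. 0) f (U \<omega>)"
          using nN[OF elim(2,1)] elim True by (simp add: perturbed_solution_pot)
        then have eq: "AE x in lborel. x \<in> D \<longrightarrow> U \<omega> x = u0 x" and UL: "U \<omega> \<in> L2 D"
          by (simp_all add: perturbed_solution_def u0_def green_op_def)
        have "L1_class D (\<lambda>x. (U \<omega> x - u0 x) / s) = ?zero"
          by (subst L1_class_eq_iff[OF set_integrable_divide[OF L1_le_L2(1)[OF L2_diff[OF UL u0]]] set_integrable_const_D])
            (use eq in \<open>auto elim: eventually_mono\<close>)
        then show ?thesis using True by (simp add: Y_def u0_def)
      qed (use elim in \<open>simp add: Y_def u0_def\<close>)
    qed
  qed
qed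

end

section \<open>Convergence in \<open>L\<^sup>1\<close>\<close>

lemma (in prob_space) Markov_inequality_ennreal:
  assumes [measurable]: "g \<in> borel_measurable M" and e: "(\<integral>\<^sup>+\<omega>. g \<omega> \<partial>M) \<le> ennreal e" "0 \<le> e" and t: "0 < t"
  shows "prob {\<omega> \<in> space M. \<not> g \<omega> \<le> ennreal t} \<le> e / t"
proof -
  have "emeasure M {\<omega> \<in> space M. \<not> g \<omega> \<le> ennreal t} \<le> emeasure M {\<omega> \<in> space M. 1 \<le> ennreal (1 / t) * g \<omega>}"
  proof (rule emeasure_mono)
    have "1 \<le> ennreal (1 / t) * g \<omega>" if "\<not> g \<omega> \<le> ennreal t" for \<omega>
    proof -
      have "ennreal (1 / t) * ennreal t \<le> ennreal (1 / t) * g \<omega>" using that by (intro mult_left_mono) auto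
      then show ?thesis using t by (simp add: ennreal_mult[symmetric])
    qed
    then show "{\<omega> \<in> space M. \<not> g \<omega> \<le> ennreal t} \<subseteq> {\<omega> \<in> space M. 1 \<le> ennreal (1 / t) * g \<omega>}" by auto
  qed measurable
  also have "\<dots> \<le> ennreal (1 / t) * (\<integral>\<^sup>+\<omega>. g \<omega> * indicator (space M) \<omega> \<partial>M)"
    by (rule nn_integral_Markov_inequality) auto
  also have "(\<integral>\<^sup>+\<omega>. g \<omega> * indicator (space M) \<omega> \<partial>M) = (\<integral>\<^sup>+\<omega>. g \<omega> \<partial>M)"
    by (intro nn_integral_cong) simp
  also have "ennreal (1 / t) * \<dots> \<le> ennreal (1 / t) * ennreal e" by (intro mult_left_mono e) simp
  also have "\<dots> = ennreal (e / t)" using e t by (simp add: ennreal_mult[symmetric])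
  finally show ?thesis using e t by (simp add: emeasure_eq_measure)
qed

lemma (in dyadic) bounded_Lipschitz_L1_class:
  assumes "bounded_Lipschitz (L1_metric D) B L F"
  shows "bounded_Lipschitz (C_metric D) B (L * (b - a)) (\<lambda>h. F (L1_class D h))"
proof -
  have i: "L1_class D h \<in> L1_space D" if "h \<in> mspace (C_metric D)" for h
    using that by (auto simp: mspace_C_metric intro!: L1_class_in_L1_space set_integrable_bounded_continuous[OF refl])
  show ?thesis unfolding bounded_Lipschitz_def
  proof (intro conjI ballI)
    fix h h' assume h: "h \<in> mspace (C_metric D)" "h' \<in> mspace (C_metric D)"
    have "\<bar>F (L1_class D h) - F (L1_class D h')\<bar> \<le> L * L1_dist D (L1_class D h) (L1_class D h')"
      using assms i h by (simp add: bounded_Lipschitz_def)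
    also have "\<dots> \<le> L * ((b - a) * mdist (C_metric D) h h')"
      using assms by (intro mult_left_mono L1_dist_le_C_metric[OF ab refl] h) (simp add: bounded_Lipschitz_def)
    finally show "\<bar>F (L1_class D h) - F (L1_class D h')\<bar> \<le> L * (b - a) * mdist (C_metric D) h h'" by (simp add: mult.assoc)
  qed (use assms i ab in \<open>auto simp: bounded_Lipschitz_def\<close>)
qed

section \<open>The remainder in probability\<close>

context oscillating_green
begin

text \<open>Split the dyadic limit at level \<open>m + 1\<close>. The Riemann sum is at most the sup
  norm times \<open>2^m * A\<close> by \<open>NV_le_TV\<close>, the tail at most
  \<open>L * (b - a) * \<tau>\<close> by \<open>RF_tail\<close>; the factor
  \<open>sqrt \<epsilon>\<close> undoes the normalization in \<open>B\<close>.\<close>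

lemma pot_oscillation:
  assumes \<omega>: "0 < \<epsilon>" "\<omega> \<in> space M" "Q2 \<epsilon> \<omega> < \<top>" and TV: "TV 0 (B \<epsilon> \<omega>) \<le> ennreal A" "TV (Suc m) (B \<epsilon> \<omega>) \<le> ennreal \<tau>"
    and pos: "0 \<le> A" "0 \<le> \<tau>"
  shows "P.oscillation_bound \<epsilon> \<omega> (sqrt \<epsilon> * (2 ^ m * A)) (sqrt \<epsilon> * ((b - a) * \<tau>))"
  unfolding P.oscillation_bound_def
proof (intro conjI allI impI)
  show "0 \<le> sqrt \<epsilon> * (2 ^ m * A)" "0 \<le> sqrt \<epsilon> * ((b - a) * \<tau>)" using \<omega> pos ab by auto
  fix h L C assume h: "Lipschitz_on L h" and C: "\<forall>x\<in>D. \<bar>h x\<bar> \<le> C"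
  let ?\<beta> = "B \<epsilon> \<omega>"
  have C0: "0 \<le> C" using order_trans[OF abs_ge_zero C[rule_format, of "(a + b) / 2"]] ab by simp
  have L0: "0 \<le> L" using h by (simp add: Lipschitz_on_def)
  have fin: "TV 0 ?\<beta> < \<top>" using TV(1) by (rule le_less_trans) simp
  have "ennreal \<bar>RF ?\<beta> h - RS (Suc m) ?\<beta> h\<bar> \<le> ennreal (L * (b - a)) * ennreal \<tau>"
    by (rule order_trans[OF RF_tail[OF B_additive h fin] mult_left_mono[OF TV(2)]]) simp
  then have "\<bar>RF ?\<beta> h - RS (Suc m) ?\<beta> h\<bar> \<le> L * (b - a) * \<tau>"
    using L0 ab pos by (simp add: ennreal_mult[symmetric])
  moreover have "\<bar>RS (Suc m) ?\<beta> h\<bar> \<le> C * NV (Suc m) ?\<beta>"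
    using RS_diff_le[of h "\<lambda>_. 0" C "Suc m" ?\<beta>] C by (simp add: RS_def)
  moreover have "C * NV (Suc m) ?\<beta> \<le> C * (2 ^ m * A)"
  proof (rule mult_left_mono[OF _ C0])
    have "ennreal (NV (Suc m) ?\<beta>) \<le> 2 ^ m * ennreal A"
      by (rule order_trans[OF NV_le_TV mult_left_mono[OF TV(1)]]) simp
    also have "\<dots> = ennreal (2 ^ m * A)" using pos by (simp add: ennreal_mult ennreal_power[symmetric])
    finally show "NV (Suc m) ?\<beta> \<le> 2 ^ m * A" using pos by simp
  qed
  ultimately have RF: "\<bar>RF ?\<beta> h\<bar> \<le> C * (2 ^ m * A) + L * (b - a) * \<tau>" by linarith
  have "(LINT y:D|lborel. h y * pot \<epsilon> \<omega> y) = - sqrt \<epsilon> * RF ?\<beta> h"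
    using B_RF[OF \<omega>(2,3) fin h C[rule_format]] \<omega> by (simp add: pot_eq)
  then have "\<bar>LINT y:D|lborel. h y * pot \<epsilon> \<omega> y\<bar> = sqrt \<epsilon> * \<bar>RF ?\<beta> h\<bar>" using \<omega>(1) by (simp add: abs_mult)
  also have "\<dots> \<le> sqrt \<epsilon> * (C * (2 ^ m * A) + L * (b - a) * \<tau>)" using \<omega>(1) by (intro mult_left_mono RF) simp
  finally show "\<bar>LINT y:D|lborel. h y * pot \<epsilon> \<omega> y\<bar> \<le> C * (sqrt \<epsilon> * (2 ^ m * A)) + L * (sqrt \<epsilon> * ((b - a) * \<tau>))"
    by (simp add: algebra_simps)
qed

lemma pot_norm:
  assumes "\<omega> \<in> space M" "Q2 \<epsilon> \<omega> \<le> ennreal (A\<^sup>2)" "0 \<le> A"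
  shows "L2_norm D (pot \<epsilon> \<omega>) \<le> A"
proof -
  have fin: "Q2 \<epsilon> \<omega> < \<top>" using assms(2) by (rule le_less_trans) simp
  have "(LINT y:D|lborel. (q (y / \<epsilon>) \<omega>)\<^sup>2) = (LINT y:{a<..b}|lborel. (q (y / \<epsilon>) \<omega>)\<^sup>2)"
    unfolding set_lebesgue_integral_def
  proof (rule integral_cong_AE)
    note [measurable] = q_section[OF assms(1), of \<epsilon>]
    show "(\<lambda>y. indicat_real D y *\<^sub>R (q (y / \<epsilon>) \<omega>)\<^sup>2) \<in> borel_measurable lborel"
      "(\<lambda>y. indicat_real {a<..b} y *\<^sub>R (q (y / \<epsilon>) \<omega>)\<^sup>2) \<in> borel_measurable lborel" by measurable
    show "AE y in lborel. indicat_real D y *\<^sub>R (q (y / \<epsilon>) \<omega>)\<^sup>2 = indicat_real {a<..b} y *\<^sub>R (q (y / \<epsilon>) \<omega>)\<^sup>2"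
      using AE_lborel_singleton[of b] by eventually_elim (auto simp: indicator_def)
  qed
  also have "\<dots> = enn2real (Q2 \<epsilon> \<omega>)" by (rule q_square_integrable(2)[OF fin assms(1)])
  also have "\<dots> \<le> A\<^sup>2" using enn2real_mono[OF assms(2)] by simp
  finally show ?thesis unfolding L2_norm_def pot_eq[OF assms(1) fin]
    using real_sqrt_le_mono[of _ "A\<^sup>2"] assms(3) by fastforce
qed

lemma green_L2_data:
  assumes f: "f \<in> L2 D"
  obtains L0 c0 where "Lipschitz_on L0 (green_op D G f)" "\<And>x. x \<in> D \<Longrightarrow> \<bar>green_op D G f x\<bar> \<le> c0"
  using P.green_Lipschitz[OF L1_le_L2(1)[OF f]] P.green_bound[OF _ L1_le_L2(1)[OF f]] by blast

context
  fixes f :: "real \<Rightarrow> real" and L0 c0 \<rho> :: real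
  assumes f: "f \<in> L2 D" and u0: "Lipschitz_on L0 (green_op D G f)" "\<And>x. x \<in> D \<Longrightarrow> \<bar>green_op D G f x\<bar> \<le> c0"
    and \<rho>: "0 < \<rho>" "\<rho> < 1"
begin

abbreviation \<kappa> :: "real \<Rightarrow> real \<Rightarrow> real" where "\<kappa> x y \<equiv> G x y * green_op D G f y"

lemma source_kernel: "Lipschitz_kernel (g0 * L0 + LG * c0) (g0 * c0) \<kappa>"
  by (rule P.kernel_product[OF u0])

lemma leading_term:
  assumes "\<omega> \<in> space M" "Q2 \<epsilon> \<omega> < \<top>" "TV 0 (B \<epsilon> \<omega>) < \<top>" "x \<in> D"
  shows "RF (B \<epsilon> \<omega>) (\<kappa> x) = - (1 / sqrt \<epsilon>) * (LINT y:D|lborel. \<kappa> x y * q (y / \<epsilon>) \<omega>)"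
  by (rule B_RF[OF assms(1-3), where C = "g0 * c0"]) (use source_kernel assms(4) in \<open>auto simp: Lipschitz_kernel_def\<close>)

text \<open>The smallness condition serves twice: the bound by \<rho> keeps the path out of the
  exceptional event, so that the modified potential is the original one, and the bound by 1/2
  permits the absorption in the perturbation estimate.\<close>

lemma L1_error:
  assumes \<omega>: "0 < \<epsilon>" "\<omega> \<in> space M" "Q2 \<epsilon> \<omega> \<le> ennreal (A\<^sup>2)"
    and TV: "TV 0 (B \<epsilon> \<omega>) \<le> ennreal A" "TV (Suc m) (B \<epsilon> \<omega>) \<le> ennreal \<tau>" and pos: "0 \<le> A" "0 \<le> \<tau>"
    and small: "sqrt \<epsilon> * P.gain g0 LG A ((b - a) * A) * (sqrt (b - a) * A) \<le> min \<rho> (1 / 2)"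
    and u: "perturbed_solution D G (\<lambda>x. modified_potential M D G q \<rho> \<epsilon> x \<omega>) f u"
  shows "L1_dist D (L1_class D (\<lambda>x. (u x - green_op D G f x) / sqrt \<epsilon>)) (L1_class D (\<lambda>x\<in>D. RF (B \<epsilon> \<omega>) (\<kappa> x)))
    \<le> (b - a) * P.error c0 L0 A \<tau> m (sqrt \<epsilon>)"
proof -
  have fin: "Q2 \<epsilon> \<omega> < \<top>" using \<omega>(3) by (rule le_less_trans) simp
  have finT: "TV 0 (B \<epsilon> \<omega>) < \<top>" using TV(1) by (rule le_less_trans) simp
  \<comment> \<open>The coarse oscillation bound is the case \<open>m = 0\<close>,
    \<open>\<tau> = A\<close> of \<open>pot_oscillation\<close>.\<close>
  have TV1: "TV (Suc 0) (B \<epsilon> \<omega>) \<le> ennreal A" using TV_antimono[of 0 "Suc 0"] TV(1) by (rule order_trans) simp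
  have s: "0 < sqrt \<epsilon>" using \<omega> by simp
  have VA: "L2_norm D (pot \<epsilon> \<omega>) \<le> A" by (rule pot_norm[OF \<omega>(2,3) pos(1)])
  have o: "P.oscillation_bound \<epsilon> \<omega> (sqrt \<epsilon> * A) (sqrt \<epsilon> * ((b - a) * A))"
    using pot_oscillation[OF \<omega>(1,2) fin TV(1) TV1 pos(1,1)] by simp
  have o': "P.oscillation_bound \<epsilon> \<omega> (sqrt \<epsilon> * (2 ^ m * A)) (sqrt \<epsilon> * ((b - a) * \<tau>))"
    by (rule pot_oscillation[OF \<omega>(1,2) fin TV pos])
  have g: "0 \<le> P.gain g0 LG A ((b - a) * A)" using P.kernel(1,2) pos ab by (intro P.gain_nonneg) auto
  have "L2_operator_norm D (P.T \<epsilon> \<omega>) \<le> ennreal \<rho>"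
  proof (rule P.operator_norm_small[OF o])
    have "sqrt (b - a) * (sqrt \<epsilon> * P.gain g0 LG A ((b - a) * A) * L2_norm D (pot \<epsilon> \<omega>))
        \<le> sqrt (b - a) * (sqrt \<epsilon> * P.gain g0 LG A ((b - a) * A) * A)"
      using s g ab VA by (intro mult_left_mono) auto
    also have "\<dots> \<le> \<rho>" using small by (simp add: mult_ac)
    finally show "sqrt (b - a) * (P.gain g0 LG (sqrt \<epsilon> * A) (sqrt \<epsilon> * ((b - a) * A)) * L2_norm D (pot \<epsilon> \<omega>)) \<le> \<rho>"
      by (simp only: P.gain_scale)
  qed
  then have "\<omega> \<notin> exceptional \<rho> \<epsilon>" by (simp add: exceptional_def not_less)
  then have ps: "perturbed_solution D G (pot \<epsilon> \<omega>) f u"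
    using u \<omega>(2) fin by (simp add: perturbed_solution_pot)
  let ?u0 = "green_op D G f" and ?w = "green_op D G (\<lambda>y. pot \<epsilon> \<omega> y * green_op D G f y)"
  have half: "sqrt \<epsilon> * P.gain g0 LG A ((b - a) * A) * (sqrt (b - a) * A) \<le> 1 / 2" using small by simp
  have est: "AE x in lborel. x \<in> D \<longrightarrow> \<bar>u x - green_op D G f x + green_op D G (\<lambda>y. pot \<epsilon> \<omega> y * green_op D G f y) x\<bar>
      \<le> sqrt \<epsilon> * P.error c0 L0 A \<tau> m (sqrt \<epsilon>)"
    by (rule P.scaled_estimate[OF ps u0 s pos VA o o' half])
  have u0L: "?u0 \<in> L2 D" by (rule L2_Lipschitz[OF u0])
  have wL: "?w \<in> L2 D" by (rule P.inner_L2[OF u0L])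
  note vL = P.perturbation_equation(1)[OF ps u0L]
  have L: "(\<lambda>x. 1 / sqrt \<epsilon> * (u x - ?u0 x)) \<in> L2 D" "(\<lambda>x. - (1 / sqrt \<epsilon>) * ?w x) \<in> L2 D"
    by (intro L2_scale vL wL)+
  have RF: "(\<lambda>x\<in>D. RF (B \<epsilon> \<omega>) (\<kappa> x)) = restrict (\<lambda>x. - (1 / sqrt \<epsilon>) * ?w x) D"
  proof (rule restrict_ext)
    fix x assume x: "x \<in> D"
    have "(LINT y:D|lborel. \<kappa> x y * q (y / \<epsilon>) \<omega>) = ?w x"
      unfolding pot_eq[OF \<omega>(2) fin] green_op_def[of D G "\<lambda>y. q (y / \<epsilon>) \<omega> * green_op D G f y"] by (simp add: mult_ac)
    then show "RF (B \<epsilon> \<omega>) (\<kappa> x) = - (1 / sqrt \<epsilon>) * ?w x"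
      unfolding leading_term[OF \<omega>(2) fin finT x] by (simp only:)
  qed
  have "L1_dist D (L1_class D (\<lambda>x. (u x - ?u0 x) / sqrt \<epsilon>)) (L1_class D (\<lambda>x\<in>D. RF (B \<epsilon> \<omega>) (\<kappa> x)))
      = (LINT x:D|lborel. \<bar>1 / sqrt \<epsilon> * (u x - ?u0 x) - - (1 / sqrt \<epsilon>) * ?w x\<bar>)"
    unfolding RF L1_class_restrict[OF L1_le_L2(1)[OF L(2)]]
    using L1_dist_L1_class[OF L1_le_L2(1)[OF L(1)] L1_le_L2(1)[OF L(2)]] by simp
  \<comment> \<open>One factor \<open>sqrt (b - a)\<close> passes from the L1 to the L2 norm and
    another from the L2 norm to the sup bound; together they give \<open>b - a\<close>.\<close>
  also have "\<dots> \<le> sqrt (b - a) * L2_norm D (\<lambda>x. 1 / sqrt \<epsilon> * (u x - ?u0 x) - - (1 / sqrt \<epsilon>) * ?w x)"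
    by (rule L1_le_L2(2)[OF L2_diff[OF L]])
  also have "\<dots> \<le> sqrt (b - a) * (sqrt (b - a) * P.error c0 L0 A \<tau> m (sqrt \<epsilon>))"
  proof (rule mult_left_mono[OF L2_norm_le[OF L2_diff[OF L]]])
    have le: "\<bar>1 / sqrt \<epsilon> * (u x - ?u0 x) - - (1 / sqrt \<epsilon>) * ?w x\<bar> \<le> P.error c0 L0 A \<tau> m (sqrt \<epsilon>)"
      if "\<bar>u x - ?u0 x + ?w x\<bar> \<le> sqrt \<epsilon> * P.error c0 L0 A \<tau> m (sqrt \<epsilon>)" for x
    proof -
      have "1 / sqrt \<epsilon> * (u x - ?u0 x) - - (1 / sqrt \<epsilon>) * ?w x = (u x - ?u0 x + ?w x) / sqrt \<epsilon>"
        by (simp add: add_divide_distrib diff_divide_distrib)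
      moreover have "\<bar>(u x - ?u0 x + ?w x) / sqrt \<epsilon>\<bar> \<le> P.error c0 L0 A \<tau> m (sqrt \<epsilon>)"
        using that s by (simp add: abs_divide pos_divide_le_eq mult.commute)
      ultimately show ?thesis by (simp only:)
    qed
    show AE: "AE x in lborel. x \<in> D \<longrightarrow> \<bar>1 / sqrt \<epsilon> * (u x - ?u0 x) - - (1 / sqrt \<epsilon>) * ?w x\<bar> \<le> P.error c0 L0 A \<tau> m (sqrt \<epsilon>)"
      using est by eventually_elim (use le in blast)
    have c0: "0 \<le> c0" "0 \<le> L0" using order_trans[OF abs_ge_zero u0(2)[of "(a + b) / 2"]] u0(1) ab by (auto simp: Lipschitz_on_def)
    have "0 \<le> P.gain (sqrt \<epsilon> * P.gain c0 L0 A ((b - a) * A)) (LG * (c0 * (sqrt (b - a) * A))) (2 ^ m * A) ((b - a) * \<tau>)"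
      "0 \<le> P.gain c0 L0 A ((b - a) * A)"
      using c0 pos s ab P.kernel(1,2) by (auto intro!: P.gain_nonneg mult_nonneg_nonneg)
    then show "0 \<le> P.error c0 L0 A \<tau> m (sqrt \<epsilon>)"
      unfolding P.error_def Let_def using g s pos ab by (intro add_nonneg_nonneg mult_nonneg_nonneg) auto
  qed (use ab in simp)
  also have "\<dots> = (b - a) * P.error c0 L0 A \<tau> m (sqrt \<epsilon>)" using ab by (simp add: mult.assoc[symmetric])
  finally show ?thesis .
qed

definition TV_const :: real where "TV_const = 2 * sqrt RI * sqrt (b - a) * geom"

text \<open>The event on which all pathwise constants are deterministic. The bound for
  \<open>Q2\<close> is a square so that \<open>A\<close> bounds the norm of the potential as well as
  the variation.\<close>

definition control :: "real \<Rightarrow> real \<Rightarrow> nat \<Rightarrow> real \<Rightarrow> 'w set" where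
  "control A \<tau> m \<epsilon> = {\<omega> \<in> space M. Q2 \<epsilon> \<omega> \<le> ennreal (A\<^sup>2) \<and> TV 0 (B \<epsilon> \<omega>) \<le> ennreal A \<and> TV (Suc m) (B \<epsilon> \<omega>) \<le> ennreal \<tau>}"

lemma TV_const_nonneg: "0 \<le> TV_const"
  unfolding TV_const_def using RI_nonneg geom_nonneg ab by simp

text \<open>Markov's inequality for each of the three conditions. The bound does not involve
  \<epsilon>, so the constants may be chosen before the limit.\<close>

lemma control_prob:
  assumes \<epsilon>: "0 < \<epsilon>" and pos: "0 < A" "0 < \<tau>"
  shows "control A \<tau> m \<epsilon> \<in> sets M"
    and "prob (space M - control A \<tau> m \<epsilon>) \<le> (b - a) * m2 / A\<^sup>2 + TV_const / A + TV_const * sqrt (1 / 2) ^ Suc m / \<tau>"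
proof -
  have [measurable]: "(\<lambda>\<omega>. TV n (B \<epsilon> \<omega>)) \<in> borel_measurable M" for n by (rule moment_TV_measurable[OF B_moment[OF \<epsilon>]])
  show "control A \<tau> m \<epsilon> \<in> sets M" unfolding control_def by measurable
  define E1 E2 E3 where "E1 = {\<omega> \<in> space M. \<not> Q2 \<epsilon> \<omega> \<le> ennreal (A\<^sup>2)}"
    and "E2 = {\<omega> \<in> space M. \<not> TV 0 (B \<epsilon> \<omega>) \<le> ennreal A}"
    and "E3 = {\<omega> \<in> space M. \<not> TV (Suc m) (B \<epsilon> \<omega>) \<le> ennreal \<tau>}"
  have [measurable]: "E1 \<in> sets M" "E2 \<in> sets M" "E3 \<in> sets M" unfolding E1_def E2_def E3_def by measurable
  have TV: "(\<integral>\<^sup>+\<omega>. TV n (B \<epsilon> \<omega>) \<partial>M) \<le> ennreal (TV_const * sqrt (1 / 2) ^ n)" for n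
    using moment_TV[OF B_moment[OF \<epsilon>], of n] by (simp add: TV_const_def)
  have "space M - control A \<tau> m \<epsilon> = E1 \<union> (E2 \<union> E3)" by (auto simp: control_def E1_def E2_def E3_def)
  then have "prob (space M - control A \<tau> m \<epsilon>) \<le> prob E1 + prob (E2 \<union> E3)"
    by (simp add: measure_Un_le)
  also have "\<dots> \<le> prob E1 + (prob E2 + prob E3)" by (intro add_left_mono measure_Un_le) measurable
  also have "prob E1 \<le> (b - a) * m2 / A\<^sup>2" unfolding E1_def
    using Q2_expectation[of \<epsilon>] m2_nonneg ab pos by (intro Markov_inequality_ennreal) auto
  also have "prob E2 \<le> TV_const / A" unfolding E2_def
    using TV[of 0] TV_const_nonneg pos by (intro Markov_inequality_ennreal) auto
  also have "prob E3 \<le> TV_const * sqrt (1 / 2) ^ Suc m / \<tau>" unfolding E3_def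
    using TV[of "Suc m"] TV_const_nonneg pos by (intro Markov_inequality_ennreal) auto
  finally show "prob (space M - control A \<tau> m \<epsilon>) \<le> (b - a) * m2 / A\<^sup>2 + TV_const / A + TV_const * sqrt (1 / 2) ^ Suc m / \<tau>"
    by simp
qed

lemma leading_term_class_measurable:
  "(\<lambda>\<omega>. L1_class D (\<lambda>x\<in>D. RF (B \<epsilon> \<omega>) (\<kappa> x))) \<in> measurable M (borel_sigma (mtopology_of (L1_metric D)))"
  by (rule measurable_compose[OF RF_field_measurable[OF source_kernel B_rv B_additive]
        measurable_borel_sigma_continuous_map[OF continuous_map_L1_class[OF ab refl]]])

text \<open>The order of choices is essential: \<open>A\<close> makes the first two failure
  probabilities small, \<tau> makes the limiting error small for this \<open>A\<close>,
  \<open>m\<close> makes the tail of level \<open>m + 1\<close> small compared with \<tau>, and only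
  then does \<epsilon> tend to 0.\<close>

lemma remainder_tendsto_0:
  fixes u :: "real \<Rightarrow> 'w \<Rightarrow> real \<Rightarrow> real"
  assumes F: "bounded_Lipschitz (L1_metric D) Bf Lf F"
    and X': "\<And>\<epsilon>. 0 < \<epsilon> \<Longrightarrow> X' \<epsilon> \<in> measurable M (borel_sigma (mtopology_of (L1_metric D)))"
      "\<And>\<epsilon>. 0 < \<epsilon> \<Longrightarrow> AE \<omega> in M. L1_class D (\<lambda>x. (u \<epsilon> \<omega> x - green_op D G f x) / sqrt \<epsilon>) = X' \<epsilon> \<omega>"
    and u: "\<And>\<epsilon>. 0 < \<epsilon> \<Longrightarrow> AE \<omega> in M. perturbed_solution D G (\<lambda>x. modified_potential M D G q \<rho> \<epsilon> x \<omega>) f (u \<epsilon> \<omega>)"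
  shows "((\<lambda>\<epsilon>. (LINT \<omega>|M. F (X' \<epsilon> \<omega>)) - (LINT \<omega>|M. F (L1_class D (\<lambda>x\<in>D. RF (B \<epsilon> \<omega>) (\<kappa> x))))) \<longlongrightarrow> 0) (at_right 0)"
proof (rule tendstoI)
  fix r :: real assume r: "0 < r"
  have BL: "0 \<le> Bf" "0 \<le> Lf" using F by (auto simp: bounded_Lipschitz_def)
  \<comment> \<open>\<eta> bounds the failure probability and \<delta> the scaled error on the good
    event; each contributes less than \<open>r / 2\<close>.\<close>
  define \<eta> where "\<eta> = r / (4 * (Bf + 1))"
  define \<delta> where "\<delta> = r / (4 * (Lf * (b - a) + 1))"
  have Lb: "0 \<le> Lf * (b - a)" using BL ab by simp
  have \<eta>: "0 < \<eta>" "2 * Bf * \<eta> < r / 2"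
    unfolding \<eta>_def using r BL by (auto simp: field_simps)
  have "K * (r / (4 * (K + 1))) < r / 2" if "0 \<le> K" for K using r that by (simp add: field_simps add_pos_nonneg)
  from this[OF Lb] have \<delta>: "0 < \<delta>" "Lf * ((b - a) * \<delta>) < r / 2"
    unfolding \<delta>_def mult.assoc using r Lb by (auto intro!: divide_pos_pos)
  define c where "c = (b - a) * m2 + TV_const"
  have c: "0 \<le> (b - a) * m2" "0 \<le> c" unfolding c_def using m2_nonneg ab TV_const_nonneg by auto
  \<comment> \<open>\<open>A \<ge> 1\<close> gives \<open>1 / A^2 \<le> 1 / A\<close>, so both
    failure probabilities together are at most \<open>c / A\<close>, hence at most
    \<open>\<eta> / 2\<close>.\<close>
  define A where "A = 1 + 2 * c / \<eta>"
  have A: "1 \<le> A" unfolding A_def using c \<eta> by simp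
  have cA: "(b - a) * m2 / A\<^sup>2 + TV_const / A \<le> \<eta> / 2"
  proof -
    have "(b - a) * m2 / A\<^sup>2 \<le> (b - a) * m2 / A"
      using A c by (intro divide_left_mono) (auto simp: power2_eq_square)
    moreover have "c / A \<le> \<eta> / 2"
      using A \<eta> c by (simp add: A_def field_simps)
    ultimately show ?thesis unfolding c_def add_divide_distrib by linarith
  qed
  define K0 where "K0 = g0 * (LG * (c0 * (sqrt (b - a) * A))) * (b - a)"
  have "0 \<le> c0" using order_trans[OF abs_ge_zero u0(2)[of "(a + b) / 2"]] ab by simp
  then have K0: "0 \<le> K0" unfolding K0_def using P.kernel(1,2) A ab by simp
  \<comment> \<open>The limit of \<open>error\<close> at 0 is \<open>K0 * \<tau>\<close>, which this
    choice puts below \<delta>.\<close>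
  define \<tau> where "\<tau> = \<delta> / (2 * (K0 + 1))"
  have \<tau>: "0 < \<tau>" "K0 * \<tau> < \<delta>" unfolding \<tau>_def using \<delta>(1) K0 by (auto simp: field_simps add_nonneg_pos)
  have "(\<lambda>m. TV_const * sqrt (1 / 2) ^ Suc m / \<tau>) \<longlonglongrightarrow> TV_const * 0 / \<tau>"
    by (intro tendsto_divide tendsto_mult tendsto_const LIMSEQ_Suc[OF LIMSEQ_realpow_zero]) (use \<tau> in auto)
  then have "\<forall>\<^sub>F m in sequentially. TV_const * sqrt (1 / 2) ^ Suc m / \<tau> < \<eta> / 2"
    by (rule order_tendstoD(2)) (use \<eta> in simp)
  then obtain m where m: "TV_const * sqrt (1 / 2) ^ Suc m / \<tau> < \<eta> / 2"
    using eventually_happens trivial_limit_sequentially by blast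
  have err: "\<forall>\<^sub>F \<epsilon> in at_right 0. P.error c0 L0 A \<tau> m (sqrt \<epsilon>) < \<delta>"
    by (rule order_tendstoD(2)[OF P.error_tendsto]) (use \<tau> in \<open>simp add: K0_def mult_ac\<close>)
  have "((\<lambda>\<epsilon>. sqrt \<epsilon> * P.gain g0 LG A ((b - a) * A) * (sqrt (b - a) * A)) \<longlongrightarrow> sqrt 0 * P.gain g0 LG A ((b - a) * A) * (sqrt (b - a) * A)) (at_right 0)"
    by (intro tendsto_mult tendsto_const tendsto_real_sqrt tendsto_ident_at)
  then have "\<forall>\<^sub>F \<epsilon> in at_right 0. sqrt \<epsilon> * P.gain g0 LG A ((b - a) * A) * (sqrt (b - a) * A) < min \<rho> (1 / 2)"
    by (rule order_tendstoD(2)) (use \<rho> in simp)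
  with err eventually_at_right_less[of "0 :: real"]
  show "\<forall>\<^sub>F \<epsilon> in at_right 0. dist ((LINT \<omega>|M. F (X' \<epsilon> \<omega>)) - (LINT \<omega>|M. F (L1_class D (\<lambda>x\<in>D. RF (B \<epsilon> \<omega>) (\<kappa> x))))) 0 < r"
  proof eventually_elim
    case (elim \<epsilon>)
    note \<epsilon> = elim(2)
    have A0: "0 < A" using A by simp
    have bad: "prob (space M - control A \<tau> m \<epsilon>) \<le> \<eta>"
      using control_prob(2)[OF \<epsilon> A0 \<tau>(1), of m] cA m by linarith
    have le: "AE \<omega> in M. \<omega> \<in> control A \<tau> m \<epsilon> \<longrightarrow>
        mdist (L1_metric D) (X' \<epsilon> \<omega>) (L1_class D (\<lambda>x\<in>D. RF (B \<epsilon> \<omega>) (\<kappa> x))) \<le> (b - a) * \<delta>"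
      using X'(2)[OF \<epsilon>] u[OF \<epsilon>]
    proof eventually_elim
      case (elim \<omega>)
      show ?case
      proof
        assume \<omega>: "\<omega> \<in> control A \<tau> m \<epsilon>"
        have "L1_dist D (X' \<epsilon> \<omega>) (L1_class D (\<lambda>x\<in>D. RF (B \<epsilon> \<omega>) (\<kappa> x))) \<le> (b - a) * P.error c0 L0 A \<tau> m (sqrt \<epsilon>)"
          unfolding elim(1)[symmetric]
        proof (rule L1_error[OF \<epsilon> _ _ _ _ _ _ _ elim(2)])
          show "sqrt \<epsilon> * P.gain g0 LG A ((b - a) * A) * (sqrt (b - a) * A) \<le> min \<rho> (1 / 2)"
            using \<open>sqrt \<epsilon> * P.gain g0 LG A ((b - a) * A) * (sqrt (b - a) * A) < min \<rho> (1 / 2)\<close> by (rule less_imp_le)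
        qed (use \<omega> A0 \<tau> in \<open>auto simp: control_def\<close>)
        also have "\<dots> \<le> (b - a) * \<delta>"
          using \<open>P.error c0 L0 A \<tau> m (sqrt \<epsilon>) < \<delta>\<close> ab by (intro mult_left_mono) auto
        finally show "mdist (L1_metric D) (X' \<epsilon> \<omega>) (L1_class D (\<lambda>x\<in>D. RF (B \<epsilon> \<omega>) (\<kappa> x))) \<le> (b - a) * \<delta>" by simp
      qed
    qed
    have "\<bar>(LINT \<omega>|M. F (X' \<epsilon> \<omega>)) - (LINT \<omega>|M. F (L1_class D (\<lambda>x\<in>D. RF (B \<epsilon> \<omega>) (\<kappa> x))))\<bar> \<le> Lf * ((b - a) * \<delta>) + 2 * Bf * \<eta>"
      by (rule bounded_Lipschitz_expectation_diff_event[OF X'(1)[OF \<epsilon>] leading_term_class_measurable F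
            control_prob(1)[OF \<epsilon> A0 \<tau>(1)] bad le]) (use ab \<delta> in simp)
    then show ?case using \<eta>(2) \<delta>(2) by (simp add: dist_real_def)
  qed
qed

text \<open>The remainder vanishes, and a bounded Lipschitz function on L1 becomes one on C(D) when
  composed with \<open>L1_class\<close>; so the convergence of the leading term is used as it
  stands.\<close>

theorem L1_convergence:
  fixes u :: "real \<Rightarrow> 'w \<Rightarrow> real \<Rightarrow> real" and N :: "'v measure"
  assumes W: "wiener N W" and \<sigma>: "\<sigma>\<^sup>2 = \<sigma>2"
    and F: "bounded_Lipschitz (L1_metric D) Bf Lf F"
    and X': "\<And>\<epsilon>. 0 < \<epsilon> \<Longrightarrow> X' \<epsilon> \<in> measurable M (borel_sigma (mtopology_of (L1_metric D)))"
      "\<And>\<epsilon>. 0 < \<epsilon> \<Longrightarrow> AE \<omega> in M. L1_class D (\<lambda>x. (u \<epsilon> \<omega> x - green_op D G f x) / sqrt \<epsilon>) = X' \<epsilon> \<omega>"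
    and u: "\<And>\<epsilon>. 0 < \<epsilon> \<Longrightarrow> AE \<omega> in M. perturbed_solution D G (\<lambda>x. modified_potential M D G q \<rho> \<epsilon> x \<omega>) f (u \<epsilon> \<omega>)"
  shows "((\<lambda>\<epsilon>. LINT \<omega>|M. F (X' \<epsilon> \<omega>)) \<longlongrightarrow> (LINT \<omega>|N. F (L1_class D (\<lambda>x\<in>D. RF (white_noise W \<sigma> \<omega>) (\<kappa> x))))) (at_right 0)"
  using tendsto_add[OF remainder_tendsto_0[OF F X' u] leading_term_convergence[OF source_kernel W \<sigma> bounded_Lipschitz_L1_class[OF F]]]
  by simp

end

end

theorem theorem2p8:
  fixes M :: "'w measure" and N :: "'v measure"
    and a b \<rho> \<sigma> :: real and D :: "real set"
    and \<D> :: "(real \<Rightarrow> real) set" and P :: "(real \<Rightarrow> real) \<Rightarrow> real \<Rightarrow> real"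
    and G :: "real \<Rightarrow> real \<Rightarrow> real"
    and q :: "real \<Rightarrow> 'w \<Rightarrow> real" and W :: "real \<Rightarrow> 'v \<Rightarrow> real"
    and f u\<^sub>0 :: "real \<Rightarrow> real" and u u\<^sub>1\<^sub>\<epsilon> :: "real \<Rightarrow> real \<Rightarrow> 'w \<Rightarrow> real"
  assumes "a < b" and D: "D = {a<..<b}"
    \<comment> \<open>the unperturbed problem and its Green's function\<close>
    and "symmetric_operator D \<D> P" and "green_function D \<D> P G"
    and "\<And>x y. x \<in> D \<Longrightarrow> y \<in> D \<Longrightarrow> 0 \<le> G x y"
    and "\<And>x y. x \<in> D \<Longrightarrow> y \<in> D \<Longrightarrow> G x y = G y x"
    and "\<exists>\<eta>>0. (SUP x\<in>D. \<integral>\<^sup>+y\<in>D. ennreal (\<bar>G x y\<bar> powr (2 + \<eta>)) \<partial>lborel) < \<infinity>"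
    and "\<exists>L. L-lipschitz_on (D \<times> D) (\<lambda>(x, y). G x y)"
    \<comment> \<open>the random field\<close>
    and "prob_space M"
    and "(\<lambda>(x, \<omega>). q x \<omega>) \<in> borel_measurable (borel \<Otimes>\<^sub>M M)"
    and "\<And>x. integrable M (q x)" and "\<And>x. (LINT \<omega>|M. q x \<omega>) = 0"
    and "strictly_stationary M q"
    and "integrable lborel (correlation M q)"
    and H2: "\<And>x. integrable M (\<lambda>\<omega>. q x \<omega> ^ 6)" "strongly_mixing M q"
    and "0 < \<rho>" and "\<rho> < 1"
    and H3: "((\<lambda>\<epsilon>. \<integral>\<^sup>+\<omega>. indicator (exceptional_set M D G q \<rho> \<epsilon>) \<omega> *
        ennreal (L2_norm D (\<lambda>x. 1 / sqrt \<epsilon> * q (x / \<epsilon>) \<omega>)) \<partial>M) \<longlongrightarrow> 0) (at_right 0)"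
    \<comment> \<open>the unperturbed and perturbed solutions\<close>
    and "f \<in> L2 D" and "u\<^sub>0 = green_op D G f" and "continuous_on D u\<^sub>0"
    and "\<And>\<epsilon>. 0 < \<epsilon> \<Longrightarrow> AE \<omega> in M.
      perturbed_solution D G (\<lambda>x. modified_potential M D G q \<rho> \<epsilon> x \<omega>) f (\<lambda>x. u \<epsilon> x \<omega>)"
    and "\<And>\<epsilon> x \<omega>. u\<^sub>1\<^sub>\<epsilon> \<epsilon> x \<omega> = - (LINT y:D|lborel. G x y * (1 / sqrt \<epsilon>) * q (y / \<epsilon>) \<omega> * u\<^sub>0 y)"
    \<comment> \<open>the limiting white noise\<close>
    and "prob_space N" and "standard_wiener_process N W"
    and "0 \<le> \<sigma>" and "\<sigma>\<^sup>2 = (LINT r|lborel. correlation M q r)"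
  shows "(\<exists>u\<^sub>1. continuous_wiener_field N W a b \<sigma> (\<lambda>x y. G x y * u\<^sub>0 y) u\<^sub>1) \<and>
    (\<forall>u\<^sub>1. continuous_wiener_field N W a b \<sigma> (\<lambda>x y. G x y * u\<^sub>0 y) u\<^sub>1 \<longrightarrow>
      converges_in_distribution (mtopology_of (C_metric D)) (at_right 0)
        M (\<lambda>\<epsilon> \<omega>. \<lambda>x\<in>D. u\<^sub>1\<^sub>\<epsilon> \<epsilon> x \<omega>) N (\<lambda>\<omega>. \<lambda>x\<in>D. u\<^sub>1 x \<omega>) \<and>
      converges_in_distribution (mtopology_of (L1_metric D)) (at_right 0)
        M (\<lambda>\<epsilon> \<omega>. L1_class D (\<lambda>x. (u \<epsilon> x \<omega> - u\<^sub>0 x) / sqrt \<epsilon>))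
        N (\<lambda>\<omega>. L1_class D (\<lambda>x. u\<^sub>1 x \<omega>)))"
proof -
  obtain \<phi> :: "real \<Rightarrow> real" where \<phi>: "\<forall>r\<ge>0. 0 \<le> \<phi> r" "antimono_on {0..} \<phi>" "set_integrable lborel {0..} (\<lambda>r. sqrt (\<phi> r))"
    "\<forall>A \<in> sets borel. \<forall>B \<in> sets borel. A \<noteq> {} \<longrightarrow> B \<noteq> {} \<longrightarrow>
        (\<forall>\<zeta> \<in> borel_measurable (field_sigma M q A). \<forall>\<xi> \<in> borel_measurable (field_sigma M q B).
          integrable M (\<lambda>\<omega>. (\<zeta> \<omega>)\<^sup>2) \<longrightarrow> integrable M (\<lambda>\<omega>. (\<xi> \<omega>)\<^sup>2) \<longrightarrow>
          \<bar>LINT \<omega>|M. (\<zeta> \<omega> - (LINT \<omega>'|M. \<zeta> \<omega>')) * (\<xi> \<omega> - (LINT \<omega>'|M. \<xi> \<omega>'))\<bar>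
            \<le> \<phi> (2 * setdist A B) *
              sqrt ((LINT \<omega>|M. (\<zeta> \<omega>)\<^sup>2) * (LINT \<omega>|M. (\<xi> \<omega>)\<^sup>2)))"
    using H2(2) unfolding strongly_mixing_def by (elim exE conjE) (rule that)
  interpret M: mixing_field M q \<phi>
  proof (intro mixing_field.intro mixing_field_axioms.intro)
    show "\<phi> r \<ge> 0" if "0 \<le> r" for r using \<phi>(1) that by blast
    show "\<bar>LINT \<omega>|M. (\<zeta> \<omega> - (LINT \<omega>'|M. \<zeta> \<omega>')) * (\<xi> \<omega> - (LINT \<omega>'|M. \<xi> \<omega>'))\<bar>
        \<le> \<phi> (2 * setdist A B) * sqrt ((LINT \<omega>|M. (\<zeta> \<omega>)\<^sup>2) * (LINT \<omega>|M. (\<xi> \<omega>)\<^sup>2))"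
      if "A \<in> sets borel" "B \<in> sets borel" "A \<noteq> {}" "B \<noteq> {}" "\<zeta> \<in> borel_measurable (field_sigma M q A)"
        "\<xi> \<in> borel_measurable (field_sigma M q B)" "integrable M (\<lambda>\<omega>. (\<zeta> \<omega>)\<^sup>2)" "integrable M (\<lambda>\<omega>. (\<xi> \<omega>)\<^sup>2)"
      for A B \<zeta> \<xi>
      using \<phi>(4)[rule_format, OF that] .
  qed (fact assms \<phi>)+
  obtain LG where LG: "LG-lipschitz_on (D \<times> D) (\<lambda>(x, y). G x y)" using assms by blast
  have LG0: "0 \<le> LG" by (rule lipschitz_on_nonneg[OF LG])
  have G1: "\<bar>G x y - G x' y\<bar> \<le> LG * \<bar>x - x'\<bar>" "\<bar>G y x - G y x'\<bar> \<le> LG * \<bar>x - x'\<bar>"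
    if "x \<in> D" "x' \<in> D" "y \<in> D" for x x' y
    using lipschitz_onD[OF LG, of "(x, y)" "(x', y)"] lipschitz_onD[OF LG, of "(y, x)" "(y, x')"] that
    by (auto simp: dist_Pair_Pair dist_real_def)
  define c where "c = (a + b) / 2"
  have c: "c \<in> D" using \<open>a < b\<close> D by (simp add: c_def)
  \<comment> \<open>Two Lipschitz steps lead from the centre \<open>(c, c)\<close> of the square to
    any of its points, one in each variable and each of length at most \<open>b - a\<close>.\<close>
  define g0 where "g0 = \<bar>G c c\<bar> + 2 * (LG * (b - a))"
  have gb: "\<bar>G x y\<bar> \<le> g0" if "x \<in> D" "y \<in> D" for x y
  proof -
    have "LG * \<bar>z - c\<bar> \<le> LG * (b - a)" if "z \<in> D" for z
      using that c D by (intro mult_left_mono[OF _ LG0]) auto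
    then show ?thesis
      using G1(1)[OF that(1) c that(2)] G1(2)[OF that(2) c c] that unfolding g0_def by smt
  qed
  interpret O: oscillating_green a b M q \<phi> G LG g0
  proof unfold_locales
    have "0 \<le> g0" using gb[OF c c] by linarith
    then show "dyadic.Lipschitz_kernel a b LG g0 G"
      using LG0 G1 gb unfolding dyadic.Lipschitz_kernel_def[OF dyadic.intro[OF \<open>a < b\<close>]]
        dyadic.Lipschitz_on_def[OF dyadic.intro[OF \<open>a < b\<close>]] D by blast
  qed (rule \<open>a < b\<close>)
  interpret W: wiener N W using assms by (intro wiener.intro wiener_axioms.intro)
  have Wn: "wiener N W" by (rule W.wiener_axioms)
  have fL: "f \<in> L2 {a<..<b}" using \<open>f \<in> L2 D\<close> D by simp
  obtain L0 c0 where u0: "O.Lipschitz_on L0 (green_op {a<..<b} G f)" "\<And>x. x \<in> {a<..<b} \<Longrightarrow> \<bar>green_op {a<..<b} G f x\<bar> \<le> c0"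
    by (rule O.green_L2_data[OF fL]) (rule that)
  have u0_eq: "u\<^sub>0 = green_op {a<..<b} G f" using \<open>u\<^sub>0 = green_op D G f\<close> D by simp
  let ?\<kappa> = "\<lambda>x y. G x y * green_op {a<..<b} G f y"
  have K: "O.Lipschitz_kernel (g0 * L0 + LG * c0) (g0 * c0) ?\<kappa>"
    by (rule O.source_kernel[OF fL u0 \<open>0 < \<rho>\<close> \<open>\<rho> < 1\<close>])
  have \<sigma>: "\<sigma>\<^sup>2 = (LINT r|lborel. correlation M q r)" by fact
  \<comment> \<open>The Borel modifications required by \<open>converges_in_distribution\<close>:
    \<open>RF\<close> is defined for every path, while the integrals and Wiener integrals agree with
    it only almost surely.\<close>
  define XC where "XC \<epsilon> \<omega> = (\<lambda>x\<in>{a<..<b}. O.RF (O.B \<epsilon> \<omega>) (?\<kappa> x))" for \<epsilon> \<omega>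
  define YC where "YC \<omega> = (\<lambda>x\<in>{a<..<b}. O.RF (O.white_noise W \<sigma> \<omega>) (?\<kappa> x))" for \<omega>
  have XCm: "XC \<epsilon> \<in> measurable M (borel_sigma (mtopology_of (C_metric D)))" for \<epsilon>
    unfolding XC_def[abs_def] D by (rule O.RF_field_measurable[OF K O.B_rv O.B_additive])
  have YCm: "YC \<in> measurable N (borel_sigma (mtopology_of (C_metric D)))"
    using O.white_noise_moment[OF Wn] unfolding YC_def[abs_def] D
    by (intro O.RF_field_measurable[OF K]) (auto simp: O.moment_increments_def)
  have exists: "continuous_wiener_field N W a b \<sigma> ?\<kappa> (\<lambda>x \<omega>. O.RF (O.white_noise W \<sigma> \<omega>) (?\<kappa> x))"
    by (rule O.continuous_wiener_field_exists[OF Wn K])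
  have XC_AE: "AE \<omega> in M. (\<lambda>x\<in>D. u\<^sub>1\<^sub>\<epsilon> \<epsilon> x \<omega>) = XC \<epsilon> \<omega>" if \<epsilon>: "0 < \<epsilon>" for \<epsilon>
    using AE_space O.AE_Q2[of \<epsilon>] O.moment_AE_finite[OF O.B_moment[OF \<epsilon>]]
  proof eventually_elim
    case (elim \<omega>)
    show ?case unfolding XC_def D
    proof (rule restrict_ext)
      fix x assume x: "x \<in> {a<..<b}"
      have "O.RF (O.B \<epsilon> \<omega>) (?\<kappa> x) = - (1 / sqrt \<epsilon>) * (LINT y:{a<..<b}|lborel. ?\<kappa> x y * q (y / \<epsilon>) \<omega>)"
        by (rule O.leading_term[OF fL u0 \<open>0 < \<rho>\<close> \<open>\<rho> < 1\<close> elim x])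
      also have "\<dots> = - (LINT y:{a<..<b}|lborel. 1 / sqrt \<epsilon> * (?\<kappa> x y * q (y / \<epsilon>) \<omega>))" by simp
      also have "\<dots> = u\<^sub>1\<^sub>\<epsilon> \<epsilon> x \<omega>" unfolding assms(24) u0_eq D by (simp add: mult_ac)
      finally show "u\<^sub>1\<^sub>\<epsilon> \<epsilon> x \<omega> = O.RF (O.B \<epsilon> \<omega>) (?\<kappa> x)" ..
    qed
  qed
  have U: "AE \<omega> in M. perturbed_solution {a<..<b} G (\<lambda>x. modified_potential M {a<..<b} G q \<rho> \<epsilon> x \<omega>) f (\<lambda>x. u \<epsilon> x \<omega>)"
    if "0 < \<epsilon>" for \<epsilon> using assms(23)[OF that] unfolding D .
  \<comment> \<open>The positivity of \<epsilon> is put under the quantifier so that one choice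
    covers all real \<epsilon>.\<close>
  have "\<exists>X'. 0 < \<epsilon> \<longrightarrow> X' \<in> measurable M (borel_sigma (mtopology_of (L1_metric {a<..<b}))) \<and>
      (AE \<omega> in M. L1_class {a<..<b} (\<lambda>x. (u \<epsilon> x \<omega> - green_op {a<..<b} G f x) / sqrt \<epsilon>) = X' \<omega>)" for \<epsilon>
  proof (cases "0 < \<epsilon>")
    case True
    obtain X' where "X' \<in> measurable M (borel_sigma (mtopology_of (L1_metric {a<..<b})))"
      "AE \<omega> in M. L1_class {a<..<b} (\<lambda>x. (u \<epsilon> x \<omega> - green_op {a<..<b} G f x) / sqrt \<epsilon>) = X' \<omega>"
      by (rule O.solution_measurable[OF \<open>0 < \<rho>\<close> \<open>\<rho> < 1\<close> fL U[OF True]])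
    then show ?thesis by (intro exI[of _ X']) simp
  qed simp
  then have "\<forall>\<epsilon>. \<exists>X'. 0 < \<epsilon> \<longrightarrow> X' \<in> measurable M (borel_sigma (mtopology_of (L1_metric {a<..<b}))) \<and>
      (AE \<omega> in M. L1_class {a<..<b} (\<lambda>x. (u \<epsilon> x \<omega> - green_op {a<..<b} G f x) / sqrt \<epsilon>) = X' \<omega>)" by (rule allI)
  from choice[OF this] obtain XL where XL: "\<And>\<epsilon>. 0 < \<epsilon> \<Longrightarrow> XL \<epsilon> \<in> measurable M (borel_sigma (mtopology_of (L1_metric {a<..<b})))"
    "\<And>\<epsilon>. 0 < \<epsilon> \<Longrightarrow> AE \<omega> in M. L1_class {a<..<b} (\<lambda>x. (u \<epsilon> x \<omega> - green_op {a<..<b} G f x) / sqrt \<epsilon>) = XL \<epsilon> \<omega>"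
    by blast
  have pos: "\<forall>\<^sub>F \<epsilon> in at_right (0 :: real). 0 < \<epsilon>" by (rule eventually_at_right_less)
  have YLm: "(\<lambda>\<omega>. L1_class D (YC \<omega>)) \<in> measurable N (borel_sigma (mtopology_of (L1_metric D)))"
    by (rule measurable_compose[OF YCm measurable_borel_sigma_continuous_map[OF continuous_map_L1_class[OF \<open>a < b\<close> D]]])
  have YCint: "set_integrable lborel D (YC \<omega>)" if "\<omega> \<in> space N" for \<omega>
  proof -
    have "YC \<omega> \<in> mspace (C_metric D)" using measurable_space[OF YCm that] by simp
    then have "continuous_on D (YC \<omega>)" "bounded (YC \<omega> ` D)" unfolding mspace_C_metric by blast+
    then show ?thesis by (rule set_integrable_bounded_continuous[OF D])
  qed
  show ?thesis unfolding u0_eq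
  proof (intro conjI allI impI)
    show "\<exists>u\<^sub>1. continuous_wiener_field N W a b \<sigma> ?\<kappa> u\<^sub>1" by (rule exI, rule exists)
    fix u\<^sub>1 assume u1: "continuous_wiener_field N W a b \<sigma> ?\<kappa> u\<^sub>1"
    \<comment> \<open>An arbitrary continuous version is indistinguishable from the one constructed
      by \<open>RF\<close>, which therefore represents it in both convergence statements.\<close>
    have Y_AE: "AE \<omega> in N. (\<lambda>x\<in>D. u\<^sub>1 x \<omega>) = YC \<omega>"
      using O.continuous_wiener_field_unique[OF Wn u1 exists]
      by eventually_elim (auto simp: YC_def D intro!: restrict_ext)
    show "converges_in_distribution (mtopology_of (C_metric D)) (at_right 0)
        M (\<lambda>\<epsilon> \<omega>. \<lambda>x\<in>D. u\<^sub>1\<^sub>\<epsilon> \<epsilon> x \<omega>) N (\<lambda>\<omega>. \<lambda>x\<in>D. u\<^sub>1 x \<omega>)"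
      unfolding converges_in_distribution_def
    proof (rule exI[of _ XC], rule exI[of _ YC], intro conjI allI impI)
      show "\<forall>\<^sub>F \<epsilon> in at_right 0. XC \<epsilon> \<in> measurable M (borel_sigma (mtopology_of (C_metric D))) \<and> (AE \<omega> in M. (\<lambda>x\<in>D. u\<^sub>1\<^sub>\<epsilon> \<epsilon> x \<omega>) = XC \<epsilon> \<omega>)"
        using pos by eventually_elim (use XCm XC_AE in blast)
      show "YC \<in> measurable N (borel_sigma (mtopology_of (C_metric D)))" by (rule YCm)
      show "AE \<omega> in N. (\<lambda>x\<in>D. u\<^sub>1 x \<omega>) = YC \<omega>" by (rule Y_AE)
      fix F :: "(real \<Rightarrow> real) \<Rightarrow> real"
      assume F: "continuous_map (mtopology_of (C_metric D)) euclideanreal F" "bounded (F ` topspace (mtopology_of (C_metric D)))"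
      show "((\<lambda>\<epsilon>. LINT \<omega>|M. F (XC \<epsilon> \<omega>)) \<longlongrightarrow> (LINT \<omega>|N. F (YC \<omega>))) (at_right 0)"
      proof (rule bounded_Lipschitz_imp_continuous_convergence[OF \<open>prob_space M\<close> \<open>prob_space N\<close> _ YCm _ F(1)])
        show "\<forall>\<^sub>F \<epsilon> in at_right 0. XC \<epsilon> \<in> measurable M (borel_sigma (mtopology_of (C_metric D)))" using XCm by simp
        show "bounded (F ` mspace (C_metric D))" using F(2) by simp
        fix g B L assume "bounded_Lipschitz (C_metric D) B L g"
        then show "((\<lambda>\<epsilon>. LINT \<omega>|M. g (XC \<epsilon> \<omega>)) \<longlongrightarrow> (LINT \<omega>|N. g (YC \<omega>))) (at_right 0)"
          unfolding XC_def YC_def D by (rule O.leading_term_convergence[OF K Wn \<sigma>])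
      qed
    qed
    show "converges_in_distribution (mtopology_of (L1_metric D)) (at_right 0)
        M (\<lambda>\<epsilon> \<omega>. L1_class D (\<lambda>x. (u \<epsilon> x \<omega> - green_op {a<..<b} G f x) / sqrt \<epsilon>))
        N (\<lambda>\<omega>. L1_class D (\<lambda>x. u\<^sub>1 x \<omega>))"
      unfolding converges_in_distribution_def
    proof (rule exI[of _ XL], rule exI[of _ "\<lambda>\<omega>. L1_class D (YC \<omega>)"], intro conjI allI impI)
      show "\<forall>\<^sub>F \<epsilon> in at_right 0. XL \<epsilon> \<in> measurable M (borel_sigma (mtopology_of (L1_metric D))) \<and>
          (AE \<omega> in M. L1_class D (\<lambda>x. (u \<epsilon> x \<omega> - green_op {a<..<b} G f x) / sqrt \<epsilon>) = XL \<epsilon> \<omega>)"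
        using pos by eventually_elim (use XL D in blast)
      show "(\<lambda>\<omega>. L1_class D (YC \<omega>)) \<in> measurable N (borel_sigma (mtopology_of (L1_metric D)))" by (rule YLm)
      show "AE \<omega> in N. L1_class D (\<lambda>x. u\<^sub>1 x \<omega>) = L1_class D (YC \<omega>)"
        using Y_AE AE_space
      proof eventually_elim
        case (elim \<omega>)
        have eq: "YC \<omega> x = u\<^sub>1 x \<omega>" if "x \<in> D" for x using elim(1)[symmetric] that by simp
        have "set_integrable lborel D (\<lambda>x. u\<^sub>1 x \<omega>)"
          using YCint[OF elim(2)] eq by (subst set_integrable_cong[of _ lborel D D _ "YC \<omega>"]) auto
        then show ?case using eq YCint[OF elim(2)] by (subst L1_class_eq_iff) auto
      qed
      fix F :: "(real \<Rightarrow> real) set \<Rightarrow> real"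
      assume F: "continuous_map (mtopology_of (L1_metric D)) euclideanreal F" "bounded (F ` topspace (mtopology_of (L1_metric D)))"
      show "((\<lambda>\<epsilon>. LINT \<omega>|M. F (XL \<epsilon> \<omega>)) \<longlongrightarrow> (LINT \<omega>|N. F (L1_class D (YC \<omega>)))) (at_right 0)"
      proof (rule bounded_Lipschitz_imp_continuous_convergence[OF \<open>prob_space M\<close> \<open>prob_space N\<close> _ YLm _ F(1)])
        show "\<forall>\<^sub>F \<epsilon> in at_right 0. XL \<epsilon> \<in> measurable M (borel_sigma (mtopology_of (L1_metric D)))"
          using pos by eventually_elim (use XL(1) D in blast)
        show "bounded (F ` mspace (L1_metric D))" using F(2) by simp
        fix g B L assume g: "bounded_Lipschitz (L1_metric D) B L g"
        show "((\<lambda>\<epsilon>. LINT \<omega>|M. g (XL \<epsilon> \<omega>)) \<longlongrightarrow> (LINT \<omega>|N. g (L1_class D (YC \<omega>)))) (at_right 0)"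
          unfolding YC_def D by (rule O.L1_convergence[OF fL u0 \<open>0 < \<rho>\<close> \<open>\<rho> < 1\<close> Wn \<sigma> g[unfolded D] XL U])
      qed
    qed
  qed
qed

end
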